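(* Let $\mathcal{E}\to\mathcal{X}\xrightarrow{\pi}\Delta$ be a holomorphic family of pairs $\{(X_t,E_t)\}_{t\in\Delta}$ with $\Delta\subset\mathbb{C}^m$ a sufficiently small neighbourhood of $0$, with a fixed compatible trivialization. Let $\nabla$ be the Chern connection of a Hermitian metric on $E_0$, and let $\phi(t)\in A^{0,1}(X_0,T^{1,0}X_0)$ and $\psi_{E_t}\in A^{0,1}(X_0,\mathrm{End}(E_0))$ be the two components, via $\nabla$, of the Beltrami differential of the family of pairs. Let $P_t=(I_t^{p,q})^{-1}\circ e^{i_{\phi(t)}}\circ I_0^{p,q}:A^{p,q}(X_0,E_0)\to A^{p,q}(X_t,E_t)$. Then for all $t\in\Delta$, all $p,q$ and every $E_0$-valued $(p,q)$-form $s\in A^{p,q}(X_0,E_0)$, $$\bar\partial_t\circ P_t(s)=P_t\circ\left(\bar\partial-\mathcal{L}^{1,0}_{\phi(t)}+\psi_{E_t}\right)s,$$ where $\bar\partial_t$ is the Dolbeault operator of the holomorphic bundle $E_t\to X_t$, $\bar\partial$ that of $E_0\to X_0$, and $\mathcal{L}^{1,0}_{\phi(t)}=i_{\phi(t)}\circ\nabla^{1,0}-\nabla^{1,0}\circ i_{\phi(t)}$.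
   Context: Family and trivialization. $\pi:\mathcal{X}\to\Delta$ is a holomorphic proper submersion, $X_t=\pi^{-1}(t)$ is a compact complex manifold, $n=\dim_{\mathbb{C}}X_0$; $p:\mathcal{E}\to\mathcal{X}$ is a holomorphic vector bundle and $E_t=\mathcal{E}|_{X_t}$. A transversely holomorphic trivialization is a diffeomorphism $(\sigma,\pi):\mathcal{X}\to X_0\times\Delta$ with $\sigma|_{X_0}=\mathrm{id}$ and such that each $\sigma^{-1}(x)$, $x\in X_0$, is a complex submanifold of $\mathcal{X}$. A compatible trivialization is in addition a smooth vector bundle isomorphism $(\lambda,\pi\circ p):\mathcal{E}\to E_0\times\Delta$ covering $(\sigma,\pi)$, with $\lambda|_{E_0}=\mathrm{id}$ (such trivializations exist for small $\Delta$). Using $\sigma_t=\sigma|_{X_t}:X_t\to X_0$ and $\lambda_t=\lambda|_{E_t}:E_t\to E_0$ we regard $X_t$ as the smooth manifold $X_0$ with another complex structure, and $E_t$ as the smooth bundle $E_0$ with another holomorphic structure. $A^{p,q}(X_t,V)$ denotes smooth $V$-valued forms of type $(p,q)$ with respect to the complex structure of $X_t$. Beltrami differential. If $(z_t^k)$ are local holomorphic coordinates of $X_t$ (viewed as functions on $X_0$ via $\sigma_t$) and $z=z_0$, then $\phi(t)=\left(\frac{\partial z_t}{\partial z}\right)^{-1}_{ik}\frac{\partial z_t^k}{\partial\bar z^j}\,d\bar z^j\otimes\frac{\partial}{\partial z^i}$; write $\phi^i=\phi^i_j d\bar z^j$ for its coefficients. It satisfies $\bar\partial\phi(t)=\frac12[\phi(t),\phi(t)]$,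 and the $(1,0)$-forms on $X_t$ are the forms $\alpha+i_{\phi(t)}\alpha$ with $\alpha$ of type $(1,0)$ on $X_0$. If $e_t^k$ is a local holomorphic frame of $E_t$, and under $\lambda_t$ one has $e_t^k=(w^{-1})^{lk}e_0^l$ for an invertible matrix $w$ of smooth functions (equivalently the fibre coordinates satisfy $v_t^j=w^{jl}v_0^l$), and $\nabla e_0^k=\theta^{kl}e_0^l$, then $\psi_{E_t}(e_0^k)=\psi^{kl}e_0^l$ with $$\psi^{kl}=(w^{-1})^{lj}\left(\bar\partial w^{jk}-i_{\phi(t)}\partial w^{jk}\right)+i_{\phi(t)}\theta^{kl}.$$ These local formulas define global objects. Operators. $i_{\phi}$ is contraction: for $\phi=\phi^i\otimes\partial/\partial z^i$, $i_\phi\beta=\sum_i\phi^i\wedge(\iota_{\partial/\partial z^i}\beta)$, extended to bundle-valued forms by acting on the form part; $e^{i_\phi}=\sum_{k\ge0}\frac1{k!}i_\phi^k$. On bundle-valued forms, $\nabla^{1,0}(\beta\otimes e)=\partial\beta\otimes e+(-1)^{\deg\beta}\beta\wedge\nabla^{1,0}e$ and $\psi_{E_t}(\beta\otimes e)=(-1)^{\deg\beta}\beta\wedge\psi_{E_t}(e)$. The map $P_t$. $\Omega_t$ is the holomorphic cotangent bundle of $X_t$, $\Omega_t^p=\Lambda^p\Omega_t$, $K_t=\Omega_t^n$. For local holomorphic coordinates $(z^i)$ of $X_t$ and a holomorphic frame $e_k$ of $E_t$, with $\langle dz\rangle=dz^1\wedge\cdots\wedge dz^n$, the isomorphism $I_t^{p,q}:A^{p,q}(X_t,E_t)\to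 A^{n,q}(X_t,\Omega_t^p\otimes K_t^{-1}\otimes E_t)$ is $$I_t^{p,q}\Big(\sum s_{I,\bar J,k}\,d\bar z^J\wedge dz^I\otimes e_k\Big)=\sum s_{I,\bar J,k}\,d\bar z^J\wedge\langle dz\rangle\otimes dz^I\otimes\tfrac{1}{\langle dz\rangle}\otimes e_k .$$ The bundle $\Omega_t$ is identified smoothly with $\Omega_0$ by the isomorphism (for small $t$) $\pi^{1,0}:\Omega_t\to\Omega_0$, $dz_t^k\mapsto\frac{\partial z_t^k}{\partial z^j}dz^j$ (the $(1,0)$-part with respect to $X_0$); this induces identifications $\Omega_t^p\cong\Omega_0^p$ and $K_t^{-1}\cong K_0^{-1}$, and $E_t\cong E_0$ via $\lambda_t$. With these identifications of the coefficient bundles, $e^{i_{\phi(t)}}$, acting on the form part, is an isomorphism $A^{n,q}(X_0,\Omega_0^p\otimes K_0^{-1}\otimes E_0)\to A^{n,q}(X_t,\Omega_t^p\otimes K_t^{-1}\otimes E_t)$. *)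

theory Defs
  imports "HOL-Analysis.Analysis"
begin

section \<open>Smooth and holomorphic maps between number spaces\<close>

primrec Ck_on :: "nat \<Rightarrow> 'a::real_normed_vector set \<Rightarrow> ('a \<Rightarrow> 'b::real_normed_vector) \<Rightarrow> bool" where
  "Ck_on 0 S f \<longleftrightarrow> continuous_on S f"
| "Ck_on (Suc k) S f \<longleftrightarrow>
     f differentiable_on S \<and> (\<forall>v. Ck_on k S (\<lambda>x. frechet_derivative f (at x) v))"

text \<open>Only used for open sets of finite-dimensional spaces, where it is real \<open>C\<close>-infinity.\<close>

definition smooth_on :: "'a::real_normed_vector set \<Rightarrow> ('a \<Rightarrow> 'b::real_normed_vector) \<Rightarrow> bool" where
  "smooth_on S f \<longleftrightarrow> (\<forall>k. Ck_on k S f)"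

definition holo_on :: "(complex^'a::finite) set \<Rightarrow> (complex^'a \<Rightarrow> complex) \<Rightarrow> bool" where
  "holo_on S f \<longleftrightarrow>
     (\<forall>x\<in>S. \<exists>D. (f has_derivative D) (at x) \<and> (\<forall>c v. D (c *s v) = c * D v))"

definition holo_map_on :: "(complex^'a::finite) set \<Rightarrow> (complex^'a \<Rightarrow> complex^'b::finite) \<Rightarrow> bool" where
  "holo_map_on S f \<longleftrightarrow> (\<forall>i. holo_on S (\<lambda>x. f x $ i))"


section \<open>Complex manifolds and submanifolds\<close>

text \<open>A chart is a pair of its domain and its coordinate map; manifolds are subspaces \<open>M\<close> of
  a topological type.\<close>

type_synonym ('x, 'd) chart = "'x set \<times> ('x \<Rightarrow> complex^'d)"

definition coord_chart :: "'x::topological_space set \<Rightarrow> ('x, 'd::finite) chart \<Rightarrow> bool" where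
  "coord_chart M c \<longleftrightarrow> (case c of (U, z) \<Rightarrow>
     openin (top_of_set M) U \<and> open (z ` U) \<and> homeomorphism U (z ` U) z (inv_into U z))"

definition holo_compat :: "('x, 'd::finite) chart \<Rightarrow> ('x, 'd) chart \<Rightarrow> bool" where
  "holo_compat c d \<longleftrightarrow> (case c of (U, z) \<Rightarrow> case d of (V, w) \<Rightarrow>
     holo_map_on (z ` (U \<inter> V)) (w \<circ> inv_into U z) \<and>
     holo_map_on (w ` (U \<inter> V)) (z \<circ> inv_into V w))"

definition complex_atlas :: "'x::topological_space set \<Rightarrow> ('x, 'd::finite) chart set \<Rightarrow> bool" where
  "complex_atlas M A \<longleftrightarrow>
     (\<forall>c\<in>A. coord_chart M c) \<and> \<Union>(fst ` A) = M \<and> (\<forall>c\<in>A. \<forall>d\<in>A. holo_compat c d)"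

definition holo_charts :: "'x::topological_space set \<Rightarrow> ('x, 'd::finite) chart set \<Rightarrow> ('x, 'd) chart set" where
  "holo_charts M A = {c. coord_chart M c \<and> (\<forall>d\<in>A. holo_compat c d)}"

definition complex_submanifold :: "('x::topological_space, 'd::finite) chart set \<Rightarrow> 'x set \<Rightarrow> bool" where
  "complex_submanifold A S \<longleftrightarrow>
     (\<forall>x\<in>S. \<exists>(U, Z)\<in>holo_charts UNIV A. x \<in> U \<and>
        (\<exists>L. vec.subspace L \<and> Z ` (S \<inter> U) = Z ` U \<inter> L))"


section \<open>Holomorphic families of pairs with a trivialization\<close>

text \<open>
  The total space of the family of manifolds is the type \<open>'x\<close> with the atlas \<open>charts\<close>.
  The total space of the bundle is the type \<open>'e\<close>; its structure is given by \<open>frames\<close>, a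
  set of local fibre coordinates: a pair \<open>(U, \<tau>)\<close> stands for the local trivialization
  \<open>e \<mapsto> (bproj e, \<tau> e)\<close> over \<open>U\<close>, or equivalently for the local frame dual to \<open>\<tau>\<close>.
  The pair \<open>(sg, lm)\<close> is the compatible trivialization.
\<close>

record ('x, 'n::finite, 'm::finite, 'e, 'r::finite) family =
  charts :: "('x, 'n + 'm) chart set"
  base :: "(complex^'m) set"
  proj :: "'x \<Rightarrow> complex^'m"
  bproj :: "'e \<Rightarrow> 'x"
  frames :: "('x set \<times> ('e \<Rightarrow> complex^'r)) set"
  sg :: "'x \<Rightarrow> 'x"
  lm :: "'e \<Rightarrow> 'e"

definition family_of_manifolds ::
  "('x::topological_space, 'n::finite, 'm::finite, 'e, 'r::finite) family \<Rightarrow> bool" where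
  "family_of_manifolds X \<longleftrightarrow>
     complex_atlas UNIV (charts X) \<and>
     open (base X) \<and> 0 \<in> base X \<and> range (proj X) \<subseteq> base X \<and>
     (\<forall>(U, z)\<in>charts X.
        holo_map_on (z ` U) (proj X \<circ> inv_into U z) \<and>
        (\<forall>x\<in>U. surj (frechet_derivative (proj X \<circ> inv_into U z) (at (z x))))) \<and>
     (\<forall>K. compact K \<and> K \<subseteq> base X \<longrightarrow> compact (proj X -` K))"

definition holomorphic_bundle ::
  "('x::topological_space, 'n::finite, 'm::finite, 'e, 'r::finite) family \<Rightarrow> bool" where
  "holomorphic_bundle X \<longleftrightarrow>
     \<Union>(fst ` frames X) = UNIV \<and>
     (\<forall>(U, \<tau>)\<in>frames X. open U \<and> (\<forall>x\<in>U. bij_betw \<tau> (bproj X -` {x}) UNIV)) \<and>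
     (\<forall>(U, \<tau>)\<in>frames X. \<forall>(V, \<rho>)\<in>frames X. \<exists>g :: 'x \<Rightarrow> complex^'r^'r.
        (\<forall>e. bproj X e \<in> U \<inter> V \<longrightarrow> \<rho> e = g (bproj X e) *v \<tau> e) \<and>
        (\<forall>(W, z)\<in>charts X. \<forall>i j.
           holo_on (z ` (W \<inter> U \<inter> V)) (\<lambda>u. g (inv_into W z u) $ i $ j)))"

definition family_of_pairs ::
  "('x::topological_space, 'n::finite, 'm::finite, 'e, 'r::finite) family \<Rightarrow> bool" where
  "family_of_pairs X \<longleftrightarrow> family_of_manifolds X \<and> holomorphic_bundle X"

definition fib :: "('x, 'n::finite, 'm::finite, 'e, 'r::finite) family \<Rightarrow> complex^'m \<Rightarrow> 'x set" where
  "fib X t = proj X -` {t}"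

text \<open>The local holomorphic coordinates of the submanifold \<open>fib X t\<close>: both the chart and its
  inverse are holomorphic with respect to the ambient structure.\<close>

definition fibre_charts ::
  "('x::topological_space, 'n::finite, 'm::finite, 'e, 'r::finite) family \<Rightarrow> complex^'m \<Rightarrow> ('x, 'n) chart set" where
  "fibre_charts X t = {(U, z). coord_chart (fib X t) (U, z) \<and>
     (\<forall>(W, Z)\<in>charts X. holo_map_on (z ` (U \<inter> W)) (Z \<circ> inv_into U z)) \<and>
     (\<forall>x\<in>U. \<exists>(W, Z)\<in>holo_charts UNIV (charts X). x \<in> W \<and>
        (\<exists>F. holo_map_on (Z ` W) F \<and> (\<forall>y\<in>U \<inter> W. F (Z y) = z y)))}"

text \<open>The local holomorphic frames of the restriction of the bundle to \<open>fib X t\<close>.\<close>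

definition fibre_frames ::
  "('x::topological_space, 'n::finite, 'm::finite, 'e, 'r::finite) family \<Rightarrow> complex^'m \<Rightarrow>
   ('x set \<times> ('e \<Rightarrow> complex^'r)) set" where
  "fibre_frames X t = {(U, \<tau>). openin (top_of_set (fib X t)) U \<and>
     (\<forall>(W, \<rho>)\<in>frames X. \<exists>g :: 'x \<Rightarrow> complex^'r^'r.
        (\<forall>e. bproj X e \<in> U \<inter> W \<longrightarrow> \<tau> e = g (bproj X e) *v \<rho> e) \<and>
        (\<forall>x\<in>U \<inter> W. invertible (g x)) \<and>
        (\<forall>(V, z)\<in>fibre_charts X t. \<forall>i j.
           holo_on (z ` (V \<inter> U \<inter> W)) (\<lambda>u. g (inv_into V z u) $ i $ j)))}"

definition transversely_holomorphic_trivialization ::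
  "('x::topological_space, 'n::finite, 'm::finite, 'e, 'r::finite) family \<Rightarrow> bool" where
  "transversely_holomorphic_trivialization X \<longleftrightarrow>
     (let \<Theta> = inv_into UNIV (\<lambda>x. (sg X x, proj X x)) in
     bij_betw (\<lambda>x. (sg X x, proj X x)) UNIV (fib X 0 \<times> base X) \<and>
     (\<forall>x\<in>fib X 0. sg X x = x) \<and>
     continuous_on UNIV (sg X) \<and>
     (\<forall>(U, z)\<in>charts X. \<forall>(V, w)\<in>fibre_charts X 0.
        smooth_on (z ` (U \<inter> sg X -` V)) (w \<circ> sg X \<circ> inv_into U z)) \<and>
     continuous_on (fib X 0 \<times> base X) \<Theta> \<and>
     (\<forall>(U, z)\<in>charts X. \<forall>(V, w)\<in>fibre_charts X 0.
        smooth_on {(u, t). u \<in> w ` V \<and> t \<in> base X \<and> \<Theta> (inv_into V w u, t) \<in> U}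
          (\<lambda>(u, t). z (\<Theta> (inv_into V w u, t)))) \<and>
     (\<forall>x\<in>fib X 0. complex_submanifold (charts X) (sg X -` {x})))"

definition compatible_trivialization ::
  "('x::topological_space, 'n::finite, 'm::finite, 'e, 'r::finite) family \<Rightarrow> bool" where
  "compatible_trivialization X \<longleftrightarrow>
     transversely_holomorphic_trivialization X \<and>
     (\<forall>e. bproj X (lm X e) = sg X (bproj X e)) \<and>
     (\<forall>e. bproj X e \<in> fib X 0 \<longrightarrow> lm X e = e) \<and>
     (\<forall>(U, \<tau>)\<in>frames X. \<forall>(V, \<rho>)\<in>fibre_frames X 0. \<exists>L :: 'x \<Rightarrow> complex^'r^'r.
        (\<forall>e. bproj X e \<in> U \<inter> sg X -` V \<longrightarrow> \<rho> (lm X e) = L (bproj X e) *v \<tau> e) \<and>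
        (\<forall>y\<in>U \<inter> sg X -` V. invertible (L y)) \<and>
        (\<forall>(W, z)\<in>charts X. smooth_on (z ` (W \<inter> U \<inter> sg X -` V)) (\<lambda>u. L (inv_into W z u))))"

text \<open>
  From here on \<open>fib X t\<close> is regarded as the smooth manifold \<open>fib X 0\<close> with another complex
  structure, via \<open>sg\<close>, and its bundle as the smooth bundle over \<open>fib X 0\<close> with another
  holomorphic structure, via \<open>lm\<close>.  For \<open>t = 0\<close> these are the original structures.
\<close>

definition Xcharts ::
  "('x::topological_space, 'n::finite, 'm::finite, 'e, 'r::finite) family \<Rightarrow> complex^'m \<Rightarrow> ('x, 'n) chart set" where
  "Xcharts X t = {(U, z). U \<subseteq> fib X 0 \<and> (fib X t \<inter> sg X -` U, z \<circ> sg X) \<in> fibre_charts X t}"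

definition Eframes ::
  "('x::topological_space, 'n::finite, 'm::finite, 'e, 'r::finite) family \<Rightarrow> complex^'m \<Rightarrow>
   ('x set \<times> ('e \<Rightarrow> complex^'r)) set" where
  "Eframes X t = {(U, \<tau>). U \<subseteq> fib X 0 \<and> (fib X t \<inter> sg X -` U, \<tau> \<circ> lm X) \<in> fibre_frames X t}"

definition efib :: "('x, 'n::finite, 'm::finite, 'e, 'r::finite) family \<Rightarrow> 'x \<Rightarrow> 'e set" where
  "efib X x = bproj X -` {x}"

text \<open>The vector \<open>a u + b v\<close> of the fibre containing \<open>u\<close> and \<open>v\<close>.\<close>

definition elin ::
  "('x::topological_space, 'n::finite, 'm::finite, 'e, 'r::finite) family \<Rightarrow>
   complex \<Rightarrow> 'e \<Rightarrow> complex \<Rightarrow> 'e \<Rightarrow> 'e" where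
  "elin X a u b v = (THE e. e \<in> efib X (bproj X u) \<and>
     (\<forall>(V, \<tau>)\<in>Eframes X 0. bproj X u \<in> V \<longrightarrow> \<tau> e = a *s \<tau> u + b *s \<tau> v))"

definition frame_vec :: "('x, 'n::finite, 'm::finite, 'e, 'r::finite) family \<Rightarrow> ('e \<Rightarrow> complex^'r) \<Rightarrow> 'r \<Rightarrow> 'x \<Rightarrow> 'e" where
  "frame_vec X \<tau> k x = inv_into (efib X x) \<tau> (axis k 1)"


section \<open>Complexified tangent vectors\<close>

definition smooth_at ::
  "('x::topological_space, 'n::finite, 'm::finite, 'e, 'r::finite) family \<Rightarrow> 'x \<Rightarrow> ('x \<Rightarrow> complex) \<Rightarrow> bool" where
  "smooth_at X x f \<longleftrightarrow> (\<exists>(U, z)\<in>Xcharts X 0. x \<in> U \<and> smooth_on (z ` U) (f \<circ> inv_into U z))"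

text \<open>Complexified tangent vectors of \<open>fib X 0\<close> at \<open>x\<close> are derivations of the complex-valued
  functions that are smooth near \<open>x\<close>, extended by \<open>0\<close> to all functions.  The two definitions
  after \<open>dir_deriv\<close> are the coordinate vectors \<open>\<partial>/\<partial>z^i\<close> and \<open>\<partial>/\<partial>zbar^i\<close>.\<close>

type_synonym 'x tvec = "('x \<Rightarrow> complex) \<Rightarrow> complex"

definition dir_deriv :: "('x, 'n::finite) chart \<Rightarrow> 'x \<Rightarrow> complex^'n \<Rightarrow> ('x \<Rightarrow> complex) \<Rightarrow> complex" where
  "dir_deriv c x a f = frechet_derivative (f \<circ> inv_into (fst c) (snd c)) (at (snd c x)) a"

definition dz_vec ::
  "('x::topological_space, 'n::finite, 'm::finite, 'e, 'r::finite) family \<Rightarrow> ('x, 'n) chart \<Rightarrow> 'n \<Rightarrow> 'x \<Rightarrow> 'x tvec" where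
  "dz_vec X c i x = (\<lambda>f. if smooth_at X x f
     then (dir_deriv c x (axis i 1) f - \<i> * dir_deriv c x (axis i \<i>) f) / 2 else 0)"

definition dzb_vec ::
  "('x::topological_space, 'n::finite, 'm::finite, 'e, 'r::finite) family \<Rightarrow> ('x, 'n) chart \<Rightarrow> 'n \<Rightarrow> 'x \<Rightarrow> 'x tvec" where
  "dzb_vec X c i x = (\<lambda>f. if smooth_at X x f
     then (dir_deriv c x (axis i 1) f + \<i> * dir_deriv c x (axis i \<i>) f) / 2 else 0)"

definition tangent ::
  "('x::topological_space, 'n::finite, 'm::finite, 'e, 'r::finite) family \<Rightarrow> 'x \<Rightarrow> 'x tvec set" where
  "tangent X x = {v. \<exists>c\<in>Xcharts X 0. x \<in> fst c \<and>
     (\<exists>a b. v = (\<lambda>f. \<Sum>i\<in>UNIV. a i * dz_vec X c i x f + b i * dzb_vec X c i x f))}"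

definition T01 ::
  "('x::topological_space, 'n::finite, 'm::finite, 'e, 'r::finite) family \<Rightarrow> 'x \<Rightarrow> 'x tvec set" where
  "T01 X x = {v. \<exists>c\<in>Xcharts X 0. x \<in> fst c \<and> (\<exists>b. v = (\<lambda>f. \<Sum>i\<in>UNIV. b i * dzb_vec X c i x f))}"

definition cnj_vec :: "'x tvec \<Rightarrow> 'x tvec" where
  "cnj_vec v = (\<lambda>f. cnj (v (\<lambda>y. cnj (f y))))"

definition dz :: "('x, 'n::finite) chart \<Rightarrow> 'n \<Rightarrow> 'x tvec \<Rightarrow> complex" where
  "dz c i v = v (\<lambda>y. snd c y $ i)"

definition dzb :: "('x, 'n::finite) chart \<Rightarrow> 'n \<Rightarrow> 'x tvec \<Rightarrow> complex" where
  "dzb c i v = v (\<lambda>y. cnj (snd c y $ i))"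

text \<open>The projection of a tangent vector to its \<open>(1,0)\<close>-part with respect to \<open>fib X 0\<close>.\<close>

definition pr10 ::
  "('x::topological_space, 'n::finite, 'm::finite, 'e, 'r::finite) family \<Rightarrow> 'x \<Rightarrow> 'x tvec \<Rightarrow> 'x tvec" where
  "pr10 X x v = (THE u. \<forall>c\<in>Xcharts X 0. x \<in> fst c \<longrightarrow>
     u = (\<lambda>f. \<Sum>i\<in>UNIV. dz c i v * dz_vec X c i x f))"


section \<open>Bundle-valued forms\<close>

definition tlists ::
  "('x::topological_space, 'n::finite, 'm::finite, 'e, 'r::finite) family \<Rightarrow> 'x \<Rightarrow> nat \<Rightarrow> 'x tvec list set" where
  "tlists X x k = {vs. set vs \<subseteq> tangent X x \<and> length vs = k}"

text \<open>Exterior product of a 1-form \<open>\<alpha>\<close> from the left with an alternating form \<open>\<beta>\<close>, normalized by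
  \<open>(\<alpha>\<^sub>1 \<and> \<dots> \<and> \<alpha>\<^sub>k) (v\<^sub>1, \<dots>, v\<^sub>k) = det (\<alpha>\<^sub>i v\<^sub>j)\<close>.  Since \<open>(-1)^(deg \<beta>) \<beta> \<and> \<alpha> = \<alpha> \<and> \<beta>\<close>
  for a 1-form \<open>\<alpha>\<close>, no other product is needed.\<close>

definition wedge :: "('t \<Rightarrow> complex) \<Rightarrow> ('t list \<Rightarrow> complex) \<Rightarrow> 't list \<Rightarrow> complex" where
  "wedge \<alpha> \<beta> vs = (\<Sum>j<length vs. (-1) ^ j * \<alpha> (vs ! j) * \<beta> (take j vs @ drop (Suc j) vs))"

definition wedges :: "('t \<Rightarrow> complex) list \<Rightarrow> 't list \<Rightarrow> complex" where
  "wedges \<alpha>s = foldr wedge \<alpha>s (\<lambda>_. 1)"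

text \<open>Increasing multi-indices.\<close>

definition mi :: "nat \<Rightarrow> 'n::linorder list set" where
  "mi k = {I. sorted_wrt (<) I \<and> length I = k}"

definition all_idx :: "'n::{finite,linorder} list" where
  "all_idx = sorted_list_of_set UNIV"

text \<open>An \<open>E\<^sub>0\<close>-valued \<open>k\<close>-form assigns to \<open>x\<close> in \<open>fib X 0\<close> and to \<open>k\<close> complexified tangent
  vectors an element of the fibre over \<open>x\<close>; outside this domain it is \<open>undefined\<close>.\<close>

type_synonym ('x, 'v) form = "'x \<Rightarrow> 'x tvec list \<Rightarrow> 'v"

text \<open>The bundle-valued forms of type \<open>(p,q)\<close> with respect to the complex structure of index \<open>t\<close>.\<close>

definition Apq ::
  "('x::topological_space, 'n::{finite,linorder}, 'm::finite, 'e, 'r::finite) family \<Rightarrow> complex^'m \<Rightarrow>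
   nat \<Rightarrow> nat \<Rightarrow> ('x, 'e) form set" where
  "Apq X t p q = {s.
     (\<forall>x vs. if x \<in> fib X 0 \<and> vs \<in> tlists X x (p + q)
             then s x vs \<in> efib X x else s x vs = undefined) \<and>
     (\<forall>c\<in>Xcharts X t. \<forall>(V, \<tau>)\<in>Eframes X t. \<exists>a :: 'n list \<Rightarrow> 'n list \<Rightarrow> 'x \<Rightarrow> complex^'r.
        (\<forall>J\<in>mi q. \<forall>I\<in>mi p. \<forall>k. \<forall>x\<in>fst c \<inter> V. smooth_at X x (\<lambda>y. a J I y $ k)) \<and>
        (\<forall>x\<in>fst c \<inter> V. \<forall>vs\<in>tlists X x (p + q).
           \<tau> (s x vs) = (\<Sum>J\<in>mi q. \<Sum>I\<in>mi p.
              wedges (map (dzb c) J @ map (dz c) I) vs *s a J I x)))}"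

text \<open>The coefficient (column over the frame index) of \<open>dzbar^J \<and> dz^I\<close>.\<close>

definition coef ::
  "('x::topological_space, 'n::finite, 'm::finite, 'e, 'r::finite) family \<Rightarrow> ('x, 'n) chart \<Rightarrow>
   ('e \<Rightarrow> complex^'r) \<Rightarrow> ('x, 'e) form \<Rightarrow> 'n list \<Rightarrow> 'n list \<Rightarrow> 'x \<Rightarrow> complex^'r" where
  "coef X c \<tau> s J I y = \<tau> (s y (map (\<lambda>j. dzb_vec X c j y) J @ map (\<lambda>i. dz_vec X c i y) I))"

text \<open>The global \<open>k\<close>-form given, in all holomorphic coordinates \<open>c\<close> and all holomorphic frames \<open>\<tau>\<close>
  of the structure of index \<open>t\<close>, by the local formula \<open>F c \<tau>\<close>.\<close>

definition glue ::
  "('x::topological_space, 'n::finite, 'm::finite, 'e, 'r::finite) family \<Rightarrow> complex^'m \<Rightarrow> nat \<Rightarrow>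
   (('x, 'n) chart \<Rightarrow> ('e \<Rightarrow> complex^'r) \<Rightarrow> ('x, complex^'r) form) \<Rightarrow> ('x, 'e) form" where
  "glue X t k F = (\<lambda>x vs. if x \<in> fib X 0 \<and> vs \<in> tlists X x k
     then THE e. e \<in> efib X x \<and>
       (\<forall>c\<in>Xcharts X t. \<forall>(V, \<tau>)\<in>Eframes X t. x \<in> fst c \<inter> V \<longrightarrow> \<tau> e = F c \<tau> x vs)
     else undefined)"

definition form_add ::
  "('x::topological_space, 'n::finite, 'm::finite, 'e, 'r::finite) family \<Rightarrow> nat \<Rightarrow>
   ('x, 'e) form \<Rightarrow> ('x, 'e) form \<Rightarrow> ('x, 'e) form" where
  "form_add X k s s' = glue X 0 k (\<lambda>c \<tau> x vs. \<tau> (s x vs) + \<tau> (s' x vs))"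

definition form_diff ::
  "('x::topological_space, 'n::finite, 'm::finite, 'e, 'r::finite) family \<Rightarrow> nat \<Rightarrow>
   ('x, 'e) form \<Rightarrow> ('x, 'e) form \<Rightarrow> ('x, 'e) form" where
  "form_diff X k s s' = glue X 0 k (\<lambda>c \<tau> x vs. \<tau> (s x vs) - \<tau> (s' x vs))"

text \<open>In the operators below, the argument \<open>k\<close> is the degree of the form \<open>s\<close>.\<close>

definition dbar ::
  "('x::topological_space, 'n::{finite,linorder}, 'm::finite, 'e, 'r::finite) family \<Rightarrow> complex^'m \<Rightarrow>
   nat \<Rightarrow> ('x, 'e) form \<Rightarrow> ('x, 'e) form" where
  "dbar X t k s = glue X t (Suc k) (\<lambda>c \<tau> x vs. \<chi> l.
     \<Sum>q\<le>k. \<Sum>J\<in>mi q. \<Sum>I\<in>mi (k - q). \<Sum>j\<in>UNIV.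
        dzb_vec X c j x (\<lambda>y. coef X c \<tau> s J I y $ l) *
        wedges (dzb c j # map (dzb c) J @ map (dz c) I) vs)"


section \<open>The Chern connection\<close>

definition smooth_section ::
  "('x::topological_space, 'n::finite, 'm::finite, 'e, 'r::finite) family \<Rightarrow> 'x set \<Rightarrow> ('x \<Rightarrow> 'e) \<Rightarrow> bool" where
  "smooth_section X U s \<longleftrightarrow> openin (top_of_set (fib X 0)) U \<and>
     (\<forall>x\<in>U. s x \<in> efib X x \<and>
        (\<forall>(V, \<tau>)\<in>Eframes X 0. x \<in> V \<longrightarrow> (\<forall>k. smooth_at X x (\<lambda>y. \<tau> (s y) $ k))))"

definition hermitian_metric ::
  "('x::topological_space, 'n::finite, 'm::finite, 'e, 'r::finite) family \<Rightarrow> ('e \<Rightarrow> 'e \<Rightarrow> complex) \<Rightarrow> bool" where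
  "hermitian_metric X h \<longleftrightarrow>
     (\<forall>x\<in>fib X 0. \<forall>u\<in>efib X x. \<forall>v\<in>efib X x.
        h v u = cnj (h u v) \<and>
        (\<forall>w\<in>efib X x. \<forall>a b. h (elin X a u b v) w = a * h u w + b * h v w) \<and>
        (u \<noteq> elin X 0 u 0 u \<longrightarrow> 0 < Re (h u u))) \<and>
     (\<forall>U s s'. smooth_section X U s \<and> smooth_section X U s' \<longrightarrow>
        (\<forall>x\<in>U. smooth_at X x (\<lambda>y. h (s y) (s' y))))"

text \<open>\<open>nab s x v\<close> is the covariant derivative at \<open>x\<close>, in direction \<open>v\<close>, of a local section \<open>s\<close>
  that is smooth near \<open>x\<close>.\<close>

definition connection ::
  "('x::topological_space, 'n::finite, 'm::finite, 'e, 'r::finite) family \<Rightarrow>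
   (('x \<Rightarrow> 'e) \<Rightarrow> 'x \<Rightarrow> 'x tvec \<Rightarrow> 'e) \<Rightarrow> bool" where
  "connection X nab \<longleftrightarrow>
     (\<forall>U s. smooth_section X U s \<longrightarrow>
        (\<forall>x\<in>U. \<forall>v\<in>tangent X x.
           nab s x v \<in> efib X x \<and>
           (\<forall>w\<in>tangent X x. \<forall>a b.
              nab s x (\<lambda>f. a * v f + b * w f) = elin X a (nab s x v) b (nab s x w)) \<and>
           (\<forall>s'. smooth_section X U s' \<longrightarrow>
              ((\<forall>y\<in>U. s y = s' y) \<longrightarrow> nab s x v = nab s' x v) \<and>
              nab (\<lambda>y. elin X 1 (s y) 1 (s' y)) x v = elin X 1 (nab s x v) 1 (nab s' x v)) \<and>
           (\<forall>f. (\<forall>y\<in>U. smooth_at X y f) \<longrightarrow>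
              nab (\<lambda>y. elin X (f y) (s y) 0 (s y)) x v = elin X (v f) (s x) (f x) (nab s x v))) \<and>
        (\<forall>c\<in>Xcharts X 0. \<forall>i.
           smooth_section X (U \<inter> fst c) (\<lambda>y. nab s y (dz_vec X c i y)) \<and>
           smooth_section X (U \<inter> fst c) (\<lambda>y. nab s y (dzb_vec X c i y))))"

text \<open>\<open>cnj_vec\<close> appears because \<open>h\<close> is conjugate linear in its second argument.\<close>

definition chern_connection ::
  "('x::topological_space, 'n::finite, 'm::finite, 'e, 'r::finite) family \<Rightarrow> ('e \<Rightarrow> 'e \<Rightarrow> complex) \<Rightarrow>
   (('x \<Rightarrow> 'e) \<Rightarrow> 'x \<Rightarrow> 'x tvec \<Rightarrow> 'e) \<Rightarrow> bool" where
  "chern_connection X h nab \<longleftrightarrow> connection X nab \<and>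
     (\<forall>U s s'. smooth_section X U s \<and> smooth_section X U s' \<longrightarrow>
        (\<forall>x\<in>U. \<forall>v\<in>tangent X x.
           v (\<lambda>y. h (s y) (s' y)) = h (nab s x v) (s' x) + h (s x) (nab s' x (cnj_vec v)))) \<and>
     (\<forall>U s. smooth_section X U s \<longrightarrow>
        (\<forall>x\<in>U. \<forall>v\<in>T01 X x. \<forall>(V, \<tau>)\<in>Eframes X 0. x \<in> V \<longrightarrow>
           (\<forall>k. \<tau> (nab s x v) $ k = v (\<lambda>y. \<tau> (s y) $ k))))"

text \<open>\<open>\<theta> (\<partial>/\<partial>z^i)\<close>, where \<open>\<nabla> e\<^sub>k = \<theta>^{kl} e\<^sub>l\<close> for the frame \<open>e\<close> dual to \<open>\<tau>\<close>.\<close>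

definition theta ::
  "('x::topological_space, 'n::finite, 'm::finite, 'e, 'r::finite) family \<Rightarrow>
   (('x \<Rightarrow> 'e) \<Rightarrow> 'x \<Rightarrow> 'x tvec \<Rightarrow> 'e) \<Rightarrow> ('x, 'n) chart \<Rightarrow> ('e \<Rightarrow> complex^'r) \<Rightarrow> 'x \<Rightarrow>
   'n \<Rightarrow> 'r \<Rightarrow> 'r \<Rightarrow> complex" where
  "theta X nab c \<tau> x i k l = \<tau> (nab (frame_vec X \<tau> k) x (dz_vec X c i x)) $ l"

definition nabla10 ::
  "('x::topological_space, 'n::{finite,linorder}, 'm::finite, 'e, 'r::finite) family \<Rightarrow>
   (('x \<Rightarrow> 'e) \<Rightarrow> 'x \<Rightarrow> 'x tvec \<Rightarrow> 'e) \<Rightarrow> nat \<Rightarrow> ('x, 'e) form \<Rightarrow> ('x, 'e) form" where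
  "nabla10 X nab k s = glue X 0 (Suc k) (\<lambda>c \<tau> x vs. \<chi> l.
     (\<Sum>q\<le>k. \<Sum>J\<in>mi q. \<Sum>I\<in>mi (k - q). \<Sum>i\<in>UNIV.
        dz_vec X c i x (\<lambda>y. coef X c \<tau> s J I y $ l) *
        wedges (dz c i # map (dzb c) J @ map (dz c) I) vs) +
     (\<Sum>m\<in>UNIV. wedge (\<lambda>v. \<Sum>i\<in>UNIV. theta X nab c \<tau> x i m l * dz c i v) (\<lambda>ws. \<tau> (s x ws) $ m) vs))"


section \<open>The two components of the Beltrami differential\<close>

text \<open>The coefficient matrix \<open>\<phi>^i\<^sub>j\<close> for coordinates \<open>d\<close> of \<open>X\<^sub>t\<close> and \<open>c\<close> of \<open>X\<^sub>0\<close>.\<close>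

definition phi_coeff ::
  "('x::topological_space, 'n::finite, 'm::finite, 'e, 'r::finite) family \<Rightarrow>
   ('x, 'n) chart \<Rightarrow> ('x, 'n) chart \<Rightarrow> 'x \<Rightarrow> complex^'n^'n" where
  "phi_coeff X d c x =
     matrix_inv (\<chi> k i. dz_vec X c i x (\<lambda>y. snd d y $ k)) ** (\<chi> k j. dzb_vec X c j x (\<lambda>y. snd d y $ k))"

text \<open>As a vector-valued 1-form, \<open>\<phi>(t)\<close> maps tangent vectors to tangent vectors.\<close>

definition phi ::
  "('x::topological_space, 'n::finite, 'm::finite, 'e, 'r::finite) family \<Rightarrow> complex^'m \<Rightarrow> 'x \<Rightarrow>
   'x tvec \<Rightarrow> 'x tvec" where
  "phi X t x v = (THE u. \<forall>d\<in>Xcharts X t. \<forall>c\<in>Xcharts X 0. x \<in> fst d \<inter> fst c \<longrightarrow>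
     u = (\<lambda>f. \<Sum>i\<in>UNIV. \<Sum>j\<in>UNIV. phi_coeff X d c x $ i $ j * dzb c j v * dz_vec X c i x f))"

definition iphi ::
  "('x::topological_space, 'n::finite, 'm::finite, 'e, 'r::finite) family \<Rightarrow> complex^'m \<Rightarrow>
   nat \<Rightarrow> ('x, 'e) form \<Rightarrow> ('x, 'e) form" where
  "iphi X t k s = glue X 0 k (\<lambda>c \<tau> x vs. \<chi> l.
     \<Sum>i\<in>UNIV. wedge (\<lambda>v. dz c i (phi X t x v)) (\<lambda>ws. \<tau> (s x (dz_vec X c i x # ws)) $ l) vs)"

text \<open>The sum is finite because \<open>i\<^sub>\<phi>\<close> lowers the number of \<open>dz\<close>-factors, of which there are at
  most \<open>k\<close>.\<close>

definition exp_iphi ::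
  "('x::topological_space, 'n::finite, 'm::finite, 'e, 'r::finite) family \<Rightarrow> complex^'m \<Rightarrow>
   nat \<Rightarrow> ('x, 'e) form \<Rightarrow> ('x, 'e) form" where
  "exp_iphi X t k s = glue X 0 k (\<lambda>c \<tau> x vs.
     \<Sum>j\<le>k. (1 / fact j) *s \<tau> ((iphi X t k ^^ j) s x vs))"

text \<open>\<open>v\<^sub>t = w v\<^sub>0\<close> for the fibre coordinates \<open>\<rho> = v\<^sub>t\<close> and \<open>\<tau> = v\<^sub>0\<close>.\<close>

definition wmat ::
  "('x, 'n::finite, 'm::finite, 'e, 'r::finite) family \<Rightarrow> ('e \<Rightarrow> complex^'r) \<Rightarrow> ('e \<Rightarrow> complex^'r) \<Rightarrow> 'x \<Rightarrow> complex^'r^'r" where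
  "wmat X \<rho> \<tau> y = (\<chi> j l. \<rho> (frame_vec X \<tau> l y) $ j)"

definition psi_form ::
  "('x::topological_space, 'n::finite, 'm::finite, 'e, 'r::finite) family \<Rightarrow>
   (('x \<Rightarrow> 'e) \<Rightarrow> 'x \<Rightarrow> 'x tvec \<Rightarrow> 'e) \<Rightarrow> complex^'m \<Rightarrow>
   ('x, 'n) chart \<Rightarrow> ('e \<Rightarrow> complex^'r) \<Rightarrow> 'x \<Rightarrow> 'r \<Rightarrow> 'r \<Rightarrow> 'x tvec \<Rightarrow> complex" where
  "psi_form X nab t c \<tau> x k l v = (THE a. \<forall>(V, \<rho>)\<in>Eframes X t. x \<in> V \<longrightarrow>
     a = (\<Sum>j\<in>UNIV. matrix_inv (wmat X \<rho> \<tau> x) $ l $ j *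
            ((\<Sum>i\<in>UNIV. dzb_vec X c i x (\<lambda>y. wmat X \<rho> \<tau> y $ j $ k) * dzb c i v) -
             (\<Sum>i\<in>UNIV. dz_vec X c i x (\<lambda>y. wmat X \<rho> \<tau> y $ j $ k) * dz c i (phi X t x v)))) +
         (\<Sum>i\<in>UNIV. theta X nab c \<tau> x i k l * dz c i (phi X t x v)))"

text \<open>The action \<open>\<beta> \<otimes> e\<^sub>m \<mapsto> (-1)^(deg \<beta>) \<beta> \<and> \<psi>^{ml} \<otimes> e\<^sub>l = \<psi>^{ml} \<and> \<beta> \<otimes> e\<^sub>l\<close>.\<close>

definition psi ::
  "('x::topological_space, 'n::finite, 'm::finite, 'e, 'r::finite) family \<Rightarrow>
   (('x \<Rightarrow> 'e) \<Rightarrow> 'x \<Rightarrow> 'x tvec \<Rightarrow> 'e) \<Rightarrow> complex^'m \<Rightarrow> nat \<Rightarrow> ('x, 'e) form \<Rightarrow> ('x, 'e) form" where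
  "psi X nab t k s = glue X 0 (Suc k) (\<lambda>c \<tau> x vs. \<chi> l.
     \<Sum>m\<in>UNIV. wedge (psi_form X nab t c \<tau> x m l) (\<lambda>ws. \<tau> (s x ws) $ m) vs)"

definition Lphi10 ::
  "('x::topological_space, 'n::{finite,linorder}, 'm::finite, 'e, 'r::finite) family \<Rightarrow>
   (('x \<Rightarrow> 'e) \<Rightarrow> 'x \<Rightarrow> 'x tvec \<Rightarrow> 'e) \<Rightarrow> complex^'m \<Rightarrow> nat \<Rightarrow> ('x, 'e) form \<Rightarrow> ('x, 'e) form" where
  "Lphi10 X nab t k s =
     form_diff X (Suc k) (iphi X t (Suc k) (nabla10 X nab k s)) (nabla10 X nab k (iphi X t k s))"


section \<open>The map \<open>P\<^sub>t\<close>\<close>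

text \<open>The fibre at \<open>x\<close> of the canonical bundle of the structure of index \<open>t\<close>.\<close>

definition canon ::
  "('x::topological_space, 'n::{finite,linorder}, 'm::finite, 'e, 'r::finite) family \<Rightarrow> complex^'m \<Rightarrow>
   'x \<Rightarrow> ('x tvec list \<Rightarrow> complex) set" where
  "canon X t x = {\<kappa>. \<exists>c\<in>Xcharts X t. x \<in> fst c \<and> (\<exists>a. \<kappa> =
     (\<lambda>ws. if ws \<in> tlists X x CARD('n) then a * wedges (map (dz c) all_idx) ws else 0))}"

text \<open>
  An element of \<open>\<Omega>^p \<otimes> K^{-1} \<otimes> E = \<Omega>^p \<otimes> Hom(K, E)\<close> at \<open>x\<close> is encoded as a map taking \<open>p\<close> tangent
  vectors and an element \<open>\<kappa>\<close> of \<open>canon X t x\<close> to the fibre of \<open>E\<close>.  In particular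
  \<open>dz^I \<otimes> 1/<dz> \<otimes> e\<close> is \<open>\<lambda>us \<kappa>. dz^I us * (\<kappa> / <dz>) * e\<close>, with \<open>\<kappa> / <dz>\<close> the value of \<open>\<kappa>\<close> on
  \<open>(\<partial>/\<partial>z^1, \<dots>, \<partial>/\<partial>z^n)\<close>.
\<close>

type_synonym ('x, 'e) vval = "'x tvec list \<Rightarrow> ('x tvec list \<Rightarrow> complex) \<Rightarrow> 'e"

definition Iop ::
  "('x::topological_space, 'n::{finite,linorder}, 'm::finite, 'e, 'r::finite) family \<Rightarrow> complex^'m \<Rightarrow>
   nat \<Rightarrow> nat \<Rightarrow> ('x, 'e) form \<Rightarrow> ('x, ('x, 'e) vval) form" where
  "Iop X t p q s = (\<lambda>x vs us \<kappa>.
     if x \<in> fib X 0 \<and> us \<in> tlists X x p \<and> \<kappa> \<in> canon X t x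
     then glue X t (CARD('n) + q) (\<lambda>c \<tau> y ws.
       \<Sum>J\<in>mi q. \<Sum>I\<in>mi p.
         (wedges (map (dzb c) J @ map (dz c) all_idx) ws *
          wedges (map (dz c) I) us * \<kappa> (map (\<lambda>i. dz_vec X c i y) all_idx)) *s coef X c \<tau> s J I y) x vs
     else undefined)"

text \<open>\<open>e^{i\<^sub>\<phi>}\<close> acting on the form part only.\<close>

definition exp_iphi_V ::
  "('x::topological_space, 'n::{finite,linorder}, 'm::finite, 'e, 'r::finite) family \<Rightarrow> complex^'m \<Rightarrow>
   nat \<Rightarrow> nat \<Rightarrow> ('x, ('x, 'e) vval) form \<Rightarrow> ('x, ('x, 'e) vval) form" where
  "exp_iphi_V X t p q S = (\<lambda>x vs us \<kappa>.
     if x \<in> fib X 0 \<and> us \<in> tlists X x p \<and> \<kappa> \<in> canon X 0 x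
     then exp_iphi X t (CARD('n) + q) (\<lambda>y ws. S y ws us \<kappa>) x vs
     else undefined)"

text \<open>The map induced by \<open>\<pi>^{1,0}\<close> on \<open>k\<close>-covectors: on a product of 1-forms it replaces every
  factor \<open>\<alpha>\<close> by its \<open>(1,0)\<close>-part \<open>\<alpha> \<circ> pr10 X x\<close>.\<close>

definition pi10 ::
  "('x::topological_space, 'n::finite, 'm::finite, 'e, 'r::finite) family \<Rightarrow> 'x \<Rightarrow> nat \<Rightarrow>
   ('x tvec list \<Rightarrow> complex) \<Rightarrow> 'x tvec list \<Rightarrow> complex" where
  "pi10 X x k \<beta> = (\<lambda>ws. if ws \<in> tlists X x k then \<beta> (map (pr10 X x) ws) else 0)"

text \<open>The identification of the coefficient bundle \<open>\<Omega>\<^sub>t^p \<otimes> K\<^sub>t^{-1} \<otimes> E\<^sub>t\<close> with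
  \<open>\<Omega>\<^sub>0^p \<otimes> K\<^sub>0^{-1} \<otimes> E\<^sub>0\<close>: \<open>\<pi>^{1,0}\<close> on \<open>\<Omega>\<^sub>t^p\<close>, and the inverse transpose of the isomorphism
  from \<open>K\<^sub>t\<close> to \<open>K\<^sub>0\<close> on the dual bundles.\<close>

definition ident_V ::
  "('x::topological_space, 'n::{finite,linorder}, 'm::finite, 'e, 'r::finite) family \<Rightarrow> complex^'m \<Rightarrow>
   nat \<Rightarrow> ('x, ('x, 'e) vval) form \<Rightarrow> ('x, ('x, 'e) vval) form" where
  "ident_V X t p S = (\<lambda>x vs us \<kappa>.
     if x \<in> fib X 0 \<and> us \<in> tlists X x p \<and> \<kappa> \<in> canon X 0 x
     then S x vs (map (pr10 X x) us) (inv_into (canon X t x) (pi10 X x CARD('n)) \<kappa>)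
     else undefined)"

text \<open>\<open>P\<^sub>t = (I\<^sub>t^{p,q})^{-1} \<circ> e^{i\<^sub>\<phi>} \<circ> I\<^sub>0^{p,q}\<close>, with \<open>I\<^sub>t^{p,q}\<close> read through \<open>ident_V\<close>.\<close>

definition Pmap ::
  "('x::topological_space, 'n::{finite,linorder}, 'm::finite, 'e, 'r::finite) family \<Rightarrow> complex^'m \<Rightarrow>
   nat \<Rightarrow> nat \<Rightarrow> ('x, 'e) form \<Rightarrow> ('x, 'e) form" where
  "Pmap X t p q =
     inv_into (Apq X t p q) (ident_V X t p \<circ> Iop X t p q) \<circ> exp_iphi_V X t p q \<circ> Iop X 0 p q"

end

theory Submission
  imports Defs "HOL-Complex_Analysis.Cauchy_Integral_Formula"
begin

text \<open>For small \<open>t\<close>, \<open>P\<^sub>t\<close> turns out to be the pullback by the bundle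
  automorphism \<open>A\<close> of the complexified tangent bundle which maps the \<open>(1,0)\<close>- and \<open>(0,1)\<close>-vectors of \<open>X\<^sub>t\<close> to
  those of \<open>X\<^sub>0\<close>: both sides of the identity defining \<open>P\<^sub>t\<close> are alternating forms with the same values
  on lists of \<open>(0,1)\<close>-vectors of \<open>X\<^sub>t\<close> followed by arbitrary vectors.  In a chart of \<open>X\<^sub>0\<close> and a holomorphic
  frame of \<open>E\<^sub>t\<close> the connection cancels, and the operator on the right becomes the alternation of the
  derivative along \<open>D\<^sub>u = u\<^sup>0\<^sup>1 - \<phi> u\<close> plus a derivative of \<open>\<phi>\<close>; on the left, differentiating \<open>s \<circ> A\<close> gives
  the same main term.  The remaining first-order terms differ by a vector-valued form which is
  symmetric in its two arguments, because second derivatives commute, and alternation kills it.\<close>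

text \<open>Smallness of \<open>t\<close> means that no nonzero (1,0)-vector of X_0 is of type (0,1)
  on X_t. This makes the matrix of derivatives of z_t by z invertible, and compactness of X_0 yields
  one neighbourhood of 0 for all points. Then \<phi> v is the only (1,0)-vector of X_0 for which
  v^{01} - \<phi> v is of type (0,1) on X_t, and A sends a (0,1)-vector of X_t to its (0,1)-part on
  X_0, and a (1,0)-vector of X_t to the (1,0)-vector of X_0 with the same values of dz_t.

  Two obstacles shape the proof. The operators, \<phi>, \<psi> and I_t are definite descriptions
  over all charts and frames, so every local formula must be shown independent of them before it can
  be used. And forms are functions of lists of vectors at one point, so to differentiate them the
  vectors are extended with constant coefficients in a chart; replacing such an extension by another
  one costs a first-order term. Independence of the chart therefore rests on the same cancellation
  as the identity itself.\<close>

abbreviation "smo \<equiv> smooth_on"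
abbreviation "hmap \<equiv> holo_map_on"
abbreviation "minv \<equiv> matrix_inv"
abbreviation "wgs \<equiv> wedges"
abbreviation "cont \<equiv> continuous_on"
abbreviation "ddr \<equiv> dir_deriv"
abbreviation sR (infixr "*R" 75) where "a *R b \<equiv> a *\<^sub>R b"

abbreviation "fder f x \<equiv> frechet_derivative f (at x)"
abbreviation "iv \<equiv> inv_into"
abbreviation "dzs c J I \<equiv> map (dzb c) J @ map (dz c) I"

section \<open>Calculus of smooth maps\<close>

lemma differentiable_on_open:
 "open S ==> f differentiable_on S \<longleftrightarrow> (ALL x:S. f differentiable (at x))" by (simp add: differentiable_on_eq_differentiable_at)

lemma differentiable_has_derivative:
 "f differentiable (at x) ==> (f has_derivative fder f x) (at x)" by (simp add: frechet_derivative_works)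

lemma fderI: "(f has_derivative D) (at x) ==> fder f x = D" by (metis frechet_derivative_at)

text \<open>\<open>frechet_derivative\<close> is a choice among all derivatives at the point. The
  two functions have the same derivatives there, possibly none, so the choices coincide.\<close>

lemma fder_cong_open:
 assumes "open S" "x : S" "!!y. y : S ==> f y = g y" shows "fder f x = fder g x"
proof -
 have "(f has_derivative D) (at x) \<longleftrightarrow> (g has_derivative D) (at x)" for D
  using assms has_derivative_transform_within_open[of f D x UNIV S g]
   has_derivative_transform_within_open[of g D x UNIV S f] by auto
 thus ?thesis by (simp add: frechet_derivative_def)
qed

lemma Ck_on_cong:
 assumes "open S" "!!x. x : S ==> f x = g x" "Ck_on k S f" shows "Ck_on k S g" using assms(2,3)
proof (induction k arbitrary: f g)
 case 0 thus ?case by (metis Ck_on.simps(1) continuous_on_cong)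
next
 case (Suc k)
 have "g differentiable (at x)" if "x : S" for x using Suc.prems that assms(1) differentiable_on_open[of S f]
  by (metis Ck_on.simps(2) differentiable_def has_derivative_transform_within_open)
 moreover have "Ck_on k S (%x. fder g x v)" for v
 proof (rule Suc.IH) show "Ck_on k S (%x. fder f x v)" using Suc.prems by simp
  show "fder f x v = fder g x v" if "x : S" for x using fder_cong_open[OF assms(1) that Suc.prems(1)] by simp
 qed ultimately show ?case by (simp add: differentiable_on_open assms(1))
qed

lemma Ck_on_subset:
 assumes "Ck_on k S f" "open S" "open T" "T <= S" shows "Ck_on k T f" using assms(1)
proof (induction k arbitrary: f)
 case 0 thus ?case using assms(4) by (auto intro: continuous_on_subset)
next
 case (Suc k) thus ?case using assms by (auto simp: differentiable_on_open)
qed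

lemma Ck_on_Suc_imp: "open S ==> Ck_on (Suc k) S f ==> Ck_on k S f"
proof (induction k arbitrary: f)
 case 0 thus ?case by (auto simp: differentiable_imp_continuous_on)
next
 case (Suc k) thus ?case by (metis Ck_on.simps(2))
qed

lemma Ck_on_const: "Ck_on k S (%x. c)" by (induction k arbitrary: c) simp_all

lemma Ck_on_SucI:
 assumes "open S" "!!x. x : S ==> (f has_derivative f' x) (at x)" "!!v. Ck_on k S (%x. f' x v)" shows "Ck_on (Suc k) S f"
proof -
 have "Ck_on k S (%x. fder f x v)" for v using assms(2) by (intro Ck_on_cong[OF assms(1) _ assms(3)[of v]]) (metis fderI)
 thus ?thesis using assms by (auto simp: differentiable_on_open differentiable_def)
qed

lemma Ck_Suc_deriv:
 assumes "open S" "Ck_on (Suc k) S f" "x : S" shows "(f has_derivative fder f x) (at x)"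
 using assms by (simp add: differentiable_on_open differentiable_has_derivative)

lemma Ck_on_bounded_linear_compose:
 assumes "bounded_linear h" "open S" "Ck_on k S f" shows "Ck_on k S (%x. h (f x))" using assms(3)
proof (induction k arbitrary: f)
 case 0 thus ?case using assms(1) by (auto intro: bounded_linear.continuous_on)
next
 case (Suc k)
 thus ?case using assms(1,2) Ck_Suc_deriv[of S k f] by (intro Ck_on_SucI[of S _ "%x v. h (fder f x v)"])
   (auto intro: bounded_linear.has_derivative)
qed

lemma Ck_on_bounded_linear: "bounded_linear h ==> open S ==> Ck_on k S h"
proof (cases k)
 case (Suc j) assume "bounded_linear h" "open S"
 thus ?thesis unfolding Suc by (intro Ck_on_SucI[of S h "%_. h"]) (auto intro: bounded_linear_imp_has_derivative Ck_on_const)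
qed (auto intro: linear_continuous_on)

lemma Ck_on_add:
 assumes "open S" "Ck_on k S f" "Ck_on k S g" shows "Ck_on k S (%x. f x + g x)" using assms(2,3)
proof (induction k arbitrary: f g)
 case 0 thus ?case by (auto intro: continuous_on_add)
next
 case (Suc k) thus ?case using assms(1) Ck_Suc_deriv[of S k f] Ck_Suc_deriv[of S k g]
  by (intro Ck_on_SucI[of S _ "%x v. fder f x v + fder g x v"]) (auto intro!: derivative_intros)
qed

lemma Ck_on_sum:
 assumes "open S" "!!i. i : I ==> Ck_on k S (f i)" shows "Ck_on k S (%x. SUM i:I. f i x)" using assms(2)
 by (induction I rule: infinite_finite_induct) (auto intro: Ck_on_const Ck_on_add assms(1))

lemma Ck_on_bilinear:
 assumes "bounded_bilinear h" "open S" "Ck_on k S f" "Ck_on k S g" shows "Ck_on k S (%x. h (f x) (g x))" using assms(3,4)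
proof (induction k arbitrary: f g)
 case 0 thus ?case using assms(1) by (auto intro: bounded_bilinear.continuous_on)
next
 case (Suc k)
 have *: "Ck_on k S f" "Ck_on k S g" using Suc.prems Ck_on_Suc_imp assms(2) by blast+
 show ?case using assms(1,2) Suc * Ck_Suc_deriv[of S k f] Ck_Suc_deriv[of S k g] by (intro Ck_on_SucI[of S _ "%x v. h (f x) (fder g x v)
   + h (fder f x v) (g x)"] Ck_on_add) (auto intro: bounded_bilinear.FDERIV)
qed

text \<open>In the chain rule the direction \<open>fder g x v\<close> depends on \<open>x\<close>.
  Expanding it in the basis of the middle space leaves derivatives of \<open>f\<close> in fixed
  directions, composed with \<open>g\<close>, and to these the induction hypothesis applies.\<close>

lemma Ck_on_compose:
 fixes g :: "'a::euclidean_space => 'b::euclidean_space" and f :: "'b => 'c::real_normed_vector"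
 assumes "open S" "open T" "Ck_on k T f" "Ck_on k S g" "g ` S <= T" shows "Ck_on k S (%x. f (g x))" using assms(3,4)
proof (induction k arbitrary: f)
 case 0 thus ?case using assms(5) by (auto intro: continuous_on_compose2)
next
 case (Suc k)
 let ?D = "%x v. SUM b:Basis. (fder g x v \<bullet> b) *R fder f (g x) b"
 have gk: "Ck_on k S g" using Suc.prems Ck_on_Suc_imp assms(1) by blast
 have D: "((%x. f (g x)) has_derivative ?D x) (at x)" if "x : S" for x
 proof -
  have f: "(f has_derivative fder f (g x)) (at (g x))" using Suc.prems(1) that assms Ck_Suc_deriv by blast
  have g: "(g has_derivative fder g x) (at x)" using Suc.prems(2) that assms Ck_Suc_deriv by blast
  have "((%x. f (g x)) has_derivative (%v. fder f (g x) (fder g x v))) (at x)" using diff_chain_at[OF g f] by (simp add: o_def)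
  moreover have "fder f (g x) (fder g x w) = ?D x w" for w
  proof -
   have lin: "linear (fder f (g x))" using f has_derivative_linear by blast
   have "fder f (g x) (SUM b:Basis. (fder g x w \<bullet> b) *R b) = ?D x w" using lin by (simp add: linear_sum linear_cmul)
   thus ?thesis by (simp only: euclidean_representation) qed
  ultimately show ?thesis by (rule has_derivative_eq_rhs[OF _ ext]) qed
 have "Ck_on k S (%x. ?D x v)" for v
 proof (rule Ck_on_sum[OF assms(1)], rule Ck_on_bilinear[OF bounded_bilinear_scaleR assms(1)])
  fix b :: 'b show "Ck_on k S (%x. fder g x v \<bullet> b)" using Suc.prems(2)
   by (intro Ck_on_bounded_linear_compose[OF bounded_linear_inner_left assms(1)]) simp
  show "Ck_on k S (%x. fder f (g x) b)" using Suc gk by auto qed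
 thus ?case using D assms(1) by (intro Ck_on_SucI[where f' = ?D]) auto
qed

lemma so_cong: "open S ==> (!!x. x : S ==> f x = g x) ==> smo S f ==> smo S g" unfolding smooth_on_def using Ck_on_cong by blast

lemma so_subset: "smo S f ==> open S ==> open T ==> T <= S ==> smo T f" unfolding smooth_on_def using Ck_on_subset by blast

lemma so_const: "smo S (%x. c)" unfolding smooth_on_def by (simp add: Ck_on_const)

lemma so_bounded_linear: "bounded_linear h ==> open S ==> smo S h" unfolding smooth_on_def by (simp add: Ck_on_bounded_linear)

lemma so_bounded_linear_compose:
 "bounded_linear h ==> open S ==> smo S f ==> smo S (%x. h (f x))" unfolding smooth_on_def by (simp add: Ck_on_bounded_linear_compose)

lemma so_add: "open S ==> smo S f ==> smo S g ==> smo S (%x. f x + g x)" unfolding smooth_on_def by (simp add: Ck_on_add)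

lemma so_sum:
 "open S ==> (!!i. i : I ==> smo S (f i)) ==> smo S (%x. SUM i:I. f i x)" unfolding smooth_on_def by (simp add: Ck_on_sum)

lemma so_mult:
 fixes f g :: "'a::real_normed_vector => complex"
 shows "open S ==> smo S f ==> smo S g ==> smo S (%x. f x * g x)"
 unfolding smooth_on_def by (simp add: Ck_on_bilinear[OF bounded_bilinear_mult])

lemma so_compose:
 fixes g :: "'a::euclidean_space => 'b::euclidean_space" and f :: "'b => 'c::real_normed_vector"
 shows "open S ==> open T ==> smo T f ==> smo S g ==> g ` S <= T ==>
  smo S (%x. f (g x))" unfolding smooth_on_def using Ck_on_compose by blast

lemma so_fder:
 "smo S f ==> smo S (%x. fder f x v)" unfolding smooth_on_def by (metis Ck_on.simps(2))

lemma so_has_derivative: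
 "smo S f ==> open S ==> x : S ==> (f has_derivative fder f x) (at x)" unfolding smooth_on_def using Ck_Suc_deriv by blast

lemma so_imp_continuous_on: "smo S f ==> cont S f" unfolding smooth_on_def using Ck_on.simps(1) by blast

text \<open>The derivative of 1/f is a product of two factors 1/f and a derivative of
  \<open>f\<close>, so each order of differentiability of 1/f yields the next one.\<close>

lemma so_inverse:
 fixes f :: "'a::real_normed_vector => complex"
 assumes "open S" "smo S f" "!!x. x : S ==> f x ~= 0" shows "smo S (%x. inverse (f x))"
proof -
 have "Ck_on k S (%x. inverse (f x))" for k
 proof (induction k)
  case 0
  show ?case using so_imp_continuous_on[OF assms(2)] assms(3) by (simp add: continuous_on_inverse)
 next
  case (Suc k)
  have "Ck_on k S (%x. fder f x v)" for v using so_fder[OF assms(2), of v] unfolding smooth_on_def by blast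
  hence "Ck_on k S (%x. - (inverse (f x) * fder f x v * inverse (f x)))" for v
   by (intro Ck_on_bilinear[OF bounded_bilinear_mult] assms(1) Suc
   Ck_on_bounded_linear_compose[OF bounded_linear_minus[OF bounded_linear_ident]])
  moreover have "((%x. inverse (f x)) has_derivative (%v. - (inverse (f x) * fder f x v * inverse (f x)))) (at x)" if "x : S" for x
   by (rule Deriv.has_derivative_inverse[OF assms(3)[OF that] so_has_derivative[OF assms(2,1) that]])
  ultimately show ?case by (intro Ck_on_SucI[OF assms(1), where f' =
   "%x v. - (inverse (f x) * fder f x v * inverse (f x))"]) qed
 thus ?thesis unfolding smooth_on_def by blast
qed

lemma so_local:
 assumes "open S" "!!x. x : S ==> EX N. open N & x : N & N <= S & smo N f" shows "smo S f"
proof -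
 have "Ck_on k S g" if "!!x. x : S ==> EX N. open N & x : N & N <= S & Ck_on k N g" for k and g :: "'a => 'b" using that
 proof (induction k arbitrary: g)
  case 0 hence "continuous (at x) g" if "x : S" for x using that by (metis Ck_on.simps(1) at_within_open continuous_on_eq_continuous_within)
  thus ?case by (simp add: continuous_at_imp_continuous_on) next
  case (Suc k)
  have "g differentiable (at x)" if "x : S" for x using Suc.prems[OF that] differentiable_on_open by (metis Ck_on.simps(2))
  moreover have "Ck_on k S (%x. fder g x v)" for v by (rule Suc.IH) (metis Suc.prems Ck_on.simps(2))
  ultimately show ?case by (simp add: differentiable_on_open assms(1)) qed
 thus ?thesis using assms unfolding smooth_on_def by meson
qed

lemma bounded_linear_axis: "bounded_linear (axis i :: 'a::euclidean_space => 'a^'n::finite)"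
proof -
 have "linear (axis i :: 'a => 'a^'n)" by (rule linearI) (auto simp: vec_eq_iff axis_def)
 thus ?thesis by (simp add: linear_conv_bounded_linear)
qed

lemma vec_lambda_eq_sum_axis: "(\<chi> i. f i) = (SUM i:UNIV. axis i (f i :: 'a::euclidean_space))"
 by (simp add: vec_eq_iff axis_def if_distrib cong: if_cong)

lemma so_vec:
 fixes f :: "'a::real_normed_vector => 'b::euclidean_space^'n::finite"
 assumes "open S" "!!i. smo S (%x. f x $ i)" shows "smo S f"
proof -
 have "smo S (%x. SUM i:UNIV. axis i (f x $ i))" by (intro so_sum so_bounded_linear_compose[OF bounded_linear_axis] assms)
 thus ?thesis by (simp flip: vec_lambda_eq_sum_axis)
qed

lemma so_vec_nth:
 fixes f :: "'a::real_normed_vector => 'b::euclidean_space^'n::finite"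
 shows "open S ==> smo S f ==> smo S (%x. f x $ i)" by (rule so_bounded_linear_compose[OF bounded_linear_vec_nth])

lemma has_derivative_vec:
 fixes f :: "'a::real_normed_vector => 'b::euclidean_space^'n::finite"
 assumes "!!i. ((%x. f x $ i) has_derivative (%v. f' v $ i)) (at x within S)" shows "(f has_derivative f') (at x within S)"
proof -
 have "((%x. SUM i:UNIV. axis i (f x $ i)) has_derivative (%v. SUM i:UNIV. axis i (f' v $ i))) (at x within S)"
  by (intro derivative_intros bounded_linear.has_derivative[OF bounded_linear_axis] assms)
 thus ?thesis by (simp flip: vec_lambda_eq_sum_axis)
qed

subsection \<open>Symmetry of second derivatives\<close>

text \<open>Two applications of the mean value theorem to
 \<open>F (x + s u + s v) - F (x + s u) - F (x + s v) + F x\<close>.\<close>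

lemma second_difference_mvt:
 fixes F :: "'a::euclidean_space => real"
 assumes "Ck_on 2 (ball x d) F" "s > 0" "s * (norm u + norm v) < d"
 obtains a b where "0 < a" "a < s" "0 < b" "b < s"
  "F (x + s *R u + s *R v) - F (x + s *R u) - F (x + s *R v) + F x =
   s * (s * fder (%y. fder F y u) (x + a *R u + b *R v) v)"
proof -
 let ?S = "ball x d"
 have in_ball: "x + a *R u + b *R v : ?S" if "0 <= a" "a <= s" "0 <= b" "b <= s" for a b
 proof -
  have "norm (a *R u + b *R v) <= a * norm u + b * norm v" using norm_triangle_ineq[of "a *R u" "b *R v"] that by simp
  also have "... <= s * norm u + s * norm v" using that by (intro add_mono mult_right_mono) auto
  finally have "norm (a *R u + b *R v) < d" using assms(3) by (simp add: distrib_left)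
  moreover have "dist x (x + a *R u + b *R v) = norm (a *R u + b *R v)" by (metis add.assoc add_diff_cancel_left' dist_commute dist_norm)
  ultimately show ?thesis by simp qed
 have k1: "Ck_on (Suc 0) ?S (%y. fder F y u)" and k2: "Ck_on (Suc 1) ?S F" using assms(1) by (simp_all add: numeral_2_eq_2)
 have F: "(F has_derivative fder F y) (at y)" if "y : ?S" for y using Ck_Suc_deriv[OF _ k2 that] by simp
 have G: "((%y. fder F y u) has_derivative
   fder (%y. fder F y u) y) (at y)" if "y : ?S" for y using Ck_Suc_deriv[OF _ k1 that] by simp
 have lin: "!!y c w. y : ?S ==> fder F y (c *R w) = c * fder F y w" using F has_derivative_linear linear_cmul by (metis real_scaleR_def)
 have lin2: "!!y c w. y : ?S ==> fder (%y. fder F y u) y (c *R w)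
   = c * fder (%y. fder F y u) y w" using G has_derivative_linear linear_cmul by (metis real_scaleR_def)
 have chain: "((%a. F (x + a *R u + b *R v)) has_real_derivative
   fder F (x + a *R u + b *R v) u) (at a)" if "0 <= a" "a <= s" "0 <= b" "b <= s" for a b
 proof -
  have g: "((%a. x + a *R u + b *R v) has_derivative (%h. h *R u)) (at a)" by (auto intro!: derivative_eq_intros)
  have "((%a. F (x + a *R u + b *R v)) has_derivative (%h. fder F (x + a *R u + b *R v) (h *R u))) (at a)"
   using diff_chain_at[OF g F[OF in_ball[OF that]]] by (simp add: o_def) thus ?thesis
   using lin[OF in_ball[OF that]] by (simp add: has_field_derivative_def mult.commute[of _ "frechet_derivative F _ _"])
 qed
 have chain2: "((%b. fder F (x + a *R u + b *R v) u) has_real_derivative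
   fder (%y. fder F y u) (x + a *R u + b *R v) v) (at b)" if "0 <= a" "a <= s" "0 <= b" "b <= s" for a b
 proof -
  have g: "((%b. x + a *R u + b *R v) has_derivative (%h. h *R v)) (at b)" by (auto intro!: derivative_eq_intros)
  have "((%b. fder F (x + a *R u + b *R v) u) has_derivative (%h. fder (%y. fder F y u) (x + a *R u + b *R v) (h *R v))) (at b)"
   using diff_chain_at[OF g G[OF in_ball[OF that]]] by (simp add: o_def)
  thus ?thesis using lin2[OF in_ball[OF that]]
   by (simp add: has_field_derivative_def mult.commute[of _ "frechet_derivative (%y. fder F y u) _ _"])
 qed
 have "EX a>0. a < s & (F (x + s *R u + s *R v) - F (x + s *R u + 0 *R v)) - (F (x + 0 *R u + s *R v) - F (x + 0 *R u + 0 *R v))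
   = (s - 0) * (fder F (x + a *R u + s *R v) u - fder F (x + a *R u + 0 *R v) u)"
  by (rule MVT2[of 0 s "%a. F (x + a *R u + s *R v) - F (x + a *R u + 0 *R v)"
   "%a. fder F (x + a *R u + s *R v) u - fder F (x + a *R u + 0 *R v) u"])
   (use assms(2) in \<open>auto intro!: DERIV_diff chain simp del: scaleR_zero_left\<close>)
 then obtain a where a: "0 < a" "a < s" and eq1:
  "(F (x + s *R u + s *R v) - F (x + s *R u + 0 *R v)) - (F (x + 0 *R u + s *R v) - F (x + 0 *R u + 0 *R v))
   = (s - 0) * (fder F (x + a *R u + s *R v) u - fder F (x + a *R u + 0 *R v) u)" by blast
 have "EX b>0. b < s &
  fder F (x + a *R u + s *R v) u - fder F (x + a *R u + 0 *R v) u
   = (s - 0) * fder (%y. fder F y u) (x + a *R u + b *R v) v" by (rule MVT2[of 0 s "%b. fder F (x + a *R u + b *R v) u"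
   "%b. fder (%y. fder F y u) (x + a *R u + b *R v) v"]) (use assms(2) a in \<open>auto intro!: chain2 simp del: scaleR_zero_left\<close>)
 then obtain b where b: "0 < b" "b < s" and eq2:
  "fder F (x + a *R u + s *R v) u - fder F (x + a *R u + 0 *R v) u
   = (s - 0) * fder (%y. fder F y u) (x + a *R u + b *R v) v" by blast
 show thesis by (rule that[OF a b]) (use eq1 eq2 in simp)
qed

text \<open>Both mixed derivatives, taken at points close to \<open>x\<close>, are equal to the same
  second difference divided by s^2, since that difference is symmetric in \<open>u\<close> and
  \<open>v\<close>. Continuity of the two derivatives then moves both points to
  \<open>x\<close>.\<close>

lemma deriv2_symmetric_real:
 fixes F :: "'a::euclidean_space => real"
 assumes "Ck_on 2 S F" "open S" "x : S" shows "fder (%y. fder F y u) x v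
  = fder (%y. fder F y v) x u"
proof -
 define A where "A = (%y. fder (%y. fder F y u) y v)"
 define B where "B = (%y. fder (%y. fder F y v) y u)"
 obtain d where d: "d > 0" "ball x d <= S" using assms(2,3) open_contains_ball by blast
 have C: "Ck_on 2 (ball x d) F" using Ck_on_subset[OF assms(1,2) _ d(2)] by simp
 have "cont S A" "cont S B" using assms(1) unfolding A_def B_def by (simp_all add: numeral_2_eq_2)
 hence cA: "isCont A x" and cB: "isCont B x" using assms(2,3) by (simp_all add: continuous_on_eq_continuous_at)
 have "\<bar>A x - B x\<bar> < e" if "e > 0" for e
 proof -
  obtain d1 where d1: "d1 > 0" "!!y. dist y x < d1 ==> dist (A y) (A x) < e/2"
   using cA \<open>e > 0\<close> unfolding continuous_at_eps_delta by (metis half_gt_zero)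
  obtain d2 where d2: "d2 > 0" "!!y. dist y x < d2 ==> dist (B y) (B x) < e/2"
   using cB \<open>e > 0\<close> unfolding continuous_at_eps_delta by (metis half_gt_zero)
  define r where "r = min d (min d1 d2)"
  \<comment> \<open>The summand 1 keeps the denominator positive when both directions vanish, and it
    leaves all intermediate points at distance less than \<open>r\<close> from
    \<open>x\<close>.\<close>
  define s where "s = r / (norm u + norm v + 1)"
  have pos: "norm u + norm v + 1 > 0" by (smt (verit) norm_ge_zero)
  have r: "r > 0" using d d1 d2 by (simp add: r_def)
  have s: "s > 0" using r pos by (simp add: s_def)
  have "s * (norm u + norm v) < s * (norm u + norm v + 1)" using s by simp
  also have "... = r" using pos by (simp add: s_def)
  finally have sr: "s * (norm u + norm v) < r" .
  have near: "dist (x + a *R p + b *R q) x < r" if "0 < a" "a < s" "0 < b" "b < s" "norm p + norm q = norm u + norm v" for a b p q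
  proof -
   have "dist (x + a *R p + b *R q) x = norm (a *R p + b *R q)" by (metis add.assoc add_diff_cancel_left' dist_norm)
   also have "... <= a * norm p + b * norm q" using norm_triangle_ineq[of "a *R p" "b *R q"] that by simp
   also have "... <= s * norm p + s * norm q" using that by (intro add_mono mult_right_mono) auto
   also have "... = s * (norm u + norm v)" using that by (metis distrib_left)
   finally show ?thesis using sr by simp qed
  obtain a b where ab: "0 < a" "a < s" "0 < b" "b < s"
   "F (x + s *R u + s *R v) - F (x + s *R u) - F (x + s *R v) + F x = s * (s * A (x + a *R u + b *R v))"
   using second_difference_mvt[OF C s, of u v] sr unfolding A_def r_def by auto
  obtain a' b' where ab': "0 < a'" "a' < s" "0 < b'" "b' < s"
   "F (x + s *R v + s *R u) - F (x + s *R v) - F (x + s *R u) + F x = s * (s * B (x + a' *R v + b' *R u))"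
   using second_difference_mvt[OF C s, of v u] sr unfolding B_def r_def by (auto simp: add.commute[of "norm v" "norm u"])
  have "s * (s * A (x + a *R u + b *R v)) = s * (s * B (x + a' *R v + b' *R u))"
   using ab(5) ab'(5) by (simp only: add.assoc add.commute[of "s *R v"])
  hence "A (x + a *R u + b *R v) = B (x + a' *R v + b' *R u)" using s by simp
  moreover have "dist (A (x + a *R u + b *R v)) (A x) < e/2" using near[OF ab(1-4) refl] by (intro d1) (simp add: r_def)
  moreover have "dist (B (x + a' *R v + b' *R u)) (B x) < e/2" using near[OF ab'(1-4), of v u] by (intro d2) (simp add: r_def)
  ultimately show ?thesis unfolding dist_real_def by linarith qed
 hence "~ 0 < \<bar>A x - B x\<bar>" by blast hence "A x = B x" by simp
 thus ?thesis by (simp add: A_def B_def)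
qed

text \<open>The mean value theorem needs real values, so the claim is reduced to real and imaginary
  parts.\<close>

lemma deriv2_symmetric:
 fixes f :: "'a::euclidean_space => complex"
 assumes "smo S f" "open S" "x : S" shows "fder (%y. fder f y u) x v
  = fder (%y. fder f y v) x u"
proof -
 have lin: "h (fder (%y. fder f y u) x v) =
   fder (%y. fder (%y. h (f y)) y u) x v" if h: "bounded_linear h" for h :: "complex => real" and u v
 proof -
  have 1: "fder (%y. h (f y)) y u = h (fder f y u)" if "y : S" for y
   using fderI[OF bounded_linear.has_derivative[OF h so_has_derivative[OF assms(1,2) that]]] by simp
  have 2: "fder (%y. h (fder f y u)) x v
   = h (fder (%y. fder f y u) x v)" using fderI[OF bounded_linear.has_derivative[OF h
   so_has_derivative[OF so_fder[OF assms(1)] assms(2,3)]]] by metis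
  show ?thesis using fder_cong_open[OF assms(2,3), of "%y. fder (%y. h (f y)) y u"
   "%y. h (fder f y u)"] 1 2 by simp qed
 have C: "Ck_on 2 S (%y. h (f y))" if "bounded_linear h" for h :: "complex => real"
  using so_bounded_linear_compose[OF that assms(2,1)] unfolding smooth_on_def by blast
 show ?thesis using lin[OF bounded_linear_Re] lin[OF bounded_linear_Im]
   deriv2_symmetric_real[OF C[OF bounded_linear_Re] assms(2,3)]
   deriv2_symmetric_real[OF C[OF bounded_linear_Im] assms(2,3)] by (metis complex_eqI)
qed

section \<open>Holomorphic maps of several variables\<close>

lemma ho_derivative:
 assumes "holo_on S f" "x : S" shows "(f has_derivative fder f x) (at x)" and "fder f x (c *s v) = c * fder f x v"
proof -
 obtain D where D: "(f has_derivative D) (at x)" "ALL c v. D (c *s v) = c * D v" using assms unfolding holo_on_def by blast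
 hence "fder f x = D" by (simp add: fderI)
 with D show "(f has_derivative fder f x) (at x)"
  "fder f x (c *s v) = c * fder f x v" by auto
qed

lemma ho_derivative_sum:
 assumes "holo_on S f" "x : S" shows "fder f x v = (SUM i:UNIV. v $ i * fder f x (axis i 1))"
proof -
 have "fder f x (SUM i:UNIV. (v $ i) *s axis i 1) = (SUM i:UNIV. fder f x ((v $ i) *s axis i 1))"
  using has_derivative_linear[OF ho_derivative(1)[OF assms]] by (rule linear_sum)
 thus ?thesis by (simp only: basis_expansion ho_derivative(2)[OF assms])
qed

lemma ho_subset: "holo_on S f ==> T <= S ==> holo_on T f" unfolding holo_on_def by blast

lemma ho_cong:
 assumes "open S" "!!x. x : S ==> f x = g x" "holo_on S f" shows "holo_on S g" unfolding holo_on_def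
proof fix x assume x: "x : S"
 then obtain D where D: "(f has_derivative D) (at x)" "ALL c v. D (c *s v) = c * D v" using assms unfolding holo_on_def by blast
 have "(g has_derivative D) (at x)" using has_derivative_transform_within_open[OF D(1) assms(1) x] assms(2) by simp
 with D show "EX D. (g has_derivative D) (at x) & (ALL c v. D (c *s v) = c * D v)" by blast
qed

lemma ho_local:
 assumes "!!x. x : S ==> EX N. x : N & holo_on N f" shows "holo_on S f" using assms unfolding holo_on_def by blast

lemma ho_vec_nth: "holo_on S (%x. x $ i)" unfolding holo_on_def by (intro ballI exI[of _ "%v. v $ i"])
  (auto intro: bounded_linear_imp_has_derivative bounded_linear_vec_nth)

lemma ho_const: "holo_on S (%x. c)" unfolding holo_on_def by (intro ballI exI[of _ "%v. 0"]) auto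

lemma hm_derivative:
 assumes "hmap S f" "x : S" shows "(f has_derivative fder f x) (at x)" and "fder f x (c *s v) = c *s fder f x v"
  and "fder f x v $ i = fder (%x. f x $ i) x v"
proof -
 let ?D = "%v. \<chi> i. fder (%x. f x $ i) x v"
 have h: "holo_on S (%x. f x $ i)" for i using assms(1) by (simp add: holo_map_on_def)
 have D: "(f has_derivative ?D) (at x)" by (rule has_derivative_vec) (simp add: ho_derivative(1)[OF h assms(2)])
 hence "fder f x = ?D" by (rule fderI)
 with D show "(f has_derivative fder f x) (at x)"
  "fder f x (c *s v) = c *s fder f x v"
  "fder f x v $ i = fder (%x. f x $ i) x v" by (auto simp: vec_eq_iff ho_derivative(2)[OF h assms(2)])
qed

lemma ho_compose:
 assumes "holo_on T f" "hmap S g" "g ` S <= T" shows "holo_on S (%x. f (g x))" unfolding holo_on_def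
proof fix x assume x: "x : S" hence gx: "g x : T" using assms(3) by blast
 have "((%x. f (g x)) has_derivative (%v. fder f (g x) (fder g x v))) (at x)"
  using diff_chain_at[OF hm_derivative(1)[OF assms(2) x] ho_derivative(1)[OF assms(1) gx]] by (simp add: o_def)
 thus "EX D. ((%x. f (g x)) has_derivative D) (at x) & (ALL c v. D (c *s v) = c * D v)"
  using hm_derivative(2)[OF assms(2) x] ho_derivative(2)[OF assms(1) gx] by auto
qed

lemma hm_compose:
 "hmap T f ==> hmap S g ==> g ` S <= T ==> hmap S (%x. f (g x))" using ho_compose unfolding holo_map_on_def by blast

lemma hm_subset: "hmap S f ==> T <= S ==> hmap T f" unfolding holo_map_on_def using ho_subset by blast

lemma hm_cong:
 "open S ==> (!!x. x : S ==> f x = g x) ==> hmap S f ==> hmap S g"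
 unfolding holo_map_on_def using ho_cong[of S "%x. f x $ i" "%x. g x $ i" for i] by auto

lemma hm_local:
 assumes "!!x. x : S ==> EX N. x : N & hmap N f" shows "hmap S f" unfolding holo_map_on_def
proof
 show "holo_on S (%x. f x $ i)" for i by (rule ho_local) (use assms in \<open>auto simp: holo_map_on_def\<close>)
qed

subsection \<open>Holomorphic maps are smooth\<close>

lemma norm_axis_eq: "norm (axis i z :: complex^'n::finite) = norm z" by (simp add: norm_eq_sqrt_inner inner_axis_axis)

text \<open>Cauchy's formula in the j-th variable alone, centred so that the kernel does not depend
  on \<open>x\<close>. All dependence on \<open>x\<close> sits in \<open>f\<close>, which prepares
  differentiation under the integral sign.\<close>

lemma Cauchy_partial_derivative:
 fixes f :: "complex^'n::finite => complex"
 assumes "holo_on S f" "r > 0" "!!zeta. zeta : cball 0 r ==> x + axis j zeta : S" shows "fder f x (axis j 1) =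
  integral (cbox 0 1) (%t. f (x + axis j (circlepath 0 r t)) * (r * exp (2 * of_real pi * \<i> * t) / (circlepath 0 r t)\<^sup>2))"
proof -
 let ?g = "%zeta. f (x + axis j zeta)"
 have ax: "axis j (c * d) = c *s (axis j d :: complex^'n)" for c d by (simp add: vec_eq_iff axis_def)
 have D: "(?g has_field_derivative fder f (x + axis j zeta) (axis j 1)) (at zeta)" if "zeta : cball 0 r" for zeta
 proof -
  have S: "x + axis j zeta : S" using assms(3) that by blast
  have a: "((%zeta. x + axis j zeta) has_derivative axis j) (at zeta)"
   using has_derivative_add[OF has_derivative_const bounded_linear_imp_has_derivative[OF bounded_linear_axis]] by simp
  have "(?g has_derivative (%h. fder f (x + axis j zeta) (axis j h))) (at zeta)"
   using diff_chain_at[OF a ho_derivative(1)[OF assms(1) S]] by (simp add: o_def)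
  moreover have "fder f (x + axis j zeta) (axis j h) =
   fder f (x + axis j zeta) (axis j 1) * h" for h using ho_derivative(2)[OF assms(1) S, of h "axis j 1"] ax[of h 1] by simp
  ultimately show ?thesis unfolding has_field_derivative_def by (rule has_derivative_eq_rhs[OF _ ext])
 qed
 have hol: "?g holomorphic_on cball 0 r" using D by (meson field_differentiable_at_within field_differentiable_def holomorphic_on_def)
 have "(?g has_field_derivative (1 / (2 * of_real pi * \<i>) *
   contour_integral (circlepath 0 r) (%u. ?g u / u\<^sup>2))) (at 0)"
 proof -
  have "(?g has_field_derivative (1 / (2 * of_real pi * \<i>) *
   contour_integral (circlepath 0 r) (%u. ?g u / (u - 0)\<^sup>2))) (at 0)" by (rule Cauchy_derivative_integral_circlepath(2))
   (use hol assms(2) in \<open>auto intro: holomorphic_on_imp_continuous_on holomorphic_on_subset\<close>)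
  thus ?thesis by simp qed
 moreover have "(?g has_field_derivative fder f x (axis j 1)) (at 0)"
 proof -
  have x0: "x + axis j 0 = x" by (simp add: vec_eq_iff axis_def)
  show ?thesis using D[of 0, unfolded x0] assms(2) by simp qed
 ultimately have "fder f x (axis j 1) =
   1 / (2 * of_real pi * \<i>) * contour_integral (circlepath 0 r) (%u. ?g u / u\<^sup>2)" by (rule DERIV_unique[rotated])
 also have "... = integral {0..1} (%t. 1 / (2 * of_real pi * \<i>) *
   (?g (circlepath 0 r t) / (circlepath 0 r t)\<^sup>2 * (2 * of_real pi * \<i> * r * exp (2 * of_real pi * \<i> * t))))"
  by (simp only: contour_integral_integral integral_mult_right vector_derivative_circlepath
   of_real_mult of_real_numeral)
 also have "... = integral (cbox 0 1) (%t. ?g (circlepath 0 r t) * (r * exp (2 * of_real pi * \<i> * t) / (circlepath 0 r t)\<^sup>2))"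
  unfolding cbox_interval by (rule integral_cong) (simp add: mult.left_commute[of _ \<i>])
 finally show ?thesis .
qed

text \<open>\<open>holo_on\<close> only asks for a complex linear derivative at each point. The
  integral formula first gives continuity of all partial derivatives; with this, Leibniz' rule
  differentiates the formula once more, and complex linearity passes through the integral.\<close>

lemma ho_partial_derivative:
 fixes f :: "complex^'n::finite => complex"
 assumes "open S" "holo_on S f" shows "holo_on S (%x. fder f x (axis j 1))"
proof -
 define gg where "gg r = circlepath 0 r" for r :: real
 define K where "K r t = r * exp (2 * of_real pi * \<i> * of_real t) / (gg r t)\<^sup>2" for r t :: real
 have contgamma: "cont A (gg r)" for r A unfolding gg_def circlepath by (intro continuous_intros)
 have contK: "cont A (K r)" if "r > 0" for r A
  unfolding K_def using that by (intro continuous_intros contgamma) (auto simp: gg_def circlepath)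
 \<comment> \<open>Half the radius of a ball inside \<open>S\<close>: one half for the shift from
   \<open>x\<close> to \<open>y\<close>, the other for the disc around \<open>y\<close> in one
   variable.\<close>
 have ball: "EX r>0. ALL y:ball x r. ALL i. ALL zeta:cball 0 r. y + axis i zeta : S" if xS: "x : S" for x
 proof -
  obtain e where e: "e > 0" "ball x e <= S" by (rule openE[OF assms(1) xS])
  have "y + axis i zeta : S" if "y : ball x (e/2)" "zeta : cball 0 (e/2)" for y i zeta
  proof -
   have "dist x (y + axis i zeta) <= dist x y + norm (axis i zeta :: complex^'n)"
   using dist_triangle[of x "y + axis i zeta" y] by (simp add: dist_norm)
   also have "... < e" using that by (simp add: norm_axis_eq)
   finally show ?thesis using e(2) by (metis mem_ball subsetD) qed
  thus ?thesis using e(1) by (intro exI[of _ "e/2"] conjI ballI allI) simp_all qed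
 have fc: "cont S f" using assms ho_derivative(1) by (meson continuous_at_imp_continuous_on has_derivative_continuous)
 have in_S: "y + axis i (gg r t) : S"
  if "r > 0" "ALL y:ball x r. ALL i. ALL zeta:cball 0 r. y + axis i zeta : S" "y : ball x r" for x y i r t
  using that by (auto simp: gg_def circlepath norm_mult)
 have contax: "cont A (%(y,t). y + axis i (gg r t))" for A i r unfolding split_beta
  by (intro continuous_intros bounded_linear.continuous_on[OF bounded_linear_axis]
   continuous_on_compose2[OF contgamma[of UNIV]]) auto
 have rep: "fder f y (axis i 1) = integral (cbox 0 1) (%t. f (y + axis i (gg r t)) * K r t)"
  if "r > 0" "ALL y:ball x r. ALL i. ALL zeta:cball 0 r. y + axis i zeta : S" "y : ball x r" for x y i r
  unfolding gg_def K_def using Cauchy_partial_derivative[OF assms(2) that(1), of y i] that by simp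
 have contd: "cont S (%x. fder f x (axis i 1))" for i
 proof -
  have "isCont (%x. fder f x (axis i 1)) x" if "x : S" for x
  proof -
   obtain r where r: "r > 0" "ALL y:ball x r. ALL i. ALL zeta:cball 0 r. y + axis i zeta : S" using ball \<open>x : S\<close> by blast
   have "cont (ball x r \<times> cbox 0 1) (%(y,t). f (y + axis i (gg r t)) * K r t)"
   proof -
   have "cont (ball x r \<times> cbox 0 1) (%p. f ((%(y,t). y + axis i (gg r t)) p))"
   by (rule continuous_on_compose2[OF fc contax]) (use in_S[OF r] in auto)
   thus ?thesis unfolding split_beta by (intro continuous_intros continuous_on_compose2[OF contK[OF r(1), of UNIV]]) auto
   qed
   hence "cont (ball x r) (%y. integral (cbox 0 1) (%t. f (y + axis i (gg r t)) * K r t))" by (rule integral_continuous_on_param)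
   hence "cont (ball x r) (%x. fder f x (axis i 1))" by (rule continuous_on_eq) (simp add: rep[OF r])
   thus ?thesis using r(1) by (simp add: continuous_on_eq_continuous_at) qed
  thus ?thesis by (simp add: continuous_at_imp_continuous_on) qed
 show ?thesis unfolding holo_on_def
 proof fix x assume x: "x : S"
  obtain r where r: "r > 0" "ALL y:ball x r. ALL i. ALL zeta:cball 0 r. y + axis i zeta : S" using ball x by blast
  define fx where "fx y t = Blinfun (%v. fder f (y + axis j (gg r t)) v * K r t)" for y t
  have fx: "blinfun_apply (fx y t) = (%v. fder f (y + axis j (gg r t)) v * K r t)" if "y : ball x r" for y t unfolding fx_def
   by (rule bounded_linear_Blinfun_apply, rule bounded_linear_mult_const,
   rule has_derivative_bounded_linear, rule ho_derivative(1)[OF assms(2) in_S[OF r that]])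
  have cfx: "cont (ball x r \<times> cbox 0 1) (%(y, t). fx y t)"
  proof (rule continuous_on_blinfun_componentwise) fix v :: "complex^'n"
   have "cont (ball x r \<times> cbox 0 1) (%(y, t). (SUM i:UNIV. v $ i * fder f (y + axis j (gg r t)) (axis i 1)) * K r t)"
   proof -
   have "cont (ball x r \<times> cbox 0 1) (%p. fder f ((%(y,t). y + axis j (gg r t)) p) (axis i 1))" for i
   by (rule continuous_on_compose2[OF contd contax]) (use in_S[OF r] in auto)
   thus ?thesis unfolding split_beta by (intro continuous_intros continuous_on_compose2[OF contK[OF r(1), of UNIV]]) auto
   qed
   thus "cont (ball x r \<times> cbox 0 1) (%p. blinfun_apply (case p of (y, t) => fx y t) v)" by (rule continuous_on_eq)
   (auto simp: fx ho_derivative_sum[OF assms(2) in_S[OF r], of _ _ _ v]) qed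
  have der: "((%y. integral (cbox 0 1) (%t. f (y + axis j (gg r t)) * K r t))
   has_derivative integral (cbox 0 1) (fx x)) (at x within ball x r)"
  proof (rule leibniz_rule[OF _ _ cfx]) fix y t assume y: "y : ball x r"
   have sh: "((%y. y + axis j (gg r t)) has_derivative (%v. v)) (at y within ball x r)" by (auto intro!: derivative_eq_intros)
   have "(f has_derivative fder f (y + axis j (gg r t))) (at (y + axis j (gg r t)))" by (rule ho_derivative(1)[OF assms(2) in_S[OF r y]])
   hence "((%y. f (y + axis j (gg r t))) has_derivative fder f (y + axis j (gg r t))) (at y within ball x r)"
   using diff_chain_within[OF sh, of f "fder f (y + axis j (gg r t))"] by (simp add: o_def has_derivative_at_withinI)
   thus "((%y. f (y + axis j (gg r t)) * K r t) has_derivative blinfun_apply (fx y t)) (at y within ball x r)"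
   unfolding fx[OF y] by (rule has_derivative_mult_left) next
   fix y assume y: "y : ball x r"
   have "cont (cbox 0 1) (%t. f (y + axis j (gg r t)))" by (rule continuous_on_compose2[OF fc])
   (use in_S[OF r y] in \<open>auto intro!: continuous_intros bounded_linear.continuous_on[OF bounded_linear_axis] contgamma\<close>)
   thus "(%t. f (y + axis j (gg r t)) * K r t) integrable_on cbox 0 1" by (intro integrable_continuous continuous_intros contK r(1))
  qed (use r in auto)
  have "((%y. fder f y (axis j 1)) has_derivative integral (cbox 0 1) (fx x)) (at x)"
  proof (rule has_derivative_transform_within_open)
   show "((%y. integral (cbox 0 1) (%t. f (y + axis j (gg r t)) * K r t))
   has_derivative integral (cbox 0 1) (fx x)) (at x)" using der at_within_open[of x "ball x r"] r(1) by simp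
   show "open (ball x r)" "x : ball x r" using r(1) by simp_all
  qed (rule rep[OF r, symmetric])
  moreover have "integral (cbox 0 1) (fx x) (c *s v) = c * integral (cbox 0 1) (fx x) v" for c v
  proof -
   have "cont (cbox 0 1) (%t. (%(y, t). fx y t) (x, t))"
   by (rule continuous_on_compose2[OF cfx]) (use r in \<open>auto intro!: continuous_intros\<close>)
   hence "cont (cbox 0 1) (fx x)" by simp
   hence int: "fx x integrable_on cbox 0 1" by (rule integrable_continuous)
   have "integral (cbox 0 1) (fx x) (c *s v) = integral (cbox 0 1) (%t. fx x t (c *s v))" by (rule blinfun_apply_integral[OF int])
   also have "... = integral (cbox 0 1) (%t. c * fx x t v)"
   using r by (intro integral_cong) (simp add: fx ho_derivative(2)[OF assms(2) in_S[OF r]])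
   also have "... = c * integral (cbox 0 1) (%t. fx x t v)" by (rule integral_mult_right)
   also have "integral (cbox 0 1) (%t. fx x t v) = integral (cbox 0 1) (fx x) v" by (rule blinfun_apply_integral[OF int, symmetric])
   finally show ?thesis . qed
  ultimately show "EX D. ((%x. fder f x (axis j 1)) has_derivative D) (at x) & (ALL c v. D (c *s v) = c * D v)" by blast
 qed
qed

text \<open>A complex linear derivative is determined by the partial derivatives, and these are
  holomorphic again, so the induction on the order of differentiability can continue.\<close>

lemma ho_imp_so:
 fixes f :: "complex^'n::finite => complex"
 assumes "open S" "holo_on S f" shows "smo S f"
proof -
 have "Ck_on k S f" for k using assms(2)
 proof (induction k arbitrary: f)
  case 0
  thus ?case by (simp add: continuous_at_imp_continuous_on has_derivative_continuous[OF ho_derivative(1)])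
 next
  case (Suc k) show ?case
  proof (rule Ck_on_SucI[OF assms(1)])
   show "(f has_derivative (%v. SUM i:UNIV. v $ i * fder f x (axis i 1))) (at x)" if "x : S" for x
   by (rule has_derivative_eq_rhs[OF ho_derivative(1)[OF Suc.prems that] ext]) (rule ho_derivative_sum[OF Suc.prems that])
   show "Ck_on k S (%x. SUM i:UNIV. v $ i * fder f x (axis i 1))" for v :: "complex^'n"
   by (intro Ck_on_sum[OF assms(1)] Ck_on_bilinear[OF bounded_bilinear_mult assms(1)] Ck_on_const
   Suc.IH ho_partial_derivative[OF assms(1) Suc.prems]) qed qed
 thus ?thesis by (simp add: smooth_on_def)
qed

lemma hm_imp_so:
 fixes f :: "complex^'n::finite => complex^'k::finite" shows "open S ==> hmap S f ==> smo S f"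
 by (rule so_vec) (auto simp: holo_map_on_def ho_imp_so)

subsection \<open>The holomorphic inverse function theorem\<close>

text \<open>The real inverse function theorem provides the inverse, and its derivative is the
  inverse of a complex linear map, hence complex linear.\<close>

lemma holo_inverse_function:
 fixes H :: "complex^'n::finite => complex^'n"
 assumes "open S" "hmap S H" "x0 : S" "inj (fder H x0)"
 obtains U V G where "open U" "U <= S" "x0 : U" "open V" "homeomorphism U V H G" "hmap V G"
proof -
 have bl: "bounded_linear (fder H x)" if "x : S" for x by (rule has_derivative_bounded_linear[OF hm_derivative(1)[OF assms(2) that]])
 obtain g where g: "linear g" "g o fder H x0 = id"
  using linear_injective_left_inverse[OF bounded_linear.linear[OF bl[OF assms(3)]] assms(4)] by blast
 define H' where "H' x = Blinfun (fder H x)" for x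
 have H': "blinfun_apply (H' x) = fder H x" if "x : S" for x unfolding H'_def by (rule bounded_linear_Blinfun_apply[OF bl[OF that]])
 have cont: "cont S H'"
 proof (rule continuous_on_blinfun_componentwise) fix v :: "complex^'n"
  have "cont S (%x. fder H x v)" by (rule so_imp_continuous_on[OF so_fder[OF hm_imp_so[OF assms(1,2)]]])
  thus "cont S (%x. blinfun_apply (H' x) v)" by (rule continuous_on_eq) (simp add: H') qed
 have inv: "Blinfun g o\<^sub>L H' x0 = id_blinfun"
 proof (rule blinfun_eqI)
  have "blinfun_apply (Blinfun g) = g" using g(1) by (intro bounded_linear_Blinfun_apply) (simp add: linear_conv_bounded_linear)
  thus "blinfun_apply (Blinfun g o\<^sub>L H' x0) v = blinfun_apply id_blinfun v" for v using g(2) by (simp add: H'[OF assms(3)] fun_eq_iff)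
 qed
 have der: "(H has_derivative blinfun_apply (H' x)) (at x)" if "x : S" for x
  unfolding H'[OF that] by (rule hm_derivative(1)[OF assms(2) that])
 obtain U V G G' where *: "open U" "U <= S" "x0 : U" "open V" "homeomorphism U V H G"
  "!!y. y : V ==> (G has_derivative (G' y)) (at y)"
  "!!y. y : V ==> G' y = inv (blinfun_apply (H' (G y)))"
  "!!y. y : V ==> bij (blinfun_apply (H' (G y)))" using inverse_function_theorem[OF assms(1) der cont assms(3) inv] by metis
 have "hmap V G" unfolding holo_map_on_def holo_on_def
 proof (intro allI ballI) fix i y assume y: "y : V"
  have Gy: "G y : S" using *(2) homeomorphism_image2[OF *(5)] y by blast
  let ?D = "fder H (G y)"
  have bij: "bij ?D" using *(8)[OF y] unfolding H'[OF Gy] .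
  have G': "G' y = inv ?D" using *(7)[OF y] unfolding H'[OF Gy] .
  have "inv ?D (c *s v) = c *s inv ?D v" for c v
  proof -
   have "?D (c *s inv ?D v) = c *s v" by (simp only: hm_derivative(2)[OF assms(2) Gy] surj_f_inv_f[OF bij_is_surj[OF bij]])
   thus ?thesis using inv_f_f[OF bij_is_inj[OF bij], of "c *s inv ?D v"] by (simp only:)
  qed
  hence "((%y. G y $ i) has_derivative (%v. G' y v $ i)) (at y) & (ALL c v. G' y (c *s v) $ i = c * (G' y v $ i))"
   using bounded_linear.has_derivative[OF bounded_linear_vec_nth *(6)[OF y], of i] unfolding G'
   by (simp only: vector_smult_component simp_thms)
  thus "EX D. ((%y. G y $ i) has_derivative D) (at y) & (ALL c v. D (c *s v) = c * D v)" by blast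
 qed
 with * show thesis using that by blast
qed

subsection \<open>Inverse matrices\<close>

lemma matrix_inv_id:
 fixes A :: "'a::semiring_1^'n^'n"
 assumes "invertible A" shows "A ** minv A = mat 1" "minv A ** A = mat 1"
proof -
 obtain B where "A ** B = mat 1 & B ** A = mat 1" using assms unfolding invertible_def by blast
 thus "A ** minv A = mat 1" "minv A ** A = mat 1" unfolding matrix_inv_def by (metis (mono_tags, lifting) someI_ex)+
qed

text \<open>Entries of the inverse become polynomials in the entries times one reciprocal; this is
  how inverses of smooth matrices are seen to be smooth.\<close>

lemma matrix_inv_eq_cramer:
 fixes A :: "complex^'n::finite^'n"
 assumes "invertible A"
 shows "minv A $ i $ k = det (\<chi> p j. if j = i then (if p = k then 1 else 0) else A $ p $ j) * inverse (det A)"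
proof -
 have "det A ~= 0" using assms by (simp add: invertible_det_nz)
 moreover have "A *v (minv A *v axis k 1) = axis k 1" using assms by (simp add: matrix_vector_mul_assoc matrix_inv_id(1))
 ultimately have "minv A *v axis k 1 = (\<chi> m. det (\<chi> i j. if j = m then axis k 1 $ i else A $ i $ j) / det A)"
  by (simp add: cramer) moreover have "(minv A *v axis k 1) $ i = minv A $ i $ k"
  by (simp add: matrix_vector_mult_def axis_def if_distrib cong: if_cong)
 moreover have "(\<chi> p j. if j = i then axis k 1 $ p else A $ p $ j) =
   (\<chi> p j. if j = i then (if p = k then 1 else 0) else A $ p $ j)" by (simp add: vec_eq_iff axis_def)
 ultimately show ?thesis by (simp add: field_class.field_divide_inverse)
qed

section \<open>Alternating forms on spaces of functionals\<close>

text \<open>Tangent vectors are functionals and a tangent space is merely a set of them, so linear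
  combinations are formed pointwise, and subspaces, linearity and alternation are stated relative to
  a set \<open>V\<close>.\<close>

definition lc :: "complex => ('f => complex) => complex => ('f => complex) => 'f => complex" where
 "lc a v b w = (%f. a * v f + b * w f)"

definition cspace :: "('f => complex) set => bool" where
 "cspace V \<longleftrightarrow> (%_. 0) : V & (ALL v:V. ALL w:V. ALL a b. lc a v b w : V)"

definition linform :: "('f => complex) set => (('f => complex) => complex) => bool" where
 "linform V aa \<longleftrightarrow> (ALL v:V. ALL w:V. ALL a b. aa (lc a v b w) = a * aa v + b * aa w)"

text \<open>Sign change is required for neighbouring entries only, which generates all permutations.
  Nothing is said about lists of another length or with entries outside \<open>V\<close>.\<close>

definition altern :: "('f => complex) set => nat => (('f => complex) list => complex) => bool" where
 "altern V k aa \<longleftrightarrow> (ALL us ws. ALL v:V. ALL w:V. ALL a b. set us <= V & set ws <= V & length us + length ws + 1 = k -->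
   aa (us @ lc a v b w # ws) = a * aa (us @ v # ws) + b * aa (us @ w # ws)) &
   (ALL us ws. ALL v:V. ALL w:V. set us <= V & set ws <= V & length us + length ws + 2 = k -->
   aa (us @ v # w # ws) = - aa (us @ w # v # ws))"

lemma cspace_sum:
 assumes "cspace V" "finite S" "!!a. a : S ==> e a : V" shows "(%f. SUM a:S. c a * e a f) : V" using assms(2,3)
proof (induction S rule: finite_induct)
 case empty thus ?case using assms(1) by (simp add: cspace_def)
next
 case (insert a S)
 hence "lc (c a) (e a) 1 (%f. SUM a:S. c a * e a f) : V" using assms(1) by (simp add: cspace_def)
 thus ?case using insert by (simp add: lc_def)
qed

lemma linf_sum:
 assumes "cspace V" "linform V aa" "finite S" "!!a. a : S ==> e a : V"
 shows "aa (%f. SUM a:S. c a * e a f) = (SUM a:S. c a * aa (e a))" using assms(3,4)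
proof (induction S rule: finite_induct)
 case empty
 have "aa (lc 0 (%_. 0) 0 (%_. 0)) = 0" using assms(1,2) by (simp add: linform_def cspace_def)
 thus ?case by (simp add: lc_def)
next
 case (insert a S)
 hence "aa (lc (c a) (e a) 1 (%f. SUM a:S. c a * e a f)) = c a * aa (e a) + 1 * aa (%f. SUM a:S. c a * e a f)"
  using assms(1,2) cspace_sum[OF assms(1) insert(1), of e c] unfolding linform_def by simp
 thus ?case using insert by (simp add: lc_def)
qed

lemma alt_lc:
 assumes "altern V k aa" "set us <= V" "set ws <= V" "v : V" "w : V" "length us + length ws + 1 = k"
 shows "aa (us @ lc a v b w # ws) = a * aa (us @ v # ws) + b * aa (us @ w # ws)" using assms unfolding altern_def by blast

lemma alt_swap:
 assumes "altern V k aa" "set us <= V" "set ws <= V" "v : V" "w : V" "length us + length ws + 2 = k"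
 shows "aa (us @ v # w # ws) = - aa (us @ w # v # ws)" using assms unfolding altern_def by blast

lemma alt_sum_slot:
 assumes "cspace V" "altern V k aa" "set us <= V" "set ws <= V" "length us + length ws + 1 = k"
  "finite S" "!!a. a : S ==> e a : V"
 shows "aa (us @ (%f. SUM a:S. c a * e a f) # ws) = (SUM a:S. c a * aa (us @ e a # ws))"
proof -
 have "linform V (%v. aa (us @ v # ws))" unfolding linform_def using alt_lc[OF assms(2-4) _ _ assms(5)] by blast
 thus ?thesis using linf_sum[OF assms(1) _ assms(6,7), of "%v. aa (us @ v # ws)" "%a. a" c] by simp
qed

lemma alt_zero_slot:
 assumes "cspace V" "altern V k aa" "set us <= V" "set ws <= V" "length us + length ws + 1 = k"
 shows "aa (us @ (%_. 0) # ws) = 0"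
proof -
 have "(%_. 0) : V" using assms(1) by (simp add: cspace_def)
 hence "aa (us @ lc 0 (%_. 0) 0 (%_. 0) # ws) = 0" using alt_lc[OF assms(2-4) _ _ assms(5)] by simp
 thus ?thesis by (simp add: lc_def)
qed

lemma alt_Cons:
 assumes "altern V (Suc k) aa" "u : V" shows "altern V k (%ws. aa (u # ws))" unfolding altern_def
proof (intro conjI allI ballI impI; elim conjE)
 fix us ws v w a b assume "v : V" "w : V" "set us <= V" "set ws <= V" "length us + length ws + 1 = k"
 thus "aa (u # us @ lc a v b w # ws) = a * aa (u # us @ v # ws) + b * aa (u # us @ w # ws)"
  using alt_lc[OF assms(1), of "u # us" ws v w a b] assms(2) by simp
next
 fix us ws v w assume "v : V" "w : V" "set us <= V" "set ws <= V" "length us + length ws + 2 = k"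
 thus "aa (u # us @ v # w # ws) = - aa (u # us @ w # v # ws)" using alt_swap[OF assms(1), of "u # us" ws v w] assms(2) by simp
qed

lemma alt_cong:
 assumes "!!vs. set vs <= V ==> length vs = k ==> aa vs = bb vs" "altern V k aa" "cspace V" shows "altern V k bb"
proof -
 have *: "set (us @ lc a v b w # ws) <= V" if "set us <= V" "set ws <= V" "v : V" "w : V" for us ws v w a b
  using that assms(3) by (simp add: cspace_def) show ?thesis unfolding altern_def
 proof (intro conjI allI ballI impI; elim conjE)
  fix us ws v w a b assume a: "v : V" "w : V" "set us <= V" "set ws <= V" "length us + length ws + 1 = k"
  show "bb (us @ lc a v b w # ws) = a * bb (us @ v # ws) + b * bb (us @ w # ws)" using alt_lc[OF assms(2) a(3,4,1,2,5)] a *[OF a(3,4,1,2)]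
   assms(1)[of "us @ lc a v b w # ws"] assms(1)[of "us @ v # ws"] assms(1)[of "us @ w # ws"] by simp
 next
  fix us ws v w assume a: "v : V" "w : V" "set us <= V" "set ws <= V" "length us + length ws + 2 = k"
  show "bb (us @ v # w # ws) = - bb (us @ w # v # ws)"
   using alt_swap[OF assms(2) a(3,4,1,2,5)] a assms(1)[of "us @ v # w # ws"] assms(1)[of "us @ w # v # ws"] by simp
 qed
qed

lemma alt_lincomb:
 assumes "altern V k aa" "altern V k bb" shows "altern V k (%vs. c * aa vs + d * bb vs)" unfolding altern_def
proof (intro conjI allI ballI impI; elim conjE)
 fix us ws v w a b assume a: "v : V" "w : V" "set us <= V" "set ws <= V" "length us + length ws + 1 = k"
 show "c * aa (us @ lc a v b w # ws) + d * bb (us @ lc a v b w # ws) =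
   a * (c * aa (us @ v # ws) + d * bb (us @ v # ws)) + b * (c * aa (us @ w # ws) + d * bb (us @ w # ws))"
  unfolding alt_lc[OF assms(1) a(3,4,1,2,5)] alt_lc[OF assms(2) a(3,4,1,2,5)] by (simp add: algebra_simps)
next
 fix us ws v w assume a: "v : V" "w : V" "set us <= V" "set ws <= V" "length us + length ws + 2 = k"
 show "c * aa (us @ v # w # ws) + d * bb (us @ v # w # ws) =
   - (c * aa (us @ w # v # ws) + d * bb (us @ w # v # ws))"
  by (subst alt_swap[OF assms(1) a(3,4,1,2,5)], subst alt_swap[OF assms(2) a(3,4,1,2,5)]) (simp add: algebra_simps)
qed

lemma alt_sum:
 "(!!i. i : I ==> altern V k (aa i)) ==> altern V k (%vs. SUM i:I. aa i vs)"
proof (induction I rule: infinite_finite_induct)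
 case (insert i I)
 thus ?case using alt_lincomb[of V k "aa i" "%vs. SUM i:I. aa i vs" 1 1] by simp
qed (simp_all add: altern_def)

lemma alt_scale: "altern V k aa ==> altern V k (%vs. c * aa vs)" using alt_lincomb[of V k aa aa c 0] by simp

lemma alt_dup_front:
 assumes "altern V k aa" "set ws <= V" "v : V" "length ws + 2 = k" shows "aa (v # v # ws) = 0"
 using alt_swap[OF assms(1), of "[]" ws v v] assms by simp

lemma alt_compose:
 assumes "altern W k aa" "!!v. v : V ==> A v : W"
  "!!v w a b. v : V ==> w : V ==> A (lc a v b w) = lc a (A v) b (A w)" shows "altern V k (%vs. aa (map A vs))" unfolding altern_def
proof (intro conjI allI ballI impI; elim conjE)
 fix us ws v w a b assume a: "v : V" "w : V" "set us <= V" "set ws <= V" "length us + length ws + 1 = k"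
 have "set (map A us) <= W" "set (map A ws) <= W" using a assms(2) by auto
 thus "aa (map A (us @ lc a v b w # ws)) = a * aa (map A (us @ v # ws)) + b * aa (map A (us @ w # ws))"
  using alt_lc[OF assms(1) _ _ assms(2)[OF a(1)] assms(2)[OF a(2)], of "map A us" "map A ws" a b]
   a assms(3)[OF a(1,2)] by simp
next
 fix us ws v w assume a: "v : V" "w : V" "set us <= V" "set ws <= V" "length us + length ws + 2 = k"
 have "set (map A us) <= W" "set (map A ws) <= W" using a assms(2) by auto
 thus "aa (map A (us @ v # w # ws)) = - aa (map A (us @ w # v # ws))"
  using alt_swap[OF assms(1) _ _ assms(2)[OF a(1)] assms(2)[OF a(2)], of "map A us" "map A ws"] a by simp
qed

subsection \<open>Alternating sums and substitutions\<close>

text \<open>Generalizes \<open>wedge\<close> to integrands that are not products, such as the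
  derivative in direction \<open>u\<close> of a form evaluated on the remaining vectors. All
  first-order operators below take this shape.\<close>

definition altsum :: "('t => 't list => complex) => 't list => complex" where
 "altsum T vs = (SUM j<length vs. (-1) ^ j * T (vs ! j) (take j vs @ drop (Suc j) vs))"

lemma altsum_Nil [simp]: "altsum T [] = 0" by (simp add: altsum_def)

lemma altsum_Cons [simp]: "altsum T (v # vs) = T v vs - altsum (%u ws. T u (v # ws)) vs"
 unfolding altsum_def by (simp add: sum.lessThan_Suc_shift sum_negf del: sum.lessThan_Suc)

lemma wedge_eq_altsum: "wedge aa bb = altsum (%u ws. aa u * bb ws)" by (simp add: fun_eq_iff wedge_def altsum_def mult.assoc)

lemma altsum_cong:
 assumes "set vs <= V"
  "!!u ws. u : V ==> set ws <= V ==> Suc (length ws) = length vs ==> T u ws = T' u ws" shows "altsum T vs = altsum T' vs" using assms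
proof (induction vs arbitrary: T T')
 case (Cons v vs)
 have "altsum (%u ws. T u (v # ws)) vs = altsum (%u ws. T' u (v # ws)) vs"
  by (rule Cons.IH) (use Cons.prems(1) in \<open>auto intro!: Cons.prems(2)\<close>)
 moreover have "T v vs = T' v vs" using Cons.prems(1) by (auto intro!: Cons.prems(2))
 ultimately show ?case by simp
qed simp

lemma altsum_add: "altsum (%u ws. T u ws + T' u ws) vs = altsum T vs + altsum T' vs" by (simp add: altsum_def sum.distrib algebra_simps)

lemma altsum_diff: "altsum (%u ws. T u ws - T' u ws) vs = altsum T vs - altsum T' vs" by (simp add: altsum_def sum_subtractf algebra_simps)

lemma altsum_scale: "altsum (%u ws. c * T u ws) vs = c * altsum T vs" by (simp add: altsum_def sum_distrib_left mult.left_commute)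

lemma altsum_minus: "altsum (%u ws. - T u ws) vs = - altsum T vs" using altsum_scale[of "-1" T vs] by simp

lemma altsum_zero: "altsum (%u ws. 0) vs = 0" by (simp add: altsum_def)

lemma altsum_sum: "altsum (%u ws. SUM i:I. T i u ws) vs = (SUM i:I. altsum (T i) vs)"
 by (induction I rule: infinite_finite_induct) (simp_all add: altsum_zero altsum_add)

text \<open>The derivation of the exterior algebra induced by an endomorphism: \<open>ph\<close> is
  inserted into one slot at a time and the results are added. For \<open>ph\<close> = \<phi> this is
  contraction with \<phi>.\<close>

fun subs :: "('t => 't) => ('t list => complex) => 't list => complex" where
 "subs ph aa [] = 0"
| "subs ph aa (v # vs) = aa (ph v # vs) + subs ph (%ws. aa (v # ws)) vs"

lemma subs_lincomb: "subs ph (%vs. a * aa vs + b * bb vs) vs = a * subs ph aa vs + b * subs ph bb vs"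
proof (induction vs arbitrary: aa bb)
 case (Cons v vs)
 show ?case using Cons.IH[of "%ws. aa (v # ws)" "%ws. bb (v # ws)"] by (simp add: algebra_simps)
qed simp

lemma subs_scale: "subs ph (%vs. a * aa vs) vs = a * subs ph aa vs" using subs_lincomb[of ph a aa 0 aa] by simp

lemma subs_add: "subs ph (%vs. aa vs + bb vs) vs = subs ph aa vs + subs ph bb vs" using subs_lincomb[of ph 1 aa 1 bb] by simp

lemma subs_diff: "subs ph (%vs. aa vs - bb vs) vs = subs ph aa vs - subs ph bb vs" using subs_lincomb[of ph 1 aa "-1" bb] by simp

lemma subs_sum: "subs ph (%vs. SUM i:I. aa i vs) vs = (SUM i:I. subs ph (aa i) vs)"
proof (induction I rule: infinite_finite_induct)
 case (insert i I) thus ?case by (simp add: subs_add)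
qed (use subs_scale[of ph 0 "%_. 0" vs] in simp_all)

lemma subs_cong:
 assumes "set vs <= V" "!!v. v : V ==> ph v = ps v" "!!v. v : V ==> ph v : V"
  "!!ws. set ws <= V ==> length ws = length vs ==> aa ws = bb ws" shows "subs ph aa vs = subs ps bb vs" using assms(1,4)
proof (induction vs arbitrary: aa bb)
 case (Cons v vs)
 have "subs ph (%ws. aa (v # ws)) vs = subs ps (%ws. bb (v # ws)) vs" using Cons.prems by (intro Cons.IH) auto
 moreover have "aa (ph v # vs) = bb (ps v # vs)" using Cons.prems assms(2)[of v] assms(3)[of v] by auto
 ultimately show ?case by simp
qed simp

lemma subs_map_add:
 assumes "cspace V" "altern V (length vs) aa" "set vs <= V" "!!v. v : V ==> ph v : V" "!!v. v : V ==> ps v : V"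
 shows "subs (%v. lc a (ph v) b (ps v)) aa vs = a * subs ph aa vs + b * subs ps aa vs" using assms(2,3)
proof (induction vs arbitrary: aa)
 case (Cons v vs)
 have "subs (%v. lc a (ph v) b (ps v)) (%ws. aa (v # ws)) vs =
   a * subs ph (%ws. aa (v # ws)) vs + b * subs ps (%ws. aa (v # ws)) vs" using Cons.prems by (intro Cons.IH alt_Cons) auto
 moreover have "aa (lc a (ph v) b (ps v) # vs) = a * aa (ph v # vs) + b * aa (ps v # vs)"
  using alt_lc[OF Cons.prems(1), of "[]" vs "ph v" "ps v"] Cons.prems assms(4,5) by simp
 ultimately show ?case by (simp add: algebra_simps)
qed simp

text \<open>Moving \<open>ph u\<close> from the front back to the slot from which \<open>u\<close>
  was taken costs exactly the sign that \<open>altsum\<close> supplies.\<close>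

lemma altsum_front_eq_subs:
 assumes "altern V (length vs) aa" "set vs <= V" "!!v. v : V ==> ph v : V"
 shows "altsum (%u ws. aa (ph u # ws)) vs = subs ph aa vs" using assms(1,2)
proof (induction vs arbitrary: aa)
 case (Cons v vs)
 have "altsum (%u ws. aa (ph u # v # ws)) vs = altsum (%u ws. - aa (v # ph u # ws)) vs"
 proof (rule altsum_cong[of _ V])
  fix u ws assume "u : V" "set ws <= V" "Suc (length ws) = length vs"
  thus "aa (ph u # v # ws) = - aa (v # ph u # ws)" using alt_swap[OF Cons.prems(1), of "[]" ws "ph u" v] Cons.prems(2) assms(3) by simp
 qed (use Cons.prems in simp) also have "... = - subs ph (%ws. aa (v # ws)) vs"
  unfolding altsum_minus using Cons.prems by (subst Cons.IH) (auto intro: alt_Cons)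
 finally show ?case by simp
qed simp

text \<open>The terms for \<open>(u, w)\<close> and \<open>(w, u)\<close> differ by a sign.\<close>

lemma altsum_subs_symmetric:
 assumes "altern V (length vs - 1) aa" "set vs <= V" "!!u w. u : V ==> w : V ==> G u w : V"
  "!!u w. u : V ==> w : V ==> G u w = G w u" shows "altsum (%u ws. subs (G u) aa ws) vs = 0" using assms(1,2)
proof (induction vs arbitrary: aa)
 case (Cons v vs)
 have v: "v : V" "set vs <= V" using Cons.prems by auto
 have 1: "altsum (%u ws. aa (G u v # ws)) vs = subs (G v) aa vs"
 proof -
  have "altsum (%u ws. aa (G u v # ws)) vs = altsum (%u ws. aa (G v u # ws)) vs" by (rule altsum_cong[of _ V]) (use v assms(4) in auto)
  also have "... = subs (G v) aa vs" using Cons.prems v assms(3) by (intro altsum_front_eq_subs[of V]) auto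
  finally show ?thesis . qed
 have 2: "altsum (%u ws. subs (G u) (%ws. aa (v # ws)) ws) vs = 0"
 proof (cases vs)
  case (Cons w ws)
  thus ?thesis using Cons.prems v by (intro Cons.IH) (auto intro!: alt_Cons) qed simp
 show ?case by (simp add: altsum_add 1 2)
qed simp

text \<open>The endomorphism hits either the vector singled out by the alternation or one of the
  others. For a covariant derivative the first kind of term is the derivative in direction \<phi>
  u.\<close>

lemma subs_altsum:
 "subs ph (altsum T) vs = altsum (%u ws. T (ph u) ws) vs + altsum (%u ws. subs ph (T u) ws) vs"
proof (induction vs arbitrary: T)
 case (Cons v vs)
 have "subs ph (%ws. altsum T (v # ws)) vs = subs ph (T v) vs - subs ph (altsum (%u ws. T u (v # ws))) vs" by (simp add: subs_diff)
 thus ?case using Cons.IH[of "%u ws. T u (v # ws)"] by (simp add: altsum_add)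
qed simp

subsection \<open>Exterior products\<close>

lemma wedge_Nil [simp]: "wedge aa bb [] = 0" by (simp add: wedge_eq_altsum)

lemma wedge_Cons [simp]: "wedge aa bb (v # vs) = aa v * bb vs - wedge aa (%ws. bb (v # ws)) vs" by (simp add: wedge_eq_altsum)

lemma wedges_Nil [simp]: "wgs [] vs = 1" by (simp add: wedges_def)

lemma wedges_Cons [simp]: "wgs (aa # aas) = wedge aa (wgs aas)" by (simp add: wedges_def)

lemma wedge_cong:
 assumes "set vs <= V" "!!v. v : V ==> aa v = aa' v"
  "!!ws. set ws <= V ==> Suc (length ws) = length vs ==> bb ws = bb' ws" shows "wedge aa bb vs = wedge aa' bb' vs"
 unfolding wedge_eq_altsum by (rule altsum_cong[OF assms(1)]) (simp add: assms)

lemma wedges_cong: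
 assumes "set vs <= V" "length aas = length bbs"
  "!!j v. j < length aas ==> v : V ==> (aas ! j) v = (bbs ! j) v" shows "wgs aas vs = wgs bbs vs" using assms(2,1,3)
proof (induction aas bbs arbitrary: vs rule: list_induct2)
 case (Cons aa aas bb bbs)
 have "wgs aas ws = wgs bbs ws" if "set ws <= V" for ws using that Cons.prems(2)[of "Suc _"] by (intro Cons.IH) auto
 moreover have "aa v = bb v" if "v : V" for v using Cons.prems(2)[of 0 v] that by simp
 ultimately show ?case using Cons.prems(1) by (auto intro!: wedge_cong[of _ V])
qed simp

lemma wedges_map_cong:
 assumes "set vs <= V" "!!j v. j : set J ==> v : V ==> aa j v = bb j v"
 shows "wgs (map aa J) vs = wgs (map bb J) vs" using assms by (intro wedges_cong[of _ V]) auto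

lemma alt_wedge:
 assumes "linform V aa" "altern V k bb" "cspace V" shows "altern V (Suc k) (wedge aa bb)" unfolding altern_def
proof (intro conjI allI ballI impI; elim conjE)
 fix us ws v w a b assume "v : V" "w : V" "set us <= V" "set ws <= V" "length us + length ws + 1 = Suc k"
 thus "wedge aa bb (us @ lc a v b w # ws) = a * wedge aa bb (us @ v # ws) + b * wedge aa bb (us @ w # ws)" using assms(2)
 proof (induction us arbitrary: bb k)
  case Nil
  have "wedge aa (%xs. bb (lc a v b w # xs)) ws = wedge aa (%xs. a * bb (v # xs) + b * bb (w # xs)) ws"
  proof (rule wedge_cong[of _ V])
   fix xs assume "set xs <= V" "Suc (length xs) = length ws"
   thus "bb (lc a v b w # xs) = a * bb (v # xs) + b * bb (w # xs)" using alt_lc[OF Nil.prems(6), of "[]" xs v w] Nil.prems by simp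
  qed (use Nil.prems in auto)
  also have "... = a * wedge aa (%xs. bb (v # xs)) ws + b * wedge aa (%xs. bb (w # xs)) ws"
   unfolding wedge_eq_altsum by (simp add: distrib_left altsum_add mult.left_commute altsum_scale)
  finally show ?case using assms(1) Nil.prems by (simp add: linform_def algebra_simps)
 next
  case (Cons u us) then obtain k' where k: "k = Suc k'" by (cases k) auto
  have "wedge aa (%xs. bb (u # xs)) (us @ lc a v b w # ws) =
   a * wedge aa (%xs. bb (u # xs)) (us @ v # ws) + b * wedge aa (%xs. bb (u # xs)) (us @ w # ws)"
   using Cons.prems k by (intro Cons.IH[of k']) (auto intro: alt_Cons)
  moreover have "bb (us @ lc a v b w # ws) = a * bb (us @ v # ws) + b * bb (us @ w # ws)"
   using Cons.prems by (intro alt_lc[OF Cons.prems(6)]) auto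
  ultimately show ?case by (simp add: algebra_simps) qed
next
 fix us ws v w assume "v : V" "w : V" "set us <= V" "set ws <= V" "length us + length ws + 2 = Suc k"
 thus "wedge aa bb (us @ v # w # ws) = - wedge aa bb (us @ w # v # ws)" using assms(2)
 proof (induction us arbitrary: bb k)
  case Nil
  have "wedge aa (%xs. bb (v # w # xs)) ws = wedge aa (%xs. - bb (w # v # xs)) ws"
  proof (rule wedge_cong[of _ V])
   fix xs assume "set xs <= V" "Suc (length xs) = length ws"
   thus "bb (v # w # xs) = - bb (w # v # xs)" using alt_swap[OF Nil.prems(6), of "[]" xs v w] Nil.prems by simp
  qed (use Nil.prems in auto)
  also have "... = - wedge aa (%xs. bb (w # v # xs)) ws" unfolding wedge_eq_altsum by (simp add: altsum_minus)
  finally show ?case by simp next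
  case (Cons u us) then obtain k' where k: "k = Suc k'" by (cases k) auto
  have "wedge aa (%xs. bb (u # xs)) (us @ v # w # ws) = - wedge aa (%xs. bb (u # xs)) (us @ w # v # ws)"
   using Cons.prems k by (intro Cons.IH[of k']) (auto intro: alt_Cons)
  moreover have "bb (us @ v # w # ws) = - bb (us @ w # v # ws)" using Cons.prems by (intro alt_swap[OF Cons.prems(6)]) auto
  ultimately show ?case by simp qed
qed

lemma alt_wedges:
 assumes "cspace V" "!!aa. aa : set aas ==> linform V aa" shows "altern V (length aas) (wgs aas)" using assms(2)
proof (induction aas)
 case Nil thus ?case by (simp add: altern_def)
next
 case (Cons aa aas) thus ?case by (simp add: alt_wedge assms(1))
qed

lemma alt_subs:
 assumes "cspace V" "altern V k aa" "!!v. v : V ==> ph v : V"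
  "!!v w a b. v : V ==> w : V ==> ph (lc a v b w) = lc a (ph v) b (ph w)" shows "altern V k (subs ph aa)" unfolding altern_def
proof (intro conjI allI ballI impI; elim conjE)
 have sl: "linform V (%v. subs ph (%xs. bb (v # xs)) ws)" if "altern V (Suc (length ws)) bb" "set ws <= V" for bb ws unfolding linform_def
 proof (intro ballI allI) fix v w a b assume vw: "v : V" "w : V"
  have "subs ph (%xs. bb (lc a v b w # xs)) ws = subs ph (%xs. a * bb (v # xs) + b * bb (w # xs)) ws"
  proof (rule subs_cong[of _ V]) fix xs assume "set xs <= V" "length xs = length ws"
   thus "bb (lc a v b w # xs) = a * bb (v # xs) + b * bb (w # xs)" using alt_lc[OF that(1), of "[]" xs v w] vw by simp
  qed (use that assms in auto) thus "subs ph (%xs. bb (lc a v b w # xs)) ws =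
   a * subs ph (%xs. bb (v # xs)) ws + b * subs ph (%xs. bb (w # xs)) ws" by (simp add: subs_lincomb)
 qed
 fix us ws v w a b assume "v : V" "w : V" "set us <= V" "set ws <= V" "length us + length ws + 1 = k"
 thus "subs ph aa (us @ lc a v b w # ws) = a * subs ph aa (us @ v # ws) + b * subs ph aa (us @ w # ws)" using assms(2)
 proof (induction us arbitrary: aa k)
  case Nil
  have "aa (lc a (ph v) b (ph w) # ws) = a * aa (ph v # ws) + b * aa (ph w # ws)"
   using alt_lc[OF Nil.prems(6), of "[]" ws "ph v" "ph w"] Nil.prems assms(3) by simp
  moreover have "subs ph (%xs. aa (lc a v b w # xs)) ws =
   a * subs ph (%xs. aa (v # xs)) ws + b * subs ph (%xs. aa (w # xs)) ws" using sl[of ws aa] Nil.prems unfolding linform_def by auto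
  ultimately show ?case using assms(4) Nil.prems by (simp add: algebra_simps) next
  case (Cons u us) then obtain k' where k: "k = Suc k'" by (cases k) auto
  have "aa (ph u # us @ lc a v b w # ws) = a * aa (ph u # us @ v # ws) + b * aa (ph u # us @ w # ws)"
   using alt_lc[OF Cons.prems(6), of "ph u # us" ws v w] Cons.prems assms(3) by simp
  moreover have "subs ph (%xs. aa (u # xs)) (us @ lc a v b w # ws) =
   a * subs ph (%xs. aa (u # xs)) (us @ v # ws) + b * subs ph (%xs. aa (u # xs)) (us @ w # ws)"
   using Cons.prems k by (intro Cons.IH[of k']) (auto intro: alt_Cons)
  ultimately show ?case by (simp add: algebra_simps) qed
next
 fix us ws v w assume "v : V" "w : V" "set us <= V" "set ws <= V" "length us + length ws + 2 = k"
 thus "subs ph aa (us @ v # w # ws) = - subs ph aa (us @ w # v # ws)" using assms(2)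
 proof (induction us arbitrary: aa k)
  case Nil
  have "subs ph (%xs. aa (v # w # xs)) ws = subs ph (%xs. (-1) * aa (w # v # xs)) ws"
  proof (rule subs_cong[of _ V]) fix xs assume "set xs <= V" "length xs = length ws"
   thus "aa (v # w # xs) = (-1) * aa (w # v # xs)" using alt_swap[OF Nil.prems(6), of "[]" xs v w] Nil.prems by simp
  qed (use Nil.prems assms in auto)
  moreover have "aa (ph v # w # ws) = - aa (w # ph v # ws)" "aa (ph w # v # ws) = - aa (v # ph w # ws)"
   using alt_swap[OF Nil.prems(6), of "[]" ws "ph v" w] alt_swap[OF Nil.prems(6), of "[]" ws "ph w" v]
   Nil.prems assms(3) by simp_all ultimately show ?case by (simp only: subs_scale) simp
 next
  case (Cons u us) then obtain k' where k: "k = Suc k'" by (cases k) auto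
  have "aa (ph u # us @ v # w # ws) = - aa (ph u # us @ w # v # ws)"
   using alt_swap[OF Cons.prems(6), of "ph u # us" ws v w] Cons.prems assms(3) by simp
  moreover have "subs ph (%xs. aa (u # xs)) (us @ v # w # ws) = - subs ph (%xs. aa (u # xs)) (us @ w # v # ws)"
   using Cons.prems k by (intro Cons.IH[of k']) (auto intro: alt_Cons)
  ultimately show ?case by simp qed
qed

subsection \<open>Expansion in a basis\<close>

lemma wedge_scale_right: "wedge aa (%ws. c * bb ws) vs = c * wedge aa bb vs" by (simp add: wedge_eq_altsum mult.left_commute altsum_scale)

lemma wedge_sum_right: "wedge aa (%ws. SUM i:I. bb i ws) vs = (SUM i:I. wedge aa (bb i) vs)"
 by (simp add: wedge_eq_altsum sum_distrib_left altsum_sum)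

lemma wedge_zero_right: "wedge aa (%ws. 0) vs = 0" by (simp add: wedge_eq_altsum altsum_zero)

lemma wedge_minus_right: "wedge aa (%ws. - bb ws) vs = - wedge aa bb vs" by (simp add: wedge_eq_altsum altsum_minus)

text \<open>A term with \<open>e\<close> in two slots vanishes, so only terms with at most one
  \<open>e\<close> survive; bringing that \<open>e\<close> to the front produces the signs of the
  wedge product.\<close>

lemma alt_map_add:
 assumes "cspace V" "altern V (length vs) aa" "set vs <= V" "e : V" "!!v. v : V ==> g v : V"
 shows "aa (map (%v. lc (c v) e 1 (g v)) vs) = aa (map g vs) + wedge c (%ws. aa (e # map g ws)) vs" using assms(2,3)
proof (induction vs arbitrary: aa)
 case (Cons v vs)
 let ?h = "%v. lc (c v) e 1 (g v)"
 have v: "v : V" "set vs <= V" using Cons.prems by auto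
 have "set (map ?h vs) <= V" using v assms by (auto simp: cspace_def)
 hence 0: "aa (?h v # map ?h vs) = c v * aa (e # map ?h vs) + 1 * aa (g v # map ?h vs)"
  using alt_lc[OF Cons.prems(1), of "[]" "map ?h vs" e "g v"] assms(4) assms(5)[OF v(1)] by simp
 have 1: "aa (e # map ?h vs) = aa (e # map g vs) + wedge c (%ws. aa (e # e # map g ws)) vs"
  using Cons.prems v assms(4) by (intro Cons.IH alt_Cons) auto
 have gw: "set (map g ws) <= V" if "set ws <= V" for ws using that assms(5) by auto
 have 2: "wedge c (%ws. aa (e # e # map g ws)) vs = wedge c (%ws. 0) vs"
 proof (rule wedge_cong[OF v(2) refl])
  fix ws assume "set ws <= V" "Suc (length ws) = length vs"
  thus "aa (e # e # map g ws) = 0" using alt_dup_front[OF Cons.prems(1) gw[of ws] assms(4)] by simp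
 qed
 have 3: "aa (g v # map ?h vs) = aa (g v # map g vs) + wedge c (%ws. aa (g v # e # map g ws)) vs"
  using Cons.prems v assms(5) by (intro Cons.IH alt_Cons) auto
 have 4: "wedge c (%ws. aa (g v # e # map g ws)) vs = wedge c (%ws. - aa (e # g v # map g ws)) vs"
 proof (rule wedge_cong[OF v(2) refl])
  fix ws assume "set ws <= V" "Suc (length ws) = length vs"
  thus "aa (g v # e # map g ws) = - aa (e # g v # map g ws)"
   using alt_swap[OF Cons.prems(1), of "[]" "map g ws" "g v" e] gw[of ws] assms(4) assms(5)[OF v(1)] by simp
 qed
 show ?case unfolding list.map 0 1 2 3 4 wedge_zero_right wedge_minus_right wedge_Cons by simp
qed simp

text \<open>One basis vector \<open>b\<close> is peeled off at a time by \<open>alt_map_add\<close>: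
  the sublists without \<open>b\<close> come from the remaining basis, and those starting with
  \<open>b\<close> from the wedge term.\<close>

lemma alt_expand_subseqs:
 assumes "cspace V" "!!b. b : set bs ==> e b : V" "distinct bs" "altern V (length vs) aa" "set vs <= V"
 shows "aa (map (%v f. SUM b:set bs. eta b v * e b f) vs) =
  (\<Sum>K | K \<in> set (subseqs bs) & length K = length vs. aa (map e K) * wgs (map eta K) vs)" using assms(2-)
proof (induction bs arbitrary: vs aa)
 case Nil show ?case
 proof (cases vs)
  case Nil
  have "{K. K = [] & K = []} = {[] :: 'a list}" by auto thus ?thesis using Nil by simp
 next
  case (Cons v vs')
  have "(%_. 0) : V" using assms(1) by (simp add: cspace_def)
  hence "set (map (%v f. 0) vs') <= V" by auto
  hence "aa (map (%v f. 0) vs) = 0" using alt_zero_slot[OF assms(1) Nil.prems(3), of "[]" "map (%v f. 0) vs'"] Cons by simp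
  moreover have "{K. K = [] & length K = length vs} = ({} :: 'a list set)" using Cons by auto
  ultimately show ?thesis by (simp del: length_0_conv) qed
next
 case (Cons b bs)
 let ?p = "%v f. SUM b:set bs. eta b v * e b f"
 have pV: "?p v : V" for v by (rule cspace_sum[OF assms(1)]) (use Cons.prems in auto)
 have eb: "e b : V" using Cons.prems by simp
 have fin: "finite {K. K : set (subseqs bs) & P K}" for P by simp
 have "(%v f. SUM b:set (b # bs). eta b v * e b f) = (%v. lc (eta b v) (e b) 1 (?p v))" using Cons.prems(2) by (simp add: lc_def fun_eq_iff)
 hence "aa (map (%v f. SUM b:set (b # bs). eta b v * e b f) vs) =
   aa (map ?p vs) + wedge (eta b) (%ws. aa (e b # map ?p ws)) vs" using alt_map_add[OF assms(1) Cons.prems(3,4) eb pV] by simp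
 also have "aa (map ?p vs) = (\<Sum>K | K \<in> set (subseqs bs) & length K = length vs. aa (map e K) * wgs (map eta K) vs)"
  using Cons.prems by (intro Cons.IH) auto
 also have "wedge (eta b) (%ws. aa (e b # map ?p ws)) vs =
   wedge (eta b) (%ws. \<Sum>K | K \<in> set (subseqs bs) & Suc (length K) = length vs. aa (e b # map e K) * wgs (map eta K) ws) vs"
 proof (rule wedge_cong[OF Cons.prems(4) refl])
  fix ws assume ws: "set ws <= V" "Suc (length ws) = length vs"
  hence "altern V (length ws) (%ws. aa (e b # ws))" using alt_Cons[of V "length ws" aa] Cons.prems(3) eb by simp
  hence "aa (e b # map ?p ws) = (\<Sum>K | K \<in> set (subseqs bs) & length K = length ws. aa (e b # map e K) * wgs (map eta K) ws)"
   using Cons.prems ws by (intro Cons.IH[of ws "%ws. aa (e b # ws)"]) auto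
  thus "aa (e b # map ?p ws) = (\<Sum>K | K \<in> set (subseqs bs) & Suc (length K) = length vs. aa (e b # map e K) * wgs (map eta K) ws)"
   by (simp flip: ws(2)) qed
 also have "... = (\<Sum>K | K \<in> set (subseqs bs) & Suc (length K) = length vs. aa (map e (b # K)) * wgs (map eta (b # K)) vs)"
  by (simp add: wedge_sum_right wedge_scale_right)
 also have "... = (SUM K:(#) b ` {K. K : set (subseqs bs) & Suc (length K) = length vs}. aa (map e K) * wgs (map eta K) vs)"
  by (subst sum.reindex) (auto simp: inj_on_def)
 also have "(\<Sum>K | K \<in> set (subseqs bs) & length K = length vs. aa (map e K) * wgs (map eta K) vs) + ... =
   (SUM K:{K. K : set (subseqs bs) & length K = length vs} \<union>
   (#) b ` {K. K : set (subseqs bs) & Suc (length K) = length vs}. aa (map e K) * wgs (map eta K) vs)"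
 proof (rule sum.union_disjoint[symmetric])
  have "set K <= set bs" if "K : set (subseqs bs)" for K using that subseqs_powset[of bs] by blast
  hence "b # K \<notin> set (subseqs bs)" for K using Cons.prems(2) by fastforce
  thus "{K. K : set (subseqs bs) & length K = length vs} Int (#) b ` {K. K : set (subseqs bs) & Suc (length K) = length vs} = {}" by blast
 qed (use fin in auto)
 also have "{K. K : set (subseqs bs) & length K = length vs} \<union> (#) b ` {K. K : set (subseqs bs) & Suc (length K) = length vs} =
   {K. K : set (subseqs (b # bs)) & length K = length vs}" by (auto simp: Let_def)
 finally show ?case .
qed

lemma wedge_vanish: "(!!v. v : set vs ==> aa v = 0) ==> wedge aa bb vs = 0"
 unfolding wedge_eq_altsum using altsum_cong[of vs "set vs" "%u ws. aa u * bb ws" "%u ws. 0"] by (simp add: altsum_zero)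

lemma wedges_vanish:
 assumes "!!aa. aa : set aas ==> aa v = 0" "v : set vs" "length aas = length vs" shows "wgs aas vs = 0" using assms
proof (induction aas arbitrary: vs)
 case (Cons aa aas)
 have "aa (vs ! j) * wgs aas (take j vs @ drop (Suc j) vs) = 0" if j: "j < length vs" for j
 proof (cases "vs ! j = v")
  case False
  have "v : set (take j vs @ vs ! j # drop (Suc j) vs)" using Cons.prems(2) j by (simp flip: id_take_nth_drop)
  hence "wgs aas (take j vs @ drop (Suc j) vs) = 0" using False Cons.prems j by (intro Cons.IH) auto
  thus ?thesis by simp qed (use Cons.prems in simp)
 thus ?case unfolding wedges_Cons wedge_def by (intro sum.neutral ballI) (simp add: mult.assoc del: mult_eq_0_iff)
qed simp

text \<open>The cases ask which of the two lists contains the first index \<open>b\<close>. If only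
  \<open>K\<close> does, its covector vanishes on all vectors of \<open>K'\<close>; if only
  \<open>K'\<close> does, no covector of \<open>K\<close> sees the vector of \<open>b\<close>.
  Otherwise \<open>b\<close> is removed from both or absent from both.\<close>

lemma wedges_dual_subseqs:
 assumes "distinct bs" "!!a b. a : set bs ==> b : set bs ==> eta a (e b) = (if a = b then 1 else 0)"
  "K : set (subseqs bs)" "K' : set (subseqs bs)" "length K = length K'"
 shows "wgs (map eta K) (map e K') = (if K = K' then 1 else 0)" using assms
proof (induction bs arbitrary: K K')
 case (Cons b bs)
 have sub: "set K <= set bs" if "K : set (subseqs bs)" for K using that subseqs_powset[of bs] by blast
 have b: "eta a (e b) = 0" "eta b (e a) = 0" "a ~= b" if "a : set bs" for a using that Cons.prems(1,2) by auto
 have IH: "wgs (map eta L) (map e L') = (if L = L' then 1 else 0)"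
  if "L : set (subseqs bs)" "L' : set (subseqs bs)" "length L = length L'" for L L' using that Cons.prems(1,2) by (intro Cons.IH) auto
 consider L L' where "K = b # L" "K' = b # L'" "L : set (subseqs bs)" "L' : set (subseqs bs)"
  | L where "K = b # L" "L : set (subseqs bs)" "K' : set (subseqs bs)"
  | L' where "K' = b # L'" "L' : set (subseqs bs)" "K : set (subseqs bs)"
  | "K : set (subseqs bs)" "K' : set (subseqs bs)" using Cons.prems(3,4) by (auto simp: Let_def)
 thus ?case
 proof cases
  case (1 L L')
  have "wedge (eta b) (%ws. wgs (map eta L) (e b # ws)) (map e L') = 0" by (rule wedge_vanish) (use sub[OF 1(4)] b in auto)
  thus ?thesis using 1 Cons.prems IH[of L L'] by simp next
  case (2 L)
  have "wgs (map eta K) (map e K') = 0" unfolding 2(1) by simp (rule wedge_vanish, use sub[OF 2(3)] b in auto)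
  moreover have "K ~= K'" using 2 sub[OF 2(3)] Cons.prems(1) by auto
  ultimately show ?thesis by simp next
  case (3 L')
  have "wgs (map eta K) (map e K') = 0" by (rule wedges_vanish[of _ "e b"]) (use 3 sub[OF 3(3)] b Cons.prems(5) in auto)
  moreover have "K ~= K'" using 3 sub[OF 3(3)] Cons.prems(1) by auto
  ultimately show ?thesis by simp next
  case 4 thus ?thesis using IH Cons.prems(5) by blast qed
qed simp

lemma altsum_append:
 "altsum T (us @ ws) = altsum (%u x. T u (x @ ws)) us + (-1) ^ length us * altsum (%u x. T u (us @ x)) ws"
proof (induction us arbitrary: T)
 case (Cons u us) show ?case using Cons.IH[of "%v ws. T v (u # ws)"] by simp
qed simp

text \<open>A pigeonhole argument: there are more \<open>us\<close> than \<open>aas\<close>, so in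
  each term of the determinant some covector of \<open>bbs\<close> receives a vector of
  \<open>us\<close>.\<close>

lemma wedges_block_zero:
 assumes "length aas < length us" "length aas + length bbs = length us + length ws"
  "!!bb u. bb : set bbs ==> u : set us ==> bb u = 0" shows "wgs (aas @ bbs) (us @ ws) = 0" using assms
proof (induction aas arbitrary: us ws)
 case Nil then obtain u us' where "us = u # us'" by (cases us) auto
 thus ?case using Nil.prems by (auto intro!: wedges_vanish[of _ u])
next
 case (Cons aa aas)
 have 1: "altsum (%u x. aa u * wgs (aas @ bbs) (x @ ws)) us = altsum (%u x. 0) us"
 proof (rule altsum_cong[OF order_refl])
  fix u x assume x: "set x <= set us" "Suc (length x) = length us"
  have "wgs (aas @ bbs) (x @ ws) = 0" by (rule Cons.IH) (use Cons.prems x in auto)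
  thus "aa u * wgs (aas @ bbs) (x @ ws) = 0" by simp qed
 have 2: "altsum (%u x. aa u * wgs (aas @ bbs) (us @ x)) ws = altsum (%u x. 0) ws"
 proof (rule altsum_cong[OF order_refl])
  fix u x assume x: "set x <= set ws" "Suc (length x) = length ws"
  have "wgs (aas @ bbs) (us @ x) = 0" by (rule Cons.IH) (use Cons.prems x in auto)
  thus "aa u * wgs (aas @ bbs) (us @ x) = 0" by simp qed
 show ?case by (simp add: wedge_eq_altsum altsum_append 1 2 altsum_zero)
qed

text \<open>The determinant of a block triangular matrix.\<close>

lemma wedges_block:
 assumes "length aas = length us" "length bbs = length ws"
  "!!bb u. bb : set bbs ==> u : set us ==> bb u = 0"
 shows "wgs (aas @ bbs) (us @ ws) = wgs aas us * wgs bbs ws" using assms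
proof (induction aas arbitrary: us ws)
 case (Cons aa aas)
 have 1: "altsum (%u x. aa u * wgs (aas @ bbs) (x @ ws)) us =
   altsum (%u x. wgs bbs ws * (aa u * wgs aas x)) us"
 proof (rule altsum_cong[OF order_refl])
  fix u x assume x: "set x <= set us" "Suc (length x) = length us"
  have "wgs (aas @ bbs) (x @ ws) = wgs aas x * wgs bbs ws" by (rule Cons.IH) (use Cons.prems x in auto)
  thus "aa u * wgs (aas @ bbs) (x @ ws) = wgs bbs ws * (aa u * wgs aas x)" by simp qed
 have 2: "altsum (%u x. aa u * wgs (aas @ bbs) (us @ x)) ws = altsum (%u x. 0) ws"
 proof (rule altsum_cong[OF order_refl])
  fix u x assume x: "set x <= set ws" "Suc (length x) = length ws"
  have "wgs (aas @ bbs) (us @ x) = 0" by (rule wedges_block_zero) (use Cons.prems x in auto)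
  thus "aa u * wgs (aas @ bbs) (us @ x) = 0" by simp qed
 show ?case by (simp add: wedge_eq_altsum altsum_append 1 2 altsum_zero altsum_scale)
qed simp

subsection \<open>Increasing multi-indices\<close>

lemma sorted_all_idx: "sorted_wrt (<) (all_idx :: 'n::{finite,linorder} list)" unfolding all_idx_def by simp

lemma set_all_idx: "set (all_idx :: 'n::{finite,linorder} list) = UNIV" unfolding all_idx_def by simp

lemma distinct_all_idx: "distinct (all_idx :: 'n::{finite,linorder} list)" unfolding all_idx_def by simp

lemma length_all_idx: "length (all_idx :: 'n::{finite,linorder} list) = CARD('n)" unfolding all_idx_def by simp

lemma set_subseqs_sorted:
 fixes xs :: "'n::linorder list"
 assumes "sorted_wrt (<) xs" shows "set (subseqs xs) = {I. sorted_wrt (<) I & set I <= set xs}" using assms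
proof (induction xs)
 case (Cons x xs)
 have gt: "x < y" if "y : set xs" for y using Cons.prems that by simp
 have IH: "set (subseqs xs) = {I. sorted_wrt (<) I & set I <= set xs}" using Cons by simp
 have "I : (#) x ` set (subseqs xs) \<or> I : set (subseqs xs)" if I: "sorted_wrt (<) I" "set I <= insert x (set xs)" for I
 proof (cases "x : set I")
  case True then obtain y I' where yI: "I = y # I'" by (cases I) auto
  have "y = x" using True I yI gt by (metis insertE less_asym list.set_intros(1) set_ConsD sorted_wrt.simps(2) subsetD)
  moreover have "x \<notin> set I'" using I(1) yI \<open>y = x\<close> by auto
  ultimately show ?thesis using I yI IH by auto qed (use I IH in auto)
 moreover have "sorted_wrt (<) I & set I <= insert x (set xs)" if "I : (#) x ` set (subseqs xs) \<or> I : set (subseqs xs)" for I using that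
 proof assume "I : (#) x ` set (subseqs xs)"
  then obtain I' where I': "I = x # I'" "sorted_wrt (<) I'" "set I' <= set xs" unfolding IH by blast
  hence "ALL y:set I'. x < y" using gt by blast thus ?thesis using I' by auto next
  assume "I : set (subseqs xs)" thus ?thesis unfolding IH by auto qed
 ultimately show ?case by (auto simp: Let_def)
qed auto

lemma subseqs_all_idx: "set (subseqs (all_idx :: 'n::{finite,linorder} list)) = {I. sorted_wrt (<) I}"
 using set_subseqs_sorted[OF sorted_all_idx] by (simp add: set_all_idx)

lemma set_subseqs_map: "set (subseqs (map f xs)) = map f ` set (subseqs xs)" by (induction xs) (auto simp: Let_def image_Un image_image)

lemma set_subseqs_append:
 "set (subseqs (xs @ ys)) = (%(J, I). J @ I) ` (set (subseqs xs) \<times> set (subseqs ys))"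
proof (induction xs)
 case (Cons x xs)
 have *: "(#) x ` (%(J, I). J @ I) ` (A \<times> B) = (%(J, I). J @ I) ` ((#) x ` A \<times> B)" for A B
 proof (intro set_eqI iffI) fix K assume "K : (#) x ` (%(J, I). J @ I) ` (A \<times> B)"
  then obtain J I where "K = x # (J @ I)" "J : A" "I : B" by auto
  thus "K : (%(J, I). J @ I) ` ((#) x ` A \<times> B)" by (intro image_eqI[of _ _ "(x # J, I)"]) auto
 next fix K assume "K : (%(J, I). J @ I) ` ((#) x ` A \<times> B)"
  then obtain J I where "K = (x # J) @ I" "J : A" "I : B" by auto
  thus "K : (#) x ` (%(J, I). J @ I) ` (A \<times> B)" by (intro image_eqI[of _ _ "J @ I"] image_eqI[of _ _ "(J, I)"]) auto
 qed
 have "set (subseqs ((x # xs) @ ys)) = (#) x ` set (subseqs (xs @ ys)) \<union> set (subseqs (xs @ ys))" by (simp add: Let_def)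
 also have "... = (%(J, I). J @ I) ` ((#) x ` set (subseqs xs) \<times> set (subseqs ys)) \<union>
   (%(J, I). J @ I) ` (set (subseqs xs) \<times> set (subseqs ys))" unfolding Cons.IH *[of "set (subseqs xs)"] ..
 also have "... = (%(J, I). J @ I) ` (((#) x ` set (subseqs xs) \<union> set (subseqs xs)) \<times> set (subseqs ys))"
  by (simp only: Sigma_Un_distrib1 image_Un) finally show ?case by (simp add: Let_def)
qed (auto simp: image_iff)

lemma mi_finite: "finite (mi q :: 'n::{finite,linorder} list set)"
 by (rule finite_subset[OF _ finite_lists_length_eq[of "UNIV :: 'n set" q]]) (auto simp: mi_def)

lemma mi_card: "mi CARD('n) = {all_idx :: 'n::{finite,linorder} list}"
proof -
 have "I = all_idx" if "sorted_wrt (<) I" "length I = CARD('n)" for I :: "'n list"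
 proof -
  have "distinct I" using that(1) by (simp add: strict_sorted_iff)
  hence "set I = UNIV" using that(2) by (metis card_subset_eq distinct_card finite subset_UNIV)
  thus ?thesis using that(1) unfolding all_idx_def by (metis sorted_list_of_set.idem_if_sorted_distinct strict_sorted_iff)
 qed thus ?thesis using sorted_all_idx length_all_idx by (auto simp: mi_def)
qed

lemma mi_gt_card: "k > CARD('n) ==> mi k = ({} :: 'n::{finite,linorder} list set)"
proof - assume k: "k > CARD('n)"
 have "length I <= CARD('n)" if "sorted_wrt (<) I" for I :: "'n list"
  using that by (metis card_mono distinct_card finite strict_sorted_iff subset_UNIV)
 thus ?thesis using k by (fastforce simp: mi_def)
qed

text \<open>Antiholomorphic indices (\<open>Inr\<close>) come first, so that sublists split in the
  order used by \<open>coef\<close> and \<open>Apq\<close>.\<close>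

definition two_idx :: "('n::{finite,linorder} + 'n) list" where
 "two_idx = map Inr all_idx @ map Inl all_idx"

lemma distinct_two_idx: "distinct two_idx" by (auto simp: two_idx_def distinct_map distinct_all_idx)

lemma set_two_idx: "set two_idx = UNIV"
proof -
 have "x : set two_idx" for x :: "'n::{finite,linorder} + 'n" by (cases x) (auto simp: two_idx_def set_all_idx)
 thus ?thesis by blast
qed

lemma subseqs_two_idx:
 "set (subseqs (two_idx :: ('n::{finite,linorder} + 'n) list)) =
  (%(J, I). map Inr J @ map Inl I) ` ({J. sorted_wrt (<) J} \<times> {I. sorted_wrt (<) I})"
 unfolding two_idx_def set_subseqs_append set_subseqs_map subseqs_all_idx by (auto simp: image_iff)

lemma map_Inr_Inl_inj: "map Inr J @ map Inl I = map Inr J' @ map Inl I' \<longleftrightarrow> J = J' & I = I'"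
proof assume eq: "map Inr J @ map Inl I = map Inr J' @ map Inl I'"
 have "[x. Inr x \<leftarrow> map Inr J @ map Inl I] = J" "[x. Inl x \<leftarrow> map Inr J @ map Inl I] = I"
  for J :: "'b list" and I :: "'a list" by (induction J) (simp_all, (induction I, simp_all)+)
 thus "J = J' & I = I'" using eq by metis
qed simp

text \<open>Sublists of \<open>two_idx\<close> of a given length correspond to pairs (J, I) of
  multi-indices, here sorted by the number \<open>q\<close> of antiholomorphic indices.\<close>

lemma alt_expand:
 fixes e eb :: "'n::{finite,linorder} => 'f => complex"
 assumes "cspace V" "!!i. e i : V" "!!i. eb i : V" "altern V (length vs) aa" "set vs <= V"
  "!!v. v : V ==> v = (%f. SUM i:UNIV. eta i v * e i f + etab i v * eb i f)"
 shows "aa vs = (SUM q<=length vs. SUM J:mi q. SUM I:mi (length vs - q).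
  aa (map eb J @ map e I) * wgs (map etab J @ map eta I) vs)"
proof -
 let ?e = "case_sum e eb" and ?eta = "case_sum eta etab" and ?k = "length vs"
 have sums: "(SUM b:UNIV. ?eta b v * ?e b f) = (SUM i:UNIV. eta i v * e i f + etab i v * eb i f)" for v f
  by (simp add: UNIV_Plus_UNIV[symmetric] sum.Plus sum.distrib del: UNIV_Plus_UNIV)
 have bij: "bij_betw (%(q, J, I). map Inr J @ map Inl I) (Sigma {..?k} (%q. mi q \<times> mi (?k - q)))
   {K. K : set (subseqs (two_idx :: ('n + 'n) list)) & length K = ?k}" unfolding bij_betw_def
  proof
   show "inj_on (%(q, J, I). map Inr J @ map Inl I) (Sigma {..?k} (%q. mi q \<times> mi (?k - q)))"
   by (rule inj_onI) (auto simp: map_Inr_Inl_inj mi_def)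
   show "(%(q, J, I). map Inr J @ map Inl I) ` (Sigma {..?k} (%q. mi q \<times> mi (?k - q))) =
   {K. K : set (subseqs (two_idx :: ('n + 'n) list)) & length K = ?k}" unfolding subseqs_two_idx
   proof (intro set_eqI iffI) fix K :: "('n + 'n) list"
   assume "K : {K. K : (%(J, I). map Inr J @ map Inl I) ` ({J. sorted_wrt (<) J} \<times> {I. sorted_wrt (<) I}) & length K = ?k}"
   then obtain J I :: "'n list" where K: "K = map Inr J @ map Inl I" "sorted_wrt (<) J" "sorted_wrt (<) I"
   "length J + length I = ?k" by auto
   thus "K : (%(q, J, I). map Inr J @ map Inl I) ` (Sigma {..?k} (%q. mi q \<times> mi (?k - q)))"
   by (intro image_eqI[where x = "(length J, J, I)"]) (auto simp: mi_def)
   qed (auto simp: mi_def image_iff) qed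
 have "map (%v f. SUM b:set two_idx. ?eta b v * ?e b f) vs = map (%v. v) vs"
 proof (rule map_cong[OF refl]) fix v assume "v : set vs"
  thus "(%f. SUM b:set two_idx. ?eta b v * ?e b f) = v" using assms(5) assms(6)[of v] unfolding set_two_idx sums by auto
 qed hence "aa vs = aa (map (%v f. SUM b:set two_idx. ?eta b v * ?e b f) vs)" by simp
 also have "... = (\<Sum>K | K \<in> set (subseqs two_idx) & length K = ?k. aa (map ?e K) * wgs (map ?eta K) vs)"
  by (rule alt_expand_subseqs[OF assms(1) _ distinct_two_idx assms(4,5)]) (auto simp: assms(2,3) split: sum.split)
 also have "... = (SUM p:Sigma {..?k} (%q. mi q \<times> mi (?k - q)).
   aa (map ?e ((%(q, J, I). map Inr J @ map Inl I) p)) * wgs (map ?eta ((%(q, J, I). map Inr J @ map Inl I) p)) vs)"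
  by (rule sum.reindex_bij_betw[OF bij, symmetric])
 also have "... = (\<Sum>(q, J, I)\<in>Sigma {..?k} (%q. mi q \<times> mi (?k - q)).
   aa (map eb J @ map e I) * wgs (map etab J @ map eta I) vs)" by (rule sum.cong[OF refl]) (simp add: split_beta o_def)
 also have "... = (SUM q<=?k. \<Sum>(J, I)\<in>mi q \<times> mi (?k - q).
   aa (map eb J @ map e I) * wgs (map etab J @ map eta I) vs)" by (subst sum.Sigma) (auto simp: mi_finite)
 also have "... = (SUM q<=?k. SUM J:mi q. SUM I:mi (?k - q).
  aa (map eb J @ map e I) * wgs (map etab J @ map eta I) vs)" by (simp only: sum.cartesian_product)
 finally show ?thesis .
qed

lemma wedges_dual:
 fixes e eb :: "'n::{finite,linorder} => 't"
 assumes "!!i j. eta i (e j) = (if i = j then 1 else 0)" "!!i j. etab i (eb j) = (if i = j then 1 else 0)"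
  "!!i j. eta i (eb j) = 0" "!!i j. etab i (e j) = 0"
  "sorted_wrt (<) J" "sorted_wrt (<) I" "sorted_wrt (<) J'" "sorted_wrt (<) I'"
  "length J + length I = length J' + length I'"
 shows "wgs (map etab J @ map eta I) (map eb J' @ map e I') = (if J = J' & I = I' then 1 else 0)"
proof -
 have "wgs (map (case_sum eta etab) (map Inr J @ map Inl I)) (map (case_sum e eb) (map Inr J' @ map Inl I')) =
   (if map Inr J @ map Inl I = map Inr J' @ map Inl I' then 1 else 0)"
 proof (rule wedges_dual_subseqs[OF distinct_two_idx])
  show "case_sum eta etab a (case_sum e eb b) = (if a = b then 1 else 0)" for a b by (cases a; cases b) (simp_all add: assms(1-4))
  show "map Inr J @ map Inl I : set (subseqs two_idx)" "map Inr J' @ map Inl I' : set (subseqs two_idx)"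
   unfolding subseqs_two_idx using assms(5-8) by auto qed (use assms(9) in simp)
 thus ?thesis by (simp add: map_Inr_Inl_inj o_def)
qed

subsection \<open>The exponential of a substitution\<close>

lemma funpow_subs_cong:
 assumes "!!ws. set ws <= V ==> length ws = k ==> aa ws = bb ws" "set vs <= V" "length vs = k"
  "!!v. v : V ==> ph v : V" shows "(subs ph ^^ j) aa vs = (subs ph ^^ j) bb vs" using assms(2,3)
proof (induction j arbitrary: vs)
 case (Suc j)
 show ?case unfolding funpow.simps o_def by (rule subs_cong[of _ V]) (use Suc assms(4) in auto)
qed (simp add: assms(1))

lemma funpow_subs_lincomb:
 "(subs ph ^^ j) (%vs. a * aa vs + b * bb vs) vs = a * (subs ph ^^ j) aa vs + b * (subs ph ^^ j) bb vs"
proof (induction j arbitrary: vs)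
 case (Suc j)
 have "(subs ph ^^ j) (%vs. a * aa vs + b * bb vs) = (%vs. a * (subs ph ^^ j) aa vs + b * (subs ph ^^ j) bb vs)" using Suc by blast
 thus ?case by (simp add: subs_lincomb)
qed simp

lemma funpow_subs_zero:
 assumes "!!ws. set ws <= V ==> length ws = length vs ==> bb ws = 0" "set vs <= V" "!!v. v : V ==> ph v : V"
 shows "(subs ph ^^ j) bb vs = 0"
proof -
 have "(subs ph ^^ j) bb vs = (subs ph ^^ j) (%ws. 0 * bb ws + 0 * bb ws) vs"
  by (rule funpow_subs_cong[of V "length vs"]) (use assms in auto)
 thus ?thesis unfolding funpow_subs_lincomb by simp
qed

text \<open>The first slot contributes the derivation rule for the \<open>j\<close>-th power of a square-zero
 derivation.\<close>

lemma funpow_subs_Cons: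
 assumes "cspace V" "altern V (Suc (length vs)) aa" "set vs <= V" "v : V" "!!v. v : V ==> ph v : V"
  "!!v. v : V ==> ph (ph v) = (%_. 0)" shows "(subs ph ^^ j) aa (v # vs) =
  (subs ph ^^ j) (%ws. aa (v # ws)) vs + of_nat j * (subs ph ^^ (j - 1)) (%ws. aa (ph v # ws)) vs" using assms(3,4,2)
proof (induction j arbitrary: v vs)
 case (Suc j)
 have "(subs ph ^^ Suc j) aa (v # vs) = (subs ph ^^ j) aa (ph v # vs) + subs ph (%ws. (subs ph ^^ j) aa (v # ws)) vs" by simp
 also have "(subs ph ^^ j) aa (ph v # vs) = (subs ph ^^ j) (%ws. aa (ph v # ws)) vs
   + of_nat j * (subs ph ^^ (j - 1)) (%ws. aa (ph (ph v) # ws)) vs" using Suc.prems assms(5) by (intro Suc.IH) auto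
 also have "(subs ph ^^ (j - 1)) (%ws. aa (ph (ph v) # ws)) vs = 0" by (rule funpow_subs_zero[of V])
   (use Suc.prems alt_zero_slot[OF assms(1) Suc.prems(3), of "[]"] assms(5,6) in auto)
 also have "subs ph (%ws. (subs ph ^^ j) aa (v # ws)) vs =
   subs ph (%ws. 1 * (subs ph ^^ j) (%ws. aa (v # ws)) ws
   + of_nat j * (subs ph ^^ (j - 1)) (%ws. aa (ph v # ws)) ws) vs"
 proof (rule subs_cong[of _ V]) fix ws assume "set ws <= V" "length ws = length vs"
  thus "(subs ph ^^ j) aa (v # ws) = 1 * (subs ph ^^ j) (%ws. aa (v # ws)) ws
   + of_nat j * (subs ph ^^ (j - 1)) (%ws. aa (ph v # ws)) ws" using Suc.IH[of ws v] Suc.prems by simp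
 qed (use Suc.prems assms(5) in auto)
 also have "... = (subs ph ^^ Suc j) (%ws. aa (v # ws)) vs
   + of_nat j * subs ph ((subs ph ^^ (j - 1)) (%ws. aa (ph v # ws))) vs"
  using subs_lincomb[of ph 1 "(subs ph ^^ j) (%ws. aa (v # ws))" "of_nat j"
   "(subs ph ^^ (j - 1)) (%ws. aa (ph v # ws))" vs] by simp
 also have "of_nat j * subs ph ((subs ph ^^ (j - 1)) (%ws. aa (ph v # ws))) vs =
   of_nat j * (subs ph ^^ j) (%ws. aa (ph v # ws)) vs" by (cases j) simp_all
 finally show ?case by (simp add: algebra_simps)
qed simp

text \<open>The exponential of a derivation is the algebra map induced by exp \<open>ph\<close>,
  which is 1 + \<open>ph\<close> because \<open>ph\<close> squares to zero. The vanishing of high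
  powers is proved along with it, since the induction step compares sums truncated at different
  degrees.\<close>

lemma exp_subs:
 assumes "cspace V" "altern V (length vs) aa" "set vs <= V" "!!v. v : V ==> ph v : V"
  "!!v. v : V ==> ph (ph v) = (%_. 0)"
 shows "(SUM j<=length vs. 1 / fact j * (subs ph ^^ j) aa vs) = aa (map (%v. lc 1 v 1 (ph v)) vs)"
  and "j > length vs ==> (subs ph ^^ j) aa vs = 0"
proof -
 have "(SUM j<=length vs. 1 / fact j * (subs ph ^^ j) aa vs) = aa (map (%v. lc 1 v 1 (ph v)) vs) &
   (ALL j>length vs. (subs ph ^^ j) aa vs = 0)" using assms(2,3)
 proof (induction vs arbitrary: aa)
  case Nil
  have "(subs ph ^^ j) aa [] = 0" if "j > 0" for j using that by (cases j) simp_all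
  thus ?case by simp next
  case (Cons v vs)
  let ?A = "%j. (subs ph ^^ j) (%ws. aa (v # ws)) vs" and ?B = "%j. (subs ph ^^ j) (%ws. aa (ph v # ws)) vs"
  have v: "v : V" "set vs <= V" "ph v : V" using Cons.prems assms(4) by auto
  have step: "(subs ph ^^ j) aa (v # vs) = ?A j + of_nat j * ?B (j - 1)" for j
   using funpow_subs_Cons[of V vs aa v ph j] assms(1,4,5) v(1,2) Cons.prems by simp
  have A: "(SUM j<=length vs. 1 / fact j * ?A j) = aa (v # map (%v. lc 1 v 1 (ph v)) vs)" "!!j. j > length vs ==> ?A j = 0"
   using Cons.IH[of "%ws. aa (v # ws)"] alt_Cons[of V "length vs" aa v] Cons.prems v by auto
  have B: "(SUM j<=length vs. 1 / fact j * ?B j) = aa (ph v # map (%v. lc 1 v 1 (ph v)) vs)" "!!j. j > length vs ==> ?B j = 0"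
   using Cons.IH[of "%ws. aa (ph v # ws)"] alt_Cons[of V "length vs" aa "ph v"] Cons.prems v by auto
  have "(SUM j<=Suc (length vs). 1 / fact j * (subs ph ^^ j) aa (v # vs)) =
   (SUM j<=Suc (length vs). 1 / fact j * ?A j) + (SUM j<=Suc (length vs). 1 / fact j * of_nat j * ?B (j - 1))"
   unfolding step by (simp add: distrib_left sum.distrib mult.assoc)
  also have "(SUM j<=Suc (length vs). 1 / fact j * ?A j) = (SUM j<=length vs. 1 / fact j * ?A j)"
   using A(2)[of "Suc (length vs)"] by (simp del: funpow.simps)
  \<comment> \<open>At j = 0 the truncated subtraction yields \<open>?B 0\<close>, which the factor
    0 removes; for the other terms j / j! = 1 / (j - 1)!.\<close>
  also have "(SUM j<=Suc (length vs). 1 / fact j * of_nat j * ?B (j - 1)) = (SUM j<=length vs. 1 / fact j * ?B j)"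
  proof -
   have "1 / fact (Suc j) * of_nat (Suc j) = (1 / fact j :: complex)" for j by (simp add: fact_Suc del: of_nat_Suc)
   thus ?thesis unfolding sum.atMost_Suc_shift by (simp only: diff_Suc_1 of_nat_0 mult_zero_right mult_zero_left add_0)
  qed
  also have "(SUM j<=length vs. 1 / fact j * ?A j) + (SUM j<=length vs. 1 / fact j * ?B j) =
   aa (lc 1 v 1 (ph v) # map (%v. lc 1 v 1 (ph v)) vs)"
  proof -
   have "set (map (%v. lc 1 v 1 (ph v)) vs) <= V" using v assms(1,4) by (auto simp: cspace_def)
   thus ?thesis using alt_lc[OF Cons.prems(1), of "[]" _ v "ph v" 1 1] v A(1) B(1) by simp
  qed finally have "(SUM j<=length (v # vs). 1 / fact j * (subs ph ^^ j) aa (v # vs)) =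
   aa (map (%v. lc 1 v 1 (ph v)) (v # vs))" by (simp only: length_Cons list.map)
  moreover have "(subs ph ^^ j) aa (v # vs) = 0" if "j > length (v # vs)" for j
  proof -
   have "j > length vs" "j - 1 > length vs" using that by auto
   thus ?thesis unfolding step by (simp add: A(2) B(2)) qed ultimately show ?case by blast
 qed
 thus "(SUM j<=length vs. 1 / fact j * (subs ph ^^ j) aa vs) = aa (map (%v. lc 1 v 1 (ph v)) vs)"
  "j > length vs ==> (subs ph ^^ j) aa vs = 0" by blast+
qed

section \<open>Charts\<close>

lemma inv_into_cong_on: "(!!x. x : U ==> f x = g x) ==> iv U f = iv U g"
proof fix y assume *: "!!x. x : U ==> f x = g x"
 have "(%x. x : U & f x = y) = (%x. x : U & g x = y)" using * by auto
 thus "iv U f y = iv U g y" unfolding inv_into_def by simp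
qed

lemma ccD:
 assumes "coord_chart M (U, z)" shows "openin (top_of_set M) U" "open (z ` U)" "homeomorphism U (z ` U) z (iv U z)"
  "inj_on z U" "!!x. x : U ==> iv U z (z x) = x" "!!u. u : z ` U ==> iv U z u : U"
  "!!u. u : z ` U ==> z (iv U z u) = u" "U <= M"
  "cont U z" "cont (z ` U) (iv U z)"
proof -
 show o: "openin (top_of_set M) U" "open (z ` U)" and h: "homeomorphism U (z ` U) z (iv U z)" using assms unfolding coord_chart_def by auto
 show i: "!!x. x : U ==> iv U z (z x) = x" using h unfolding homeomorphism_def by auto
 thus "inj_on z U" by (metis inj_onI)
 show "!!u. u : z ` U ==> iv U z u : U" by (rule inv_into_into)
 show "!!u. u : z ` U ==> z (iv U z u) = u" by (rule f_inv_into_f)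
 show "U <= M" using openin_subset[OF o(1)] by simp
 show "cont U z" "cont (z ` U) (iv U z)" using h unfolding homeomorphism_def by auto
qed

lemma cc_open_image:
 assumes "coord_chart M (U, z)" "openin (top_of_set M) N" "N <= U" shows "open (z ` N)"
proof -
 have "openin (top_of_set U) N" using assms(2,3) ccD(8)[OF assms(1)] by (meson openin_subset_trans)
 hence "openin (top_of_set (z ` U)) (z ` N)" by (rule homeomorphism_imp_open_map[OF ccD(3)[OF assms(1)]])
 thus ?thesis using ccD(2)[OF assms(1)] openin_open_eq by blast
qed

lemma cc_vimage:
 assumes "coord_chart M (U, z)" "open S" shows "openin (top_of_set M) (U Int z -` S)"
 by (rule openin_trans[OF continuous_openin_preimage_gen[OF ccD(9)[OF assms(1)] assms(2)]
   ccD(1)[OF assms(1)]])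

lemma inv_into_restrict:
 assumes "inj_on z U" "N <= U" "u : z ` N" shows "iv N z u = iv U z u"
proof -
 obtain x where "x : N" "u = z x" using assms(3) by blast
 thus ?thesis using assms(1,2) by (metis inj_on_subset inv_into_f_f subsetD)
qed

lemma cc_restrict:
 assumes "coord_chart M (U, z)" "openin (top_of_set M) N" "N <= U" shows "coord_chart M (N, z)"
proof - note D = ccD[OF assms(1)]
 have "homeomorphism N (z ` N) z (iv U z)" by (rule homeomorphism_of_subsets[OF D(3) assms(3)]) (use assms(3) in auto)
 hence "homeomorphism N (z ` N) z (iv N z)" by (rule homeomorphism_cong) (use inv_into_restrict[OF D(4) assms(3)] in auto)
 thus ?thesis unfolding coord_chart_def using assms(2) cc_open_image[OF assms] by auto
qed

lemma cc_cong:
 assumes "coord_chart M (U, z)" "!!x. x : U ==> z x = z' x" shows "coord_chart M (U, z')"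
proof -
 have "z ` U = z' ` U" using assms(2) by auto
 moreover have "iv U z = iv U z'" by (rule inv_into_cong_on[OF assms(2)])
 moreover have "homeomorphism U (z ` U) z' (iv U z)" by (rule homeomorphism_cong[OF ccD(3)[OF assms(1)]]) (use assms(2) in auto)
 ultimately show ?thesis using ccD(1,2)[OF assms(1)] unfolding coord_chart_def by auto
qed

lemma cc_inter_image:
 assumes "coord_chart M (U, z)" "coord_chart M (V, w)" shows "open (z ` (U Int V))"
 by (rule cc_open_image[OF assms(1) openin_Int[OF ccD(1)[OF assms(1)] ccD(1)[OF assms(2)]]]) auto

text \<open>The image of a right inverse of \<open>P\<close> is a complement of the kernel, so the
  kernel has dimension \<open>CARD('k)\<close>, and \<open>L\<close> sends a basis of it to the
  standard basis. In this way the derivative of the projection is completed to an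
  isomorphism.\<close>

lemma linear_complement:
 fixes P :: "complex^('k::finite + 'l::finite) => complex^'l"
 assumes "Vector_Spaces.linear (*s) (*s) P" "surj P"
 obtains L :: "complex^('k + 'l) => complex^'k" where "Vector_Spaces.linear (*s) (*s) L" "!!v. L v = 0 ==> P v = 0 ==> v = 0"
proof -
 interpret P: Vector_Spaces.linear "(*s)" "(*s)" P by (rule assms(1))
 obtain R where R: "Vector_Spaces.linear (*s) (*s) R" "P o R = id" using vec.linear_surjective_right_inverse[OF assms(1,2)] by blast
 interpret R: Vector_Spaces.linear "(*s)" "(*s)" R by (rule R(1))
 let ?K = "{v. P v = 0}"
 have subK: "vec.subspace ?K" by (rule P.subspace_kernel)
 have PR: "P (R w) = w" for w using R(2) by (metis comp_apply id_apply)
 have injR: "inj R" by (metis PR injI)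
 have dimR: "vec.dim (range R) = CARD('l)"
 proof -
  have "vec.dim (R ` UNIV) = vec.dim (UNIV :: (complex^'l) set)"
   by (rule vec.dim_image_eq[OF R(1)]) (use injR in \<open>auto intro: inj_on_subset\<close>)
  thus ?thesis by (simp add: vec.dim_UNIV card_cart_basis) qed
 have subR: "vec.subspace (range R)" using R.subspace_image[OF vec.subspace_UNIV] .
 have "vec.dim {x + y |x y. x : ?K & y : range R} + vec.dim (?K Int range R) = vec.dim ?K + vec.dim (range R)"
  by (rule vec.dim_sums_Int[OF subK subR])
 moreover have "{x + y |x y. x : ?K & y : range R} = UNIV"
 proof -
  have "v = (v - R (P v)) + R (P v)" "v - R (P v) : ?K" for v by (auto simp: P.diff PR)
  thus ?thesis by blast qed moreover have "?K Int range R = {0}"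
 proof -
  have "R w = 0" if "P (R w) = 0" for w using that R.zero by (simp add: PR)
  moreover have "0 : range R" by (metis R.zero rangeI)
  ultimately show ?thesis using P.zero by auto qed
 ultimately have dimK: "vec.dim ?K = CARD('k)" using dimR by (simp add: vec.dim_UNIV card_cart_basis)
 obtain B where B: "B <= ?K" "vec.independent B" "?K <= vec.span B" "card B = CARD('k)" using vec.basis_exists[of ?K] dimK by metis
 have finB: "finite B" by (rule vec.finiteI_independent[OF B(2)])
 obtain b where b: "bij_betw b (UNIV :: 'k set) B" using finite_same_card_bij[OF finite finB] B(4) by metis
 obtain L where L: "Vector_Spaces.linear (*s) (*s) L" "ALL v:B. L v = axis (iv UNIV b v) (1::complex)"
  using vec.linear_independent_extend[OF B(2), of "%v. axis (iv UNIV b v) 1"] by auto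
 interpret L: Vector_Spaces.linear "(*s)" "(*s)" L by (rule L(1))
 have Lb: "L (b i) = axis i 1" for i
 proof -
  have "b i : B" "iv UNIV b (b i) = i" using b unfolding bij_betw_def by auto
  thus ?thesis using L(2) by simp qed show thesis
 proof (rule that[OF L(1)]) fix v assume v: "L v = 0" "P v = 0"
  hence "v : vec.span B" using B(3) by blast
  then obtain c where c: "v = (SUM a:B. c a *s a)" using vec.span_finite[OF finB] by auto
  also have "... = (SUM i:UNIV. c (b i) *s b i)" by (rule sum.reindex_bij_betw[OF b, symmetric])
  finally have v': "v = (SUM i:UNIV. c (b i) *s b i)" .
  hence "L v = (SUM i:UNIV. c (b i) *s axis i 1)" by (simp add: L.sum L.scale Lb)
  hence "L v $ i = c (b i)" for i by (simp add: axis_def if_distrib cong: if_cong)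
  hence "c (b i) = 0" for i using v(1) by simp thus "v = 0" using v' by simp qed
qed

lemma ho_bounded_linear:
 "bounded_linear h ==> (!!c v. h (c *s v) = c * h v) ==> holo_on S h" unfolding holo_on_def using bounded_linear_imp_has_derivative by blast

lemma scaleR_eq_smult: "r *R v = (of_real r :: complex) *s (v :: complex^'k::finite)"
 by (simp only: vec_eq_iff vector_scaleR_component vector_smult_component) (simp add: scaleR_conv_of_real)

lemma complex_linear_bounded:
 fixes L :: "complex^'k::finite => complex^'l::finite"
 assumes "Vector_Spaces.linear (*s) (*s) L" shows "bounded_linear L"
proof -
 interpret L: Vector_Spaces.linear "(*s)" "(*s)" L by (rule assms)
 have "linear L" by (intro linearI) (auto simp: L.add L.scale scaleR_eq_smult)
 thus ?thesis by (simp add: linear_conv_bounded_linear)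
qed

section \<open>The family and its trivialization\<close>

locale pair_family =
 fixes X :: "('x::{t2_space,second_countable_topology}, 'n::{finite,linorder}, 'm::finite, 'e, 'r::finite) family"
 assumes pairs: "family_of_pairs X" and triv: "compatible_trivialization X"
begin

abbreviation "M0 \<equiv> fib X 0"
abbreviation "BX \<equiv> base X"
abbreviation "FC \<equiv> fibre_charts X"
abbreviation "EE \<equiv> efib X"
abbreviation "TX \<equiv> tangent X"
abbreviation "smat \<equiv> smooth_at X"
abbreviation "XC \<equiv> Xcharts X"
abbreviation "EF \<equiv> Eframes X"
abbreviation "dzv \<equiv> dz_vec X"
abbreviation "dzbv \<equiv> dzb_vec X"
abbreviation "wm \<equiv> wmat X"

lemma atlas: "complex_atlas UNIV (charts X)" and base: "open (BX)" "0 : BX" "range (proj X) <= BX"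
 and proj_submersion: "(U, z) : charts X ==> hmap (z ` U) (proj X o iv U z)"
  "(U, z) : charts X ==> x : U ==> surj (fder (proj X o iv U z) (z x))"
 and proj_proper: "compact K ==> K <= BX ==> compact (proj X -` K)"
 using pairs unfolding family_of_pairs_def family_of_manifolds_def by fast+

lemma charts_coord: "(U, z) : charts X ==> coord_chart UNIV (U, z)" using atlas unfolding complex_atlas_def by blast

lemma charts_open: "(U, z) : charts X ==> open U" using ccD(1)[OF charts_coord] by simp

lemma charts_cover: obtains U z where "(U, z) : charts X" "x : U"
proof -
 have "x : \<Union>(fst ` charts X)" using atlas unfolding complex_atlas_def by simp
 thus thesis using that by force
qed

lemma charts_compat: "(U, z) : charts X ==> (V, w) : charts X ==> holo_compat (U, z) (V, w)"
 using atlas unfolding complex_atlas_def by blast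

lemma bundle_holomorphic: "holomorphic_bundle X" using pairs unfolding family_of_pairs_def by blast

lemma tht: "transversely_holomorphic_trivialization X" using triv unfolding compatible_trivialization_def by blast

text \<open>For \<open>t\<close> in the base this is the inverse of the trivialization
  \<open>sg X\<close> restricted to the fibre over \<open>t\<close>.\<close>

definition sgi :: "complex^'m => 'x => 'x" where
 "sgi t x = iv UNIV (%x. (sg X x, proj X x)) (x, t)"

lemma sg_bij: "bij_betw (%x. (sg X x, proj X x)) UNIV (M0 \<times> BX)" and sg_fib0: "x : M0 ==> sg X x = x"
 and sg_cont: "cont UNIV (sg X)" and sg_smooth: "(U, z) : charts X ==> (V, w) : FC 0 ==>
   smo (z ` (U Int sg X -` V)) (w o sg X o iv U z)"
 and sgi_cont: "cont (M0 \<times> BX) (%(x, t). sgi t x)"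
 and sgi_smooth: "(U, z) : charts X ==> (V, w) : FC 0 ==>
   smo {(u, t). u : w ` V & t : BX & sgi t (iv V w u) : U} (%(u, t). z (sgi t (iv V w u)))"
proof -
 note * = tht[unfolded transversely_holomorphic_trivialization_def Let_def, folded sgi_def]
 show "bij_betw (%x. (sg X x, proj X x)) UNIV (M0 \<times> BX)"
  "x : M0 ==> sg X x = x" "cont UNIV (sg X)"
  "(U, z) : charts X ==> (V, w) : FC 0 ==>
   smo (z ` (U Int sg X -` V)) (w o sg X o iv U z)"
  "(U, z) : charts X ==> (V, w) : FC 0 ==>
   smo {(u, t). u : w ` V & t : BX & sgi t (iv V w u) : U} (%(u, t). z (sgi t (iv V w u)))" using * by fast+
 have "iv UNIV (%x. (sg X x, proj X x)) = (%(x, t). sgi t x)" by (auto simp: sgi_def fun_eq_iff)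
 thus "cont (M0 \<times> BX) (%(x, t). sgi t x)" using * by simp
qed

lemma fib_iff: "x : fib X t \<longleftrightarrow> proj X x = t" by (simp add: fib_def)

lemma sg_in [simp]: "sg X x : M0" using sg_bij unfolding bij_betw_def by blast

lemma sgi_in:
 assumes "t : BX" "x : M0" shows "sgi t x : fib X t" "sg X (sgi t x) = x"
proof -
 have "(x, t) : range (%x. (sg X x, proj X x))" using sg_bij assms unfolding bij_betw_def by auto
 hence "(sg X (sgi t x), proj X (sgi t x)) = (x, t)" unfolding sgi_def by (rule f_inv_into_f)
 thus "sgi t x : fib X t" "sg X (sgi t x) = x" by (auto simp: fib_iff)
qed

lemma sgi_sg: "y : fib X t ==> sgi t (sg X y) = y" using inv_into_f_f[of "%x. (sg X x, proj X x)" UNIV y] sg_bij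
 unfolding bij_betw_def sgi_def by (simp add: fib_iff)

lemma sg_inj_fib: "y : fib X t ==> y' : fib X t ==> sg X y = sg X y' ==> y = y'" by (metis sgi_sg)

lemma sgi_cont_fib: "t : BX ==> cont (M0) (sgi t)"
proof - assume t: "t : BX"
 have "cont (M0) (%x. (%(x, t). sgi t x) (x, t))" by (rule continuous_on_compose2[OF sgi_cont])
   (use t in \<open>auto intro!: continuous_on_Pair continuous_on_id continuous_on_const\<close>)
 thus ?thesis by simp
qed

lemma sg_homeo:
 assumes "t : BX" shows "homeomorphism (fib X t) (M0) (sg X) (sgi t)"
proof (rule homeomorphismI)
 show "cont (fib X t) (sg X)" using sg_cont continuous_on_subset by blast
 show "cont (M0) (sgi t)" by (rule sgi_cont_fib[OF assms])
qed (use sgi_in[OF assms] sgi_sg in auto)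

subsection \<open>Fibre charts\<close>

lemma FCD:
 assumes "(U, z) : FC t" shows "coord_chart (fib X t) (U, z)"
  "!!W Z. (W, Z) : charts X ==> hmap (z ` (U Int W)) (Z o iv U z)"
  "!!x. x : U ==> EX (W, Z):holo_charts UNIV (charts X). x : W & (EX F. hmap (Z ` W) F & (ALL y:U Int W. F (Z y) = z y))"
 using assms unfolding fibre_charts_def by auto

lemma FC_cong:
 assumes "(U, z) : FC t" "!!x. x : U ==> z x = z' x" shows "(U, z') : FC t"
proof - note D = FCD[OF assms(1)]
 have inv: "iv U z = iv U z'" by (rule inv_into_cong_on[OF assms(2)])
 have im: "z ` (U Int W) = z' ` (U Int W)" for W using assms(2) by auto
 have "EX (W, Z):holo_charts UNIV (charts X). x : W &
   (EX F. hmap (Z ` W) F & (ALL y:U Int W. F (Z y) = z' y))" if "x : U" for x using D(3)[OF that] assms(2) by fastforce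
 thus ?thesis unfolding fibre_charts_def using cc_cong[OF D(1) assms(2)] D(2) inv im by auto
qed

lemma FC_restrict:
 assumes "(U, z) : FC t" "openin (top_of_set (fib X t)) N" "N <= U" shows "(N, z) : FC t"
proof - note D = FCD[OF assms(1)]
 have cc: "coord_chart (fib X t) (N, z)" by (rule cc_restrict[OF D(1) assms(2,3)])
 have "hmap (z ` (N Int W)) (Z o iv N z)" if W: "(W, Z) : charts X" for W Z
 proof (rule hm_cong) show "open (z ` (N Int W))"
  proof (rule cc_open_image[OF cc])
   show "openin (top_of_set (fib X t)) (N Int W)" using assms(2) charts_open[OF W] by (rule openin_Int_open)
  qed simp
  show "hmap (z ` (N Int W)) (Z o iv U z)" by (rule hm_subset[OF D(2)[OF W]]) (use assms(3) in auto)
  show "(Z o iv U z) u = (Z o iv N z) u" if "u : z ` (N Int W)" for u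
   using inv_into_restrict[OF ccD(4)[OF D(1)] assms(3), of u] that by auto qed
 moreover have "EX (W, Z):holo_charts UNIV (charts X). x : W & (EX F. hmap (Z ` W) F & (ALL y:N Int W. F (Z y) = z y))" if "x : N" for x
 proof -
  have "x : U" using that assms(3) by blast
  then obtain W Z F where "(W, Z) : holo_charts UNIV (charts X)" "x : W" "hmap (Z ` W) F"
   "ALL y:U Int W. F (Z y) = z y" using D(3) by blast
  thus ?thesis using assms(3) by (intro bexI[of _ "(W, Z)"]) auto qed
 ultimately show ?thesis unfolding fibre_charts_def using cc by auto
qed

lemma holo_chartsD:
 assumes "(W, Z) : holo_charts UNIV (charts X)" shows "coord_chart UNIV (W, Z)" "open W"
  "!!W' Z'. (W', Z') : charts X ==> hmap (Z ` (W Int W')) (Z' o iv W Z)"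
  "!!W' Z'. (W', Z') : charts X ==> hmap (Z' ` (W' Int W)) (Z o iv W' Z')"
proof - show c: "coord_chart UNIV (W, Z)" using assms unfolding holo_charts_def by blast
 show "open W" using ccD(1)[OF c] by simp
 show "!!W' Z'. (W', Z') : charts X ==> hmap (Z ` (W Int W')) (Z' o iv W Z)" using assms unfolding holo_charts_def holo_compat_def by blast
 show "!!W' Z'. (W', Z') : charts X ==> hmap (Z' ` (W' Int W)) (Z o iv W' Z')"
  using assms unfolding holo_charts_def holo_compat_def by (auto simp: Int_commute)
qed

text \<open>By definition a fibre chart extends holomorphically near a point in some chart of the
  maximal atlas; a transition map carries the extension to a prescribed chart of the family.\<close>

lemma fibre_chart_factor:
 assumes "(U, z) : FC t" "x : U" "(W, Z) : charts X" "x : W"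
 obtains O1 F where "open O1" "Z x : O1" "O1 <= Z ` W" "hmap O1 F"
  "!!y. y : U ==> y : W ==> Z y : O1 ==> F (Z y) = z y"
proof -
 obtain W1 Z1 F where W1: "(W1, Z1) : holo_charts UNIV (charts X)" "x : W1"
  "hmap (Z1 ` W1) F" "ALL y:U Int W1. F (Z1 y) = z y" using FCD(3)[OF assms(1,2)] by blast
 note H = holo_chartsD[OF W1(1)] and C = ccD[OF charts_coord[OF assms(3)]]
 let ?O = "Z ` (W Int W1)" and ?F = "%u. F ((Z1 o iv W Z) u)" show thesis
 proof (rule that[of ?O ?F])
  show "open ?O" by (rule cc_inter_image[OF charts_coord[OF assms(3)] H(1)])
  show "Z x : ?O" "?O <= Z ` W" using assms(4) W1(2) by auto
  show "hmap ?O ?F" by (rule hm_compose[OF W1(3) H(4)[OF assms(3)]]) (use C(5) in auto)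
  show "?F (Z y) = z y" if "y : U" "y : W" "Z y : ?O" for y
  proof -
   have "y : W1" using that(2,3) C(4) by (auto simp: inj_on_def)
   thus ?thesis using W1(4) that C(5)[OF that(2)] by simp qed qed
qed

text \<open>The inverse of the first chart is holomorphic into the total space, and the second chart
  extends holomorphically to the total space near each point; the transition map is the
  composite.\<close>

lemma FC_trans:
 assumes "(U, z) : FC t" "(V, w) : FC t" shows "hmap (z ` (U Int V)) (w o iv U z)"
proof (rule hm_local) fix u assume "u : z ` (U Int V)"
 then obtain x where x: "x : U" "x : V" "u = z x" by blast
 note U = FCD[OF assms(1)] and V = FCD[OF assms(2)]
 obtain W Z where W: "(W, Z) : charts X" "x : W" by (rule charts_cover)
 obtain O1 F where O1: "open O1" "Z x : O1" "O1 <= Z ` W" "hmap O1 F"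
  "!!y. y : V ==> y : W ==> Z y : O1 ==> F (Z y) = w y" using fibre_chart_factor[OF assms(2) x(2) W] by blast
 define N where "N = U Int (V Int (W Int Z -` O1))"
 have "open (W Int Z -` O1)" using cc_vimage[OF charts_coord[OF W(1)] O1(1)] by simp
 hence "openin (top_of_set (fib X t)) N" unfolding N_def by (intro openin_Int openin_Int_open ccD(1)[OF U(1)] ccD(1)[OF V(1)])
 hence oN: "open (z ` N)" by (rule cc_open_image[OF U(1)]) (auto simp: N_def)
 have "hmap (z ` N) (%u. F ((Z o iv U z) u))" by (rule hm_compose[OF O1(4) hm_subset[OF U(2)[OF W(1)]]]) (auto simp: N_def ccD(5)[OF U(1)])
 hence "hmap (z ` N) (w o iv U z)" by (rule hm_cong[OF oN, rotated]) (auto simp: N_def ccD(5)[OF U(1)] O1(5))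
 moreover have "u : z ` N" using x W O1 by (auto simp: N_def)
 ultimately show "EX N. u : N & hmap N (w o iv U z)" by blast
qed

text \<open>The holomorphic submersion theorem: near \<open>x0\<close> the projection is completed
  by linear functions to coordinates of the total space, in which the fibre is a coordinate
  slice.\<close>

lemma FC_exist:
 assumes "x0 : fib X t"
 obtains U z where "(U, z) : FC t" "x0 : U"
proof -
 obtain W0 Z0 where W0: "(W0, Z0) : charts X" "x0 : W0" by (rule charts_cover)
 note C0 = ccD[OF charts_coord[OF W0(1)]]
 let ?S = "Z0 ` W0"
 define p where "p = proj X o iv W0 Z0"
 have hp: "hmap ?S p" and sp: "surj (fder p (Z0 x0))" using proj_submersion W0 unfolding p_def by blast+
 have x0S: "Z0 x0 : ?S" using W0(2) by blast note dp = hm_derivative[OF hp x0S]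
 let ?P = "fder p (Z0 x0)"
 have linP: "Vector_Spaces.linear (*s) (*s) ?P" by unfold_locales (auto simp: dp(2) linear_add[OF has_derivative_linear[OF dp(1)]])
 obtain L :: "complex^('n + 'm) => (complex, 'n) vec"
  where L: "Vector_Spaces.linear (*s) (*s) L" "!!v. L v = 0 ==> ?P v = 0 ==> v = 0" using linear_complement[OF linP sp] by blast
 interpret L: Vector_Spaces.linear "(*s)" "(*s)" L by (rule L(1))
 \<comment> \<open>The components of the projection form the second block; the first block is linear
   and injective on the kernel of the derivative at the centre.\<close>
 define H where "H u = (\<chi> k. case k of Inl i => L u $ i | Inr j => p u $ j)" for u
 have blL: "bounded_linear (%v. L v $ i)" for i using bounded_linear_compose[OF bounded_linear_vec_nth complex_linear_bounded[OF L(1)]] .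
 have hL: "holo_on T (%u. L u $ i)" for T i by (rule ho_bounded_linear[OF blL]) (simp add: L.scale)
 have hH: "hmap ?S H" unfolding holo_map_on_def
 proof
  show "holo_on ?S (%u. H u $ k)" for k using hL hp unfolding H_def holo_map_on_def by (cases k) simp_all
 qed
 have injH: "inj (fder H (Z0 x0))"
 proof - note dH = hm_derivative[OF hH x0S]
  have "v = 0" if v: "fder H (Z0 x0) v = 0" for v
  proof (rule L(2))
   have "L v $ i = fder H (Z0 x0) v $ Inl i" for i unfolding dH(3) H_def
   using fderI[OF bounded_linear_imp_has_derivative[OF blL], of i "Z0 x0"] by simp
   thus "L v = 0" using v by (simp add: vec_eq_iff)
   have "?P v $ j = fder H (Z0 x0) v $ Inr j" for j unfolding dH(3) dp(3) H_def by simp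
   thus "?P v = 0" using v by (simp add: vec_eq_iff) qed
  thus ?thesis using linear_injective_0[OF has_derivative_linear[OF dH(1)]] by blast qed
 obtain U V G where G: "open U" "U <= ?S" "Z0 x0 : U" "open V" "homeomorphism U V H G" "hmap V G"
  by (rule holo_inverse_function[OF C0(2) hH x0S injH])
 define W where "W = W0 Int Z0 -` U"
 define Z where "Z = H o Z0"
 have oW: "open W" using cc_vimage[OF charts_coord[OF W0(1)] G(1)] by (simp add: W_def)
 have ZW: "Z0 ` W = U" using G(2) by (auto simp: W_def)
 have hom0: "homeomorphism W U Z0 (iv W0 Z0)" by (rule homeomorphism_of_subsets[OF C0(3)]) (use ZW in \<open>auto simp: W_def\<close>)
 define Zi where "Zi = iv W0 Z0 o G"
 have hom: "homeomorphism W V Z Zi" unfolding Z_def Zi_def by (rule homeomorphism_compose[OF hom0 G(5)])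
 have ZV: "Z ` W = V" and ZiV: "Zi ` V = W" and ZiZ: "!!y. y : W ==> Zi (Z y) = y"
  and ZZi: "!!v. v : V ==> Z (Zi v) = v" and cZ: "cont W Z" "cont V Zi" using hom unfolding homeomorphism_def by blast+
 have injZ: "inj_on Z W" by (metis ZiZ inj_onI)
 have invZ: "iv W Z v = Zi v" if "v : V" for v using that ZiV ZZi injZ by (metis image_eqI inv_into_f_f)
 have ccZ: "coord_chart UNIV (W, Z)"
 proof -
  have "homeomorphism W V Z (iv W Z)" by (rule homeomorphism_cong[OF hom]) (use invZ in auto)
  thus ?thesis unfolding coord_chart_def using oW G(4) ZV by auto qed
 have trans1: "hmap (Z ` (W Int W')) (Z' o Zi)" if W': "(W', Z') : charts X" for W' Z'
 proof -
  have "hmap (Z ` (W Int W')) (%v. (Z' o iv W0 Z0) (G v))"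
  proof (rule hm_compose[where f = "Z' o iv W0 Z0" and g = G])
   show "hmap (Z0 ` (W0 Int W')) (Z' o iv W0 Z0)" using charts_compat[OF W0(1) W'] unfolding holo_compat_def by blast
   show "hmap (Z ` (W Int W')) G" by (rule hm_subset[OF G(6)]) (use ZV in auto)
   have "G (Z y) = Z0 y" if "y : W" for y using that G(5) unfolding homeomorphism_def Z_def W_def by auto
   thus "G ` Z ` (W Int W') <= Z0 ` (W0 Int W')" by (auto simp: W_def) qed
  thus ?thesis by (simp add: Zi_def o_def) qed
 have hZ: "(W, Z) : holo_charts UNIV (charts X)"
 proof -
  have "holo_compat (W, Z) (W', Z')" if W': "(W', Z') : charts X" for W' Z'
  proof -
   have "hmap (Z ` (W Int W')) (Z' o iv W Z)"
   proof (rule hm_cong[OF _ _ trans1[OF W']])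
   show "open (Z ` (W Int W'))" by (rule cc_inter_image[OF ccZ charts_coord[OF W']])
   show "(Z' o Zi) v = (Z' o iv W Z) v" if "v : Z ` (W Int W')" for v using that ZV invZ by auto
   qed moreover have "hmap (Z' ` (W Int W')) (Z o iv W' Z')"
   proof -
   have "hmap (Z' ` (W' Int W0)) (Z0 o iv W' Z')" using charts_compat[OF W' W0(1)] unfolding holo_compat_def by blast
   hence "hmap (Z' ` (W Int W')) (Z0 o iv W' Z')" by (rule hm_subset) (auto simp: W_def)
   hence "hmap (Z' ` (W Int W')) (%v. H ((Z0 o iv W' Z') v))" by (rule hm_compose[OF hH]) (auto simp: W_def ccD(5)[OF charts_coord[OF W']])
   thus ?thesis by (simp add: Z_def o_def) qed
   ultimately show ?thesis unfolding holo_compat_def by simp qed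
  thus ?thesis unfolding holo_charts_def using ccZ by auto qed
 have pZ: "Z y $ Inr j = proj X y $ j" if "y : W" for y j using that C0(5) by (simp add: Z_def H_def p_def W_def)
 \<comment> \<open>Inserts the fixed parameter \<open>t\<close> in the second block, so that
   composing with \<open>Zi\<close> parametrizes the slice.\<close>
 define iota where "iota u = (\<chi> k. case k of Inl i => u $ i | Inr j => t $ j)" for u :: "(complex, 'n) vec"
 define z where "z y = (\<chi> i. Z y $ Inl i)" for y
 have hiota: "hmap T iota" for T unfolding holo_map_on_def
 proof
  show "holo_on T (%u. iota u $ k)" for k by (cases k) (simp_all add: iota_def ho_vec_nth ho_const)
 qed
 have ciota: "cont T iota" for T using so_imp_continuous_on[OF hm_imp_so[OF open_UNIV hiota]]
   continuous_on_subset by blast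
 let ?U = "fib X t Int W"
 have Ziota: "Z y = iota (z y)" if "y : ?U" for y
 proof -
  have "proj X y = t" "y : W" using that by (auto simp: fib_iff)
  hence "Z y $ k = iota (z y) $ k" for k by (cases k) (simp_all add: iota_def z_def pZ)
  thus ?thesis by (simp add: vec_eq_iff) qed
 have Ziiota: "Zi (iota u) : ?U & z (Zi (iota u)) = u" if "iota u : V" for u
 proof -
  have W: "Zi (iota u) : W" using that ZiV by blast
  have "proj X (Zi (iota u)) $ j = t $ j" for j using pZ[OF W, of j] ZZi[OF that] by (simp add: iota_def)
  hence "proj X (Zi (iota u)) = t" by (simp add: vec_eq_iff)
  moreover have "z (Zi (iota u)) = u" unfolding z_def ZZi[OF that] by (simp add: iota_def vec_eq_iff)
  ultimately show ?thesis using W by (simp add: fib_iff) qed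
 have zU: "z ` ?U = iota -` V"
 proof show "z ` ?U <= iota -` V" using Ziota ZV by auto (metis IntI image_eqI)
  show "iota -` V <= z ` ?U" using Ziiota by (metis image_eqI subsetI vimageE) qed
 have ZiZ': "Zi (iota (z y)) = y" if "y : ?U" for y using ZiZ[of y] Ziota[OF that] that by simp
 have oz: "open (z ` ?U)" unfolding zU by (rule open_vimage[OF G(4) ciota])
 have homz: "homeomorphism ?U (z ` ?U) z (Zi o iota)"
 proof (rule homeomorphismI) show "cont ?U z"
   unfolding z_def by (intro continuous_on_vec_lambda bounded_linear.continuous_on[OF bounded_linear_vec_nth] continuous_on_subset[OF cZ(1)]) auto
  show "cont (z ` ?U) (Zi o iota)" by (rule continuous_on_compose[OF ciota], rule continuous_on_subset[OF cZ(2)]) (auto simp: zU)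
  show "(Zi o iota) ` z ` ?U <= ?U" using ZiZ' by auto qed (use ZiZ' Ziiota in auto)
 have injz: "inj_on z ?U" by (metis ZiZ' inj_onI)
 have invz: "iv ?U z u = Zi (iota u)" if "u : z ` ?U" for u using that Ziiota injz zU by (metis inv_into_f_f vimageE)
 have ccz: "coord_chart (fib X t) (?U, z)"
 proof -
  have "homeomorphism ?U (z ` ?U) z (iv ?U z)" by (rule homeomorphism_cong[OF homz]) (use invz in auto)
  moreover have "openin (top_of_set (fib X t)) ?U" using oW by (simp add: openin_open_Int)
  ultimately show ?thesis unfolding coord_chart_def using oz by auto qed
 have 1: "hmap (z ` (?U Int W')) (Z' o iv ?U z)" if W': "(W', Z') : charts X" for W' Z'
  proof (rule hm_cong) show "open (z ` (?U Int W'))"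
   by (rule cc_open_image[OF ccz openin_Int_open[OF ccD(1)[OF ccz] charts_open[OF W']]]) auto
   show "hmap (z ` (?U Int W')) (%u. (Z' o Zi) (iota u))" by (rule hm_compose[OF trans1[OF W'] hiota]) (use Ziota[symmetric] in auto)
   show "(Z' o Zi) (iota u) = (Z' o iv ?U z) u" if "u : z ` (?U Int W')" for u using invz[of u] that by auto
  qed
 have 2: "EX (W, Z):holo_charts UNIV (charts X). y : W & (EX F. hmap (Z ` W) F & (ALL y:?U Int W. F (Z y) = z y))" if y: "y : ?U" for y
 proof -
  have "hmap (Z ` W) (%v. \<chi> i. v $ Inl i)" unfolding holo_map_on_def by (simp add: ho_vec_nth)
  hence "case (W, Z) of (W, Z) => y : W & (EX F. hmap (Z ` W) F & (ALL y:?U Int W. F (Z y) = z y))" using y by (auto simp: z_def)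
  thus ?thesis using hZ by blast qed
 have "(?U, z) : FC t" unfolding fibre_charts_def using ccz 1 2 by auto
 moreover have "x0 : ?U" using assms W0 G(3) by (simp add: W_def)
 ultimately show thesis using that by blast
qed

subsection \<open>The complex structures on the central fibre\<close>

lemma XCD:
 assumes "(U, z) : XC t" shows "U <= M0" "(fib X t Int sg X -` U, z o sg X) : FC t" using assms unfolding Xcharts_def by auto

lemma sg_hat:
 assumes "t : BX" "U <= M0" shows "sg X ` (fib X t Int sg X -` U) = U" "sgi t ` U = fib X t Int sg X -` U"
proof - show "sg X ` (fib X t Int sg X -` U) = U"
 proof show "U <= sg X ` (fib X t Int sg X -` U)"
  proof fix x assume "x : U"
   thus "x : sg X ` (fib X t Int sg X -` U)" using assms sgi_in[OF assms(1), of x] by (intro image_eqI[of _ _ "sgi t x"]) auto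
  qed qed auto show "sgi t ` U = fib X t Int sg X -` U"
 proof
  show "sgi t ` U <= fib X t Int sg X -` U" using sgi_in[OF assms(1)] assms(2) by auto
  show "fib X t Int sg X -` U <= sgi t ` U"
  proof fix y assume "y : fib X t Int sg X -` U"
   thus "y : sgi t ` U" using sgi_sg[of y t] by (intro image_eqI[of _ _ "sg X y"]) auto
  qed qed
qed

lemma XC_inv_hat:
 assumes "t : BX" "(U, z) : XC t" "u : z ` U" shows "iv (fib X t Int sg X -` U) (z o sg X) u = sgi t (iv U z u)"
proof -
 let ?U = "fib X t Int sg X -` U" note D = XCD[OF assms(2)]
 have inj: "inj_on (z o sg X) ?U" by (rule ccD(4)[OF FCD(1)[OF D(2)]])
 have x: "iv U z u : U" "z (iv U z u) = u" using assms(3) by (auto intro: inv_into_into f_inv_into_f)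
 have "sgi t (iv U z u) : ?U" "(z o sg X) (sgi t (iv U z u)) = u" using sgi_in[OF assms(1), of "iv U z u"] x D(1) by auto
 thus ?thesis using inv_into_f_f[OF inj] by metis
qed

lemma XC_coord:
 assumes "t : BX" "(U, z) : XC t" shows "coord_chart (M0) (U, z)"
proof -
 let ?U = "fib X t Int sg X -` U" note D = XCD[OF assms(2)]
 note C = ccD[OF FCD(1)[OF D(2)]]
 have im: "(z o sg X) ` ?U = z ` U" by (simp only: image_comp[symmetric] sg_hat(1)[OF assms(1) D(1)])
 have "openin (top_of_set (M0)) (sg X ` ?U)" by (rule homeomorphism_imp_open_map[OF sg_homeo[OF assms(1)] C(1)])
 hence o: "openin (top_of_set (M0)) U" using sg_hat(1)[OF assms(1) D(1)] by simp
 have h1: "homeomorphism U ?U (sgi t) (sg X)" by (rule homeomorphism_of_subsets[OF homeomorphism_symD[OF sg_homeo[OF assms(1)]] D(1)])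
   (use sg_hat(2)[OF assms(1) D(1)] in auto)
 have "homeomorphism U (z ` U) ((z o sg X) o sgi t) (sg X o iv ?U (z o sg X))" using homeomorphism_compose[OF h1 C(3)] im by simp
 hence "homeomorphism U (z ` U) z (iv U z)"
 proof (rule homeomorphism_cong)
  show "z x = ((z o sg X) o sgi t) x" if "x : U" for x using sgi_in[OF assms(1), of x] that D(1) by auto
  show "iv U z u = (sg X o iv ?U (z o sg X)) u" if "u : z ` U" for u using XC_inv_hat[OF assms that] sgi_in[OF assms(1), of "iv U z u"] D(1)
   inv_into_into[OF that] by auto qed simp_all
 moreover have "open (z ` U)" using C(2) im by simp
 ultimately show ?thesis unfolding coord_chart_def using o by auto
qed

lemma sg_hat_zero: "U <= M0 ==> M0 Int sg X -` U = U" using sg_fib0 by auto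

lemma XC_zero: "(U, z) : XC 0 \<longleftrightarrow> (U, z) : FC 0"
proof assume a: "(U, z) : XC 0" note D = XCD[OF a]
 have "(U, z o sg X) : FC 0" using D sg_hat_zero[OF D(1)] by simp
 thus "(U, z) : FC 0" by (rule FC_cong) (use sg_fib0 D(1) in auto)
next assume a: "(U, z) : FC 0"
 have U: "U <= M0" by (rule ccD(8)[OF FCD(1)[OF a]])
 have "(U, z o sg X) : FC 0" by (rule FC_cong[OF a]) (use sg_fib0 U in auto)
 thus "(U, z) : XC 0" unfolding Xcharts_def using U sg_hat_zero[OF U] by simp
qed

lemma XC_restrict:
 assumes "t : BX" "(U, z) : XC t" "openin (top_of_set (M0)) N" "N <= U" shows "(N, z) : XC t"
proof - note D = XCD[OF assms(2)]
 have N: "N <= M0" using assms(4) D(1) by blast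
 have "openin (top_of_set (fib X t)) (sgi t ` N)"
  by (rule homeomorphism_imp_open_map[OF homeomorphism_symD[OF sg_homeo[OF assms(1)]] assms(3)])
 hence o: "openin (top_of_set (fib X t)) (fib X t Int sg X -` N)" using sg_hat(2)[OF assms(1) N] by simp
 have "(fib X t Int sg X -` N, z o sg X) : FC t" by (rule FC_restrict[OF D(2) o]) (use assms(4) in auto)
 thus ?thesis unfolding Xcharts_def using N by simp
qed

lemma XC_exist:
 assumes "t : BX" "x : M0"
 obtains U z where "(U, z) : XC t" "x : U"
proof -
 obtain U1 z1 where 1: "(U1, z1) : FC t" "sgi t x : U1" by (rule FC_exist[OF sgi_in(1)[OF assms]])
 have U1: "U1 <= fib X t" by (rule ccD(8)[OF FCD(1)[OF 1(1)]])
 let ?U = "sg X ` U1" and ?z = "z1 o sgi t"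
 have hat: "fib X t Int sg X -` ?U = U1" using U1 sg_inj_fib by auto
 have "(U1, ?z o sg X) : FC t" by (rule FC_cong[OF 1(1)]) (use sgi_sg U1 in auto)
 hence "(?U, ?z) : XC t" unfolding Xcharts_def using hat sg_in by auto
 moreover have "x : ?U" using 1(2) sgi_in(2)[OF assms] by (metis imageI)
 ultimately show thesis using that by blast
qed

lemma XC_inter_image:
 assumes "t : BX" "t' : BX" "(U, z) : XC t" "(V, w) : XC t'" shows "open (z ` (U Int V))"
 by (rule cc_inter_image[OF XC_coord[OF assms(1,3)] XC_coord[OF assms(2,4)]])

lemma hat_inter_image:
 assumes "t : BX" "U <= M0" "V <= M0"
 shows "(z o sg X) ` ((fib X t Int sg X -` U) Int (fib X t Int sg X -` V)) = z ` (U Int V)"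
proof -
 have eq: "(fib X t Int sg X -` U) Int (fib X t Int sg X -` V) = fib X t Int sg X -` (U Int V)" by auto
 show ?thesis unfolding eq by (simp only: image_comp[symmetric] sg_hat(1)[OF assms(1) le_infI1[OF assms(2)]])
qed

lemma XC_trans_holo:
 assumes t: "t : BX" and U: "(U, z) : XC t" and V: "(V, w) : XC t" shows "hmap (z ` (U Int V)) (w o iv U z)"
proof - note DU = XCD[OF U] and DV = XCD[OF V]
 have "hmap (z ` (U Int V)) ((w o sg X) o iv (fib X t Int sg X -` U) (z o sg X))"
  using FC_trans[OF DU(2) DV(2)] unfolding hat_inter_image[OF t DU(1) DV(1)] .
 thus ?thesis
 proof (rule hm_cong[OF XC_inter_image[OF t t U V], rotated])
  fix u assume "u : z ` (U Int V)" hence u: "u : z ` U" by blast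
  hence "iv U z u : M0" using DU(1) inv_into_into[OF u] by blast
  thus "((w o sg X) o iv (fib X t Int sg X -` U) (z o sg X)) u = (w o iv U z) u" using XC_inv_hat[OF t U u] sgi_in(2)[OF t] by simp
 qed
qed

text \<open>The inverse chart of X_t is holomorphic into the total space, and from there
  \<open>sg X\<close> maps smoothly to X_0.\<close>

lemma XC_smooth_to_zero:
 assumes t: "t : BX" and U: "(U, z) : XC t" and V: "(V, w) : XC 0" shows "smo (z ` (U Int V)) (w o iv U z)"
proof (rule so_local[OF XC_inter_image[OF t base(2) U V]])
 fix u assume "u : z ` (U Int V)"
 then obtain x where x: "x : U" "x : V" "u = z x" by blast
 let ?U = "fib X t Int sg X -` U" note DU = XCD[OF U] and DV = XCD[OF V]
 note CU = FCD[OF DU(2)] and V0 = V[unfolded XC_zero]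
 have x0: "x : M0" using x(1) DU(1) by blast
 obtain W Z where W: "(W, Z) : charts X" "sgi t x : W" by (rule charts_cover)
 note CW = ccD[OF charts_coord[OF W(1)]]
 define A where "A = Z ` (W Int sg X -` V)"
 define N where "N = ?U Int (W Int sg X -` V)"
 have oV: "open (sg X -` V)"
 proof -
  have "openin (top_of_set (M0)) V" by (rule ccD(1)[OF XC_coord[OF base(2) V]])
  hence "openin (top_of_set UNIV) (UNIV Int sg X -` V)" by (rule continuous_openin_preimage[OF sg_cont, rotated]) auto
  thus ?thesis by simp qed
 have oW: "open (W Int sg X -` V)" using oV charts_open[OF W(1)] by blast
 have oA: "open A" unfolding A_def by (rule cc_open_image[OF charts_coord[OF W(1)]]) (use oW in auto)
 have oN: "open ((z o sg X) ` N)" unfolding N_def by (rule cc_open_image[OF CU(1) openin_Int_open[OF ccD(1)[OF CU(1)] oW]]) auto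
 have N1: "(z o sg X) ` N <= (z o sg X) ` (?U Int W)" unfolding N_def by auto
 have g: "smo ((z o sg X) ` N) (Z o iv ?U (z o sg X))" by (rule hm_imp_so[OF oN hm_subset[OF CU(2)[OF W(1)] N1]])
 have "smo ((z o sg X) ` N) (%u. (w o sg X o iv W Z) ((Z o iv ?U (z o sg X)) u))"
  by (rule so_compose[OF oN oA sg_smooth[OF W(1) V0, folded A_def] g]) (use ccD(5)[OF CU(1)] in \<open>auto simp: A_def N_def\<close>)
 moreover have "(w o sg X o iv W Z) ((Z o iv ?U (z o sg X)) u) = (w o iv U z) u" if u: "u : (z o sg X) ` N" for u
 proof -
  obtain y where y: "y : N" "u = (z o sg X) y" using u by blast
  hence "iv ?U (z o sg X) u = y" "y : W" "sg X y : U" using ccD(5)[OF CU(1)] by (auto simp: N_def)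
  moreover have "iv U z u = sg X y" using ccD(5)[OF XC_coord[OF t U]] \<open>sg X y : U\<close> y(2) by simp
  ultimately show ?thesis using CW(5) by simp qed
 ultimately have "smo ((z o sg X) ` N) (w o iv U z)" by (rule so_cong[OF oN, rotated])
 moreover have "u : (z o sg X) ` N" using x W(2) sgi_in[OF t x0] by (intro image_eqI[of _ _ "sgi t x"]) (auto simp: N_def)
 moreover have "(z o sg X) ` N <= z ` (U Int V)" by (auto simp: N_def)
 ultimately show "EX N. open N & u : N & N <= z ` (U Int V) & smo N (w o iv U z)" using oN by blast
qed

lemma sgi_chart_domain_open:
 assumes V: "(V, w) : XC 0" and W: "open W" shows "open {(u, t). u : w ` V & t : BX & sgi t (iv V w u) : W}"
proof - note C = ccD[OF XC_coord[OF base(2) V]]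
 have c1: "cont (w ` V \<times> BX) (%p. (iv V w (fst p), snd p))"
  by (intro continuous_on_Pair continuous_on_compose2[OF C(10)] continuous_on_fst continuous_on_snd continuous_on_id) auto
 have "cont (w ` V \<times> BX) (%p. (%(x, t). sgi t x) (iv V w (fst p), snd p))"
  by (rule continuous_on_compose2[OF sgi_cont c1]) (use C(6,8) in auto)
 hence "cont (w ` V \<times> BX) (%(u, t). sgi t (iv V w u))" by (simp add: split_beta)
 hence "open ((%(u, t). sgi t (iv V w u)) -` W Int (w ` V \<times> BX))"
  using continuous_on_open_vimage[OF open_Times[OF C(2) base(1)]] W by blast
 moreover have "(%(u, t). sgi t (iv V w u)) -` W Int (w ` V \<times> BX) =
   {(u, t). u : w ` V & t : BX & sgi t (iv V w u) : W}" by auto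
 ultimately show ?thesis by simp
qed

text \<open>The inverse trivialization at fixed \<open>t\<close> leads smoothly from X_0 to the
  total space, where the chart \<open>z\<close> has a holomorphic extension
  \<open>F\<close>.\<close>

lemma XC_smooth_from_zero:
 assumes t: "t : BX" and U: "(U, z) : XC t" and V: "(V, w) : XC 0" shows "smo (w ` (V Int U)) (z o iv V w)"
proof (rule so_local[OF XC_inter_image[OF base(2) t V U]])
 fix u assume "u : w ` (V Int U)"
 then obtain x where x: "x : U" "x : V" "u = w x" by blast
 let ?U = "fib X t Int sg X -` U" note DU = XCD[OF U] and V0 = V[unfolded XC_zero]
 note CV = ccD[OF XC_coord[OF base(2) V]]
 have x0: "x : M0" using x(1) DU(1) by blast
 have y: "sgi t x : ?U" using sgi_in[OF t x0] x(1) by auto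
 obtain W Z where W: "(W, Z) : charts X" "sgi t x : W" by (rule charts_cover)
 obtain O1 F where O1: "open O1" "Z (sgi t x) : O1" "O1 <= Z ` W" "hmap O1 F"
  "!!y. y : ?U ==> y : W ==> Z y : O1 ==> F (Z y) = (z o sg X) y" using fibre_chart_factor[OF DU(2) y W] by blast
 define D where "D = {(u, t). u : w ` V & t : BX & sgi t (iv V w u) : W}"
 define f where "f = (%(u, t). Z (sgi t (iv V w u)))"
 have oD: "open D" unfolding D_def by (rule sgi_chart_domain_open[OF V charts_open[OF W(1)]])
 have sf: "smo D f" unfolding D_def f_def by (rule sgi_smooth[OF W(1) V0])
 \<comment> \<open>The trivialization is jointly smooth in (u, t); composing with this affine
   inclusion fixes \<open>t\<close>.\<close>
 define j where "j u = (u, t)" for u :: "(complex, 'n) vec"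
 have sj: "smo S j" if "open S" for S
 proof -
  have "smo S (%u. (%u. (u, 0)) u + (0, t))" by (intro so_add so_const so_bounded_linear that bounded_linear_Pair
   bounded_linear_ident bounded_linear_zero)
  moreover have "j = (%u. (%u. (u, 0)) u + (0, t))" by (simp add: j_def fun_eq_iff)
  ultimately show ?thesis by simp qed
 define N where "N = w ` (V Int U) Int j -` (f -` O1 Int D)"
 have oN: "open N"
 proof -
  have "open (f -` O1 Int D)" using so_imp_continuous_on[OF sf] continuous_on_open_vimage[OF oD] O1(1) by blast
  moreover have "cont UNIV j" using so_imp_continuous_on[OF sj] by blast
  ultimately have "open (j -` (f -` O1 Int D))" by (rule open_vimage)
  thus ?thesis unfolding N_def using XC_inter_image[OF base(2) t V U] by blast qed
 have "smo N (%u. f (j u))" by (rule so_compose[OF oN oD sf sj[OF oN]]) (auto simp: N_def)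
 hence "smo N (%u. F (f (j u)))" by (rule so_compose[OF oN O1(1) hm_imp_so[OF O1(1,4)]]) (auto simp: N_def)
 moreover have "F (f (j u)) = (z o iv V w) u" if u: "u : N" for u
 proof -
  obtain y where y: "y : V" "y : U" "u = w y" using u by (auto simp: N_def)
  have y': "iv V w u = y" using CV(5) y by simp
  have y0: "y : M0" using y(2) DU(1) by blast
  have "sgi t y : W" "Z (sgi t y) : O1" using u y' by (auto simp: N_def D_def f_def j_def)
  moreover have "sgi t y : ?U" using sgi_in[OF t y0] y(2) by auto
  ultimately have "F (Z (sgi t y)) = z y" using O1(5) sgi_in(2)[OF t y0] by simp
  thus ?thesis using y' by (simp add: f_def j_def) qed
 ultimately have "smo N (z o iv V w)" by (rule so_cong[OF oN, rotated])
 moreover have "u : N"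
 proof -
  have "iv V w u = x" using CV(5) x by simp
  thus ?thesis using x O1(2) W(2) t by (auto simp: N_def D_def f_def j_def) qed
 moreover have "N <= w ` (V Int U)" by (auto simp: N_def)
 ultimately show "EX N. open N & u : N & N <= w ` (V Int U) & smo N (z o iv V w)" using oN by blast
qed

lemma XC_trans_smooth:
 assumes t: "t : BX" and t': "t' : BX" and U: "(U, z) : XC t" and V: "(V, w) : XC t'"
 shows "smo (z ` (U Int V)) (w o iv U z)"
proof (rule so_local[OF XC_inter_image[OF t t' U V]]) fix u assume "u : z ` (U Int V)"
 then obtain x where x: "x : U" "x : V" "u = z x" by blast
 have x0: "x : M0" using x(1) XCD(1)[OF U] by blast
 obtain T y where T: "(T, y) : XC 0" "x : T" by (rule XC_exist[OF base(2) x0])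
 note CU = XC_coord[OF t U] and CV = XC_coord[OF t' V] and CT = XC_coord[OF base(2) T(1)]
 let ?N = "U Int (V Int T)"
 have oN: "openin (top_of_set (M0)) ?N" by (intro openin_Int ccD(1)[OF CU] ccD(1)[OF CV] ccD(1)[OF CT])
 have ozN: "open (z ` ?N)" by (rule cc_open_image[OF CU oN]) auto
 have oyN: "open (y ` ?N)" by (rule cc_open_image[OF CT oN]) auto
 have s1: "smo (z ` ?N) (y o iv U z)" by (rule so_subset[OF XC_smooth_to_zero[OF t U T(1)] XC_inter_image[OF t base(2) U T(1)] ozN]) auto
 have s2: "smo (y ` ?N) (w o iv T y)"
  by (rule so_subset[OF XC_smooth_from_zero[OF t' V T(1)] XC_inter_image[OF base(2) t' T(1) V] oyN]) auto
 have "smo (z ` ?N) (%u. (w o iv T y) ((y o iv U z) u))" by (rule so_compose[OF ozN oyN s2 s1]) (use ccD(5)[OF CU] in auto)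
 hence "smo (z ` ?N) (w o iv U z)" by (rule so_cong[OF ozN, rotated]) (use ccD(5)[OF CU] ccD(5)[OF CT] in auto)
 thus "EX N. open N & u : N & N <= z ` (U Int V) & smo N (w o iv U z)" using ozN x T(2) by (intro exI[of _ "z ` ?N"]) auto
qed

end

section \<open>Smooth functions and tangent vectors of the central fibre\<close>

context pair_family
begin

abbreviation nbhd :: "'x set => bool" where
 "nbhd N \<equiv> openin (top_of_set (M0)) N"

lemma XC_open: "t : BX ==> c : XC t ==> nbhd (fst c)" using ccD(1)[OF XC_coord, of t "fst c" "snd c"] by simp

lemma XC_at:
 assumes "t : BX" "x : M0"
 obtains c where "c : XC t" "x : fst c" using XC_exist[OF assms] by (metis fst_conv)

lemma XC_fib0: "c : XC t ==> x : fst c ==> x : M0" using XCD(1)[of "fst c" "snd c" t] by auto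

text \<open>\<open>smooth_at\<close> is defined by charts of X_0, but transitions between charts of
  different structures are smooth, so smoothness can be tested in a chart of any X_t.\<close>

lemma smat_iff:
 assumes t: "t : BX" and U: "(U, z) : XC t" and x: "x : U"
 shows "smat x f \<longleftrightarrow> (EX N. nbhd N & x : N & N <= U & smo (z ` N) (f o iv U z))"
proof note CU = XC_coord[OF t U] assume "smat x f"
 then obtain V w where V: "(V, w) : XC 0" "x : V" "smo (w ` V) (f o iv V w)" unfolding smooth_at_def by blast
 note CV = XC_coord[OF base(2) V(1)]
 have "smo (z ` (U Int V)) (%u. (f o iv V w) ((w o iv U z) u))"
  by (rule so_compose[OF XC_inter_image[OF t base(2) U V(1)] ccD(2)[OF CV] V(3)
   XC_trans_smooth[OF t base(2) U V(1)]]) (use ccD(5)[OF CU] in auto)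
 hence "smo (z ` (U Int V)) (f o iv U z)" by (rule so_cong[OF XC_inter_image[OF t base(2) U V(1)], rotated])
   (use ccD(5)[OF CU] ccD(5)[OF CV] in auto)
 thus "EX N. nbhd N & x : N & N <= U & smo (z ` N) (f o iv U z)" using x V(2) openin_Int[OF ccD(1)[OF CU] ccD(1)[OF CV]] by blast
next note CU = XC_coord[OF t U]
 assume "EX N. nbhd N & x : N & N <= U & smo (z ` N) (f o iv U z)"
 then obtain N where N: "nbhd N" "x : N" "N <= U" "smo (z ` N) (f o iv U z)" by blast
 have x0: "x : M0" using x XCD(1)[OF U] by blast
 obtain V w where V: "(V, w) : XC 0" "x : V" by (rule XC_exist[OF base(2) x0])
 note CV = XC_coord[OF base(2) V(1)]
 let ?N = "V Int N"
 have oN: "nbhd ?N" using N(1) ccD(1)[OF CV] by blast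
 have N': "(?N, w) : XC 0" by (rule XC_restrict[OF base(2) V(1) oN]) auto
 have o: "open (w ` ?N)" "open (z ` N)" by (rule cc_open_image[OF CV oN], blast, rule cc_open_image[OF CU N(1,3)])
 have s: "smo (w ` ?N) (z o iv V w)" by (rule so_subset[OF XC_trans_smooth[OF base(2) t V(1) U] XC_inter_image[OF base(2) t V(1) U] o(1)])
   (use N(3) in auto)
 have "smo (w ` ?N) (%u. (f o iv U z) ((z o iv V w) u))" by (rule so_compose[OF o N(4) s]) (use ccD(5)[OF CV] in auto)
 hence "smo (w ` ?N) (f o iv ?N w)"
 proof (rule so_cong[OF o(1), rotated]) fix u assume u: "u : w ` ?N"
  then obtain y where "y : V" "y : N" "u = w y" by blast
  thus "(f o iv U z) ((z o iv V w) u) = (f o iv ?N w) u"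
   using inv_into_restrict[OF ccD(4)[OF CV] _ u] ccD(5)[OF CV] ccD(5)[OF CU] N(3) by auto
 qed thus "smat x f" unfolding smooth_at_def using N' V(2) N(2) by blast
qed

lemma smat_fib0: "smat x f ==> x : M0" unfolding smooth_at_def using XCD(1) by fastforce

lemma smat_nbhd:
 assumes "smat x f"
 obtains N where "nbhd N" "x : N" "!!y. y : N ==> smat y f"
proof -
 obtain V w where V: "(V, w) : XC 0" "x : V" "smo (w ` V) (f o iv V w)" using assms unfolding smooth_at_def by blast
 have "smat y f" if "y : V" for y unfolding smooth_at_def using V that by blast
 thus thesis using that V(2) ccD(1)[OF XC_coord[OF base(2) V(1)]] by blast
qed

lemma smat_common:
 assumes t: "t : BX" and U: "(U, z) : XC t" and x: "x : U" and f: "smat x f" and g: "smat x g"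
 obtains N where "nbhd N" "x : N" "N <= U" "open (z ` N)"
  "smo (z ` N) (f o iv U z)" "smo (z ` N) (g o iv U z)"
proof - note CU = XC_coord[OF t U]
 obtain N1 where N1: "nbhd N1" "x : N1" "N1 <= U" "smo (z ` N1) (f o iv U z)" using f unfolding smat_iff[OF t U x] by blast
 obtain N2 where N2: "nbhd N2" "x : N2" "N2 <= U" "smo (z ` N2) (g o iv U z)" using g unfolding smat_iff[OF t U x] by blast
 have N: "nbhd (N1 Int N2)" using N1(1) N2(1) by blast
 have sub: "N1 Int N2 <= U" using N1(3) by blast note o = cc_open_image[OF CU] show thesis
 proof (rule that[OF N _ sub o[OF N sub]])
  show "smo (z ` (N1 Int N2)) (f o iv U z)" by (rule so_subset[OF N1(4) o[OF N1(1,3)] o[OF N sub]]) auto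
  show "smo (z ` (N1 Int N2)) (g o iv U z)" by (rule so_subset[OF N2(4) o[OF N2(1,3)] o[OF N sub]]) auto
 qed (use N1 N2 in auto)
qed

lemma smat_cong:
 assumes "nbhd N" "x : N" "!!y. y : N ==> f y = g y" "smat x f" shows "smat x g"
proof -
 have x0: "x : M0" by (rule smat_fib0[OF assms(4)])
 obtain U z where U: "(U, z) : XC 0" "x : U" by (rule XC_exist[OF base(2) x0])
 note CU = XC_coord[OF base(2) U(1)]
 obtain N1 where N1: "nbhd N1" "x : N1" "N1 <= U" "smo (z ` N1) (f o iv U z)" using assms(4) unfolding smat_iff[OF base(2) U] by blast
 have N: "nbhd (N1 Int N)" "N1 Int N <= U" using N1 assms(1) by blast+
 note o = cc_open_image[OF CU]
 have "smo (z ` (N1 Int N)) (f o iv U z)" by (rule so_subset[OF N1(4) o[OF N1(1,3)] o[OF N]]) auto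
 hence "smo (z ` (N1 Int N)) (g o iv U z)" by (rule so_cong[OF o[OF N], rotated]) (use ccD(5)[OF CU] N1(3) assms(3) in auto)
 thus ?thesis unfolding smat_iff[OF base(2) U] using N N1(2) assms(2) by blast
qed

lemma smat_const: "x : M0 ==> smat x (%y. c)"
proof - assume "x : M0"
 then obtain U z where "(U, z) : XC 0" "x : U" using XC_exist[OF base(2)] by metis
 thus ?thesis unfolding smooth_at_def by (intro bexI[of _ "(U, z)"]) (simp_all add: o_def so_const)
qed

lemma smat_combine:
 assumes "smat x f" "smat x g"
  "!!S (F :: (complex, 'n) vec => complex) G. open S ==> smo S F ==> smo S G ==> smo S (%u. h (F u) (G u))"
 shows "smat x (%y. h (f y) (g y))"
proof -
 obtain U z where U: "(U, z) : XC 0" "x : U" by (rule XC_exist[OF base(2) smat_fib0[OF assms(1)]])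
 obtain N where N: "nbhd N" "x : N" "N <= U" "open (z ` N)"
  "smo (z ` N) (f o iv U z)" "smo (z ` N) (g o iv U z)" by (rule smat_common[OF base(2) U assms(1,2)])
 have "smo (z ` N) ((%y. h (f y) (g y)) o iv U z)" using assms(3)[OF N(4-6)] by (simp add: o_def)
 thus ?thesis unfolding smat_iff[OF base(2) U] using N by blast
qed

lemma smat_add: "smat x f ==> smat x g ==> smat x (%y. f y + g y)" using smat_combine[of x f g "(+)"] so_add by blast

lemma smat_mult: "smat x f ==> smat x g ==> smat x (%y. f y * g y)" using smat_combine[of x f g "(*)"] so_mult by blast

lemma smat_scale: "smat x f ==> smat x (%y. c * f y)" by (intro smat_mult smat_const) (auto intro: smat_fib0)

lemma smat_cnj: "smat x f ==> smat x (%y. cnj (f y))"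
 using smat_combine[of x f f "%a b. cnj a"] so_bounded_linear_compose[OF bounded_linear_cnj] by blast

lemma smat_minus: "smat x f ==> smat x (%y. - f y)" using smat_scale[of x f "-1"] by simp

lemma smat_sum:
 "x : M0 ==> (!!i. i : I ==> smat x (f i)) ==> smat x (%y. SUM i:I. f i y)"
 by (induction I rule: infinite_finite_induct) (auto intro: smat_const smat_add)

lemma smat_prod:
 "x : M0 ==> (!!i. i : I ==> smat x (f i)) ==> smat x (%y. \<Prod>i\<in>I. f i y)"
 by (induction I rule: infinite_finite_induct) (auto intro: smat_const smat_mult)

lemma smat_inverse:
 assumes "smat x f" "f x ~= 0" shows "smat x (%y. inverse (f y))"
proof -
 obtain U z where U: "(U, z) : XC 0" "x : U" by (rule XC_exist[OF base(2) smat_fib0[OF assms(1)]])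
 note CU = XC_coord[OF base(2) U(1)]
 obtain N where N: "nbhd N" "x : N" "N <= U" "open (z ` N)" "smo (z ` N) (f o iv U z)" by (rule smat_common[OF base(2) U assms(1,1)])
 let ?S = "(f o iv U z) -` (- {0}) Int z ` N"
 have oS: "open ?S" using continuous_on_open_vimage[OF N(4), of "f o iv U z"] so_imp_continuous_on[OF N(5)] by blast
 have "nbhd (U Int z -` ?S)" by (rule cc_vimage[OF CU oS])
 moreover have im: "z ` (U Int z -` ?S) = ?S" using N(3) by auto
 moreover have "smo ?S ((%y. inverse (f y)) o iv U z)" using so_inverse[OF oS so_subset[OF N(5,4) oS]] by (simp add: o_def)
 moreover have "x : U Int z -` ?S" using N(2) U(2) assms(2) ccD(5)[OF CU U(2)] by auto
 ultimately show ?thesis unfolding smat_iff[OF base(2) U] by (metis inf_le1)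
qed

lemma smat_det:
 fixes A :: "'x => complex^'k::finite^'k"
 assumes "x : M0" "!!i j. smat x (%y. A y $ i $ j)" shows "smat x (%y. det (A y))" unfolding det_def using assms
 by (intro smat_sum smat_mult smat_const smat_prod)

lemma smat_matrix_inv:
 fixes A :: "'x => complex^'k::finite^'k"
 assumes "nbhd N" "x : N" "!!y. y : N ==> invertible (A y)" "!!i j. smat x (%y. A y $ i $ j)"
 shows "smat x (%y. minv (A y) $ i $ j)"
proof -
 have x0: "x : M0" using assms(4) smat_fib0 by blast
 have "smat x (%y. (\<chi> p l. if l = i then (if p = j then 1 else 0) else A y $ p $ l) $ p $ l)" for p l
  using assms(4)[of p l] smat_const[OF x0] by (cases "l = i"; cases "p = j") simp_all
 moreover have "det (A x) ~= 0" using assms(2,3) by (simp add: invertible_det_nz)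
 ultimately have "smat x (%y. det (\<chi> p l. if l = i then (if p = j then 1 else 0) else A y $ p $ l) * inverse (det (A y)))"
  by (intro smat_mult smat_det smat_inverse x0 assms(4)) simp_all
 thus ?thesis by (rule smat_cong[OF assms(1,2), rotated]) (simp add: matrix_inv_eq_cramer assms(3))
qed

subsection \<open>Directional derivatives\<close>

lemma dd_cong:
 assumes "t : BX" "c : XC t" "x : fst c" "nbhd N" "x : N" "!!y. y : N ==> f y = g y"
 shows "ddr c x a f = ddr c x a g"
proof -
 obtain U z where c: "c = (U, z)" by (cases c)
 note CU = XC_coord[OF assms(1) assms(2)[unfolded c]]
 have o: "open (z ` (U Int N))" by (rule cc_open_image[OF CU openin_Int[OF ccD(1)[OF CU] assms(4)]]) auto
 have "fder (f o iv U z) (z x) = fder (g o iv U z) (z x)" by (rule fder_cong_open[OF o]) (use assms(3,5,6) c ccD(5)[OF CU] in auto)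
 thus ?thesis by (simp add: dir_deriv_def c)
qed

lemma dd_has_derivative:
 assumes "t : BX" "(U, z) : XC t" "x : U" "smat x f"
 shows "((f o iv U z) has_derivative (%a. ddr (U, z) x a f)) (at (z x))"
proof -
 obtain N where N: "nbhd N" "x : N" "N <= U" "open (z ` N)" "smo (z ` N) (f o iv U z)" by (rule smat_common[OF assms(1-4,4)])
 thus ?thesis using so_has_derivative[OF N(5,4), of "z x"] by (simp add: dir_deriv_def)
qed

lemma dd_eq:
 assumes "((f o iv U z) has_derivative D) (at (z x))" shows "ddr (U, z) x a f = D a" using fderI[OF assms] by (simp add: dir_deriv_def)

lemma dd_add_dir:
 assumes "t : BX" "c : XC t" "x : fst c" "smat x f" shows "ddr c x (a + b) f = ddr c x a f + ddr c x b f"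
  "ddr c x (r *R a) f = of_real r * ddr c x a f"
proof -
 obtain U z where c: "c = (U, z)" by (cases c)
 have lin: "linear (%a. ddr (U, z) x a f)"
  using dd_has_derivative[OF assms(1) assms(2)[unfolded c] _ assms(4)] assms(3) c has_derivative_linear by fastforce
 show "ddr c x (a + b) f = ddr c x a f + ddr c x b f" unfolding c by (rule linear_add[OF lin])
 have "ddr c x (r *R a) f = r *R ddr c x a f" unfolding c by (rule linear_cmul[OF lin])
 thus "ddr c x (r *R a) f = of_real r * ddr c x a f" by (simp only: scaleR_conv_of_real[of r "ddr c x a f"])
qed

lemma dd_add:
 assumes "t : BX" "c : XC t" "x : fst c" "smat x f" "smat x g"
 shows "ddr c x a (%y. f y + g y) = ddr c x a f + ddr c x a g"
  "ddr c x a (%y. f y * g y) = ddr c x a f * g x + f x * ddr c x a g"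
  "ddr c x a (%y. cnj (f y)) = cnj (ddr c x a f)"
proof -
 obtain U z where c: "c = (U, z)" by (cases c)
 note f = dd_has_derivative[OF assms(1) assms(2)[unfolded c] _ assms(4)]
  and g = dd_has_derivative[OF assms(1) assms(2)[unfolded c] _ assms(5)]
 have x: "x : U" "iv U z (z x) = x" using assms(3) c ccD(5)[OF XC_coord[OF assms(1) assms(2)[unfolded c]]] by auto
 show "ddr c x a (%y. f y + g y) = ddr c x a f + ddr c x a g"
  unfolding c by (rule dd_eq) (use has_derivative_add[OF f g] x in \<open>simp add: o_def\<close>)
 have "ddr (U, z) x a (%y. f y * g y) = (f o iv U z) (z x) * ddr (U, z) x a g
   + ddr (U, z) x a f * (g o iv U z) (z x)" by (rule dd_eq) (use has_derivative_mult[OF f g] x in \<open>simp add: o_def\<close>)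
 thus "ddr c x a (%y. f y * g y) = ddr c x a f * g x + f x * ddr c x a g" unfolding c using x by simp
 show "ddr c x a (%y. cnj (f y)) = cnj (ddr c x a f)"
  unfolding c by (rule dd_eq) (use bounded_linear.has_derivative[OF bounded_linear_cnj f] x in \<open>simp add: o_def\<close>)
qed

lemma dd_const: "ddr c x a (%y. k) = 0" by (cases c) (simp add: dir_deriv_def o_def)

lemma dd_smooth:
 assumes "t : BX" "c : XC t" "x : fst c" "smat x f" shows "smat x (%y. ddr c y a f)"
proof -
 obtain U z where c: "c = (U, z)" by (cases c)
 have x: "x : U" and U: "(U, z) : XC t" using assms c by auto
 note CU = XC_coord[OF assms(1) U]
 obtain N where N: "nbhd N" "x : N" "N <= U" "open (z ` N)" "smo (z ` N) (f o iv U z)" by (rule smat_common[OF assms(1) U x assms(4,4)])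
 have "smo (z ` N) ((%y. ddr c y a f) o iv U z)" by (rule so_cong[OF N(4) _ so_fder[OF N(5), of a]])
   (use ccD(5)[OF CU] N(3) in \<open>auto simp: c dir_deriv_def\<close>)
 thus ?thesis unfolding smat_iff[OF assms(1) U x] using N by blast
qed

lemma dd_commute:
 assumes "t : BX" "c : XC t" "x : fst c" "smat x f"
 shows "ddr c x a (%y. ddr c y b f) = ddr c x b (%y. ddr c y a f)"
proof -
 obtain U z where c: "c = (U, z)" by (cases c)
 have x: "x : U" and U: "(U, z) : XC t" using assms c by auto
 note CU = XC_coord[OF assms(1) U]
 obtain N where N: "nbhd N" "x : N" "N <= U" "open (z ` N)" "smo (z ` N) (f o iv U z)" by (rule smat_common[OF assms(1) U x assms(4,4)])
 have zx: "z x : z ` N" using N(2) by blast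
 have eq: "ddr c x a (%y. ddr c y b f) =
   fder (%u. fder (f o iv U z) u b) (z x) a" for a b
 proof -
  have "fder ((%y. ddr c y b f) o iv U z) (z x) =
   fder (%u. fder (f o iv U z) u b) (z x)" by (rule fder_cong_open[OF N(4) zx])
   (use ccD(5)[OF CU] N(3) in \<open>auto simp: c dir_deriv_def\<close>)
  thus ?thesis by (simp add: dir_deriv_def[of _ x a] c) qed
 show ?thesis unfolding eq by (rule deriv2_symmetric[OF N(5,4) zx])
qed

lemma dd_chain:
 assumes "t : BX" "(U, z) : XC t" "t' : BX" "(V, w) : XC t'" "x : U" "x : V" "smat x f"
 shows "ddr (U, z) x a f = ddr (V, w) x (fder (w o iv U z) (z x) a) f"
proof - note CU = XC_coord[OF assms(1,2)] and CV = XC_coord[OF assms(3,4)]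
 note o = XC_inter_image[OF assms(1,3,2,4)]
 have zx: "z x : z ` (U Int V)" using assms(5,6) by blast
 have J: "((w o iv U z) has_derivative fder (w o iv U z) (z x)) (at (z x))"
  by (rule so_has_derivative[OF XC_trans_smooth[OF assms(1,3,2,4)] o zx])
 have wx: "(w o iv U z) (z x) = w x" using ccD(5)[OF CU assms(5)] by simp
 have "((f o iv V w) o (w o iv U z) has_derivative (%a. ddr (V, w) x a f) o fder (w o iv U z) (z x)) (at (z x))"
  by (rule diff_chain_at[OF J]) (use dd_has_derivative[OF assms(3,4,6,7)] wx in simp)
 hence "((f o iv U z) has_derivative (%a. ddr (V, w) x a f) o fder (w o iv U z) (z x)) (at (z x))"
  by (rule has_derivative_transform_within_open[OF _ o zx]) (use ccD(5)[OF CU] ccD(5)[OF CV] in auto)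
 thus ?thesis using dd_eq by fastforce
qed

subsection \<open>Complexified tangent vectors\<close>

text \<open>A complexified tangent vector as a + i b with two real directions a and b. Real
  directions transform by the ordinary chain rule under all changes of charts, also between
  different complex structures.\<close>

definition rv :: "('x, 'n) chart => 'x => (complex, 'n) vec => (complex, 'n) vec => 'x tvec" where
 "rv c x a b = (%f. if smat x f then ddr c x a f + \<i> * ddr c x b f else 0)"

lemma dd_basis:
 assumes "t : BX" "c : XC t" "x : fst c" "smat x f"
 shows "ddr c x a f = (SUM i:UNIV. a $ i * dzv c i x f + cnj (a $ i) * dzbv c i x f)"
proof -
 obtain U z where c: "c = (U, z)" by (cases c)
 have lin: "linear (%a. ddr c x a f)" by (intro linearI) (simp_all only: dd_add_dir[OF assms] scaleR_conv_of_real[of _ "ddr c x _ f"])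
 have ax: "axis i (a $ i) = Re (a $ i) *R axis i 1 + Im (a $ i) *R (axis i \<i> :: (complex, 'n) vec)" for i
  by (simp add: vec_eq_iff axis_def complex_eq_iff)
 have "a = (SUM i:UNIV. axis i (a $ i))" using vec_lambda_eq_sum_axis[of "%i. a $ i"] by simp
 hence "ddr c x a f = (SUM i:UNIV. ddr c x (axis i (a $ i)) f)" using linear_sum[OF lin, of "%i. axis i (a $ i)" UNIV] by simp
 also have "... = (SUM i:UNIV. a $ i * dzv c i x f + cnj (a $ i) * dzbv c i x f)"
 proof (rule sum.cong[OF refl]) fix i
  have a: "a $ i = of_real (Re (a $ i)) + \<i> * of_real (Im (a $ i))"
   "cnj (a $ i) = of_real (Re (a $ i)) - \<i> * of_real (Im (a $ i))" by (simp_all add: complex_eq_iff)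
  have "ddr c x (axis i (a $ i)) f =
   of_real (Re (a $ i)) * ddr c x (axis i 1) f + of_real (Im (a $ i)) * ddr c x (axis i \<i>) f"
   unfolding ax by (simp only: dd_add_dir[OF assms])
  also have "... = (of_real (Re (a $ i)) + \<i> * of_real (Im (a $ i))) * dzv c i x f
   + (of_real (Re (a $ i)) - \<i> * of_real (Im (a $ i))) * dzbv c i x f" using assms(4) by (simp add: dz_vec_def dzb_vec_def field_simps)
  finally show "ddr c x (axis i (a $ i)) f = a $ i * dzv c i x f + cnj (a $ i) * dzbv c i x f" using a by simp
 qed finally show ?thesis .
qed

lemma rv_basis:
 assumes "t : BX" "c : XC t" "x : fst c"
 shows "rv c x a b f = (SUM i:UNIV. (a $ i + \<i> * b $ i) * dzv c i x f + (cnj (a $ i) + \<i> * cnj (b $ i)) * dzbv c i x f)"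
proof (cases "smat x f")
 case True
 thus ?thesis by (simp add: rv_def dd_basis[OF assms] sum_distrib_left sum.distrib[symmetric] algebra_simps)
qed (simp add: rv_def dz_vec_def dzb_vec_def)

text \<open>The two directions solve a + i b = \<open>aa\<close> and a - i b =
  \<open>cnj bb\<close>, componentwise.\<close>

lemma basis_rv:
 assumes "t : BX" "c : XC t" "x : fst c" shows "(%f. SUM i:UNIV. aa i * dzv c i x f + bb i * dzbv c i x f) =
  rv c x (\<chi> i. (aa i + cnj (bb i)) / 2) (\<chi> i. - \<i> * (aa i - cnj (bb i)) / 2)"
proof fix f
 have "(aa i + cnj (bb i)) / 2 + \<i> * (- \<i> * (aa i - cnj (bb i)) / 2) = aa i"
  "cnj ((aa i + cnj (bb i)) / 2) + \<i> * cnj (- \<i> * (aa i - cnj (bb i)) / 2) = bb i" for i by (simp_all add: complex_eq_iff field_simps)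
 thus "(SUM i:UNIV. aa i * dzv c i x f + bb i * dzbv c i x f) =
  rv c x (\<chi> i. (aa i + cnj (bb i)) / 2) (\<chi> i. - \<i> * (aa i - cnj (bb i)) / 2) f"
  unfolding rv_basis[OF assms] by (simp only: vec_lambda_beta)
qed

lemma rv_chain:
 assumes "t : BX" "c : XC t" "t' : BX" "d : XC t'" "x : fst c" "x : fst d"
 obtains a' b' where "rv c x a b = rv d x a' b'"
proof -
 obtain U z V w where cd: "c = (U, z)" "d = (V, w)" by (cases c, cases d)
 let ?J = "fder (w o iv U z) (z x)"
 have "rv c x a b = rv d x (?J a) (?J b)"
  unfolding rv_def cd using dd_chain[OF assms(1) assms(2)[unfolded cd] assms(3) assms(4)[unfolded cd]] assms(5,6) cd
  by (simp add: fun_eq_iff) thus thesis by (rule that)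
qed

text \<open>\<open>tangent\<close> is defined through charts of X_0. Since pairs of real directions
  transform by the chain rule, the charts of any X_t describe the same space.\<close>

lemma T_iff_rv:
 assumes "t : BX" "c : XC t" "x : fst c" shows "v : TX x \<longleftrightarrow> (EX a b. v = rv c x a b)"
proof assume "v : TX x" then obtain d aa bb where d: "d : XC 0" "x : fst d"
  "v = (%f. SUM i:UNIV. aa i * dzv d i x f + bb i * dzbv d i x f)" unfolding tangent_def by blast
 hence "EX a b. v = rv d x a b" using basis_rv[OF base(2) d(1,2)] by blast
 thus "EX a b. v = rv c x a b" using rv_chain[OF base(2) d(1) assms(1,2) d(2) assms(3)] by metis
next assume "EX a b. v = rv c x a b" then obtain a b where v: "v = rv c x a b" by blast
 obtain d where d: "d : XC 0" "x : fst d" by (rule XC_at[OF base(2) XC_fib0[OF assms(2,3)]])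
 obtain a' b' where "v = rv d x a' b'" using rv_chain[OF assms(1,2) base(2) d(1) assms(3) d(2)] v by metis
 hence "v = (%f. SUM i:UNIV. (a' $ i + \<i> * b' $ i) * dzv d i x f + (cnj (a' $ i) + \<i> * cnj (b' $ i)) * dzbv d i x f)"
  using rv_basis[OF base(2) d] by (simp add: fun_eq_iff)
 thus "v : TX x" unfolding tangent_def
  using d by (intro CollectI bexI[of _ d] conjI exI[of _ "%i. a' $ i + \<i> * b' $ i"] exI[of _ "%i. cnj (a' $ i) + \<i> * cnj (b' $ i)"])
qed

lemma T_basis:
 assumes "t : BX" "c : XC t" "x : fst c" shows "(%f. SUM i:UNIV. aa i * dzv c i x f + bb i * dzbv c i x f) : TX x"
 unfolding T_iff_rv[OF assms] basis_rv[OF assms] by blast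

lemma TD:
 assumes "v : TX x" shows "x : M0"
  "~ smat x f ==> v f = 0"
  "smat x f ==> smat x g ==> v (%y. f y + g y) = v f + v g"
  "smat x f ==> smat x g ==> v (%y. f y * g y) = v f * g x + f x * v g"
  "v (%y. k) = 0"
  "nbhd N ==> x : N ==> (!!y. y : N ==> f y = g y) ==> v f = v g"
proof -
 obtain c where c: "c : XC 0" "x : fst c" using assms unfolding tangent_def by blast
 show x0: "x : M0" by (rule XC_fib0[OF c])
 obtain a b where v: "v = rv c x a b" using assms unfolding T_iff_rv[OF base(2) c] by blast
 show "~ smat x f ==> v f = 0" by (simp add: v rv_def)
 show "smat x f ==> smat x g ==> v (%y. f y + g y) = v f + v g" by (simp add: v rv_def smat_add dd_add[OF base(2) c] algebra_simps)
 show "smat x f ==> smat x g ==> v (%y. f y * g y) = v f * g x + f x * v g"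
  by (simp add: v rv_def smat_mult dd_add[OF base(2) c] algebra_simps)
 show "v (%y. k) = 0" by (simp add: v rv_def dd_const)
 show "v f = v g" if N: "nbhd N" "x : N" "!!y. y : N ==> f y = g y"
 proof -
  have "smat x f \<longleftrightarrow> smat x g" using smat_cong[OF N] smat_cong[OF N(1,2), of g f] N(3) by auto
  thus ?thesis using dd_cong[OF base(2) c N] by (simp add: v rv_def) qed
qed

text \<open>The function may fail to be smooth: a nonzero multiple is then not smooth either, and
  tangent vectors are 0 on both.\<close>

lemma T_scale: "v : TX x ==> v (%y. k * f y) = k * v f"
proof (cases "smat x f")
 case True assume v: "v : TX x"
 show ?thesis using TD(4)[OF v smat_const[OF TD(1)[OF v]] True] TD(5)[OF v] by simp
next
 case False assume v: "v : TX x" show ?thesis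
 proof (cases "k = 0")
  case True thus ?thesis using TD(5)[OF v, of 0] by simp next
  case k: False
  have "~ smat x (%y. k * f y)" using smat_scale[of x "%y. k * f y" "1 / k"] False k by auto
  thus ?thesis using TD(2)[OF v] False by simp qed
qed

lemma T_sum:
 assumes "v : TX x" "!!i. i : I ==> smat x (f i)" shows "v (%y. SUM i:I. f i y) = (SUM i:I. v (f i))" using assms(2)
proof (induction I rule: infinite_finite_induct)
 case (insert i I)
 have "smat x (%y. SUM i:I. f i y)" by (rule smat_sum[OF TD(1)[OF assms(1)]]) (use insert in auto)
 thus ?case using insert TD(3)[OF assms(1), of "f i"] by simp
qed (use TD(5)[OF assms(1), of 0] in simp_all)

lemma T_diff:
 assumes "v : TX x" "smat x f" "smat x g" shows "v (%y. f y - g y) = v f - v g"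
 using TD(3)[OF assms(1,2) smat_minus[OF assms(3)]] T_scale[OF assms(1), of "-1" g] by simp

lemma TX_cspace: "x : M0 ==> cspace (TX x)"
proof - assume "x : M0"
 then obtain c where c: "c : XC 0" "x : fst c" using XC_at[OF base(2)] by blast
 have "lc k v l w : TX x" if vw: "v : TX x" "w : TX x" for k v l w
 proof -
  obtain a b a' b' where "v = rv c x a b" "w = rv c x a' b'" using vw unfolding T_iff_rv[OF base(2) c] by blast
  hence "lc k v l w = (%f. SUM i:UNIV. (k * (a $ i + \<i> * b $ i) + l * (a' $ i + \<i> * b' $ i)) * dzv c i x f +
   (k * (cnj (a $ i) + \<i> * cnj (b $ i)) + l * (cnj (a' $ i) + \<i> * cnj (b' $ i))) * dzbv c i x f)" unfolding lc_def
   by (intro ext) (simp only: rv_basis[OF base(2) c] sum_distrib_left sum.distrib[symmetric] distrib_left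
   distrib_right mult.assoc ac_simps) thus ?thesis using T_basis[OF base(2) c] by simp qed
 moreover have "(%_. 0) : TX x" using T_basis[OF base(2) c, of "%_. 0" "%_. 0"] by simp
 ultimately show ?thesis unfolding cspace_def by blast
qed

end

context pair_family
begin

subsection \<open>Coordinate vectors and covectors\<close>

lemma coord_has_derivative:
 assumes "t : BX" "(U, z) : XC t" "x : U" shows "((%y. z y $ i) o iv U z has_derivative (%a. a $ i)) (at (z x))"
proof (rule has_derivative_transform_within_open) note CU = XC_coord[OF assms(1,2)]
 show "((%u. u $ i) has_derivative (%a. a $ i)) (at (z x))" by (rule bounded_linear_imp_has_derivative[OF bounded_linear_vec_nth])
 show "open (z ` U)" by (rule ccD(2)[OF CU]) show "z x : z ` U" using assms(3) by blast
 show "u $ i = ((%y. z y $ i) o iv U z) u" if "u : z ` U" for u using ccD(7)[OF CU that] by simp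
qed

lemma coord_smooth:
 assumes "t : BX" "c : XC t" "x : fst c" shows "smat x (%y. snd c y $ i)"
proof -
 obtain U z where c: "c = (U, z)" by (cases c)
 have x: "x : U" and U: "(U, z) : XC t" using assms c by auto
 note CU = XC_coord[OF assms(1) U]
 have "smo (z ` U) (%u. u $ i)" by (rule so_bounded_linear[OF bounded_linear_vec_nth ccD(2)[OF CU]])
 hence "smo (z ` U) ((%y. z y $ i) o iv U z)" by (rule so_cong[OF ccD(2)[OF CU], rotated]) (use ccD(7)[OF CU] in simp)
 thus ?thesis unfolding smat_iff[OF assms(1) U x] using x c ccD(1)[OF CU] by auto
qed

lemma coord_dd:
 assumes "t : BX" "c : XC t" "x : fst c" shows "ddr c x a (%y. snd c y $ i) = a $ i"
  "ddr c x a (%y. cnj (snd c y $ i)) = cnj (a $ i)"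
proof -
 obtain U z where c: "c = (U, z)" by (cases c)
 show *: "ddr c x a (%y. snd c y $ i) = a $ i"
  using dd_eq[OF coord_has_derivative[OF assms(1) assms(2)[unfolded c], of x i]] assms(3) c by simp
 show "ddr c x a (%y. cnj (snd c y $ i)) = cnj (a $ i)" using dd_add(3)[OF assms coord_smooth[OF assms] coord_smooth[OF assms]] * by simp
qed

lemma coord_dual:
 assumes "t : BX" "c : XC t" "x : fst c" shows "dz c i (dzv c j x) = (if i = j then 1 else 0)" "dz c i (dzbv c j x) = 0"
  "dzb c i (dzv c j x) = 0" "dzb c i (dzbv c j x) = (if i = j then 1 else 0)"
 using coord_smooth[OF assms] smat_cnj[OF coord_smooth[OF assms]]
 by (auto simp: dz_def dzb_def dz_vec_def dzb_vec_def coord_dd[OF assms] axis_def)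

lemma linf_dz: "linform V (dz c i)" "linform V (dzb c i)" by (simp_all add: linform_def dz_def dzb_def lc_def)

lemma dz_basis_sum:
 assumes "t : BX" "c : XC t" "x : fst c"
 shows "dz c i (%f. SUM j:UNIV. aa j * dzv c j x f + bb j * dzbv c j x f) = aa i"
  "dzb c i (%f. SUM j:UNIV. aa j * dzv c j x f + bb j * dzbv c j x f) = bb i"
proof -
 have "dz c i (%f. SUM j:UNIV. aa j * dzv c j x f + bb j * dzbv c j x f) =
   (SUM j:UNIV. aa j * dz c i (dzv c j x) + bb j * dz c i (dzbv c j x))"
  "dzb c i (%f. SUM j:UNIV. aa j * dzv c j x f + bb j * dzbv c j x f) =
   (SUM j:UNIV. aa j * dzb c i (dzv c j x) + bb j * dzb c i (dzbv c j x))" by (simp_all add: dz_def dzb_def)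
 thus "dz c i (%f. SUM j:UNIV. aa j * dzv c j x f + bb j * dzbv c j x f) = aa i"
  "dzb c i (%f. SUM j:UNIV. aa j * dzv c j x f + bb j * dzbv c j x f) = bb i"
  by (simp_all add: coord_dual[OF assms] if_distrib[of "(*) _"] cong: if_cong)
qed

lemma T_decomp:
 assumes "t : BX" "c : XC t" "x : fst c" "v : TX x"
 shows "v = (%f. SUM i:UNIV. dz c i v * dzv c i x f + dzb c i v * dzbv c i x f)"
proof -
 obtain a b where "v = rv c x a b" using assms(4) unfolding T_iff_rv[OF assms(1-3)] by blast
 hence v: "v = (%f. SUM i:UNIV. (a $ i + \<i> * b $ i) * dzv c i x f + (cnj (a $ i) + \<i> * cnj (b $ i)) * dzbv c i x f)"
  using rv_basis[OF assms(1-3)] by (simp add: fun_eq_iff)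
 have "dz c i v = a $ i + \<i> * b $ i" "dzb c i v = cnj (a $ i) + \<i> * cnj (b $ i)" for i
  unfolding v by (rule dz_basis_sum[OF assms(1-3)])+ thus ?thesis using v by simp
qed

lemma T_eqI:
 assumes "t : BX" "c : XC t" "x : fst c" "v : TX x" "w : TX x"
  "!!i. dz c i v = dz c i w" "!!i. dzb c i v = dzb c i w" shows "v = w"
 using T_decomp[OF assms(1-4)] T_decomp[OF assms(1-3,5)] assms(6,7) by simp

text \<open>The vector \<open>v\<close>, given at one point, is extended to the field with the same
  constant coefficients in the chart \<open>c\<close>. Values of forms on such fields are functions,
  which can be differentiated.\<close>

definition vext :: "('x, 'n) chart => 'x tvec => 'x => 'x tvec" where
 "vext c v y = (%f. SUM i:UNIV. dz c i v * dzv c i y f + dzb c i v * dzbv c i y f)"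

abbreviation "ext c ws y \<equiv> map (%w. vext c w y) ws"

definition p10 :: "('x, 'n) chart => 'x => 'x tvec => 'x tvec" where
 "p10 c x v = (%f. SUM i:UNIV. dz c i v * dzv c i x f)"

definition p01 :: "('x, 'n) chart => 'x => 'x tvec => 'x tvec" where
 "p01 c x v = (%f. SUM i:UNIV. dzb c i v * dzbv c i x f)"

context
 fixes t c x
 assumes t: "t : BX" and c: "c : XC t" and x: "x : fst c"
begin

lemma vext_self: "v : TX x ==> vext c v x = v" using T_decomp[OF t c x] by (simp add: vext_def)

lemma vext_T: "vext c v x : TX x" unfolding vext_def by (rule T_basis[OF t c x])

lemma vext_dz: "dz c i (vext c v x) = dz c i v" "dzb c i (vext c v x) = dzb c i v" unfolding vext_def by (rule dz_basis_sum[OF t c x])+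

lemma dzv_T: "dzv c i x : TX x" "dzbv c i x : TX x"
proof -
 have "dzv c i x = (%f. SUM j:UNIV. (if j = i then 1 else 0) * dzv c j x f + 0 * dzbv c j x f)"
  "dzbv c i x = (%f. SUM j:UNIV. 0 * dzv c j x f + (if j = i then 1 else 0) * dzbv c j x f)"
  by (simp_all add: if_distrib[of "%x. x * _"] cong: if_cong)
 thus "dzv c i x : TX x" "dzbv c i x : TX x" using T_basis[OF t c x, of "%j. if j = i then 1 else 0" "%_. 0"]
   T_basis[OF t c x, of "%_. 0" "%j. if j = i then 1 else 0"] by presburger+
qed

lemma p10_T: "p10 c x v : TX x" "p01 c x v : TX x"
 using T_basis[OF t c x, of "%i. dz c i v" "%i. 0"] T_basis[OF t c x, of "%i. 0" "%i. dzb c i v"] by (simp_all add: p10_def p01_def)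

lemma p10_dz: "dz c i (p10 c x v) = dz c i v" "dzb c i (p10 c x v) = 0"
  "dz c i (p01 c x v) = 0" "dzb c i (p01 c x v) = dzb c i v" using dz_basis_sum[OF t c x, where aa = "%i. dz c i v" and bb = "%i. 0"]
  dz_basis_sum[OF t c x, where aa = "%i. 0" and bb = "%i. dzb c i v"] by (simp_all add: p10_def p01_def)

lemma p10_add: "v : TX x ==> v = lc 1 (p10 c x v) 1 (p01 c x v)"
 using T_decomp[OF t c x, of v] by (simp add: lc_def p10_def p01_def sum.distrib)

end

lemma p10_lc: "p10 c x (lc a v b w) = lc a (p10 c x v) b (p10 c x w)" "p01 c x (lc a v b w) = lc a (p01 c x v) b (p01 c x w)"
 by (simp_all add: p10_def p01_def lc_def dz_def dzb_def sum_distrib_left sum.distrib[symmetric] distrib_right mult.assoc)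

lemma holo_dzb:
 assumes "t : BX" "(U, z) : XC t" "x : U" "nbhd N" "x : N" "N <= U" "holo_on (z ` N) (f o iv U z)"
 shows "smat x f" "dzbv (U, z) j x f = 0"
proof - note CU = XC_coord[OF assms(1,2)]
 have o: "open (z ` N)" by (rule cc_open_image[OF CU assms(4,6)])
 show s: "smat x f" unfolding smat_iff[OF assms(1-3)] using ho_imp_so[OF o assms(7)] assms(4-6) by blast
 have zx: "z x : z ` N" using assms(5) by blast
 have "axis j \<i> = \<i> *s (axis j 1 :: (complex, 'n) vec)" by (simp add: vec_eq_iff axis_def)
 hence "ddr (U, z) x (axis j \<i>) f = \<i> * ddr (U, z) x (axis j 1) f"
  using ho_derivative(2)[OF assms(7) zx, of \<i> "axis j 1"] by (simp add: dir_deriv_def)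
 thus "dzbv (U, z) j x f = 0" using s by (simp add: dzb_vec_def)
qed

lemma dzv_cnj:
 assumes "t : BX" "c : XC t" "x : fst c" shows "dzv c j x (%y. cnj (f y)) = cnj (dzbv c j x f)"
  "dzbv c j x (%y. cnj (f y)) = cnj (dzv c j x f)"
proof -
 have "smat x (%y. cnj (f y)) \<longleftrightarrow> smat x f" using smat_cnj[of x f] smat_cnj[of x "%y. cnj (f y)"] by auto
 thus "dzv c j x (%y. cnj (f y)) = cnj (dzbv c j x f)"
  "dzbv c j x (%y. cnj (f y)) = cnj (dzv c j x f)" by (auto simp: dz_vec_def dzb_vec_def dd_add(3)[OF assms])
qed

lemma coord_holo:
 assumes "t : BX" "c : XC t" "d : XC t" "x : fst c" "x : fst d"
 shows "dzbv c j x (%y. snd d y $ k) = 0" "dzv c j x (%y. cnj (snd d y $ k)) = 0"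
proof -
 obtain U z V w where cd: "c = (U, z)" "d = (V, w)" by (cases c, cases d)
 note CU = XC_coord[OF assms(1) assms(2)[unfolded cd]] and CV = XC_coord[OF assms(1) assms(3)[unfolded cd]]
 have "holo_on (z ` (U Int V)) (%u. (w o iv U z) u $ k)"
  using XC_trans_holo[OF assms(1) assms(2,3)[unfolded cd]] unfolding holo_map_on_def by blast
 hence "holo_on (z ` (U Int V)) ((%y. w y $ k) o iv U z)" by (simp add: o_def)
 thus *: "dzbv c j x (%y. snd d y $ k) = 0" using holo_dzb(2)[OF assms(1) assms(2)[unfolded cd], of x "U Int V" "%y. w y $ k" j] assms(4,5)
   openin_Int[OF ccD(1)[OF CU] ccD(1)[OF CV]] cd by simp
 show "dzv c j x (%y. cnj (snd d y $ k)) = 0" unfolding dzv_cnj[OF assms(1,2,4)] * by simp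
qed

text \<open>Transition maps within one structure are holomorphic, so the (1,0)-part in the chart
  \<open>c\<close> has no dzbar-components in \<open>d\<close>, and the (0,1)-part no dz-components.
  The type projections thus depend on the structure only.\<close>

lemma p10_indep:
 assumes "t : BX" "c : XC t" "d : XC t" "x : fst c" "x : fst d" "v : TX x"
 shows "p10 c x v = p10 d x v" "p01 c x v = p01 d x v"
proof -
 have 1: "dz d k (p01 c x v) = 0" "dzb d k (p10 c x v) = 0" for k
  by (simp_all add: dz_def dzb_def p01_def p10_def coord_holo[OF assms(1-5)])
 have "dz d k v = dz d k (p10 c x v) + dz d k (p01 c x v)" "dzb d k v = dzb d k (p10 c x v) + dzb d k (p01 c x v)" for k
  by (subst p10_add[OF assms(1,2,4,6)], simp add: lc_def dz_def dzb_def)+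
 hence 2: "dz d k v = dz d k (p10 c x v)" "dzb d k v = dzb d k (p01 c x v)" for k using 1 by auto
 show "p10 c x v = p10 d x v" "p01 c x v = p01 d x v" by (rule T_eqI[OF assms(1,3,5)];
   simp add: p10_T[OF assms(1,2,4)] p10_T[OF assms(1,3,5)] p10_dz[OF assms(1,3,5)] 1 2)+
qed

text \<open>The sign \<open>s\<close> distinguishes the two kinds of coordinate vectors.\<close>

definition cv :: "complex => ('x, 'n) chart => 'n => 'x => 'x tvec" where
 "cv s c i x = (%f. if smat x f then (ddr c x (axis i 1) f + s * \<i> * ddr c x (axis i \<i>) f) / 2 else 0)"

lemma dzv_cv: "dzv c i x = cv (-1) c i x" "dzbv c i x = cv 1 c i x" by (simp_all add: cv_def dz_vec_def dzb_vec_def fun_eq_iff)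

lemma cv_smooth:
 assumes "t : BX" "c : XC t" "x : fst c" "smat x f" shows "smat x (%y. cv s c i y f)"
proof -
 obtain N where N: "nbhd N" "x : N" "!!y. y : N ==> smat y f" using smat_nbhd[OF assms(4)] by metis
 have "smat x (%y. 1/2 * (ddr c y (axis i 1) f + (s * \<i>) * ddr c y (axis i \<i>) f))" by (intro smat_add smat_scale dd_smooth[OF assms])
 thus ?thesis by (rule smat_cong[OF N(1,2), rotated]) (simp add: cv_def N(3))
qed

lemma cv_commute:
 assumes "t : BX" "c : XC t" "x : fst c" "smat x f" shows "cv s c i x (%y. cv s' c j y f) = cv s' c j x (%y. cv s c i y f)"
proof -
 obtain N where N: "nbhd N" "x : N" "!!y. y : N ==> smat y f" using smat_nbhd[OF assms(4)] by metis
 have x0: "x : M0" by (rule smat_fib0[OF assms(4)])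
 have *: "ddr c x a (%y. cv s c i y f) =
   (ddr c x a (%y. ddr c y (axis i 1) f) + s * \<i> * ddr c x a (%y. ddr c y (axis i \<i>) f)) / 2" for s i a
 proof -
  let ?f = "%y. ddr c y (axis i 1) f" and ?g = "%y. ddr c y (axis i \<i>) f"
  have f: "smat x ?f" "smat x ?g" by (rule dd_smooth[OF assms])+
  have "ddr c x a (%y. cv s c i y f) = ddr c x a (%y. 1/2 * (?f y + (s * \<i>) * ?g y))"
   by (rule dd_cong[OF assms(1-3) N(1,2)]) (simp add: cv_def N(3))
  also have "... = 1/2 * ddr c x a (%y. ?f y + (s * \<i>) * ?g y)"
   using dd_add(2)[OF assms(1-3) smat_const[OF x0, of "1/2"] smat_add[OF f(1) smat_scale[OF f(2)]]] by (simp add: dd_const)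
  also have "ddr c x a (%y. ?f y + (s * \<i>) * ?g y) = ddr c x a ?f + (s * \<i>) * ddr c x a ?g"
   using dd_add(1)[OF assms(1-3) f(1) smat_scale[OF f(2)]]
   dd_add(2)[OF assms(1-3) smat_const[OF x0, of "s * \<i>"] f(2)] by (simp add: dd_const)
  finally show ?thesis by simp qed
 show ?thesis using cv_smooth[OF assms] unfolding cv_def[of _ _ _ x] *
  by (simp add: dd_commute[OF assms, of "axis i 1" "axis j 1"] dd_commute[OF assms, of "axis i \<i>" "axis j 1"]
   dd_commute[OF assms, of "axis i 1" "axis j \<i>"] dd_commute[OF assms, of "axis i \<i>" "axis j \<i>"] field_simps)
qed

lemma T_apply_smooth:
 assumes "t : BX" "c : XC t" "x : fst c" "smat x f" shows "smat x (%y. dzv c i y f)" "smat x (%y. dzbv c i y f)"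
 unfolding dzv_cv by (rule cv_smooth[OF assms])+

text \<open>For constant-coefficient vector fields the bracket vanishes.\<close>

lemma vext_smooth:
 assumes "t : BX" "c : XC t" "x : fst c" "smat x f" shows "smat x (%y. vext c v y f)" unfolding vext_def
 by (intro smat_sum smat_add smat_scale T_apply_smooth[OF assms] smat_fib0[OF assms(4)])

lemma vext_commute:
 assumes "t : BX" "c : XC t" "x : fst c" "smat x f" "v : TX x" "w : TX x" shows "v (%y. vext c w y f) = w (%y. vext c v y f)"
proof -
 have x0: "x : M0" by (rule smat_fib0[OF assms(4)])
 note sm = T_apply_smooth[OF assms(1-4)]
 have e: "u (%y. vext c w y f) = (SUM i:UNIV. dz c i w * u (%y. dzv c i y f) + dzb c i w * u (%y. dzbv c i y f))"
  if u: "u : TX x" for u w unfolding vext_def by (simp add: T_sum[OF u] smat_add smat_scale sm TD(3)[OF u] T_scale[OF u])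
 have ev: "v (%y. vext c w y f) = (SUM j:UNIV. dz c j v * dzv c j x (%y. vext c w y f) + dzb c j v * dzbv c j x (%y. vext c w y f))"
  if "v : TX x" for v w using fun_cong[OF T_decomp[OF assms(1-3) that], of "%y. vext c w y f"] .
 note tv = dzv_T[OF assms(1-3)]
 have "v (%y. vext c w y f) = (SUM j:UNIV. SUM i:UNIV.
   dz c j v * dz c i w * dzv c j x (%y. dzv c i y f) + dz c j v * dzb c i w * dzv c j x (%y. dzbv c i y f)
  + dzb c j v * dz c i w * dzbv c j x (%y. dzv c i y f) + dzb c j v * dzb c i w * dzbv c j x (%y. dzbv c i y f))"
  if "v : TX x" for v w unfolding ev[OF that] e[OF tv(1)] e[OF tv(2)] sum_distrib_left sum.distrib[symmetric]
  by (intro sum.cong refl) (simp add: algebra_simps) note E = this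
 show ?thesis unfolding E[OF assms(5), of w] E[OF assms(6), of v] by (subst (2) sum.swap)
   (intro sum.cong refl, simp add: dzv_cv cv_commute[OF assms(1-4), of "-1" _ "-1"] cv_commute[OF assms(1-4), of 1 _ 1]
   cv_commute[OF assms(1-4), of 1 _ "-1"])
qed

subsection \<open>Frames\<close>

lemma framesD:
 assumes "(W, rh) : frames X" shows "open W" "x : W ==> bij_betw rh (EE x) UNIV"
 using assms bundle_holomorphic unfolding holomorphic_bundle_def efib_def by fast+

lemma frames_cover: obtains W rh where "(W, rh) : frames X" "x : W"
proof -
 have "x : \<Union>(fst ` frames X)" using bundle_holomorphic unfolding holomorphic_bundle_def by simp
 thus thesis using that by force
qed

lemma frames_trans:
 assumes "(U, ta) : frames X" "(V, rh) : frames X"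
 obtains g :: "'x => complex^'r^'r" where "ALL e. bproj X e : U Int V --> rh e = g (bproj X e) *v ta e"
  "ALL W z i j. (W, z) : charts X --> holo_on (z ` (W Int U Int V)) (%u. g (iv W z u) $ i $ j)"
proof -
 have "EX g :: 'x => complex^'r^'r. (ALL e. bproj X e : U Int V --> rh e = g (bproj X e) *v ta e) &
   (ALL (W, z):charts X. ALL i j. holo_on (z ` (W Int U Int V)) (%u. g (iv W z u) $ i $ j))"
  using bundle_holomorphic assms unfolding holomorphic_bundle_def by fast
 thus thesis using that by fast
qed

lemma matrix_bij_invertible:
 fixes A :: "complex^'k::finite^'k"
 assumes "bij_betw f S UNIV" "bij_betw g S UNIV" "!!e. e : S ==> f e = A *v g e" shows "invertible A"
proof -
 have "inj ((*v) A)"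
 proof (rule injI) fix a b assume eq: "A *v a = A *v b"
  obtain e e' where e: "e : S" "g e = a" "e' : S" "g e' = b" using assms(2) unfolding bij_betw_def by (metis UNIV_I imageE)
  hence "f e = f e'" using assms(3) eq by simp
  thus "a = b" using e assms(1) unfolding bij_betw_def inj_on_def by blast qed
 thus ?thesis by (metis invertible_left_inverse matrix_left_invertible_injective)
qed

lemma invertible_bij: "invertible (A :: complex^'k::finite^'k) ==> bij ((*v) A)"
 using matrix_inv_id[of A] by (intro o_bij[of "(*v) (minv A)"]) (auto simp: fun_eq_iff matrix_vector_mul_assoc)

lemma FFD:
 assumes "(U, ta) : fibre_frames X t" "(W, rh) : frames X"
 obtains g :: "'x => complex^'r^'r" where "ALL e. bproj X e : U Int W --> ta e = g (bproj X e) *v rh e"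
  "ALL x. x : U --> x : W --> invertible (g x)"
  "ALL V z i j. (V, z) : FC t --> holo_on (z ` (V Int U Int W)) (%u. g (iv V z u) $ i $ j)"
proof -
 have "EX g :: 'x => complex^'r^'r. (ALL e. bproj X e : U Int W --> ta e = g (bproj X e) *v rh e) & (ALL x:U Int W. invertible (g x)) &
   (ALL (V, z):FC t. ALL i j. holo_on (z ` (V Int U Int W)) (%u. g (iv V z u) $ i $ j))" using assms unfolding fibre_frames_def by fast
 thus thesis using that by fast
qed

lemma FF_bij:
 assumes "(U, ta) : fibre_frames X t" "y : U" shows "bij_betw ta (EE y) UNIV"
proof -
 obtain W rh where W: "(W, rh) : frames X" "y : W" by (rule frames_cover)
 obtain g where g0: "ALL e. bproj X e : U Int W --> ta e = g (bproj X e) *v rh e"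
  "ALL x. x : U --> x : W --> invertible (g x)"
  "ALL V z i j. (V, z) : FC t --> holo_on (z ` (V Int U Int W)) (%u. g (iv V z u) $ i $ j)" by (rule FFD[OF assms(1) W(1)])
 note g = g0(1)[rule_format] g0(2)[rule_format, OF assms(2) W(2)]
 have "bij_betw ((*v) (g y) o rh) (EE y) UNIV" by (rule bij_betw_trans[OF framesD(2)[OF W] invertible_bij[OF g(2)]])
 thus ?thesis by (rule bij_betw_cong[THEN iffD1, rotated]) (use g(1) assms(2) W(2) in \<open>auto simp: efib_def\<close>)
qed

text \<open>Agreement over the fibre is all that can be asked of \<open>rh'\<close>: in
  \<open>EF_at\<close> it is \<open>rh\<close> composed with \<open>lm X\<close> and an inverse of
  it on one fibre.\<close>

lemma FF_restrict_frame:
 assumes "(W, rh) : frames X" "!!e. bproj X e : fib X t Int W ==> rh' e = rh e"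
 shows "(fib X t Int W, rh') : fibre_frames X t"
proof -
 have *: "EX g :: 'x => complex^'r^'r. (ALL e. bproj X e : (fib X t Int W) Int W1 --> rh' e = g (bproj X e) *v rh1 e) &
   (ALL x:(fib X t Int W) Int W1. invertible (g x)) &
   (ALL (V, z):FC t. ALL i j. holo_on (z ` (V Int (fib X t Int W) Int W1)) (%u. g (iv V z u) $ i $ j))"
  if W1: "(W1, rh1) : frames X" for W1 rh1
 proof -
  obtain g :: "'x => complex^'r^'r" where g0: "ALL e. bproj X e : W1 Int W --> rh e = g (bproj X e) *v rh1 e"
   "ALL W' z i j. (W', z) : charts X --> holo_on (z ` (W' Int W1 Int W)) (%u. g (iv W' z u) $ i $ j)" by (rule frames_trans[OF W1 assms(1)])
 note g = g0[rule_format]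
  have "invertible (g x)" if "x : W" "x : W1" for x
   by (rule matrix_bij_invertible[OF framesD(2)[OF assms(1) that(1)] framesD(2)[OF W1 that(2)]])
   (use g(1) that in \<open>auto simp: efib_def\<close>)
  moreover have "holo_on (z ` (V Int (fib X t Int W) Int W1)) (%u. g (iv V z u) $ i $ j)" if V: "(V, z) : FC t" for V z i j
  proof (rule ho_local) fix u assume "u : z ` (V Int (fib X t Int W) Int W1)"
   then obtain y where y: "y : V" "y : W" "y : W1" "u = z y" by blast
   obtain W2 Z where W2: "(W2, Z) : charts X" "y : W2" by (rule charts_cover)
   note CV = FCD[OF V] and C2 = ccD[OF charts_coord[OF W2(1)]]
   let ?N = "V Int (W2 Int W1 Int W)"
   have o: "open (W2 Int W1 Int W)" using framesD(1) W1 assms(1) charts_open[OF W2(1)] by blast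
   have oN: "open (z ` ?N)" by (rule cc_open_image[OF CV(1) openin_Int_open[OF ccD(1)[OF CV(1)] o]]) auto
   have sub: "z ` ?N <= z ` (V Int W2)" by auto
   have "holo_on (z ` ?N) (%u. (%u. g (iv W2 Z u) $ i $ j) ((Z o iv V z) u))"
   by (rule ho_compose[OF g(2)[OF W2(1)] hm_subset[OF CV(2)[OF W2(1)] sub]]) (use ccD(5)[OF CV(1)] in auto)
   hence "holo_on (z ` ?N) (%u. g (iv V z u) $ i $ j)" by (rule ho_cong[OF oN, rotated]) (use ccD(5)[OF CV(1)] C2(5) in auto)
   moreover have "u : z ` ?N" using y W2(2) by auto
   ultimately show "EX N. u : N & holo_on N (%u. g (iv V z u) $ i $ j)" by (intro exI[of _ "z ` ?N"] conjI)
  qed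
  ultimately show ?thesis using g0(1) assms(2) by (intro exI[of _ g] conjI) (simp, blast, blast)
 qed show ?thesis unfolding fibre_frames_def mem_Collect_eq case_prod_conv
 proof (intro conjI ballI)
  show "openin (top_of_set (fib X t)) (fib X t Int W)" using framesD(1)[OF assms(1)] by (simp add: openin_open_Int)
  fix p assume p: "p : frames X"
  obtain W1 rh1 where eq: "p = (W1, rh1)" by (cases p)
  show "case p of (W1, rh1) => EX g :: 'x => complex^'r^'r. (ALL e. bproj X e : (fib X t Int W) Int W1 --> rh' e = g (bproj X e) *v rh1 e) &
   (ALL x:(fib X t Int W) Int W1. invertible (g x)) &
   (ALL (V, z):FC t. ALL i j. holo_on (z ` (V Int (fib X t Int W) Int W1)) (%u. g (iv V z u) $ i $ j))"
   unfolding eq case_prod_conv by (rule *[OF p[unfolded eq]]) qed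
qed

lemma lm_trivialization:
 "ALL e. bproj X (lm X e) = sg X (bproj X e)"
 "ALL e. bproj X e : M0 --> lm X e = e"
 "ALL (U, ta):frames X. ALL (V, rh):fibre_frames X 0. EX L :: 'x => complex^'r^'r.
   (ALL e. bproj X e : U Int sg X -` V --> rh (lm X e) = L (bproj X e) *v ta e) & (ALL y:U Int sg X -` V. invertible (L y)) &
   (ALL (W, z):charts X. smo (z ` (W Int U Int sg X -` V)) (%u. L (iv W z u)))"
proof - note * = triv[unfolded compatible_trivialization_def]
 show "ALL e. bproj X (lm X e) = sg X (bproj X e)" by (rule *[THEN conjunct2, THEN conjunct1])
 show "ALL e. bproj X e : M0 --> lm X e = e" by (rule *[THEN conjunct2, THEN conjunct2, THEN conjunct1])
 show "ALL (U, ta):frames X. ALL (V, rh):fibre_frames X 0. EX L :: 'x => complex^'r^'r.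
   (ALL e. bproj X e : U Int sg X -` V --> rh (lm X e) = L (bproj X e) *v ta e) & (ALL y:U Int sg X -` V. invertible (L y)) &
   (ALL (W, z):charts X. smo (z ` (W Int U Int sg X -` V)) (%u. L (iv W z u)))" by (rule *[THEN conjunct2, THEN conjunct2, THEN conjunct2])
qed

lemma lm_bproj: "bproj X (lm X e) = sg X (bproj X e)" by (rule lm_trivialization(1)[rule_format])

lemma lm_fib0: "bproj X e : M0 ==> lm X e = e" by (rule lm_trivialization(2)[rule_format])

lemma lm_smooth:
 assumes "(U, ta) : frames X" "(V, rh) : fibre_frames X 0"
 obtains L :: "'x => complex^'r^'r"
  where "ALL e. bproj X e : U Int sg X -` V --> rh (lm X e) = L (bproj X e) *v ta e"
  "ALL y. y : U --> sg X y : V --> invertible (L y)"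
  "ALL W z. (W, z) : charts X --> smo (z ` (W Int U Int sg X -` V)) (%u. L (iv W z u))"
proof -
 have "EX L :: 'x => complex^'r^'r. (ALL e. bproj X e : U Int sg X -` V --> rh (lm X e) = L (bproj X e) *v ta e) &
   (ALL y:U Int sg X -` V. invertible (L y)) & (ALL (W, z):charts X. smo (z ` (W Int U Int sg X -` V)) (%u. L (iv W z u)))"
  using bspec[OF bspec[OF lm_trivialization(3) assms(1), unfolded case_prod_conv] assms(2), unfolded case_prod_conv] .
 then obtain L :: "'x => complex^'r^'r" where
  L: "ALL e. bproj X e : U Int sg X -` V --> rh (lm X e) = L (bproj X e) *v ta e"
   "ALL y:U Int sg X -` V. invertible (L y)"
   "ALL (W, z):charts X. smo (z ` (W Int U Int sg X -` V)) (%u. L (iv W z u))" by (elim exE conjE)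
 show thesis by (rule that[OF L(1)]) (use L(2,3) in auto)
qed

lemma lm_lm: "lm X (lm X e) = lm X e" using lm_fib0 lm_bproj sg_in by metis

lemma lm_bij:
 assumes t: "t : BX" and x: "x : M0" shows "bij_betw (lm X) (EE (sgi t x)) (EE x)"
proof -
 obtain W0 rh0 where W0: "(W0, rh0) : frames X" "x : W0" by (rule frames_cover)
 obtain W rh where W: "(W, rh) : frames X" "sgi t x : W" by (rule frames_cover)
 have F0: "(M0 Int W0, rh0) : fibre_frames X 0" by (rule FF_restrict_frame[OF W0(1) refl])
 obtain L where L0: "ALL e. bproj X e : W Int sg X -` (M0 Int W0) --> rh0 (lm X e) = L (bproj X e) *v rh e"
  "ALL y. y : W --> sg X y : M0 Int W0 --> invertible (L y)"
  "ALL W' z. (W', z) : charts X --> smo (z ` (W' Int W Int sg X -` (M0 Int W0))) (%u. L (iv W' z u))" by (rule lm_smooth[OF W(1) F0])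
 note L = L0[rule_format]
 have sx: "sg X (sgi t x) = x" by (rule sgi_in(2)[OF t x])
 have "bij_betw ((*v) (L (sgi t x)) o rh) (EE (sgi t x)) UNIV"
  by (rule bij_betw_trans[OF framesD(2)[OF W] invertible_bij[OF L(2)]]) (use W(2) sx x W0(2) in auto)
 hence b: "bij_betw (rh0 o lm X) (EE (sgi t x)) UNIV"
  by (rule bij_betw_cong[THEN iffD1, rotated]) (use L(1) W(2) sx x W0(2) in \<open>auto simp: efib_def\<close>)
 have into: "lm X ` EE (sgi t x) <= EE x" using lm_bproj sx by (auto simp: efib_def)
 have b0: "bij_betw rh0 (EE x) UNIV" by (rule framesD(2)[OF W0])
 show ?thesis by (rule bij_betw_comp_iff2[OF b0 into, THEN iffD2, OF b])
qed

lemma EFD: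
 assumes "(V, ta) : EF t" shows "V <= M0" "(fib X t Int sg X -` V, ta o lm X) : fibre_frames X t" using assms unfolding Eframes_def by auto

lemma EF_open:
 assumes t: "t : BX" and V: "(V, ta) : EF t" shows "nbhd V"
proof - note D = EFD[OF V]
 have "openin (top_of_set (fib X t)) (fib X t Int sg X -` V)" using D(2) unfolding fibre_frames_def by blast
 hence "nbhd (sg X ` (fib X t Int sg X -` V))" by (rule homeomorphism_imp_open_map[OF sg_homeo[OF t]])
 thus ?thesis using sg_hat(1)[OF t D(1)] by simp
qed

lemma EF_bij:
 assumes t: "t : BX" and V: "(V, ta) : EF t" and x: "x : V" shows "bij_betw ta (EE x) UNIV"
proof - note D = EFD[OF V]
 have x0: "x : M0" using x D(1) by blast
 have "bij_betw (ta o lm X) (EE (sgi t x)) UNIV" by (rule FF_bij[OF D(2)]) (use sgi_in[OF t x0] x in auto)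
 thus ?thesis using bij_betw_comp_iff[OF lm_bij[OF t x0]] by blast
qed

lemma EF_at:
 assumes t: "t : BX" and x: "x : M0"
 obtains V ta where "(V, ta) : EF t" "x : V"
proof -
 obtain W rh where W: "(W, rh) : frames X" "sgi t x : W" by (rule frames_cover)
 define V where "V = sg X ` (fib X t Int W)"
 define ta where "ta e = rh (iv (EE (sgi t (bproj X e))) (lm X) e)" for e
 have hat: "fib X t Int sg X -` V = fib X t Int W" unfolding V_def using sg_inj_fib by auto
 have "(fib X t Int W, ta o lm X) : fibre_frames X t"
 proof (rule FF_restrict_frame[OF W(1)]) fix e assume e: "bproj X e : fib X t Int W"
  hence eq: "sgi t (bproj X (lm X e)) = bproj X e" using sgi_sg lm_bproj by simp
  have "inj_on (lm X) (EE (sgi t (bproj X (lm X e))))" by (rule bij_betw_imp_inj_on[OF lm_bij[OF t]]) (simp add: lm_bproj)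
  hence "iv (EE (sgi t (bproj X (lm X e)))) (lm X) (lm X e) = e" by (rule inv_into_f_f) (simp add: eq efib_def)
  thus "(ta o lm X) e = rh e" by (simp add: ta_def) qed
 hence "(V, ta) : EF t" unfolding Eframes_def using hat by (auto simp: V_def)
 moreover have "x : V" unfolding V_def using sgi_in[OF t x] W(2) by (metis IntI image_eqI)
 ultimately show thesis by (rule that)
qed

lemma frame_vec_in:
 assumes "t : BX" "(V, ta) : EF t" "x : V" shows "frame_vec X ta k x : EE x" "ta (frame_vec X ta k x) = axis k 1"
proof -
 have "axis k 1 : ta ` EE x" using EF_bij[OF assms] unfolding bij_betw_def by simp
 thus "frame_vec X ta k x : EE x" "ta (frame_vec X ta k x) = axis k 1" unfolding frame_vec_def by (auto intro: inv_into_into f_inv_into_f)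
qed

lemma wmat_unique:
 assumes "t : BX" "(V, ta) : EF t" "x : V" "!!e. e : EE x ==> rh e = A *v ta e" shows "wm rh ta x = A"
proof -
 have "rh (frame_vec X ta l x) = A *v axis l 1" for l
  using assms(4)[OF frame_vec_in(1)[OF assms(1-3)]] frame_vec_in(2)[OF assms(1-3)] by simp
 hence "rh (frame_vec X ta l x) $ j = A $ j $ l" for j l by (simp add: matrix_vector_mult_def axis_def if_distrib[of "(*) _"] cong: if_cong)
 thus ?thesis by (simp add: wmat_def vec_eq_iff)
qed

text \<open>The comparison of a frame of index \<open>t\<close> with a frame of the total space, both read on the
 central fibre.\<close>

lemma EF_ambient:
 assumes t: "t : BX" and V: "(V, ta) : EF t" and W: "(W, rh) : frames X"
 obtains G where "ALL y e. y : V --> sgi t y : W --> e : EE (sgi t y) --> ta (lm X e) = G y *v rh e"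
  "ALL y. y : V --> sgi t y : W --> invertible (G y)"
  "ALL y i j. y : V --> sgi t y : W --> smat y (%y. G y $ i $ j)"
  "ALL y i j c k. y : V --> sgi t y : W --> c : XC t --> y : fst c --> dzbv c k y (%y. G y $ i $ j) = 0"
proof - note D = EFD[OF V]
 let ?V = "fib X t Int sg X -` V"
 obtain g :: "'x => complex^'r^'r" where g0: "ALL e. bproj X e : ?V Int W --> (ta o lm X) e = g (bproj X e) *v rh e"
  "ALL x. x : ?V --> x : W --> invertible (g x)"
  "ALL V' z i j. (V', z) : FC t --> holo_on (z ` (V' Int ?V Int W)) (%u. g (iv V' z u) $ i $ j)" by (rule FFD[OF D(2) W])
 note g = g0[rule_format]
 define N where "N = sg X ` (?V Int W)"
 have Niff: "y : N \<longleftrightarrow> y : V & sgi t y : W" for y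
 proof assume "y : N" thus "y : V & sgi t y : W" unfolding N_def using sgi_sg by auto next
  assume y: "y : V & sgi t y : W"
  hence "sgi t y : ?V Int W" "y = sg X (sgi t y)" using sgi_in[OF t, of y] D(1) by auto
  thus "y : N" unfolding N_def by blast qed
 have oN: "nbhd N"
 proof -
  have "openin (top_of_set (fib X t)) ?V" using D(2) unfolding fibre_frames_def by blast
  hence "openin (top_of_set (fib X t)) (?V Int W)" using framesD(1)[OF W] by (rule openin_Int_open)
  thus ?thesis unfolding N_def by (rule homeomorphism_imp_open_map[OF sg_homeo[OF t]]) qed
 have h: "smat y (%y. g (sgi t y) $ i $ j) & dzbv (U, z) k y (%y. g (sgi t y) $ i $ j) = 0"
  if y: "y : N" and U: "(U, z) : XC t" "y : U" for y U z i j k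
 proof - note DU = XCD[OF U(1)] and CU = XC_coord[OF t U(1)]
  let ?U = "fib X t Int sg X -` U"
  have o: "nbhd (U Int N)" by (rule openin_Int[OF ccD(1)[OF CU] oN])
  have ou: "open (z ` (U Int N))" by (rule cc_open_image[OF CU o]) auto
  have im: "(z o sg X) ` (?U Int ?V Int W) = z ` (U Int N)"
  proof -
   have "sg X ` (?U Int ?V Int W) = U Int N" unfolding N_def by auto
   thus ?thesis by (simp only: image_comp[symmetric]) qed
  have "holo_on (z ` (U Int N)) (%u. g (iv ?U (z o sg X) u) $ i $ j)" using g(3)[OF DU(2)] unfolding im .
  hence "holo_on (z ` (U Int N)) ((%y. g (sgi t y) $ i $ j) o iv U z)" by (rule ho_cong[OF ou, rotated]) (use XC_inv_hat[OF t U(1)] in auto)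
  thus ?thesis using holo_dzb[OF t U o, of "%y. g (sgi t y) $ i $ j"] y U(2) by simp qed
 show thesis
 proof (rule that[of "%y. g (sgi t y)"]; intro allI impI)
  show "ta (lm X e) = g (sgi t y) *v rh e" if "y : V" "sgi t y : W" "e : EE (sgi t y)" for y e
   using g(1)[of e] that sgi_in[OF t, of y] D(1) by (auto simp: efib_def)
  show "invertible (g (sgi t y))" if "y : V" "sgi t y : W" for y using g(2) that sgi_in[OF t, of y] D(1) by auto
  show "smat y (%y. g (sgi t y) $ i $ j)" if y: "y : V" "sgi t y : W" for y i j
  proof -
   obtain U z where "(U, z) : XC t" "y : U" by (rule XC_exist[OF t subsetD[OF D(1) y(1)]])
   thus ?thesis using h y Niff by blast qed
  show "dzbv c k y (%y. g (sgi t y) $ i $ j) = 0" if "y : V" "sgi t y : W" "c : XC t" "y : fst c" for y i j c k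
   using h[of y "fst c" "snd c"] that Niff by simp qed
qed

lemma EF_zero_ambient:
 assumes t: "t : BX" and V: "(V, ta) : EF 0" and W: "(W, rh) : frames X"
 obtains G where "ALL y e. y : V --> sgi t y : W --> e : EE (sgi t y) --> ta (lm X e) = G y *v rh e"
  "ALL y. y : V --> sgi t y : W --> invertible (G y)"
  "ALL y i j. y : V --> sgi t y : W --> smat y (%y. G y $ i $ j)"
proof - note D = EFD[OF V]
 have F: "(V, ta o lm X) : fibre_frames X 0" using D sg_hat_zero[OF D(1)] by simp
 obtain L where L0: "ALL e. bproj X e : W Int sg X -` V --> (ta o lm X) (lm X e) = L (bproj X e) *v rh e"
  "ALL y. y : W --> sg X y : V --> invertible (L y)"
  "ALL W' z. (W', z) : charts X --> smo (z ` (W' Int W Int sg X -` V)) (%u. L (iv W' z u))" by (rule lm_smooth[OF W F])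
 note L = L0[rule_format]
 have oV: "open (sg X -` V)"
 proof -
  have "openin (top_of_set UNIV) (UNIV Int sg X -` V)" by (rule continuous_openin_preimage[OF sg_cont _ EF_open[OF base(2) V]]) auto
  thus ?thesis by simp qed show thesis
 proof (rule that[of "%y. L (sgi t y)"]; intro allI impI)
  show "ta (lm X e) = L (sgi t y) *v rh e" if "y : V" "sgi t y : W" "e : EE (sgi t y)" for y e
   using L(1)[of e] that sgi_in[OF t, of y] D(1) by (auto simp: efib_def lm_lm)
  show "invertible (L (sgi t y))" if "y : V" "sgi t y : W" for y using L(2) that sgi_in[OF t, of y] D(1) by auto
  show "smat y (%y. L (sgi t y) $ i $ j)" if y: "y : V" "sgi t y : W" for y i j
  proof -
   have y0: "y : M0" using y(1) D(1) by blast
   obtain U z where U: "(U, z) : XC t" "y : U" by (rule XC_exist[OF t y0])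
   obtain W1 Z where W1: "(W1, Z) : charts X" "sgi t y : W1" by (rule charts_cover)
   note DU = XCD[OF U(1)] and CU = XC_coord[OF t U(1)]
   note FU = FCD[OF DU(2)] and C1 = ccD[OF charts_coord[OF W1(1)]]
   let ?U = "fib X t Int sg X -` U" and ?T = "W1 Int W Int sg X -` V"
   have oT: "open ?T" using charts_open[OF W1(1)] framesD(1)[OF W] oV by blast
   have oZT: "open (Z ` ?T)" by (rule cc_open_image[OF charts_coord[OF W1(1)]]) (use oT in auto)
   have oUT: "openin (top_of_set (fib X t)) (?U Int ?T)" by (rule openin_Int_open[OF ccD(1)[OF FU(1)] oT])
   define N where "N = sg X ` (?U Int ?T)"
   have oN: "nbhd N" unfolding N_def by (rule homeomorphism_imp_open_map[OF sg_homeo[OF t] oUT])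
   have NU: "N <= U" unfolding N_def by auto
   have im: "z ` N = (z o sg X) ` (?U Int ?T)" unfolding N_def by (simp only: image_comp)
   have ozN: "open (z ` N)" by (rule cc_open_image[OF CU oN NU])
   have "z ` N <= (z o sg X) ` (?U Int W1)" unfolding im by auto
   hence g: "smo (z ` N) (Z o iv ?U (z o sg X))" using hm_imp_so[OF ozN hm_subset[OF FU(2)[OF W1(1)]]] by blast
   have f: "smo (Z ` ?T) (%u. L (iv W1 Z u) $ i $ j)" by (intro so_vec_nth[OF oZT] L(3)[OF W1(1)])
   have "smo (z ` N) (%u. (%u. L (iv W1 Z u) $ i $ j) ((Z o iv ?U (z o sg X)) u))"
   by (rule so_compose[OF ozN oZT f g]) (use ccD(5)[OF FU(1)] in \<open>auto simp: im\<close>)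
   hence "smo (z ` N) ((%y. L (sgi t y) $ i $ j) o iv U z)"
   proof (rule so_cong[OF ozN, rotated]) fix u assume u: "u : z ` N"
   hence uU: "u : z ` U" using NU by blast
   obtain y' where y': "y' : ?U Int ?T" "u = (z o sg X) y'" using u unfolding im by blast
   have "iv ?U (z o sg X) u = y'" using ccD(5)[OF FU(1)] y' by auto
   hence "sgi t (iv U z u) = y'" using XC_inv_hat[OF t U(1) uU] by simp
   thus "(%u. L (iv W1 Z u) $ i $ j) ((Z o iv ?U (z o sg X)) u) = ((%y. L (sgi t y) $ i $ j) o iv U z) u"
   using \<open>iv ?U (z o sg X) u = y'\<close> C1(5) y'(1) by simp qed
   moreover have "y : N" unfolding N_def using sgi_in[OF t y0] y U(2) W1(2) by (intro image_eqI[of _ _ "sgi t y"]) auto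
   ultimately show ?thesis unfolding smat_iff[OF t U] using oN NU by blast qed qed
qed

text \<open>Both frames are compared with one frame of the total space, by matrices G and L; near
  \<open>x\<close> the transition matrix is G L^{-1}.\<close>

lemma wmat_zero:
 assumes t: "t : BX" and V: "(V, rh) : EF t" and V0: "(V0, ta) : EF 0" and x: "x : V" "x : V0"
 shows "e : EE x ==> rh e = wm rh ta x *v ta e" "invertible (wm rh ta x)"
  "smat x (%y. wm rh ta y $ i $ j)"
proof -
 obtain W ss where W: "(W, ss) : frames X" "sgi t x : W" by (rule frames_cover)
 obtain G where G0: "ALL y e. y : V --> sgi t y : W --> e : EE (sgi t y) --> rh (lm X e) = G y *v ss e"
  "ALL y. y : V --> sgi t y : W --> invertible (G y)"
  "ALL y i j. y : V --> sgi t y : W --> smat y (%y. G y $ i $ j)"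
  "ALL y i j c k. y : V --> sgi t y : W --> c : XC t --> y : fst c --> dzbv c k y (%y. G y $ i $ j) = 0" by (rule EF_ambient[OF t V W(1)])
 note G = G0[rule_format]
 obtain L where L0: "ALL y e. y : V0 --> sgi t y : W --> e : EE (sgi t y) --> ta (lm X e) = L y *v ss e"
  "ALL y. y : V0 --> sgi t y : W --> invertible (L y)"
  "ALL y i j. y : V0 --> sgi t y : W --> smat y (%y. L y $ i $ j)" by (rule EF_zero_ambient[OF t V0 W(1)])
 note L = L0[rule_format]
 have x0: "x : M0" using x EFD(1)[OF V] by blast
 define N where "N = {y : V Int V0. sgi t y : W}"
 have oN: "nbhd N"
 proof -
  have "openin (top_of_set (M0)) (M0 Int sgi t -` W)" by (rule continuous_openin_preimage_gen[OF sgi_cont_fib[OF t] framesD(1)[OF W(1)]])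
  hence "nbhd ((V Int V0) Int (M0 Int sgi t -` W))" using EF_open[OF t V] EF_open[OF base(2) V0] by blast
  moreover have "(V Int V0) Int (M0 Int sgi t -` W) = N" using EFD(1)[OF V] by (auto simp: N_def)
  ultimately show ?thesis by simp qed
 have A: "rh e = (G y ** minv (L y)) *v ta e" if y: "y : N" "e : EE y" for y e
 proof -
  have y0: "y : M0" using y(1) EFD(1)[OF V] by (auto simp: N_def)
  obtain e' where e': "e' : EE (sgi t y)" "e = lm X e'" using lm_bij[OF t y0] y(2) unfolding bij_betw_def by blast
  have "minv (L y) *v ta e = ss e'" using L(1)[of y e'] L(2)[of y] y e' by (simp add: N_def matrix_vector_mul_assoc matrix_inv_id)
  thus ?thesis using G(1)[of y e'] y e' by (simp add: N_def matrix_vector_mul_assoc[symmetric])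
 qed
 have W': "wm rh ta y = G y ** minv (L y)" if y: "y : N" for y
  by (rule wmat_unique[OF base(2) V0 _ A[OF y]]) (use y in \<open>auto simp: N_def\<close>)
 have xN: "x : N" using x W(2) by (simp add: N_def)
 show e: "rh e = wm rh ta x *v ta e" if "e : EE x" for e using A[OF xN that] W'[OF xN] by simp
 show "invertible (wm rh ta x)" by (rule matrix_bij_invertible[OF EF_bij[OF t V x(1)] EF_bij[OF base(2) V0 x(2)] e])
 have "smat x (%y. minv (L y) $ k $ l)" for k l by (rule smat_matrix_inv[OF oN xN]) (use L(2,3) xN in \<open>auto simp: N_def\<close>)
 hence "smat x (%y. SUM k:UNIV. G y $ i $ k * minv (L y) $ k $ j)"
  by (intro smat_sum[OF x0] smat_mult) (use G(3) xN in \<open>auto simp: N_def\<close>)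
 thus "smat x (%y. wm rh ta y $ i $ j)" by (rule smat_cong[OF oN xN, rotated]) (simp add: W' matrix_matrix_mult_def)
qed

text \<open>The transition matrix is again G L^{-1}, where now both matrices are holomorphic on
  X_t.\<close>

lemma wmat_holo:
 assumes t: "t : BX" and V: "(V, rh) : EF t" and V0: "(V0, ta) : EF t" and x: "x : V" "x : V0"
 shows "e : EE x ==> rh e = wm rh ta x *v ta e" "invertible (wm rh ta x)"
  "smat x (%y. wm rh ta y $ i $ j)"
  "c : XC t ==> x : fst c ==> dzbv c k x (%y. wm rh ta y $ i $ j) = 0"
proof -
 obtain W ss where W: "(W, ss) : frames X" "sgi t x : W" by (rule frames_cover)
 obtain G where G0: "ALL y e. y : V --> sgi t y : W --> e : EE (sgi t y) --> rh (lm X e) = G y *v ss e"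
  "ALL y. y : V --> sgi t y : W --> invertible (G y)"
  "ALL y i j. y : V --> sgi t y : W --> smat y (%y. G y $ i $ j)"
  "ALL y i j c k. y : V --> sgi t y : W --> c : XC t --> y : fst c --> dzbv c k y (%y. G y $ i $ j) = 0" by (rule EF_ambient[OF t V W(1)])
 note G = G0[rule_format]
 obtain L where L0: "ALL y e. y : V0 --> sgi t y : W --> e : EE (sgi t y) --> ta (lm X e) = L y *v ss e"
  "ALL y. y : V0 --> sgi t y : W --> invertible (L y)"
  "ALL y i j. y : V0 --> sgi t y : W --> smat y (%y. L y $ i $ j)"
  "ALL y i j c k. y : V0 --> sgi t y : W --> c : XC t --> y : fst c --> dzbv c k y (%y. L y $ i $ j) = 0" by (rule EF_ambient[OF t V0 W(1)])
 note L = L0[rule_format]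
 have x0: "x : M0" using x EFD(1)[OF V] by blast
 define N where "N = {y : V Int V0. sgi t y : W}"
 have oN: "nbhd N"
 proof -
  have "openin (top_of_set (M0)) (M0 Int sgi t -` W)" by (rule continuous_openin_preimage_gen[OF sgi_cont_fib[OF t] framesD(1)[OF W(1)]])
  hence "nbhd ((V Int V0) Int (M0 Int sgi t -` W))" using EF_open[OF t V] EF_open[OF t V0] by blast
  moreover have "(V Int V0) Int (M0 Int sgi t -` W) = N" using EFD(1)[OF V] by (auto simp: N_def)
  ultimately show ?thesis by simp qed
 have A: "rh e = (G y ** minv (L y)) *v ta e" if y: "y : N" "e : EE y" for y e
 proof -
  have y0: "y : M0" using y(1) EFD(1)[OF V] by (auto simp: N_def)
  obtain e' where e': "e' : EE (sgi t y)" "e = lm X e'" using lm_bij[OF t y0] y(2) unfolding bij_betw_def by blast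
  have "minv (L y) *v ta e = ss e'" using L(1)[of y e'] L(2)[of y] y e' by (simp add: N_def matrix_vector_mul_assoc matrix_inv_id)
  thus ?thesis using G(1)[of y e'] y e' by (simp add: N_def matrix_vector_mul_assoc[symmetric])
 qed
 have W': "wm rh ta y = G y ** minv (L y)" if y: "y : N" for y
  by (rule wmat_unique[OF t V0 _ A[OF y]]) (use y in \<open>auto simp: N_def\<close>)
 have xN: "x : N" using x W(2) by (simp add: N_def)
 show e: "rh e = wm rh ta x *v ta e" if "e : EE x" for e using A[OF xN that] W'[OF xN] by simp
 show "invertible (wm rh ta x)" by (rule matrix_bij_invertible[OF EF_bij[OF t V x(1)] EF_bij[OF t V0 x(2)] e])
 have "smat x (%y. minv (L y) $ k $ l)" for k l by (rule smat_matrix_inv[OF oN xN]) (use L(2,3) xN in \<open>auto simp: N_def\<close>)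
 hence "smat x (%y. SUM k:UNIV. G y $ i $ k * minv (L y) $ k $ j)" for i j
  by (intro smat_sum[OF x0] smat_mult) (use G(3) xN in \<open>auto simp: N_def\<close>)
 thus sw: "smat x (%y. wm rh ta y $ i $ j)" for i j by (rule smat_cong[OF oN xN, rotated]) (simp add: W' matrix_matrix_mult_def)
 show "dzbv c k x (%y. wm rh ta y $ i $ j) = 0" if c: "c : XC t" "x : fst c" for i j
 proof -
  let ?v = "dzbv c k x" note v = dzv_T(2)[OF t c]
  \<comment> \<open>Differentiating W L = G along an antiholomorphic coordinate vector leaves B L =
    0, and L is invertible.\<close>
  define B where "B = (\<chi> i j. ?v (%y. wm rh ta y $ i $ j))"
  have sL: "smat x (%y. L y $ i $ j)" for i j using L(3) x W(2) by blast
  have "(SUM k:UNIV. B $ i $ k * L x $ k $ j) = 0" for i j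
  proof -
   have "?v (%y. SUM k:UNIV. wm rh ta y $ i $ k * L y $ k $ j) = ?v (%y. G y $ i $ j)"
   proof (rule TD(6)[OF v oN xN]) fix y assume y: "y : N"
   have "wm rh ta y ** L y = G y" using W'[OF y] L(2)[of y] y by (simp add: N_def matrix_mul_assoc[symmetric] matrix_inv_id)
   thus "(SUM k:UNIV. wm rh ta y $ i $ k * L y $ k $ j) = G y $ i $ j" by (simp add: matrix_matrix_mult_def vec_eq_iff)
   qed also have "... = 0" using G(4) x W(2) c by blast
   finally have 0: "?v (%y. SUM k:UNIV. wm rh ta y $ i $ k * L y $ k $ j) = 0" .
   have "?v (%y. L y $ k $ j) = 0" for k using L(4) x W(2) c by blast
   thus ?thesis using 0 by (simp add: T_sum[OF v] smat_mult sw sL TD(4)[OF v] B_def) qed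
  hence "B ** L x = 0" by (simp add: vec_eq_iff matrix_matrix_mult_def)
  hence "(B ** L x) ** minv (L x) = 0" by (simp add: matrix_matrix_mult_def vec_eq_iff)
  hence "B = 0" using L(2) x W(2) by (simp add: matrix_mul_assoc[symmetric] matrix_inv_id)
  thus ?thesis by (simp add: B_def vec_eq_iff) qed
qed

end

section \<open>Linear structure of the fibres and smooth sections\<close>

context pair_family
begin

lemma efib_eqI:
 assumes "t : BX" "(V, ta) : EF t" "x : V" "e : EE x" "e' : EE x" "ta e = ta e'" shows "e = e'"
 using EF_bij[OF assms(1-3)] assms(4-6) unfolding bij_betw_def inj_on_def by blast

lemma efib_exists:
 assumes "t : BX" "(V, ta) : EF t" "x : V"
 obtains e where "e : EE x" "ta e = a"
proof -
 have "a : ta ` EE x" using EF_bij[OF assms] unfolding bij_betw_def by simp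
 thus thesis using that by blast
qed

lemma elin_props:
 assumes x: "x : M0" and u: "u : EE x" and v: "v : EE x"
 shows "elin X a u b v : EE x" "(V, ta) : EF 0 ==> x : V ==> ta (elin X a u b v) = a *s ta u + b *s ta v"
proof -
 have bu: "bproj X u = x" using u by (simp add: efib_def)
 obtain V0 ta0 where V0: "(V0, ta0) : EF 0" "x : V0" by (rule EF_at[OF base(2) x])
 obtain e where e: "e : EE x" "ta0 e = a *s ta0 u + b *s ta0 v" by (rule efib_exists[OF base(2) V0])
 have all: "ta e = a *s ta u + b *s ta v" if V: "(V, ta) : EF 0" "x : V" for V ta
  using wmat_holo(1)[OF base(2) V(1) V0(1) V(2) V0(2)] e u v by (simp add: matrix_vector_right_distrib vector_scalar_commute)
 have "elin X a u b v = e" unfolding elin_def bu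
 proof (rule the_equality)
  show "e : EE x & (ALL (V, ta):EF 0. x : V --> ta e = a *s ta u + b *s ta v)" using e(1) all by auto
  show "e' = e" if "e' : EE x & (ALL (V, ta):EF 0. x : V --> ta e' = a *s ta u + b *s ta v)" for e'
   by (rule efib_eqI[OF base(2) V0]) (use that e V0 in auto) qed
 thus "elin X a u b v : EE x" "(V, ta) : EF 0 ==> x : V ==> ta (elin X a u b v) = a *s ta u + b *s ta v" using e(1) all by auto
qed

lemma ssecD:
 assumes "smooth_section X U s" shows "nbhd U" "x : U ==> s x : EE x" "x : U ==> x : M0"
  "x : U ==> (V, ta) : EF 0 ==> x : V ==> smat x (%y. ta (s y) $ k)"
proof - show "nbhd U" "x : U ==> s x : EE x"
  "x : U ==> (V, ta) : EF 0 ==> x : V ==> smat x (%y. ta (s y) $ k)" using assms unfolding smooth_section_def by (auto, blast)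
 thus "x : U ==> x : M0" using openin_subset by fastforce
qed

lemma ssecI:
 assumes "nbhd U" "!!x. x : U ==> s x : EE x"
  "!!x V ta k. x : U ==> (V, ta) : EF 0 ==> x : V ==> smat x (%y. ta (s y) $ k)" shows "smooth_section X U s"
 using assms unfolding smooth_section_def by auto

lemma ssec_frameI:
 assumes "nbhd U" "(V, ta) : EF 0" "U <= V" "!!x. x : U ==> s x : EE x"
  "!!x k. x : U ==> smat x (%y. ta (s y) $ k)" shows "smooth_section X U s"
proof (rule ssecI[OF assms(1,4)])
 fix x V' ta' k assume x: "x : U" and V': "(V', ta') : EF 0" "x : V'"
 have x0: "x : M0" using V' EFD(1) by blast
 let ?N = "U Int V'"
 have N: "nbhd ?N" using assms(1) EF_open[OF base(2) V'(1)] by blast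
 have "smat x (%y. SUM l:UNIV. wm ta' ta y $ k $ l * ta (s y) $ l)"
  by (intro smat_sum[OF x0] smat_mult assms(5)[OF x] wmat_holo(3)[OF base(2) V'(1) assms(2) V'(2)]) (use x assms(3) in blast)
 thus "smat x (%y. ta' (s y) $ k)"
 proof (rule smat_cong[OF N, rotated 2]) fix y assume y: "y : ?N"
  hence "ta' (s y) = wm ta' ta y *v ta (s y)" using assms(3,4) by (intro wmat_holo(1)[OF base(2) V'(1) assms(2)]) auto
  thus "(SUM l:UNIV. wm ta' ta y $ k $ l * ta (s y) $ l) = ta' (s y) $ k" by (simp add: matrix_vector_mult_def)
 qed (use x V' in simp)
qed

lemma ssec_restrict:
 assumes "smooth_section X U s" "nbhd N" "N <= U" shows "smooth_section X N s" using assms unfolding smooth_section_def by blast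

lemma ssec_frame_vec: "(V, ta) : EF 0 ==> smooth_section X V (frame_vec X ta k)"
proof - assume V: "(V, ta) : EF 0" note o = EF_open[OF base(2) V] show ?thesis
 proof (rule ssec_frameI[OF o V order_refl frame_vec_in(1)[OF base(2) V]])
  fix x l assume x: "x : V"
  have x0: "x : M0" using x EFD(1)[OF V] by blast
  show "smat x (%y. ta (frame_vec X ta k y) $ l)" by (rule smat_cong[OF o x _ smat_const[OF x0, of "axis k 1 $ l"]])
   (simp add: frame_vec_in(2)[OF base(2) V]) qed
qed

end

section \<open>Connections in a local frame\<close>

locale pair_connection = pair_family X
 for X :: "('x::{t2_space,second_countable_topology}, 'n::{finite,linorder}, 'm::finite, 'e, 'r::finite) family" +
 fixes nab :: "('x => 'e) => 'x => 'x tvec => 'e"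
 assumes conn: "connection X nab"
begin

lemma connD:
 assumes "smooth_section X U s" "x : U" "v : TX x" shows "nab s x v : EE x"
  "w : TX x ==> nab s x (lc a v b w) = elin X a (nab s x v) b (nab s x w)"
  "smooth_section X U s' ==> (!!y. y : U ==> s y = s' y) ==> nab s x v = nab s' x v"
  "smooth_section X U s' ==> nab (%y. elin X 1 (s y) 1 (s' y)) x v = elin X 1 (nab s x v) 1 (nab s' x v)"
  "(!!y. y : U ==> smat y f) ==> nab (%y. elin X (f y) (s y) 0 (s y)) x v = elin X (v f) (s x) (f x) (nab s x v)"
proof -
 have *: "nab s x v : EE x & (ALL w:TX x. ALL a b.
   nab s x (%f. a * v f + b * w f) = elin X a (nab s x v) b (nab s x w)) & (ALL s'. smooth_section X U s' -->
   ((ALL y:U. s y = s' y) --> nab s x v = nab s' x v) &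
   nab (%y. elin X 1 (s y) 1 (s' y)) x v = elin X 1 (nab s x v) 1 (nab s' x v)) & (ALL f. (ALL y:U. smat y f) -->
   nab (%y. elin X (f y) (s y) 0 (s y)) x v = elin X (v f) (s x) (f x) (nab s x v))"
  using conn[unfolded connection_def, rule_format, OF assms(1), THEN conjunct1, rule_format, OF assms(2,3)] .
 show "nab s x v : EE x" using * by (elim conjE)
 show "w : TX x ==> nab s x (lc a v b w) = elin X a (nab s x v) b (nab s x w)"
  using * unfolding lc_def by (elim conjE) (drule bspec, assumption, elim allE)
 show "smooth_section X U s' ==> (!!y. y : U ==> s y = s' y) ==> nab s x v = nab s' x v"
  using *[THEN conjunct2, THEN conjunct2, THEN conjunct1, rule_format, of s'] by blast
 show "smooth_section X U s' ==> nab (%y. elin X 1 (s y) 1 (s' y)) x v = elin X 1 (nab s x v) 1 (nab s' x v)"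
  using *[THEN conjunct2, THEN conjunct2, THEN conjunct1, rule_format, of s'] by blast
 show "(!!y. y : U ==> smat y f) ==> nab (%y. elin X (f y) (s y) 0 (s y)) x v = elin X (v f) (s x) (f x) (nab s x v)"
  using *[THEN conjunct2, THEN conjunct2, THEN conjunct2, rule_format, of f] by blast
qed

definition cform :: "('e => complex^'r) => 'x => 'r => 'r => 'x tvec => complex" where
 "cform ta x k l v = ta (nab (frame_vec X ta k) x v) $ l"

lemma cform_linf:
 assumes "(V, ta) : EF 0" "x : V" shows "linform (TX x) (cform ta x k l)" unfolding linform_def cform_def
proof (intro ballI allI) fix v w a b assume v: "v : TX x" "w : TX x"
 note D = connD[OF ssec_frame_vec[OF assms(1)] assms(2)]
 have x0: "x : M0" using assms EFD(1) by blast
 show "ta (nab (frame_vec X ta k) x (lc a v b w)) $ l = a * ta (nab (frame_vec X ta k) x v) $ l + b * ta (nab (frame_vec X ta k) x w) $ l"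
  unfolding D(2)[OF v] elin_props(2)[OF x0 D(1)[OF v(1)] D(1)[OF v(2)] assms] by simp
qed

lemma theta_sum:
 assumes "(V, ta) : EF 0" "x : V" "t : BX" "c : XC t" "x : fst c"
 shows "(SUM i:UNIV. theta X nab c ta x i k l * dz c i v) = cform ta x k l (p10 c x v)"
proof -
 have "cform ta x k l (p10 c x v) = (SUM i:UNIV. dz c i v * cform ta x k l (dzv c i x))" unfolding p10_def
  by (rule linf_sum[OF TX_cspace[OF XC_fib0[OF assms(4,5)]] cform_linf[OF assms(1,2)] finite dzv_T(1)[OF assms(3-5)]])
 thus ?thesis by (simp add: theta_def cform_def mult.commute)
qed

text \<open>The axioms of a connection speak of sums of two sections and of multiples by functions.
  The section is therefore built up from its frame components one index at a time, and the formula
  is proved for all partial sums.\<close>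

lemma nab_frame:
 assumes S: "smooth_section X U S" "x : U" and V: "(V, ta) : EF 0" "x : V" and v: "v : TX x"
 shows "ta (nab S x v) $ l = v (%y. ta (S y) $ l) + (SUM m:UNIV. ta (S x) $ m * cform ta x m l v)"
proof -
 define N where "N = U Int V"
 have N: "nbhd N" "x : N" "N <= V" "N <= U" using ssecD(1)[OF S(1)] EF_open[OF base(2) V(1)] S V by (auto simp: N_def)
 have fib0: "y : M0" if "y : N" for y using that N(3) EFD(1)[OF V(1)] by blast
 have SN: "smooth_section X N S" by (rule ssec_restrict[OF S(1) N(1,4)])
 have eN: "smooth_section X N (frame_vec X ta m)" for m by (rule ssec_restrict[OF ssec_frame_vec[OF V(1)] N(1,3)])
 \<comment> \<open>The partial sum of the section over the frame indices in \<open>I\<close>, given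
   through its coordinates because the type of the total space carries no addition.\<close>
 define R where "R I y = iv (EE y) ta (\<chi> l. if l : I then ta (S y) $ l else 0)" for I y
 have R: "R I y : EE y" "ta (R I y) = (\<chi> l. if l : I then ta (S y) $ l else 0)" if "y : N" for I y
 proof -
  have "(\<chi> l. if l : I then ta (S y) $ l else 0) : ta ` EE y"
   using EF_bij[OF base(2) V(1), of y] that N(3) unfolding bij_betw_def by auto
  thus "R I y : EE y" "ta (R I y) = (\<chi> l. if l : I then ta (S y) $ l else 0)"
   unfolding R_def by (auto intro: inv_into_into f_inv_into_f) qed
 have Ssm: "smat y (%y. ta (S y) $ l)" if "y : N" for y l using ssecD(4)[OF SN that V(1)] that N(3) by blast
 have RN: "smooth_section X N (R I)" for I
 proof (rule ssec_frameI[OF N(1) V(1) N(3) R(1)]) fix y l assume y: "y : N"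
  have "smat y (%y. if l : I then ta (S y) $ l else 0)" using Ssm[OF y, of l] smat_const[OF fib0[OF y], of 0] by (cases "l : I") simp_all
  thus "smat y (%y. ta (R I y) $ l)" by (rule smat_cong[OF N(1) y, rotated]) (simp add: R(2))
 qed
 have x0: "x : M0" by (rule fib0[OF N(2)])
 have main: "ALL l. ta (nab (R I) x v) $ l = (if l : I then v (%y. ta (S y) $ l) else 0) + (SUM m:I. ta (S x) $ m * cform ta x m l v)"
  if "finite I" for I using that
 proof (induction I rule: finite_induct)
  case empty
  \<comment> \<open>The zero section is written as 0 times the given section, so that the Leibniz
    rule shows its derivative to be 0.\<close>
  have sZ: "smooth_section X N (%y. elin X 0 (S y) 0 (S y))"
  proof (rule ssec_frameI[OF N(1) V(1) N(3)]) fix y assume y: "y : N"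
   note Sy = ssecD(2)[OF SN y]
   show "elin X 0 (S y) 0 (S y) : EE y" by (rule elin_props(1)[OF fib0[OF y] Sy Sy]) fix l
   show "smat y (%y. ta (elin X 0 (S y) 0 (S y)) $ l)" by (rule smat_cong[OF N(1) y _ smat_const[OF fib0[OF y], of 0]])
   (use elin_props(2)[OF fib0 ssecD(2)[OF SN] ssecD(2)[OF SN] V(1)] N(3) in auto) qed
  have eq: "R {} y = elin X 0 (S y) 0 (S y)" if y: "y : N" for y
  proof (rule efib_eqI[OF base(2) V(1) subsetD[OF N(3) y] R(1)[OF y]])
   note Sy = ssecD(2)[OF SN y]
   show "elin X 0 (S y) 0 (S y) : EE y" by (rule elin_props(1)[OF fib0[OF y] Sy Sy])
   show "ta (R {} y) = ta (elin X 0 (S y) 0 (S y))"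
   unfolding R(2)[OF y] elin_props(2)[OF fib0[OF y] Sy Sy V(1) subsetD[OF N(3) y]] by (simp add: vec_eq_iff)
  qed
  have "nab (R {}) x v = nab (%y. elin X 0 (S y) 0 (S y)) x v" by (rule connD(3)[OF RN N(2) v sZ eq])
  also have "... = elin X (v (%_. 0)) (S x) 0 (nab S x v)" by (rule connD(5)[OF SN N(2) v]) (rule smat_const[OF fib0])
  also have "v (%_. 0) = 0" by (rule TD(5)[OF v])
  finally show ?case using elin_props(2)[OF x0 ssecD(2)[OF SN N(2)] connD(1)[OF SN N(2) v] V] by simp
 next
  case (insert m I)
  let ?g = "%y. elin X (ta (S y) $ m) (frame_vec X ta m y) 0 (frame_vec X ta m y)"
  have ev: "frame_vec X ta m y : EE y" "ta (frame_vec X ta m y) = axis m 1" if "y : N" for y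
   using frame_vec_in[OF base(2) V(1)] that N(3) by blast+
  have gin: "?g y : EE y" "ta (?g y) = ta (S y) $ m *s axis m 1" if y: "y : N" for y
   using elin_props(1)[OF fib0[OF y] ev(1)[OF y] ev(1)[OF y]]
   elin_props(2)[OF fib0[OF y] ev(1)[OF y] ev(1)[OF y] V(1) subsetD[OF N(3) y], of "ta (S y) $ m" 0] ev(2)[OF y] by simp_all
  have sg': "smooth_section X N ?g"
  proof (rule ssec_frameI[OF N(1) V(1) N(3) gin(1)]) fix y l assume y: "y : N"
   show "smat y (%y. ta (?g y) $ l)"
   by (rule smat_cong[OF N(1) y _ smat_mult[OF Ssm[OF y, of m] smat_const[OF fib0[OF y], of "axis m 1 $ l"]]]) (simp add: gin(2))
  qed
  let ?h = "%y. elin X 1 (R I y) 1 (?g y)"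
  have hin: "?h y : EE y" "ta (?h y) = ta (R I y) + ta (?g y)" if y: "y : N" for y
   using elin_props(1)[OF fib0[OF y] R(1)[OF y, of I] gin(1)[OF y]]
   elin_props(2)[OF fib0[OF y] R(1)[OF y, of I] gin(1)[OF y] V(1) subsetD[OF N(3) y], of 1 1] by simp_all
  have sh: "smooth_section X N ?h"
  proof (rule ssec_frameI[OF N(1) V(1) N(3) hin(1)]) fix y l assume y: "y : N"
   have yV: "y : V" using y N(3) by blast show "smat y (%y. ta (?h y) $ l)"
   by (rule smat_cong[OF N(1) y _ smat_add[OF ssecD(4)[OF RN y V(1) yV, of I l] ssecD(4)[OF sg' y V(1) yV, of l]]]) (simp add: hin(2))
  qed
  have eq: "R (insert m I) y = ?h y" if y: "y : N" for y
  proof (rule efib_eqI[OF base(2) V(1) subsetD[OF N(3) y] R(1)[OF y] hin(1)[OF y]])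
   show "ta (R (insert m I) y) = ta (?h y)"
   unfolding hin(2)[OF y] gin(2)[OF y] R(2)[OF y] using insert(2) by (auto simp: vec_eq_iff axis_def)
  qed
  have "nab (R (insert m I)) x v = nab ?h x v" by (rule connD(3)[OF RN N(2) v sh eq])
  also have "... = elin X 1 (nab (R I) x v) 1 (nab ?g x v)" by (rule connD(4)[OF RN N(2) v sg'])
  also have "nab ?g x v = elin X (v (%y. ta (S y) $ m)) (frame_vec X ta m x) (ta (S x) $ m) (nab (frame_vec X ta m) x v)"
   by (rule connD(5)[OF eN N(2) v]) (rule Ssm)
  finally have *: "nab (R (insert m I)) x v = elin X 1 (nab (R I) x v) 1
   (elin X (v (%y. ta (S y) $ m)) (frame_vec X ta m x) (ta (S x) $ m) (nab (frame_vec X ta m) x v))" .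
  note e1 = elin_props[OF x0 ev(1)[OF N(2)] connD(1)[OF eN N(2) v]]
  note e2 = elin_props(2)[OF x0 connD(1)[OF RN N(2) v] e1(1) V] show ?case
  proof fix l
   have "ta (nab (R (insert m I)) x v) $ l = ta (nab (R I) x v) $ l + (v (%y. ta (S y) $ m) * axis m 1 $ l
   + ta (S x) $ m * cform ta x m l v)" unfolding * e2 e1(2)[OF V] ev(2)[OF N(2)] by (simp add: cform_def)
   thus "ta (nab (R (insert m I)) x v) $ l = (if l : insert m I then v (%y. ta (S y) $ l) else 0) +
   (SUM m:insert m I. ta (S x) $ m * cform ta x m l v)" using insert by (auto simp: axis_def)
  qed qed
 have "R UNIV y = S y" if y: "y : N" for y
  by (rule efib_eqI[OF base(2) V(1) subsetD[OF N(3) y] R(1)[OF y] ssecD(2)[OF SN y]]) (simp add: R(2)[OF y] vec_eq_iff)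
 hence "nab (R UNIV) x v = nab S x v" by (rule connD(3)[OF RN N(2) v SN])
 thus ?thesis using main[of UNIV] by simp
qed

end

context pair_family
begin

section \<open>Small deformations\<close>

text \<open>Since \<open>G\<close> is holomorphic, its chain rule involves the components of
  \<open>g\<close> but not their conjugates, for complex vectors \<open>v\<close> as well.\<close>

lemma holo_chain:
 assumes G: "open O1" "holo_on O1 G" and g: "!!l. smat x (%y. g y $ l)" "g x : O1" and v: "v : TX x" shows "smat x (%y. G (g y))"
  "v (%y. G (g y)) = (SUM l:UNIV. fder G (g x) (axis l 1) * v (%y. g y $ l))"
proof -
 have x0: "x : M0" by (rule TD(1)[OF v])
 obtain U z where U: "(U, z) : XC 0" "x : U" by (rule XC_exist[OF base(2) x0])
 note CU = XC_coord[OF base(2) U(1)]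
 have "EX N. nbhd N & x : N & N <= U & (ALL l. smo (z ` N) ((%y. g y $ l) o iv U z))"
 proof -
  have "ALL l. EX N. nbhd N & x : N & N <= U & smo (z ` N) ((%y. g y $ l) o iv U z)" using g(1) unfolding smat_iff[OF base(2) U] by blast
  then obtain N where N: "!!l. nbhd (N l) & x : N l & N l <= U & smo (z ` N l) ((%y. g y $ l) o iv U z)" by metis
  let ?N = "\<Inter>l. N l"
  have oN: "nbhd ?N" by (rule openin_INT2) (use N in auto)
  have sub: "?N <= U" using N by blast
  have "smo (z ` ?N) ((%y. g y $ l) o iv U z)" for l by (rule so_subset[of "z ` N l"]) (use N oN sub cc_open_image[OF CU] in auto)
  thus ?thesis using oN sub N by blast qed
 then obtain N where N: "nbhd N" "x : N" "N <= U" "!!l. smo (z ` N) ((%y. g y $ l) o iv U z)" by blast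
 have oz: "open (z ` N)" by (rule cc_open_image[OF CU N(1,3)])
 have sg: "smo (z ` N) (g o iv U z)" by (rule so_vec[OF oz]) (use N(4) in \<open>simp add: o_def\<close>)
 have zx: "z x : z ` N" "iv U z (z x) = x" using N(2) ccD(5)[OF CU U(2)] by auto
 let ?S = "(g o iv U z) -` O1 Int z ` N"
 have oS: "open ?S" using continuous_on_open_vimage[OF oz] so_imp_continuous_on[OF sg] G(1) by blast
 have "smo ?S (%u. G ((g o iv U z) u))" by (rule so_compose[OF oS G(1) ho_imp_so[OF G] so_subset[OF sg oz oS]]) auto
 hence sGg: "smo ?S ((%y. G (g y)) o iv U z)" by (simp add: o_def)
 have "nbhd (U Int z -` ?S)" by (rule cc_vimage[OF CU oS])
 moreover have "z ` (U Int z -` ?S) = ?S" using N(3) by auto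
 moreover have "x : U Int z -` ?S" using U(2) zx g(2) by auto
 ultimately show sm: "smat x (%y. G (g y))" unfolding smat_iff[OF base(2) U] using sGg by (metis inf_le1)
 have dg: "((g o iv U z) has_derivative (%a. \<chi> l. ddr (U, z) x a (%y. g y $ l))) (at (z x))"
  by (rule has_derivative_vec) (use dd_has_derivative[OF base(2) U g(1)] in \<open>simp add: o_def\<close>)
 have dd: "ddr (U, z) x a (%y. G (g y)) = (SUM l:UNIV. fder G (g x) (axis l 1) * ddr (U, z) x a (%y. g y $ l))" for a
 proof -
  have "(G o (g o iv U z) has_derivative
   fder G (g x) o (%a. \<chi> l. ddr (U, z) x a (%y. g y $ l))) (at (z x))"
   by (rule diff_chain_at[OF dg]) (use ho_derivative(1)[OF G(2) g(2)] zx in simp)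
  hence "ddr (U, z) x a (%y. G (g y)) = fder G (g x) (\<chi> l. ddr (U, z) x a (%y. g y $ l))"
   using dd_eq[of "%y. G (g y)" U z _ x a] by (simp add: o_def)
  thus ?thesis unfolding ho_derivative_sum[OF G(2) g(2), of "\<chi> l. ddr (U, z) x a (%y. g y $ l)"] by (simp add: mult.commute)
 qed
 obtain a b where vr: "v = rv (U, z) x a b" using v T_iff_rv[OF base(2) U(1)] U(2) by auto
 show "v (%y. G (g y)) = (SUM l:UNIV. fder G (g x) (axis l 1) * v (%y. g y $ l))"
  unfolding vr rv_def using sm g(1) by (simp add: dd sum_distrib_left sum.distrib[symmetric] algebra_simps)
qed

text \<open>Transversality of the types: at no point is a nonzero (1,0)-vector of X_0 of type (0,1)
  on X_t.\<close>

definition good :: "complex^'m => bool" where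
 "good t \<longleftrightarrow> t : BX & (ALL x. ALL c:XC 0. ALL d:XC t. x : fst c --> x : fst d -->
   (ALL v:TX x. (ALL i. dzb c i v = 0) --> (ALL k. dz d k v = 0) --> v = (%_. 0)))"

lemma T_zero_chart:
 assumes "t : BX" "c : XC t" "d : XC t" "x : fst c" "x : fst d" "v : TX x"
 shows "(ALL i. dzb c i v = 0) ==> dzb d j v = 0" "(ALL i. dz c i v = 0) ==> dz d j v = 0"
proof - assume "ALL i. dzb c i v = 0" hence "p01 c x v = (%_. 0)" by (simp add: p01_def)
 hence "p01 d x v = (%_. 0)" using p10_indep(2)[OF assms] by simp
 thus "dzb d j v = 0" using p10_dz(4)[OF assms(1,3,5), of j v] by (simp add: dzb_def)
next assume "ALL i. dz c i v = 0" hence "p10 c x v = (%_. 0)" by (simp add: p10_def)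
 hence "p10 d x v = (%_. 0)" using p10_indep(1)[OF assms] by simp
 thus "dz d j v = 0" using p10_dz(1)[OF assms(1,3,5), of j v] by (simp add: dz_def)
qed

text \<open>Charts of X_t are not given as a family continuous in \<open>t\<close>, so the condition
  is tested on the ambient coordinates \<open>H t\<close> of the trivialized fibre. A (0,1)-vector
  of X_t kills them, while a (1,0)-vector of X_0 with coefficients \<open>a\<close> takes the values
  \<open>Nn\<close> times \<open>a\<close>. The square matrix \<open>Q\<close> is the identity at
  the centre, hence invertible nearby, and \<open>a\<close> = 0.\<close>

lemma good_local:
 assumes x0: "x0 : M0"
 obtains S T where "nbhd S" "x0 : S" "open T" "0 : T" "T <= BX"
  "ALL t x c d v. t : T --> x : S --> c : XC 0 --> d : XC t --> x : fst c --> x : fst d -->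
   v : TX x --> (ALL i. dzb c i v = 0) --> (ALL k. dz d k v = 0) --> v = (%_. 0)"
proof -
 obtain V w where V: "(V, w) : XC 0" "x0 : V" by (rule XC_exist[OF base(2) x0])
 obtain W Z where W: "(W, Z) : charts X" "x0 : W" by (rule charts_cover)
 have V0: "(V, w) : FC 0" using V(1) XC_zero by blast note CV = XC_coord[OF base(2) V(1)]
 have sgi0: "sgi 0 y = y" if "y : M0" for y using sgi_sg[OF that] sg_fib0[OF that] by simp
 obtain O1 F where O1: "open O1" "Z x0 : O1" "O1 <= Z ` W" "hmap O1 F"
  "!!y. y : V ==> y : W ==> Z y : O1 ==> F (Z y) = w y" using fibre_chart_factor[OF V0 V(2) W] by blast
 define D where "D = {(u, t). u : w ` V & t : BX & sgi t (iv V w u) : W}"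
 define f where "f = (%(u, t). Z (sgi t (iv V w u)))"
 have oD: "open D" unfolding D_def by (rule sgi_chart_domain_open[OF V(1) charts_open[OF W(1)]])
 have sf: "smo D f" unfolding D_def f_def by (rule sgi_smooth[OF W(1) V0])
 \<comment> \<open>The derivative of the l-th ambient coordinate by w^i at parameter
   \<open>t\<close>, read off from the joint derivative in (u, t) so that it is continuous in
   both.\<close>
 define Nn where "Nn p l i = (fder f p (axis i 1, 0) $ l - \<i> * fder f p (axis i \<i>, 0) $ l) / 2"
  for p :: "(complex, 'n) vec \<times> (complex, 'm) vec" and l i
 define H where "H t l y = Z (sgi t y) $ l" for t l y
 have Hdz: "smat x (H t l) & dzv (V, w) i x (H t l) = Nn (w x, t) l i" if x: "x : V" and p: "(w x, t) : D" for x t l i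
 proof -
  have t: "t : BX" using p by (simp add: D_def)
  have inv: "iv V w (w x) = x" by (rule ccD(5)[OF CV x])
  define j where "j u = (u, t)" for u :: "(complex, 'n) vec"
  have dj: "(j has_derivative (%a. (a, 0))) (at u)" for u
   unfolding j_def by (intro has_derivative_Pair has_derivative_ident has_derivative_const)
  have cj: "cont UNIV j" unfolding j_def by (intro continuous_intros)
  have oj: "open (j -` D)" by (rule open_vimage[OF oD cj])
  have sj: "smo S j" if "open S" for S
  proof -
   have "smo S (%u. (%u. (u, 0)) u + (0, t))" by (intro so_add so_const so_bounded_linear that bounded_linear_Pair
   bounded_linear_ident bounded_linear_zero)
   moreover have "j = (%u. (%u. (u, 0)) u + (0, t))" by (simp add: j_def fun_eq_iff)
   ultimately show ?thesis by simp qed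
  have "smo (j -` D) (%u. f (j u))" by (rule so_compose[OF oj oD sf sj[OF oj]]) auto
  hence s1: "smo (j -` D) (%u. f (j u) $ l)" by (rule so_vec_nth[OF oj])
  let ?N = "V Int w -` (j -` D)"
  have oN: "nbhd ?N" by (rule cc_vimage[OF CV oj])
  have im: "w ` ?N = j -` D" by (auto simp: j_def D_def)
  have fH: "f (j u) $ l = (H t l o iv V w) u" for u by (simp add: f_def j_def H_def)
  have "smo (w ` ?N) (H t l o iv V w)" using s1 unfolding im fH .
  hence sH: "smat x (H t l)" unfolding smat_iff[OF base(2) V(1) x] using oN x p by (intro exI[of _ ?N]) (auto simp: j_def)
  have "((%u. f (j u)) has_derivative (%a. fder f (w x, t) (a, 0))) (at (w x))"
   using diff_chain_at[OF dj[of "w x"], of f "fder f (w x, t)"] so_has_derivative[OF sf oD p] by (simp add: o_def j_def)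
  hence "((%u. f (j u) $ l) has_derivative (%a. fder f (w x, t) (a, 0) $ l)) (at (w x))"
   by (rule bounded_linear.has_derivative[OF bounded_linear_vec_nth])
  hence "((H t l o iv V w) has_derivative (%a. fder f (w x, t) (a, 0) $ l)) (at (w x))" unfolding fH by (simp add: o_def)
  hence "ddr (V, w) x a (H t l) = fder f (w x, t) (a, 0) $ l" for a by (rule dd_eq)
  thus ?thesis using sH by (simp add: dz_vec_def Nn_def) qed
 define L where "L k l = fder (%u. F u $ k) (Z x0) (axis l 1)" for k l
 \<comment> \<open>The derivative \<open>L\<close> of the extended chart \<open>F\<close> is frozen
   at \<open>x0\<close>; it only cuts the rectangular matrix \<open>Nn\<close> down to a square one,
   which at (x0, 0) is the derivative of \<open>F\<close> o \<open>Z\<close> = \<open>w\<close> by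
   \<open>w\<close>.\<close>
 define Q where "Q p = (\<chi> k i. SUM l:UNIV. L k l * Nn p l i)" for p
 have p0: "(w x0, 0) : D" using V W sgi0[OF x0] ccD(5)[OF CV V(2)] base(2) by (auto simp: D_def)
 have Q0: "Q (w x0, 0) = mat 1"
 proof -
  have "(SUM l:UNIV. L k l * Nn (w x0, 0) l i) = (if k = i then 1 else 0)" for k i
  proof -
   let ?v = "dzv (V, w) i x0" and ?g = "%y. Z (sgi 0 y)"
   have v: "?v : TX x0" using dzv_T(1)[OF base(2) V(1)] V(2) by simp
   have hF: "holo_on O1 (%u. F u $ k)" using O1(4) unfolding holo_map_on_def by blast
   have sm: "smat x0 (%y. ?g y $ l)" for l using Hdz[OF V(2) p0, of l] by (simp add: H_def[abs_def])
   have gx: "?g x0 = Z x0" using sgi0[OF x0] by simp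
   have oN: "nbhd (V Int (W Int Z -` O1))" using ccD(1)[OF CV] cc_vimage[OF charts_coord[OF W(1)] O1(1)] by (simp add: openin_Int_open)
   have "(SUM l:UNIV. L k l * Nn (w x0, 0) l i) = ?v (%y. F (?g y) $ k)"
   using holo_chain(2)[OF O1(1) hF sm _ v] O1(2) Hdz[OF V(2) p0] gx by (simp add: L_def H_def[abs_def])
   also have "... = ?v (%y. w y $ k)"
   proof (rule TD(6)[OF v oN]) show "x0 : V Int (W Int Z -` O1)" using V W O1(2) by simp
   show "F (?g y) $ k = w y $ k" if "y : V Int (W Int Z -` O1)" for y using that O1(5)[of y] sgi0[of y] ccD(8)[OF CV] by auto
   qed
   also have "... = (if k = i then 1 else 0)" using coord_dual(1)[OF base(2) V(1), of x0 k i] V(2) by (simp add: dz_def)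
   finally show ?thesis . qed thus ?thesis by (simp add: Q_def mat_def vec_eq_iff) qed
 have cN: "cont D (%p. Nn p l i)" for l i unfolding Nn_def
  by (intro continuous_intros bounded_linear.continuous_on[OF bounded_linear_vec_nth]
   so_imp_continuous_on[OF so_fder[OF sf]]) auto
 have cQ: "cont D (%p. det (Q p))" unfolding det_def Q_def by (simp, intro continuous_intros cN)
 define O2 where "O2 = (%p. det (Q p)) -` (- {0}) Int D"
 have oO2: "open O2" unfolding O2_def using continuous_on_open_vimage[OF oD] cQ by blast
 have "(w x0, 0) : O2" using p0 Q0 by (simp add: O2_def det_I)
 then obtain A B where AB: "open A" "open B" "w x0 : A" "0 : B" "A \<times> B <= O2" using open_prod_elim[OF oO2] by (metis mem_Sigma_iff)
 define S where "S = V Int w -` A"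
 have oS: "nbhd S" unfolding S_def by (rule cc_vimage[OF CV AB(1)]) show thesis
 proof (rule that[of S "B Int BX"]; (intro allI impI)?)
  show "nbhd S" "x0 : S" "open (B Int BX)" "0 : B Int BX" "B Int BX <= BX" using oS V(2) AB base by (auto simp: S_def)
  fix t x c d v
  assume t: "t : B Int BX" and x: "x : S" and c: "c : XC 0" and d: "d : XC t"
   and xc: "x : fst c" and xd: "x : fst d" and v: "v : TX x" and v01: "ALL i. dzb c i v = 0" and vd: "ALL k. dz d k v = 0"
  have tb: "t : BX" using t by blast
  have xV: "x : V" and p: "(w x, t) : O2" using x t AB(5) by (auto simp: S_def)
  hence pD: "(w x, t) : D" and det: "det (Q (w x, t)) ~= 0" by (auto simp: O2_def)
  have v01': "dzb (V, w) i v = 0" for i using T_zero_chart(1)[OF base(2) c V(1) xc _ v v01] xV by simp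
  have sW: "sgi t x : W" using pD ccD(5)[OF CV xV] by (simp add: D_def)
  have xf: "x : M0" using XC_fib0[OF c xc] .
  obtain Ud zd where dd: "d = (Ud, zd)" by (cases d) note dU = d[unfolded dd]
  note DU = XCD[OF dU] and CU = XC_coord[OF tb dU]
  let ?U = "fib X t Int sg X -` Ud" note FU = FCD[OF DU(2)]
  \<comment> \<open>In coordinates of X_t the ambient coordinates are holomorphic functions, so a
    vector on which all dz_t vanish kills them.\<close>
  have vH: "v (H t l) = 0" for l
  proof -
   define T where "T = (zd o sg X) ` (?U Int W)"
   have oT: "open T" unfolding T_def by (rule cc_open_image[OF FU(1) openin_Int_open[OF ccD(1)[OF FU(1)] charts_open[OF W(1)]]]) auto
   have hG: "holo_on T (%u. (Z o iv ?U (zd o sg X)) u $ l)" using FU(2)[OF W(1)] unfolding T_def holo_map_on_def by blast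
   have gx: "zd x : T" unfolding T_def using sW sgi_in[OF tb xf] xd dd by (intro image_eqI[of _ _ "sgi t x"]) auto
   have sm: "smat x (%y. zd y $ k)" for k using coord_smooth[OF tb d xd] dd by simp
   have "v (%y. (Z o iv ?U (zd o sg X)) (zd y) $ l) = 0" unfolding holo_chain(2)[OF oT hG sm gx v] using vd dd by (simp add: dz_def)
   moreover have "v (H t l) = v (%y. (Z o iv ?U (zd o sg X)) (zd y) $ l)"
   proof (rule TD(6)[OF v ccD(1)[OF CU]]) show "x : Ud" using xd dd by simp
   fix y assume y: "y : Ud"
   hence "iv ?U (zd o sg X) (zd y) = sgi t (iv Ud zd (zd y))" by (intro XC_inv_hat[OF tb dU]) auto
   thus "H t l y = (Z o iv ?U (zd o sg X)) (zd y) $ l" using ccD(5)[OF CU y] by (simp add: H_def)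
   qed ultimately show ?thesis by simp qed
  define a where "a = (\<chi> i. dz (V, w) i v)"
  have "(SUM i:UNIV. Nn (w x, t) l i * a $ i) = 0" for l
  proof -
   have "v (H t l) = (SUM i:UNIV. dz (V, w) i v * dzv (V, w) i x (H t l) + dzb (V, w) i v * dzbv (V, w) i x (H t l))"
   using fun_cong[OF T_decomp[OF base(2) V(1) _ v]] xV by simp
   thus ?thesis using vH[of l] v01' Hdz[OF xV pD] by (simp add: a_def mult.commute) qed
  note Na = this
  have "(Q (w x, t) *v a) $ k = 0" for k
  proof -
   have "(Q (w x, t) *v a) $ k = (SUM i:UNIV. SUM l:UNIV. L k l * (Nn (w x, t) l i * a $ i))"
   by (simp add: matrix_vector_mult_def Q_def sum_distrib_right mult.assoc)
   also have "... = (SUM l:UNIV. L k l * (SUM i:UNIV. Nn (w x, t) l i * a $ i))" by (subst sum.swap) (simp add: sum_distrib_left)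
   finally show ?thesis by (simp add: Na) qed
  hence "Q (w x, t) *v a = 0" by (simp add: vec_eq_iff)
  moreover have "invertible (Q (w x, t))" using det by (simp add: invertible_det_nz)
  ultimately have "a = 0" by (metis invertible_left_inverse matrix_vector_mul_assoc matrix_vector_mul_lid matrix_vector_mult_0_right)
  hence "dz (V, w) i v = 0" for i by (simp add: a_def vec_eq_iff)
  thus "v = (%_. 0)" using T_decomp[OF base(2) V(1) _ v] v01' xV by simp qed
qed

text \<open>Properness makes X_0 compact, so finitely many of the local neighbourhoods suffice and
  their parameter sets can be intersected.\<close>

lemma good_nhd: "EX \<Delta>. open \<Delta> & 0 : \<Delta> & \<Delta> <= BX & (ALL t:\<Delta>. good t)"
proof -
 define P where "P S T \<longleftrightarrow> nbhd S & open T & 0 : T & T <= BX &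
  (ALL t x c d v. t : T --> x : S --> c : XC 0 --> d : XC t --> x : fst c --> x : fst d -->
   v : TX x --> (ALL i. dzb c i v = 0) --> (ALL k. dz d k v = 0) --> v = (%_. 0))" for S T
 have ex: "EX S T. x0 : S & P S T" if x0: "x0 : M0" for x0 unfolding P_def by (rule good_local[OF x0]) (intro exI conjI; assumption)
 then obtain S T where ST: "!!x0. x0 : M0 ==> x0 : S x0 & P (S x0) (T x0)" by metis
 have "compact (M0)" using proj_proper[of "{0}"] base(2) by (simp add: fib_def)
 moreover have "EX S'. open S' & S x0 = M0 Int S'" if "x0 : M0" for x0 using ST[OF that] unfolding P_def openin_open by blast
 then obtain S' where S': "!!x0. x0 : M0 ==> open (S' x0) & S x0 = M0 Int S' x0" by metis
 moreover have "M0 <= (\<Union>x0\<in>fib X 0. S' x0)" using S' ST by blast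
 ultimately obtain C where C: "C <= M0" "finite C" "M0 <= (\<Union>x0\<in>C. S' x0)" using compactE_image[of "M0" "M0" S'] by metis
 define \<Delta> where "\<Delta> = BX Int (\<Inter>x0\<in>C. T x0)"
 have "open \<Delta>" unfolding \<Delta>_def using C(1,2) ST base(1) by (intro open_Int open_INT) (auto simp: P_def)
 moreover have "0 : \<Delta>" unfolding \<Delta>_def using C(1) ST base(2) by (auto simp: P_def)
 moreover have "good t" if t: "t : \<Delta>" for t unfolding good_def
 proof (intro conjI allI ballI impI) show "t : BX" using t by (simp add: \<Delta>_def)
  fix x c d v assume *: "c : XC 0" "d : XC t" "x : fst c" "x : fst d" "v : TX x"
   "ALL i. dzb c i v = 0" "ALL k. dz d k v = 0"
  have "x : M0" by (rule XC_fib0[OF *(1,3)])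
  then obtain x0 where x0: "x0 : C" "x : S' x0" using C(3) by blast
  hence "x : S x0" using S' C(1) \<open>x : fib X 0\<close> by blast
  moreover have "t : T x0" using t x0(1) by (simp add: \<Delta>_def)
  moreover have "P (S x0) (T x0)" using ST x0(1) C(1) by blast
  ultimately show "v = (%_. 0)" using * unfolding P_def by blast qed
 moreover have "\<Delta> <= BX" by (simp add: \<Delta>_def)
 ultimately show ?thesis by blast
qed

end

context pair_family
begin

subsection \<open>The Beltrami differential\<close>

text \<open>A vector field near \<open>x\<close>, smooth at \<open>x\<close> in the sense that it
  maps functions smooth at \<open>x\<close> to such functions. Only its germ at \<open>x\<close>
  matters.\<close>

definition sfield :: "'x => ('x => 'x tvec) => bool" where
 "sfield x F \<longleftrightarrow> (EX N. nbhd N & x : N & (ALL y:N. F y : TX y)) & (ALL f. smat x f --> smat x (%y. F y f))"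

lemma sfieldD:
 assumes "sfield x F" shows "F x : TX x" "smat x f ==> smat x (%y. F y f)" using assms unfolding sfield_def by blast+

lemma sfield_coord:
 assumes "sfield x F" "t : BX" "c : XC t" "x : fst c" shows "smat x (%y. dz c i (F y))" "smat x (%y. dzb c i (F y))"
 unfolding dz_def dzb_def using assms by (auto intro!: sfieldD(2)[OF assms(1)] coord_smooth smat_cnj)

lemma sfieldI:
 assumes "nbhd N" "x : N" "!!y. y : N ==> F y : TX y"
  "!!f. smat x f ==> smat x (%y. F y f)" shows "sfield x F" unfolding sfield_def using assms by blast

lemma sfield_vec:
 assumes "t : BX" "c : XC t" "x : fst c" shows "sfield x (vext c v)" "sfield x (dzv c i)" "sfield x (dzbv c i)"
 by (rule sfieldI[OF XC_open[OF assms(1,2)] assms(3)],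
   auto intro: vext_T[OF assms(1,2)] vext_smooth[OF assms] dzv_T[OF assms(1,2)]
   T_apply_smooth[OF assms])+

lemma sfield_sum:
 assumes t: "t : BX" "c : XC t" "x : fst c" and ab: "!!i. smat x (a i)" "!!i. smat x (b i)"
 shows "sfield x (%y f. SUM i:UNIV. a i y * dzv c i y f + b i y * dzbv c i y f)"
proof (rule sfieldI[OF XC_open[OF t(1,2)] t(3)])
 show "(%f. SUM i:UNIV. a i y * dzv c i y f + b i y * dzbv c i y f) : TX y" if y: "y : fst c" for y by (rule T_basis[OF t(1,2) y])
 show "smat x (%y. SUM i:UNIV. a i y * dzv c i y f + b i y * dzbv c i y f)" if f: "smat x f" for f
  by (intro smat_sum smat_add smat_mult ab T_apply_smooth[OF t f] XC_fib0[OF t(2,3)])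
qed

lemma sfield_cong:
 assumes "nbhd N" "x : N" "!!y. y : N ==> F y = G y" "sfield x F" shows "sfield x G"
proof -
 obtain N' where N': "nbhd N'" "x : N'" "ALL y:N'. F y : TX y" using assms(4) unfolding sfield_def by blast
 show ?thesis
 proof (rule sfieldI[of "N Int N'"])
  show "nbhd (N Int N')" "x : N Int N'" using assms(1,2) N' by auto
  show "G y : TX y" if y: "y : N Int N'" for y using assms(3)[of y] N'(3) y by auto
  show "smat x (%y. G y f)" if f: "smat x f" for f by (rule smat_cong[OF assms(1,2) _ sfieldD(2)[OF assms(4) f]]) (simp add: assms(3))
 qed
qed

lemma sfield_p:
 assumes F: "sfield x F" and t: "t : BX" "c : XC t" "x : fst c"
 shows "sfield x (%y. p10 c y (F y))" "sfield x (%y. p01 c y (F y))"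
proof - note z = smat_const[OF XC_fib0[OF t(2,3)], of 0] and sm = sfield_coord[OF F t]
 show "sfield x (%y. p10 c y (F y))" using sfield_sum[OF t, of "%i y. dz c i (F y)" "%i y. 0"] sm z by (simp add: p10_def[abs_def])
 show "sfield x (%y. p01 c y (F y))" using sfield_sum[OF t, of "%i y. 0" "%i y. dzb c i (F y)"] sm z by (simp add: p01_def[abs_def])
qed

lemma sfield_lc:
 assumes F: "sfield x F" and G: "sfield x G" shows "sfield x (%y. lc a (F y) b (G y))"
proof -
 obtain N where N: "nbhd N" "x : N" "ALL y:N. F y : TX y" using F unfolding sfield_def by blast
 obtain N' where N': "nbhd N'" "x : N'" "ALL y:N'. G y : TX y" using G unfolding sfield_def by blast
 show ?thesis
 proof (rule sfieldI[of "N Int N'"])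
  show "nbhd (N Int N')" "x : N Int N'" using N N' by auto
  show "lc a (F y) b (G y) : TX y" if y: "y : N Int N'" for y
  proof -
   have T: "F y : TX y" "G y : TX y" using N(3) N'(3) y by auto
   show ?thesis using TX_cspace[OF TD(1)[OF T(1)]] T unfolding cspace_def by blast qed
  show "smat x (%y. lc a (F y) b (G y) f)" if f: "smat x f" for f
   unfolding lc_def by (intro smat_add smat_scale sfieldD(2)[OF F f] sfieldD(2)[OF G f])
 qed
qed

lemma zero_T: "x : M0 ==> (%_. 0) : TX x" using TX_cspace unfolding cspace_def by blast

lemma lc_T: "v : TX x ==> w : TX x ==> lc a v b w : TX x" using TX_cspace[OF TD(1)] unfolding cspace_def by blast

lemma dz_lc: "dz c i (lc a v b w) = a * dz c i v + b * dz c i w" "dzb c i (lc a v b w) = a * dzb c i v + b * dzb c i w"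
 by (simp_all add: dz_def dzb_def lc_def)

lemma pr10_eq:
 assumes "c : XC 0" "x : fst c" "v : TX x" shows "pr10 X x v = p10 c x v" unfolding pr10_def
proof (rule the_equality)
 show "ALL c':XC 0. x : fst c' --> p10 c x v = (%f. SUM i:UNIV. dz c' i v * dzv c' i x f)"
  using p10_indep(1)[OF base(2) assms(1) _ assms(2) _ assms(3)] unfolding p10_def by blast
 show "!!u. ALL c':XC 0. x : fst c' --> u = (%f. SUM i:UNIV. dz c' i v * dzv c' i x f) ==> u = p10 c x v"
  using assms(1,2) unfolding p10_def by blast
qed

end

locale good_fibre = pair_family X
 for X :: "('x::{t2_space,second_countable_topology}, 'n::{finite,linorder}, 'm::finite, 'e, 'r::finite) family" +
 fixes t :: "(complex, 'm) vec"
 assumes good: "good t"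
begin

abbreviation "pht \<equiv> phi X t"

lemma tb: "t : BX" using good unfolding good_def by blast

lemma good_zero:
 assumes "c : XC 0" "d : XC t" "x : fst c" "x : fst d" "v : TX x"
  "!!i. dzb c i v = 0" "!!k. dz d k v = 0" shows "v = (%_. 0)" using good assms unfolding good_def by blast

lemma good_eq:
 assumes "c : XC 0" "d : XC t" "x : fst c" "x : fst d" "v : TX x" "w : TX x"
  "!!i. dzb c i v = dzb c i w" "!!k. dz d k v = dz d k w" shows "v = w"
proof -
 have "lc 1 v (-1) w = (%_. 0)" by (rule good_zero[OF assms(1-4) lc_T[OF assms(5,6)]]) (simp_all add: dz_lc assms(7,8))
 thus ?thesis by (simp add: lc_def fun_eq_iff)
qed

definition phic :: "('x, 'n) chart => ('x, 'n) chart => 'x => 'x tvec => 'x tvec" where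
 "phic d c x v = (%f. SUM i:UNIV. SUM j:UNIV. phi_coeff X d c x $ i $ j * dzb c j v * dzv c i x f)"

context
 fixes c d x
 assumes c: "c : XC 0" and d: "d : XC t" and xc: "x : fst c" and xd: "x : fst d"
begin

lemma x_fib0: "x : M0" by (rule XC_fib0[OF c xc])

text \<open>A kernel vector is the coefficient vector of a (1,0)-vector of X_0 on which all dz_t
  vanish; it is zero by \<open>good_zero\<close>.\<close>

lemma invertible_dzd: "invertible (\<chi> k i. dzv c i x (%y. snd d y $ k) :: ((complex, 'n) vec, 'n) vec)"
proof -
 let ?M = "\<chi> k i. dzv c i x (%y. snd d y $ k) :: ((complex, 'n) vec, 'n) vec"
 have "a = 0" if a: "?M *v a = 0" for a
 proof -
  let ?v = "%f. SUM i:UNIV. a $ i * dzv c i x f + 0 * dzbv c i x f"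
  have dzd: "dz d k ?v = 0" for k
  proof -
   have "(?M *v a) $ k = 0" using a by simp
   thus ?thesis by (simp add: matrix_vector_mult_def dz_def mult.commute) qed
  have "?v = (%_. 0)" by (rule good_zero[OF c d xc xd T_basis[OF base(2) c xc]])
   (use dz_basis_sum(2)[OF base(2) c xc, of _ "%i. a $ i" "%_. 0"] dzd in simp_all)
  hence "dz c i ?v = dz c i (%_. 0)" for i by (rule arg_cong)
  hence "a $ i = 0" for i using dz_basis_sum(1)[OF base(2) c xc, of i "%i. a $ i" "%_. 0"] by (simp add: dz_def)
  thus ?thesis by (simp add: vec_eq_iff) qed
 thus ?thesis unfolding invertible_left_inverse matrix_left_invertible_ker by blast
qed

lemma phic_eq: "phic d c x v = (%f. SUM i:UNIV. (SUM j:UNIV. phi_coeff X d c x $ i $ j * dzb c j v) * dzv c i x f + 0 * dzbv c i x f)"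
 by (simp add: phic_def sum_distrib_right)

text \<open>The last equation is the content of the coordinate formula: v^{01} - \<phi> v is of type
  (0,1) on X_t. By \<open>good_eq\<close> these properties determine \<phi> v, which makes the
  formula independent of both charts.\<close>

lemma phic_props:
 "phic d c x v : TX x" "dzb c i (phic d c x v) = 0" "dz d k (phic d c x v) = dz d k (p01 c x v)"
proof - show "phic d c x v : TX x" unfolding phic_eq by (rule T_basis[OF base(2) c xc])
 show "dzb c i (phic d c x v) = 0" unfolding phic_eq by (rule dz_basis_sum(2)[OF base(2) c xc])
 let ?M = "\<chi> k i. dzv c i x (%y. snd d y $ k) :: ((complex, 'n) vec, 'n) vec"
 let ?N = "\<chi> k j. dzbv c j x (%y. snd d y $ k) :: ((complex, 'n) vec, 'n) vec"
 let ?b = "\<chi> j. dzb c j v"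
 have "dz d k (phic d c x v) = (?M *v (phi_coeff X d c x *v ?b)) $ k"
  unfolding phic_eq by (simp add: dz_def matrix_vector_mult_def mult.commute)
 also have "?M *v (phi_coeff X d c x *v ?b) = ?N *v ?b"
  unfolding phi_coeff_def by (simp add: matrix_vector_mul_assoc matrix_mul_assoc matrix_inv_id(1)[OF invertible_dzd])
 also have "(?N *v ?b) $ k = dz d k (p01 c x v)" by (simp add: matrix_vector_mult_def dz_def p01_def mult.commute)
 finally show "dz d k (phic d c x v) = dz d k (p01 c x v)" .
qed

end

lemma phi_eq_phic:
 assumes "c : XC 0" "d : XC t" "x : fst c" "x : fst d" "v : TX x" shows "pht x v = phic d c x v" unfolding phi_def phic_def[symmetric]
proof (rule the_equality)
 show "ALL d':XC t. ALL c':XC 0. x : fst d' Int fst c' --> phic d c x v = phic d' c' x v"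
 proof (intro ballI impI)
  fix d' c' assume d': "d' : XC t" and c': "c' : XC 0" and "x : fst d' Int fst c'"
  hence xd': "x : fst d'" and xc': "x : fst c'" by auto
  note P = phic_props[OF assms(1-4), where v=v] and P' = phic_props[OF c' d' xc' xd', where v=v]
  show "phic d c x v = phic d' c' x v"
  proof (rule good_eq[OF assms(1-4) P(1) P'(1)])
   show "dzb c i (phic d c x v) = dzb c i (phic d' c' x v)" for i
   unfolding P(2) by (rule T_zero_chart(1)[OF base(2) c' assms(1) xc' assms(3) P'(1), symmetric]) (simp add: P'(2))
   fix k
   have p: "p01 c' x v = p01 c x v" using p10_indep(2)[OF base(2) c' assms(1) xc' assms(3,5)] .
   have "dz d k (lc 1 (phic d' c' x v) (-1) (p01 c' x v)) = 0"
   by (rule T_zero_chart(2)[OF tb d' assms(2) xd' assms(4) lc_T[OF P'(1) p10_T(2)[OF base(2) c' xc']]]) (simp add: dz_lc P'(3))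
   thus "dz d k (phic d c x v) = dz d k (phic d' c' x v)" by (simp add: dz_lc P(3) p) qed
 qed
qed (use assms(1-4) in blast)

text \<open>The (0,1)-vector of X_t with the same (0,1)-part on X_0 as \<open>v\<close>. By
  \<open>p10_indep\<close> any chart of X_0 at \<open>x\<close> may be chosen.\<close>

definition Dop :: "'x => 'x tvec => 'x tvec" where
 "Dop x v = lc 1 (p01 (SOME c. c : XC 0 & x : fst c) x v) (-1) (pht x v)"

text \<open>On a (0,1)-vector of X_t the inner sum vanishes and the last term is its (0,1)-part on
  X_0. On a (1,0)-vector of X_t the last term vanishes and the inner sum is the (1,0)-vector of X_0
  with the same values of dz_t.\<close>

definition Aop :: "'x => 'x tvec => 'x tvec" where
 "Aop x v = lc 1 (lc 1 (p10 (SOME c. c : XC 0 & x : fst c) x v) 1 (pht x v))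
   1 (p01 (SOME c. c : XC 0 & x : fst c) x (p01 (SOME d. d : XC t & x : fst d) x v))"

definition Ainv :: "'x => 'x tvec => 'x tvec" where
 "Ainv x w = lc 1 (p10 (SOME d. d : XC t & x : fst d) x (p10 (SOME c. c : XC 0 & x : fst c) x w)) 1 (Dop x w)"

context
 fixes c d x
 assumes c: "c : XC 0" and d: "d : XC t" and xc: "x : fst c" and xd: "x : fst d"
begin

private lemma some_chart:
 "(SOME c. c : XC 0 & x : fst c) : XC 0" "x : fst (SOME c. c : XC 0 & x : fst c)"
 "(SOME c. c : XC t & x : fst c) : XC t" "x : fst (SOME c. c : XC t & x : fst c)"
 by (rule conjunct1[OF someI[of "%c. c : XC 0 & x : fst c", OF conjI[OF c xc]]],
   rule conjunct2[OF someI[of "%c. c : XC 0 & x : fst c", OF conjI[OF c xc]]],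
   rule conjunct1[OF someI[of "%c. c : XC t & x : fst c", OF conjI[OF d xd]]],
   rule conjunct2[OF someI[of "%c. c : XC t & x : fst c", OF conjI[OF d xd]]])

private lemma some_p:
 assumes "v : TX x"
 shows "p10 (SOME c. c : XC 0 & x : fst c) x v = p10 c x v" "p01 (SOME c. c : XC 0 & x : fst c) x v = p01 c x v"
  "p10 (SOME c. c : XC t & x : fst c) x v = p10 d x v" "p01 (SOME c. c : XC t & x : fst c) x v = p01 d x v"
 by (rule p10_indep[OF base(2) some_chart(1) c some_chart(2) xc assms] p10_indep[OF tb some_chart(3) d some_chart(4) xd assms])+

lemma phi_props:
 assumes v: "v : TX x" shows "pht x v : TX x" "dzb c i (pht x v) = 0" "dz d k (pht x v) = dz d k (p01 c x v)"
 using phic_props[OF c d xc xd, where v=v] by (simp_all add: phi_eq_phic[OF c d xc xd v])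

lemma phi_eqI:
 assumes "v : TX x" "w : TX x" "!!j. dzb c j v = dzb c j w" shows "pht x v = pht x w"
 by (simp add: phi_eq_phic[OF c d xc xd] assms phic_def)

lemma phi_lc:
 assumes "v : TX x" "w : TX x" shows "pht x (lc a v b w) = lc a (pht x v) b (pht x w)"
 unfolding phi_eq_phic[OF c d xc xd assms(1)] phi_eq_phic[OF c d xc xd assms(2)] phi_eq_phic[OF c d xc xd lc_T[OF assms]] phic_def dz_lc
 by (simp add: lc_def fun_eq_iff sum.distrib sum_distrib_left algebra_simps)

lemma phi_zero:
 assumes "v : TX x" "!!j. dzb c j v = 0" shows "pht x v = (%_. 0)" by (simp add: phi_eq_phic[OF c d xc xd] assms phic_def)

lemma phi_phi: "v : TX x ==> pht x (pht x v) = (%_. 0)" by (rule phi_zero) (simp_all add: phi_props)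

lemma p10_phi: "v : TX x ==> p10 c x (pht x v) = pht x v" by (rule T_eqI[OF base(2) c xc p10_T(1)[OF base(2) c xc] phi_props(1)])
  (simp_all add: p10_dz[OF base(2) c xc] phi_props)

lemma Dop_eq: "v : TX x ==> Dop x v = lc 1 (p01 c x v) (-1) (pht x v)" by (simp add: Dop_def some_p)

lemma Dop_props:
 assumes v: "v : TX x"
 shows "Dop x v : TX x" "dzb c j (Dop x v) = dzb c j v" "dz d k (Dop x v) = 0" "dz c i (Dop x v) = - dz c i (pht x v)"
proof -
 show "Dop x v : TX x" unfolding Dop_eq[OF v] by (rule lc_T[OF p10_T(2)[OF base(2) c xc] phi_props(1)[OF v]])
 show "dzb c j (Dop x v) = dzb c j v" "dz d k (Dop x v) = 0" "dz c i (Dop x v) = - dz c i (pht x v)"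
  unfolding Dop_eq[OF v] dz_lc phi_props(2,3)[OF v] p10_dz(3,4)[OF base(2) c xc] by simp_all
qed

lemma Dop_eqI:
 assumes "v : TX x" "w : TX x" "!!j. dzb c j v = dzb c j w" shows "Dop x v = Dop x w"
 unfolding Dop_eq[OF assms(1)] Dop_eq[OF assms(2)] phi_eqI[OF assms] by (simp add: p01_def assms(3))

lemma Dop_T01:
 assumes "v : TX x" "!!k. dz d k v = 0" shows "Dop x v = v"
 by (rule good_eq[OF c d xc xd Dop_props(1)[OF assms(1)] assms(1)]) (simp_all add: Dop_props[OF assms(1)] assms(2))

lemma Aop_eq:
 assumes v: "v : TX x" shows "Aop x v = lc 1 (lc 1 (p10 c x v) 1 (pht x v)) 1 (p01 c x (p01 d x v))"
 by (simp add: Aop_def some_p v p10_T[OF tb d xd])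

lemma Aop_props:
 assumes v: "v : TX x"
 shows "Aop x v : TX x" "dz c i (Aop x v) = dz c i v + dz c i (pht x v)" "dzb c j (Aop x v) = dzb c j (p01 d x v)"
 unfolding Aop_eq[OF v] by (intro lc_T p10_T[OF base(2) c xc] phi_props(1)[OF v])
  (simp_all only: dz_lc p10_dz[OF base(2) c xc] phi_props(2)[OF v] mult_1 add_0_right add_0_left mult_zero_right)

lemma Aop_lc:
 assumes v: "v : TX x" and w: "w : TX x" shows "Aop x (lc a v b w) = lc a (Aop x v) b (Aop x w)"
 unfolding Aop_eq[OF v] Aop_eq[OF w] Aop_eq[OF lc_T[OF v w]] phi_lc[OF v w] p10_lc by (simp add: lc_def fun_eq_iff algebra_simps)

text \<open>Both sides are (0,1)-vectors of X_t with equal (0,1)-parts on X_0. This turns the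
  direction in which \<open>dbar X t\<close> differentiates into D of the transported vector A
  v.\<close>

lemma p01_Dop:
 assumes v: "v : TX x" shows "p01 d x v = Dop x (Aop x v)"
proof - note p = p10_T(2)[OF tb d xd, of v]
 have "p01 d x v = Dop x (p01 d x v)" by (rule Dop_T01[OF p, symmetric]) (simp add: p10_dz[OF tb d xd])
 also have "... = Dop x (Aop x v)" by (rule Dop_eqI[OF p Aop_props(1)[OF v]]) (simp add: Aop_props[OF v])
 finally show ?thesis .
qed

lemma p10_Aop: "v : TX x ==> p10 c x (Aop x v) = lc 1 (p10 c x v) 1 (pht x v)"
 by (rule T_eqI[OF base(2) c xc p10_T(1)[OF base(2) c xc] lc_T[OF p10_T(1)[OF base(2) c xc] phi_props(1)]])
  (simp_all add: p10_dz[OF base(2) c xc] Aop_props dz_lc phi_props)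

lemma dz_Aop:
 assumes v: "v : TX x" shows "dz d k v = dz d k (p10 c x (Aop x v))"
proof -
 have "dz d k v = dz d k (lc 1 (p10 c x v) 1 (p01 c x v))" using p10_add[OF base(2) c xc v] by simp
 thus ?thesis by (simp add: p10_Aop[OF v] dz_lc phi_props[OF v])
qed

lemma p10_eqI:
 assumes "v : TX x" "w : TX x" "!!k. dz d k (p10 c x v) = dz d k (p10 c x w)" shows "dz c i v = dz c i w"
proof -
 have "p10 c x v = p10 c x w" by (rule good_eq[OF c d xc xd p10_T(1)[OF base(2) c xc] p10_T(1)[OF base(2) c xc]])
   (simp_all add: p10_dz[OF base(2) c xc] assms(3))
 thus ?thesis using p10_dz(1)[OF base(2) c xc] by metis
qed

lemma Ainv_eq:
 assumes w: "w : TX x" shows "Ainv x w = lc 1 (p10 d x (p10 c x w)) 1 (Dop x w)" by (simp add: Ainv_def some_p w p10_T[OF base(2) c xc])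

lemma Ainv_props:
 assumes w: "w : TX x" shows "Ainv x w : TX x" "dz d k (Ainv x w) = dz d k (p10 c x w)" "p01 d x (Ainv x w) = Dop x w"
  "Aop x (Ainv x w) = w"
proof - note D = Dop_props[OF w]
 show T: "Ainv x w : TX x" unfolding Ainv_eq[OF w] by (intro lc_T p10_T[OF tb d xd] D(1))
 show dA: "dz d k (Ainv x w) = dz d k (p10 c x w)" for k unfolding Ainv_eq[OF w] by (simp add: dz_lc p10_dz[OF tb d xd] D)
 show pA: "p01 d x (Ainv x w) = Dop x w" by (rule T_eqI[OF tb d xd p10_T(2)[OF tb d xd] D(1)])
   (simp_all add: p10_dz[OF tb d xd] D Ainv_eq[OF w] dz_lc) show "Aop x (Ainv x w) = w"
 proof (rule T_eqI[OF base(2) c xc Aop_props(1)[OF T] w])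
  show "dz c i (Aop x (Ainv x w)) = dz c i w" for i by (rule p10_eqI[OF Aop_props(1)[OF T] w]) (simp add: dz_Aop[OF T, symmetric] dA)
  show "dzb c i (Aop x (Ainv x w)) = dzb c i w" for i by (simp add: Aop_props[OF T] pA D)
 qed
qed

lemma Ainv_Aop:
 assumes v: "v : TX x" shows "Ainv x (Aop x v) = v"
proof (rule T_eqI[OF tb d xd Ainv_props(1)[OF Aop_props(1)[OF v]] v])
 note w = Aop_props(1)[OF v]
 show "dz d i (Ainv x (Aop x v)) = dz d i v" for i by (simp add: Ainv_props[OF w] dz_Aop[OF v])
 have "p01 d x (Ainv x (Aop x v)) = p01 d x v" by (simp add: Ainv_props[OF w] p01_Dop[OF v])
 thus "dzb d i (Ainv x (Aop x v)) = dzb d i v" for i using p10_dz(4)[OF tb d xd] by metis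
qed

lemma Aop_type:
 assumes v: "v : TX x" shows "(!!k. dz d k v = 0) ==> dz c i (Aop x v) = 0" "(!!k. dzb d k v = 0) ==> dzb c i (Aop x v) = 0"
proof - assume z: "!!k. dz d k v = 0"
 have "p10 c x (%_. 0) = (%_. 0)" "dz d k (%_. 0) = 0" for k by (simp_all add: p10_def dz_def)
 hence "dz c i (Aop x v) = dz c i (%_. 0)" by (intro p10_eqI[OF Aop_props(1)[OF v] zero_T[OF TD(1)[OF v]]])
   (simp add: dz_Aop[OF v, symmetric] z) thus "dz c i (Aop x v) = 0" by (simp add: dz_def)
next assume "!!k. dzb d k v = 0" hence "p01 d x v = (%_. 0)" by (simp add: p01_def)
 thus "dzb c i (Aop x v) = 0" unfolding Aop_props(3)[OF v] by (simp add: dzb_def)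
qed

lemma Ainv_type:
 assumes w: "w : TX x" shows "(!!k. dz c k w = 0) ==> dz d i (Ainv x w) = 0" "(!!k. dzb c k w = 0) ==> dzb d i (Ainv x w) = 0"
proof - assume "!!k. dz c k w = 0" hence "p10 c x w = (%_. 0)" by (simp add: p10_def)
 thus "dz d i (Ainv x w) = 0" unfolding Ainv_props(2)[OF w] by (simp add: dz_def)
next assume z: "!!k. dzb c k w = 0"
 have "Dop x w = (%_. 0)" by (simp add: Dop_eq[OF w] phi_zero[OF w z] p01_def z lc_def)
 hence "dzb d i (p01 d x (Ainv x w)) = 0" unfolding Ainv_props(3)[OF w] by (simp add: dzb_def)
 thus "dzb d i (Ainv x w) = 0" unfolding p10_dz(4)[OF tb d xd] .
qed

text \<open>On (1,0)-vectors of X_0 the map D vanishes, so \<open>Ainv\<close> is there the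
  projection to the (1,0)-part on X_t. This matches the \<open>p\<close> covector arguments on the
  two sides of the equation defining P_t.\<close>

lemma Aop_p10: "u : TX x ==> Aop x (p10 d x (p10 c x u)) = p10 c x u"
proof - assume u: "u : TX x"
 let ?p = "p10 c x u" note p = p10_T(1)[OF base(2) c xc, of u]
 have "p10 c x ?p = ?p" by (rule T_eqI[OF base(2) c xc p10_T(1)[OF base(2) c xc] p]) (simp_all add: p10_dz[OF base(2) c xc])
 moreover have "Dop x ?p = (%_. 0)"
  unfolding Dop_eq[OF p] phi_zero[OF p p10_dz(2)[OF base(2) c xc]] by (simp add: p01_def lc_def p10_dz(2)[OF base(2) c xc])
 ultimately have "Ainv x ?p = p10 d x ?p" unfolding Ainv_eq[OF p] by (simp add: lc_def)
 thus ?thesis using Ainv_props(4)[OF p] by simp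
qed

lemma p10_p10_Aop:
 assumes v: "v : TX x" and z: "!!k. dzb d k v = 0" shows "p10 d x (p10 c x (Aop x v)) = v"
 by (rule T_eqI[OF tb d xd p10_T(1)[OF tb d xd] v]) (simp_all add: p10_dz[OF tb d xd] dz_Aop[OF v, symmetric] z)

end

context
 fixes c d x
 assumes c: "c : XC 0" and d: "d : XC t" and xc: "x : fst c" and xd: "x : fst d"
begin

lemma phi_coeff_smooth: "smat x (%y. phi_coeff X d c y $ i $ j)"
proof -
 let ?N = "fst c Int fst d"
 have N: "nbhd ?N" "x : ?N" using XC_open[OF base(2) c] XC_open[OF tb d] xc xd by auto
 note cs = T_apply_smooth[OF base(2) c xc coord_smooth[OF tb d xd]]
 have "smat x (%y. minv (\<chi> k i. dzv c i y (%y. snd d y $ k) :: ((complex, 'n) vec, 'n) vec) $ a $ b)" for a b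
  by (rule smat_matrix_inv[OF N]) (auto intro: invertible_dzd[OF c d] cs)
 thus ?thesis unfolding phi_coeff_def matrix_matrix_mult_def by (simp, intro smat_sum smat_mult x_fib0[OF c d xc xd] cs)
qed

lemma sfield_phi:
 assumes F: "sfield x F" shows "sfield x (%y. pht y (F y))"
proof -
 obtain N where N: "nbhd N" "x : N" "ALL y:N. F y : TX y" using F unfolding sfield_def by blast
 let ?N = "fst c Int fst d Int N"
 have N': "nbhd ?N" "x : ?N" using N XC_open[OF base(2) c] XC_open[OF tb d] xc xd by auto
 have x0: "x : M0" by (rule x_fib0[OF c d xc xd])
 have "sfield x (%y f. SUM i:UNIV. (SUM j:UNIV. phi_coeff X d c y $ i $ j * dzb c j (F y)) * dzv c i y f + 0 * dzbv c i y f)"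
  by (rule sfield_sum[OF base(2) c xc]) (intro smat_sum smat_mult phi_coeff_smooth sfield_coord[OF F base(2) c xc] smat_const x0)+
 thus ?thesis by (rule sfield_cong[OF N', rotated]) (use N(3) in \<open>auto simp: phi_eq_phic[OF c d] phic_eq[OF c d]\<close>)
qed

lemma sfield_Aop:
 assumes F: "sfield x F" shows "sfield x (%y. Aop y (F y))"
proof -
 obtain N where N: "nbhd N" "x : N" "ALL y:N. F y : TX y" using F unfolding sfield_def by blast
 let ?N = "fst c Int fst d Int N"
 have N': "nbhd ?N" "x : ?N" using N XC_open[OF base(2) c] XC_open[OF tb d] xc xd by auto
 have "sfield x (%y. lc 1 (lc 1 (p10 c y (F y)) 1 (pht y (F y))) 1 (p01 c y (p01 d y (F y))))"
  by (intro sfield_lc sfield_p[OF F base(2) c xc] sfield_phi[OF F] sfield_p(2)[OF sfield_p(2)[OF F tb d xd] base(2) c xc])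
 thus ?thesis by (rule sfield_cong[OF N', rotated]) (use N(3) in \<open>auto simp: Aop_eq[OF c d]\<close>)
qed

end

end

context pair_family
begin

subsection \<open>Smooth alternating forms\<close>

text \<open>A smooth scalar \<open>k\<close>-form near \<open>x\<close>. Smoothness is tested on all
  smooth fields, not only on coordinate fields, so that it survives the insertion of \<phi> or A
  into a slot.\<close>

definition aform :: "'x => nat => ('x => 'x tvec list => complex) => bool" where
 "aform x k ss \<longleftrightarrow> (EX N. nbhd N & x : N & (ALL y:N. altern (TX y) k (ss y))) &
   (ALL Fs. length Fs = k --> (ALL F:set Fs. sfield x F) --> smat x (%y. ss y (map (%F. F y) Fs)))"

lemma aformD:
 assumes "aform x k ss" shows "altern (TX x) k (ss x)"
  "length Fs = k ==> (!!F. F : set Fs ==> sfield x F) ==> smat x (%y. ss y (map (%F. F y) Fs))" using assms unfolding aform_def by blast+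

lemma aform_nbhd:
 assumes "aform x k ss"
 obtains N where "nbhd N" "x : N" "ALL y:N. altern (TX y) k (ss y)" using assms unfolding aform_def by blast

lemma sfields_nbhd:
 assumes "x : M0" "!!F. F : set Fs ==> sfield x F" shows "EX N. nbhd N & x : N & (ALL y:N. ALL F:set Fs. F y : TX y)" using assms(2)
proof (induction Fs)
 case Nil show ?case using assms(1) by (intro exI[of _ "M0"]) auto
next
 case (Cons F Fs)
 obtain N where N: "nbhd N" "x : N" "ALL y:N. ALL F:set Fs. F y : TX y" using Cons.IH Cons.prems by auto
 obtain N' where N': "nbhd N'" "x : N'" "ALL y:N'. F y : TX y" using Cons.prems[of F] unfolding sfield_def by auto
 show ?case using N N' by (intro exI[of _ "N Int N'"]) auto
qed

lemma aform_cong: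
 assumes N: "nbhd N" "x : N" "!!y vs. y : N ==> set vs <= TX y ==> length vs = k ==> ss y vs = ss' y vs"
  and ss: "aform x k ss" shows "aform x k ss'"
proof -
 have fib0: "y : M0" if "y : N" for y using openin_subset[OF N(1)] that by auto
 obtain N' where N': "nbhd N'" "x : N'" "ALL y:N'. altern (TX y) k (ss y)" by (rule aform_nbhd[OF ss])
 show ?thesis unfolding aform_def
 proof (intro conjI allI impI exI[of _ "N Int N'"])
  show "nbhd (N Int N')" "x : N Int N'" using N N' by auto
  show "ALL y:N Int N'. altern (TX y) k (ss' y)"
  proof fix y assume y: "y : N Int N'"
   hence a: "altern (TX y) k (ss y)" and c: "cspace (TX y)" using N'(3) fib0 TX_cspace by auto
   show "altern (TX y) k (ss' y)" by (rule alt_cong[OF _ a c]) (use N(3) y in auto) qed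
  fix Fs assume Fs: "length Fs = k" "ALL F:set Fs. sfield x F"
  obtain N2 where N2: "nbhd N2" "x : N2" "ALL y:N2. ALL F:set Fs. F y : TX y" using sfields_nbhd[OF fib0[OF N(2)], of Fs] Fs(2) by auto
  show "smat x (%y. ss' y (map (%F. F y) Fs))"
  proof (rule smat_cong[of "N Int N2"])
   show "nbhd (N Int N2)" "x : N Int N2" using N N2 by auto
   show "ss y (map (%F. F y) Fs) = ss' y (map (%F. F y) Fs)" if y: "y : N Int N2" for y by (rule N(3)) (use y N2(3) Fs(1) in auto)
   show "smat x (%y. ss y (map (%F. F y) Fs))" by (rule aformD(2)[OF ss Fs(1)]) (use Fs(2) in auto)
  qed qed
qed

lemma aform_lincomb:
 assumes "aform x k ss" "aform x k ss'" "smat x f" "smat x g"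
 shows "aform x k (%y vs. f y * ss y vs + g y * ss' y vs)"
proof -
 obtain N where N: "nbhd N" "x : N" "ALL y:N. altern (TX y) k (ss y)" by (rule aform_nbhd[OF assms(1)])
 obtain N' where N': "nbhd N'" "x : N'" "ALL y:N'. altern (TX y) k (ss' y)" by (rule aform_nbhd[OF assms(2)])
 show ?thesis unfolding aform_def
 proof (intro conjI allI impI exI[of _ "N Int N'"])
  show "nbhd (N Int N')" "x : N Int N'" using N N' by auto
  show "ALL y:N Int N'. altern (TX y) k (%vs. f y * ss y vs + g y * ss' y vs)" using N(3) N'(3) by (auto intro: alt_lincomb)
  show "smat x (%y. f y * ss y (map (%F. F y) Fs) + g y * ss' y (map (%F. F y) Fs))" if "length Fs = k" "ALL F:set Fs. sfield x F" for Fs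
   using that by (intro smat_add smat_mult assms(3,4) aformD(2)[OF assms(1)] aformD(2)[OF assms(2)]) auto
 qed
qed

lemma aform_zero: "x : M0 ==> aform x k (%y vs. 0)" unfolding aform_def altern_def by (auto intro!: exI[of _ "M0"] smat_const)

lemma aform_sum:
 assumes x: "x : M0" and "finite I" "!!i. i : I ==> aform x k (ss i)" "!!i. i : I ==> smat x (f i)"
 shows "aform x k (%y vs. SUM i:I. f i y * ss i y vs)" using assms(2-)
proof (induction I rule: finite_induct)
 case empty show ?case using aform_zero[OF x] by simp
next
 case (insert i I)
 have "aform x k (%y vs. f i y * ss i y vs + (%_. 1) y * (SUM i:I. f i y * ss i y vs))"
  by (rule aform_lincomb) (use insert in \<open>auto intro: smat_const x\<close>)
 thus ?case using insert.hyps by simp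
qed

lemma smat_wedges:
 assumes x: "x : M0" "!!aa F. aa : set aas ==> F : set Fs ==> smat x (%y. aa (F y))"
 shows "smat x (%y. wgs aas (map (%F. F y) Fs))" using assms(2)
proof (induction aas arbitrary: Fs)
 case Nil show ?case using smat_const[OF x(1)] by simp
next
 case (Cons aa aas)
 have sub: "set (take j Fs @ drop (Suc j) Fs) <= set Fs" for j using set_take_subset[of j Fs] set_drop_subset[of "Suc j" Fs] by auto
 have "smat x (%y. wgs aas (map (%F. F y) (take j Fs @ drop (Suc j) Fs)))" for j by (rule Cons.IH) (use Cons.prems sub[of j] in auto)
 hence "smat x (%y. SUM j<length Fs. (-1) ^ j * aa ((Fs ! j) y) * wgs aas (map (%F. F y) (take j Fs @ drop (Suc j) Fs)))"
  by (intro smat_sum[OF x(1)] smat_mult smat_const[OF x(1)] Cons.prems) auto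
 thus ?case unfolding wedges_Cons wedge_def by (simp add: take_map drop_map)
qed

lemma aform_wedges:
 assumes t: "t : BX" "c : XC t" "x : fst c" and k: "length J + length I = k" shows "aform x k (%y. wgs (dzs c J I))" unfolding aform_def
proof (intro conjI allI impI exI[of _ "fst c"]) note x0 = XC_fib0[OF t(2)]
 show "nbhd (fst c)" "x : fst c" using XC_open[OF t(1,2)] t(3) by auto
 have "altern (TX y) (length (dzs c J I)) (wgs (dzs c J I))" if "y : fst c" for y
  by (rule alt_wedges[OF TX_cspace[OF x0[OF that]]]) (auto intro: linf_dz)
 thus "ALL y:fst c. altern (TX y) k (wgs (dzs c J I))" using k by simp
 show "smat x (%y. wgs (dzs c J I) (map (%F. F y) Fs))" if "length Fs = k" "ALL F:set Fs. sfield x F" for Fs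
  by (rule smat_wedges[OF x0[OF t(3)]]) (use that sfield_coord[OF _ t] in auto)
qed

text \<open>The derivative at \<open>x\<close> of the field \<open>F\<close> in direction
  \<open>u\<close> for the flat connection of the chart \<open>c\<close>: the coefficients are
  differentiated.\<close>

definition fd :: "('x, 'n) chart => 'x => 'x tvec => ('x => 'x tvec) => 'x tvec" where
 "fd c x u F = (%f. SUM i:UNIV. u (%y. dz c i (F y)) * dzv c i x f + u (%y. dzb c i (F y)) * dzbv c i x f)"

context
 fixes t c x
 assumes t: "t : BX" and c: "c : XC t" and x: "x : fst c"
begin

private lemma x0: "x : M0" by (rule XC_fib0[OF c x])

lemma slot_expand:
 assumes a: "altern (TX x) k aa" "set us <= TX x" "set ws <= TX x" "length us + length ws + 1 = k" "v : TX x"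
 shows "aa (us @ v # ws) = (SUM i:UNIV. dz c i v * aa (us @ dzv c i x # ws) + dzb c i v * aa (us @ dzbv c i x # ws))"
proof - note p = p10_T[OF t c x, of v]
 have "aa (us @ v # ws) = aa (us @ lc 1 (p10 c x v) 1 (p01 c x v) # ws)" using p10_add[OF t c x a(5)] by simp
 also have "... = aa (us @ p10 c x v # ws) + aa (us @ p01 c x v # ws)" using alt_lc[OF a(1-3) p a(4), of 1 1] by simp
 also have "aa (us @ p10 c x v # ws) = (SUM i:UNIV. dz c i v * aa (us @ dzv c i x # ws))"
  unfolding p10_def by (rule alt_sum_slot[OF TX_cspace[OF x0] a(1-4) finite dzv_T(1)[OF t c x]])
 also have "aa (us @ p01 c x v # ws) = (SUM i:UNIV. dzb c i v * aa (us @ dzbv c i x # ws))"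
  unfolding p01_def by (rule alt_sum_slot[OF TX_cspace[OF x0] a(1-4) finite dzv_T(2)[OF t c x]])
 finally show ?thesis by (simp add: sum.distrib)
qed

lemma fd_props:
 "fd c x u F : TX x" "dz c i (fd c x u F) = u (%y. dz c i (F y))" "dzb c i (fd c x u F) = u (%y. dzb c i (F y))"
 unfolding fd_def by (rule T_basis[OF t c x] dz_basis_sum[OF t c x])+

end

context
 fixes t c x
 assumes t: "t : BX" and c: "c : XC t" and x: "x : fst c"
begin

private lemma x0': "x : M0" by (rule XC_fib0[OF c x])

text \<open>The field in the slot is expanded in coordinate vectors. Differentiating its
  coefficients gives the \<open>fd\<close> term; freezing them at \<open>x\<close> gives the
  constant extension.\<close>

lemma slot_deriv:
 assumes ss: "aform x k ss" and u: "u : TX x" and F: "sfield x F"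
  and Fs: "!!F. F : set Fs ==> sfield x F" and Gs: "!!F. F : set Gs ==> sfield x F" and k: "length Fs + length Gs + 1 = k"
 shows "u (%y. ss y (map (%F. F y) Fs @ F y # map (%F. F y) Gs)) =
  u (%y. ss y (map (%F. F y) Fs @ vext c (F x) y # map (%F. F y) Gs)) +
  ss x (map (%F. F x) Fs @ fd c x u F # map (%F. F x) Gs)"
proof -
 define P where "P H y = ss y (map (%F. F y) Fs @ H y # map (%F. F y) Gs)" for H y
 have Psm: "smat x (P H)" if H: "sfield x H" for H
 proof -
  have "smat x (%y. ss y (map (%F. F y) (Fs @ H # Gs)))" by (rule aformD(2)[OF ss]) (use k Fs Gs H in auto)
  thus ?thesis by (simp add: P_def[abs_def]) qed
 obtain N where N: "nbhd N" "x : N" "ALL y:N. altern (TX y) k (ss y)" by (rule aform_nbhd[OF ss])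
 let ?E = "%i y. P (dzv c i) y" and ?Eb = "%i y. P (dzbv c i) y"
 have E: "smat x (?E i)" "smat x (?Eb i)" for i by (rule Psm sfield_vec[OF t c x])+
 have exp: "u (P H) = (SUM i:UNIV. (u (%y. dz c i (H y)) * ?E i x + dz c i (H x) * u (?E i)) +
   (u (%y. dzb c i (H y)) * ?Eb i x + dzb c i (H x) * u (?Eb i)))" if H: "sfield x H" for H
 proof -
  have "!!F. F : set (H # Fs @ Gs) ==> sfield x F" using H Fs Gs by auto
  then obtain N2 where N2: "nbhd N2" "x : N2" "ALL y:N2. ALL F:set (H # Fs @ Gs). F y : TX y"
   using sfields_nbhd[OF x0', of "H # Fs @ Gs"] by blast
  let ?N = "N Int N2 Int fst c"
  have oN: "nbhd ?N" "x : ?N" using N N2 XC_open[OF t c] x by auto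
  have "u (P H) = u (%y. SUM i:UNIV. dz c i (H y) * ?E i y + dzb c i (H y) * ?Eb i y)"
  proof (rule TD(6)[OF u oN]) fix y assume y: "y : ?N"
   show "P H y = (SUM i:UNIV. dz c i (H y) * ?E i y + dzb c i (H y) * ?Eb i y)"
   unfolding P_def by (rule slot_expand[OF t c, of y k]) (use y N(3) N2(3) k in auto) qed
  also have "... = (SUM i:UNIV. u (%y. dz c i (H y) * ?E i y + dzb c i (H y) * ?Eb i y))"
   by (rule T_sum[OF u]) (intro smat_add smat_mult sfield_coord[OF H t c x] E)
  also have "... = (SUM i:UNIV. (u (%y. dz c i (H y)) * ?E i x + dz c i (H x) * u (?E i)) +
   (u (%y. dzb c i (H y)) * ?Eb i x + dzb c i (H x) * u (?Eb i)))"
  proof (rule sum.cong[OF refl]) fix i note s = sfield_coord[OF H t c x, of i]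
   show "u (%y. dz c i (H y) * ?E i y + dzb c i (H y) * ?Eb i y) = (u (%y. dz c i (H y)) * ?E i x + dz c i (H x) * u (?E i)) +
   (u (%y. dzb c i (H y)) * ?Eb i x + dzb c i (H x) * u (?Eb i))" unfolding TD(3)[OF u smat_mult[OF s(1) E(1)] smat_mult[OF s(2) E(2)]]
   TD(4)[OF u s(1) E(1)] TD(4)[OF u s(2) E(2)] .. qed finally show ?thesis . qed
 have const: "u (%y. dz c i (vext c v y)) = 0" "u (%y. dzb c i (vext c v y)) = 0" for i v
 proof -
  have "u (%y. dz c i (vext c v y)) = u (%y. dz c i v)" "u (%y. dzb c i (vext c v y)) = u (%y. dzb c i v)"
   by (rule TD(6)[OF u XC_open[OF t c] x], rule vext_dz[OF t c], assumption)+
  thus "u (%y. dz c i (vext c v y)) = 0" "u (%y. dzb c i (vext c v y)) = 0" by (simp_all add: TD(5)[OF u])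
 qed
 have Fx: "F x : TX x" by (rule sfieldD(1)[OF F])
 have "u (P F) = u (P (vext c (F x))) + (SUM i:UNIV. u (%y. dz c i (F y)) * ?E i x + u (%y. dzb c i (F y)) * ?Eb i x)"
  unfolding exp[OF F] exp[OF sfield_vec(1)[OF t c x]] const vext_dz[OF t c x] by (simp add: sum.distrib[symmetric] algebra_simps)
 also have "(SUM i:UNIV. u (%y. dz c i (F y)) * ?E i x + u (%y. dzb c i (F y)) * ?Eb i x) = P (%_. fd c x u F) x" unfolding P_def
  by (subst slot_expand[OF t c x aformD(1)[OF ss] _ _ _ fd_props(1)[OF t c x]])
   (use Fs Gs k in \<open>auto simp: fd_props[OF t c x] intro: sfieldD(1)\<close>)
 finally show ?thesis unfolding P_def .
qed

lemma vext_map_self: "set ws <= TX x ==> ext c ws x = ws" by (rule map_idI) (use vext_self[OF t c x] in auto)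

text \<open>Slots are treated from left to right: \<open>us\<close> already carry constant
  extensions, \<open>ws\<close> still the fields \<open>Phi w\<close>, and each replacement costs
  one \<open>fd\<close> term.\<close>

lemma field_subs_aux:
 assumes ss: "aform x k ss" and u: "u : TX x" and Phi: "!!w. w : TX x ==> sfield x (Phi w)" "!!w. w : TX x ==> Phi w x = w"
 shows "set us <= TX x ==> set ws <= TX x ==> length us + length ws = k ==>
  u (%y. ss y (ext c us y @ map (%w. Phi w y) ws)) =
  u (%y. ss y (ext c (us @ ws) y)) + subs (%w. fd c x u (Phi w)) (%vs. ss x (us @ vs)) ws"
proof (induction ws arbitrary: us)
 case Nil thus ?case by simp
next
 case (Cons w ws)
 have w: "w : TX x" using Cons.prems by simp
 have m: "map (%w. Phi w x) ws = ws" by (rule map_idI) (use Cons.prems Phi(2) in auto)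
 have "u (%y. ss y (map (%F. F y) (map (vext c) us) @ Phi w y # map (%F. F y) (map Phi ws))) =
  u (%y. ss y (map (%F. F y) (map (vext c) us) @ vext c (Phi w x) y # map (%F. F y) (map Phi ws))) +
  ss x (map (%F. F x) (map (vext c) us) @ fd c x u (Phi w) # map (%F. F x) (map Phi ws))"
  by (rule slot_deriv[OF ss u Phi(1)[OF w]]) (use Cons.prems Phi(1) sfield_vec(1)[OF t c x] in auto)
 hence "u (%y. ss y (ext c us y @ map (%w. Phi w y) (w # ws))) =
  u (%y. ss y (ext c (us @ [w]) y @ map (%w. Phi w y) ws)) + ss x (us @ fd c x u (Phi w) # ws)"
  using vext_map_self Cons.prems by (simp add: o_def Phi(2)[OF w] m)
 also have "u (%y. ss y (ext c (us @ [w]) y @ map (%w. Phi w y) ws)) =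
  u (%y. ss y (map (%w. vext c w y) ((us @ [w]) @ ws))) + subs (%w. fd c x u (Phi w)) (%vs. ss x ((us @ [w]) @ vs)) ws"
  by (rule Cons.IH) (use Cons.prems in auto) finally show ?case by simp
qed

lemma field_subs:
 assumes "aform x k ss" "u : TX x"
  "!!w. w : TX x ==> sfield x (Phi w)" "!!w. w : TX x ==> Phi w x = w"
  "set ws <= TX x" "length ws = k" shows "u (%y. ss y (map (%w. Phi w y) ws)) =
  u (%y. ss y (ext c ws y)) + subs (%w. fd c x u (Phi w)) (ss x) ws" using field_subs_aux[OF assms(1-4), of "[]" ws] assms(5,6) by simp

lemma subs_smooth:
 assumes ss: "aform x k ss" and ps: "!!F. sfield x F ==> sfield x (%y. ps y (F y))"
 shows "(!!F. F : set Fs ==> sfield x F) ==> (!!F. F : set Gs ==> sfield x F) ==> length Fs + length Gs = k ==>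
  smat x (%y. subs (ps y) (%vs. ss y (map (%F. F y) Fs @ vs)) (map (%F. F y) Gs))"
proof (induction Gs arbitrary: Fs)
 case Nil show ?case using smat_const[OF x0'] by simp
next
 case (Cons G Gs)
 have "smat x (%y. ss y (map (%F. F y) (Fs @ (%y. ps y (G y)) # Gs)))" by (rule aformD(2)[OF ss]) (use Cons.prems ps[of G] in auto)
 moreover have "smat x (%y. subs (ps y) (%vs. ss y (map (%F. F y) (Fs @ [G]) @ vs)) (map (%F. F y) Gs))"
  by (rule Cons.IH) (use Cons.prems in auto) ultimately show ?case by (simp add: smat_add)
qed

text \<open>The derivative falls either on the endomorphism applied to a constant field, which gives
  the \<open>fd\<close> term, or on the form, with the vector \<open>ps x w\<close> extended
  constantly. The prefix \<open>us\<close> holds the slots already passed.\<close>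

lemma subs_deriv_aux:
 assumes ss: "aform x k ss" and u: "u : TX x" and ps: "!!F. sfield x F ==> sfield x (%y. ps y (F y))"
 shows "set us <= TX x ==> set ws <= TX x ==> length us + length ws = k ==>
  u (%y. subs (ps y) (%vs. ss y (ext c us y @ vs)) (ext c ws y)) =
  subs (%w. fd c x u (%y. ps y (vext c w y))) (%vs. ss x (us @ vs)) ws +
  subs (ps x) (%vs. u (%y. ss y (ext c (us @ vs) y))) ws"
proof (induction ws arbitrary: us)
 case Nil thus ?case by (simp add: TD(5)[OF u])
next
 case (Cons w ws)
 have w: "w : TX x" using Cons.prems by simp
 have F: "sfield x (%y. ps y (vext c w y))" by (rule ps[OF sfield_vec(1)[OF t c x]])
 let ?f = "%y. ss y (map (%F. F y) (map (vext c) us) @ ps y (vext c w y) # map (%F. F y) (map (vext c) ws))"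
 let ?g = "%y. subs (ps y) (%vs. ss y (map (%F. F y) (map (vext c) (us @ [w])) @ vs)) (map (%F. F y) (map (vext c) ws))"
 have f: "smat x ?f"
 proof -
  have "smat x (%y. ss y (map (%F. F y) (map (vext c) us @ (%y. ps y (vext c w y)) # map (vext c) ws)))"
   by (rule aformD(2)[OF ss]) (use Cons.prems F sfield_vec(1)[OF t c x] in auto)
  thus ?thesis by simp qed
 have g: "smat x ?g" by (rule subs_smooth[OF ss ps]) (use Cons.prems sfield_vec(1)[OF t c x] in auto)
 have "u ?f = u (%y. ss y (map (%F. F y) (map (vext c) us) @ vext c (ps x (vext c w x)) y # map (%F. F y) (map (vext c) ws))) +
  ss x (map (%F. F x) (map (vext c) us) @ fd c x u (%y. ps y (vext c w y)) # map (%F. F x) (map (vext c) ws))"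
  by (rule slot_deriv[OF ss u F]) (use Cons.prems sfield_vec(1)[OF t c x] in auto)
 hence uf: "u ?f = u (%y. ss y (ext c (us @ ps x w # ws) y)) + ss x (us @ fd c x u (%y. ps y (vext c w y)) # ws)"
  using vext_map_self Cons.prems by (simp add: o_def vext_self[OF t c x w])
 have "u ?g = subs (%w. fd c x u (%y. ps y (vext c w y))) (%vs. ss x ((us @ [w]) @ vs)) ws +
  subs (ps x) (%vs. u (%y. ss y (map (%w. vext c w y) ((us @ [w]) @ vs)))) ws" using Cons.IH[of "us @ [w]"] Cons.prems by (simp add: o_def)
 moreover have "u (%y. ?f y + ?g y) = u ?f + u ?g" by (rule TD(3)[OF u f g])
 ultimately show ?case using uf by (simp add: o_def)
qed

lemma subs_deriv:
 assumes "aform x k ss" "u : TX x" "!!F. sfield x F ==> sfield x (%y. ps y (F y))"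
  "set ws <= TX x" "length ws = k" shows "u (%y. subs (ps y) (ss y) (ext c ws y)) =
  subs (%w. fd c x u (%y. ps y (vext c w y))) (ss x) ws +
  subs (ps x) (%vs. u (%y. ss y (ext c vs y))) ws" using subs_deriv_aux[OF assms(1-3), where us="[]" and ws=ws] assms(4,5) by simp

lemma aform_subs:
 assumes ss: "aform x k ss" and ps: "!!F. sfield x F ==> sfield x (%y. ps y (F y))"
  and N: "nbhd N" "x : N" "!!y v. y : N ==> v : TX y ==> ps y v : TX y"
  "!!y v w a b. y : N ==> v : TX y ==> w : TX y ==> ps y (lc a v b w) = lc a (ps y v) b (ps y w)"
 shows "aform x k (%y. subs (ps y) (ss y))"
proof -
 obtain N' where N': "nbhd N'" "x : N'" "ALL y:N'. altern (TX y) k (ss y)" by (rule aform_nbhd[OF ss])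
 show ?thesis unfolding aform_def
 proof (intro conjI allI impI exI[of _ "N Int N'"])
  show "nbhd (N Int N')" "x : N Int N'" using N N' by auto
  show "ALL y:N Int N'. altern (TX y) k (subs (ps y) (ss y))"
  proof fix y assume y: "y : N Int N'" hence "y : M0" using openin_subset[OF N(1)] by auto
   thus "altern (TX y) k (subs (ps y) (ss y))" using y N(3,4) N'(3) by (intro alt_subs TX_cspace) auto
  qed
  show "smat x (%y. subs (ps y) (ss y) (map (%F. F y) Fs))" if "length Fs = k" "ALL F:set Fs. sfield x F" for Fs
   using subs_smooth[OF ss ps, where Fs="[]" and Gs=Fs] that by simp qed
qed

text \<open>Replaces the sums over multi-indices by an alternation of derivatives of values on
  constant extensions. \<open>dbar\<close> and the derivative part of \<open>nabla10\<close> are the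
  cases where \<open>e\<close> runs through the antiholomorphic or the holomorphic coordinate
  vectors.\<close>

lemma local_formula:
 assumes ss: "aform x k ss" and e: "!!j. e j : TX x" and vs: "set vs <= TX x" "length vs = Suc k"
 shows "(SUM q<=k. SUM J:mi q. SUM I:mi (k - q). SUM j:UNIV.
   e j (%y. ss y (map (%j. dzbv c j y) J @ map (%i. dzv c i y) I)) * wgs (aa j # dzs c J I) vs) =
  altsum (%u ws. SUM j:(UNIV::'n set). aa j u * e j (%y. ss y (ext c ws y))) vs"
proof -
 let ?B = "%J I y. ss y (map (%j. dzbv c j y) J @ map (%i. dzv c i y) I)"
 have B: "smat x (?B J I)" if "length J + length I = k" for J I
 proof -
  have "smat x (%y. ss y (map (%F. F y) (map (dzbv c) J @ map (dzv c) I)))"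
   by (rule aformD(2)[OF ss]) (use that sfield_vec[OF t c x] in auto)
  thus ?thesis by (simp add: o_def) qed
 obtain N where N: "nbhd N" "x : N" "ALL y:N. altern (TX y) k (ss y)" by (rule aform_nbhd[OF ss])
 have main: "u (%y. ss y (ext c ws y)) = (SUM q<=k. SUM J:mi q. SUM I:mi (k - q). u (?B J I) * wgs (dzs c J I) ws)"
  if ws: "length ws = k" and u: "u : TX x" for u ws
 proof -
  have oN: "nbhd (N Int fst c)" "x : N Int fst c" using N XC_open[OF t c] x by auto
  have "u (%y. ss y (ext c ws y)) =
   u (%y. SUM q<=k. SUM J:mi q. SUM I:mi (k - q). wgs (dzs c J I) ws * ?B J I y)"
  proof (rule TD(6)[OF u oN]) fix y assume y: "y : N Int fst c"
   let ?ws = "ext c ws y" note yc = t c IntD2[OF y]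
   \<comment> \<open>Constant extensions have the same coordinates at \<open>y\<close> as at
     \<open>x\<close>, so these factors are constants for the derivative.\<close>
   have w: "wgs (dzs c J I) ?ws = wgs (dzs c J I) ws" if "length J + length I = k" for J I
   proof -
   have A: "wgs (aas @ bbs) (map h zs) = wgs (map (%aa. aa o h) (aas @ bbs)) zs" for aas bbs :: "('x tvec => complex) list" and h zs
   proof -
   have "wgs ggs (map h zs) = wgs (map (%aa. aa o h) ggs) zs" for ggs
   by (induction ggs arbitrary: zs) (simp_all add: wedge_def take_map drop_map flip: map_append)
   thus ?thesis by blast qed
   show ?thesis unfolding A by (rule arg_cong[of _ _ "%z. wgs z ws"]) (simp add: fun_eq_iff vext_dz[OF yc])
   qed
   have "ss y ?ws = (SUM q<=length ?ws. SUM J:mi q. SUM I:mi (length ?ws - q).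
   ?B J I y * wgs (dzs c J I) ?ws)"
   proof (rule alt_expand[OF TX_cspace[OF XC_fib0[OF yc(2,3)]]])
   show "altern (TX y) (length ?ws) (ss y)" using N(3) y ws by auto
   show "set ?ws <= TX y" using vext_T[OF yc] by auto
   show "!!v. v : TX y ==> v = (%f. SUM i:UNIV. dz c i v * dzv c i y f + dzb c i v * dzbv c i y f)" by (rule T_decomp[OF yc])
   qed (rule dzv_T[OF yc])+
   also have "... = (SUM q<=k. SUM J:mi q. SUM I:mi (k - q). wgs (dzs c J I) ws * ?B J I y)"
   using ws by (intro sum.cong) (auto simp: mi_def w)
   finally show "ss y ?ws = (SUM q<=k. SUM J:mi q. SUM I:mi (k - q). wgs (dzs c J I) ws * ?B J I y)" .
  qed
  also have "... = (SUM q<=k. SUM J:mi q. SUM I:mi (k - q). u (?B J I) * wgs (dzs c J I) ws)"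
  proof -
   have sm: "smat x (%y. wgs (dzs c J I) ws * ?B J I y)" if "J : mi q" "I : mi (k - q)" "q <= k" for q J I
   by (rule smat_scale[OF B]) (use that in \<open>auto simp: mi_def\<close>)
   have sc: "u (%y. wgs (dzs c J I) ws * ?B J I y) = u (?B J I) * wgs (dzs c J I) ws" for J I by (simp only: T_scale[OF u] mult.commute)
   have s3: "u (%y. SUM I:mi (k - q). wgs (dzs c J I) ws * ?B J I y) =
   (SUM I:mi (k - q). u (?B J I) * wgs (dzs c J I) ws)" if "q <= k" "J : mi q" for q J
   by (rule trans[OF T_sum[OF u]], rule sm) (use that in \<open>simp_all only: sc\<close>)
   have s2: "u (%y. SUM J:mi q. SUM I:mi (k - q). wgs (dzs c J I) ws * ?B J I y) =
   (SUM J:mi q. SUM I:mi (k - q). u (?B J I) * wgs (dzs c J I) ws)" if q: "q <= k" for q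
   by (rule trans[OF T_sum[OF u]], rule smat_sum[OF x0'], rule sm) (use q in \<open>auto intro: sum.cong s3\<close>)
   show ?thesis by (rule trans[OF T_sum[OF u]], intro smat_sum[OF x0'], rule sm) (auto intro: sum.cong s2)
  qed finally show ?thesis . qed
 have "altsum (%u ws. SUM j:UNIV. aa j u * e j (%y. ss y (ext c ws y))) vs =
  altsum (%u ws. SUM j:UNIV. aa j u * (SUM q<=k. SUM J:mi q. SUM I:mi (k - q). e j (?B J I) * wgs (dzs c J I) ws)) vs"
  by (rule altsum_cong[OF vs(1)]) (use vs(2) main[OF _ e] in simp)
 also have "... = (SUM j:UNIV. SUM q<=k. SUM J:mi q. SUM I:mi (k - q). altsum (%u ws. e j (?B J I) * (aa j u * wgs (dzs c J I) ws)) vs)"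
  by (simp only: sum_distrib_left altsum_sum mult.left_commute)
 also have "... = (SUM j:UNIV. SUM q<=k. SUM J:mi q. SUM I:mi (k - q). e j (?B J I) * wgs (aa j # dzs c J I) vs)"
  by (simp only: altsum_scale wedges_Cons wedge_eq_altsum)
 also have "... = (SUM q<=k. SUM J:mi q. SUM I:mi (k - q). SUM j:UNIV. e j (?B J I) * wgs (aa j # dzs c J I) vs)"
  by (subst sum.swap, rule sum.cong[OF refl], subst sum.swap, rule sum.cong[OF refl], rule sum.swap)
 finally show ?thesis by simp
qed

end

end

context pair_family
begin

subsection \<open>Gluing local formulas\<close>

text \<open>The description ranges over all charts and frames, but it suffices to compare each pair
  with one reference pair through the transition matrix of the frames.\<close>

lemma glue_eq:
 assumes t: "t : BX" and c: "c : XC t" "x : fst c" and V: "(V, ta) : EF t" "x : V" and vs: "vs : tlists X x k"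
  and cons: "!!c' V' ta'. c' : XC t ==> x : fst c' ==> (V', ta') : EF t ==> x : V' ==>
   F c' ta' x vs = wm ta' ta x *v F c ta x vs" shows "glue X t k F x vs : EE x" "ta (glue X t k F x vs) = F c ta x vs"
proof -
 have x0: "x : M0" by (rule XC_fib0[OF c])
 obtain e where e: "e : EE x" "ta e = F c ta x vs" by (rule efib_exists[OF t V])
 have "glue X t k F x vs = (THE e. e : EE x & (ALL c:XC t. ALL (V, ta):EF t. x : fst c Int V --> ta e = F c ta x vs))"
  unfolding glue_def using x0 vs by simp also have "... = e"
 proof (rule the_equality)
  have "ta' e = F c' ta' x vs" if h: "c' : XC t" "(V', ta') : EF t" "x : fst c'" "x : V'" for c' V' ta'
   unfolding cons[OF h(1,3,2,4)] wmat_holo(1)[OF t h(2) V(1) h(4) V(2) e(1)] e(2) ..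
  thus "e : EE x & (ALL c:XC t. ALL (V, ta):EF t. x : fst c Int V --> ta e = F c ta x vs)" using e(1) by blast
  fix e' assume e': "e' : EE x & (ALL c:XC t. ALL (V, ta):EF t. x : fst c Int V --> ta e' = F c ta x vs)"
  show "e' = e"
  proof (rule efib_eqI[OF t V conjunct1[OF e'] e(1)])
   show "ta e' = ta e" using conjunct2[OF e'] c V e(2) by fastforce qed qed
 finally show "glue X t k F x vs : EE x" "ta (glue X t k F x vs) = F c ta x vs" using e by simp_all
qed

lemma glue_undef: "~ (x : M0 & vs : tlists X x k) ==> glue X t k F x vs = undefined" unfolding glue_def by (rule if_not_P)

lemma form_comb:
 assumes x: "x : M0" and vs: "vs : tlists X x k" and s: "s x vs : EE x" "s' x vs : EE x"
 shows "form_add X k s s' x vs : EE x" "form_diff X k s s' x vs : EE x"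
  "(V, ta) : EF 0 ==> x : V ==> ta (form_add X k s s' x vs) = ta (s x vs) + ta (s' x vs)"
  "(V, ta) : EF 0 ==> x : V ==> ta (form_diff X k s s' x vs) = ta (s x vs) - ta (s' x vs)"
proof -
 obtain c where c: "c : XC 0" "x : fst c" by (rule XC_at[OF base(2) x])
 have *: "ta' e = wm ta' ta x *v ta e" if "(V, ta) : EF 0" "x : V" "(V', ta') : EF 0" "x : V'" "e : EE x" for V ta V' ta' e
  by (rule wmat_holo(1)[OF base(2) that(3,1,4,2,5)])
 have A: "form_add X k s s' x vs : EE x & ta (form_add X k s s' x vs) = ta (s x vs) + ta (s' x vs)"
   "form_diff X k s s' x vs : EE x & ta (form_diff X k s s' x vs) = ta (s x vs) - ta (s' x vs)"
  if V: "(V, ta) : EF 0" "x : V" for V ta unfolding form_add_def form_diff_def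
  by (intro conjI glue_eq[OF base(2) c V vs]; simp add: *[OF V _ _ s(1)] *[OF V _ _ s(2)] matrix_vector_right_distrib matrix_vector_mult_diff_distrib)+
 obtain V0 ta0 where V0: "(V0, ta0) : EF 0" "x : V0" by (rule EF_at[OF base(2) x])
 show "form_add X k s s' x vs : EE x" "form_diff X k s s' x vs : EE x" using A[OF V0] by auto
 show "(V, ta) : EF 0 ==> x : V ==> ta (form_add X k s s' x vs) = ta (s x vs) + ta (s' x vs)"
  "(V, ta) : EF 0 ==> x : V ==> ta (form_diff X k s s' x vs) = ta (s x vs) - ta (s' x vs)" using A by auto
qed

text \<open>A smooth form with values in E_0, of any type. Smoothness in frames of index 0 implies
  smoothness in frames of index \<open>t\<close>, by \<open>eform_aform\<close>.\<close>

definition eform :: "nat => ('x, 'e) form => bool" where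
 "eform k s \<longleftrightarrow> (ALL x:fib X 0. ALL vs:tlists X x k. s x vs : EE x) &
   (ALL V ta x l. (V, ta) : EF 0 --> x : V --> aform x k (%y vs. ta (s y vs) $ l))"

lemma eform_in: "eform k s ==> x : M0 ==> set vs <= TX x ==> length vs = k ==> s x vs : EE x" unfolding eform_def tlists_def by blast

lemma eform_aform0: "eform k s ==> (V, ta) : EF 0 ==> x : V ==> aform x k (%y vs. ta (s y vs) $ l)" unfolding eform_def by blast

lemma eform_aform:
 assumes s: "eform k s" and t: "t : BX" and V: "(V, rh) : EF t" "x : V" shows "aform x k (%y vs. rh (s y vs) $ l)"
proof -
 have x0: "x : M0" using V EFD(1) by blast
 obtain V0 ta where V0: "(V0, ta) : EF 0" "x : V0" by (rule EF_at[OF base(2) x0])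
 have "aform x k (%y vs. SUM m:UNIV. wm rh ta y $ l $ m * ta (s y vs) $ m)"
  by (intro aform_sum[OF x0] finite eform_aform0[OF s V0] wmat_zero(3)[OF t V(1) V0(1) V(2) V0(2)])
 thus ?thesis
 proof (rule aform_cong[of "V Int V0", rotated 3])
  show "nbhd (V Int V0)" "x : V Int V0" using EF_open[OF t V(1)] EF_open[OF base(2) V0(1)] V V0 by auto
  fix y vs assume y: "y : V Int V0" and vs: "set vs <= TX y" "length vs = k"
  have y0: "y : M0" using y EFD(1)[OF V(1)] by blast
  have "rh (s y vs) = wm rh ta y *v ta (s y vs)" by (rule wmat_zero(1)[OF t V(1) V0(1) _ _ eform_in[OF s y0 vs]]) (use y in auto)
  thus "(SUM m:UNIV. wm rh ta y $ l $ m * ta (s y vs) $ m) = rh (s y vs) $ l" by (simp add: matrix_vector_mult_def)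
 qed
qed

lemma vext_p: "t : BX ==> c : XC t ==> x : fst c ==> vext c (p10 c x v) y = (%f. SUM i:UNIV. dz c i v * dzv c i y f)"
 "t : BX ==> c : XC t ==> x : fst c ==> vext c (p01 c x v) y = (%f. SUM i:UNIV. dzb c i v * dzbv c i y f)"
 by (simp_all add: vext_def p10_dz)

lemma vext_lc: "vext c (lc a v b w) y = lc a (vext c v y) b (vext c w y)"
 by (simp add: vext_def lc_def dz_def dzb_def fun_eq_iff sum_distrib_left sum.distrib[symmetric] algebra_simps)

text \<open>By \<open>field_subs\<close>, another chart for the constant extensions adds a
  substitution of \<open>?G\<close>, whose components are derivatives along P u of coordinates of
  \<open>c\<close> differentiated along the extension of w in \<open>c'\<close>. \<open>P\<close>
  and \<open>Q\<close> are complementary type projections, and each of these coordinates or their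
  conjugates is killed by one of the two; this makes \<open>?G\<close> symmetric.\<close>

lemma chart_independence:
 assumes ss: "aform x k ss" and t: "t : BX" and c: "c : XC t" "x : fst c" and c': "c' : XC t" "x : fst c'"
  and vs: "set vs <= TX x" "length vs = Suc k" and P: "!!u. u : TX x ==> P u : TX x" "!!u. u : TX x ==> Q u : TX x"
   "!!u. u : TX x ==> u = lc 1 (P u) 1 (Q u)" and N: "nbhd N" "x : N"
   "!!i. (ALL u:TX x. ALL y:N. vext c' (P u) y (%y. snd c y $ i) = 0) \<or> (ALL u:TX x. ALL y:N. vext c' (Q u) y (%y. snd c y $ i) = 0)"
   "!!i. (ALL u:TX x. ALL y:N. vext c' (P u) y (%y. cnj (snd c y $ i)) = 0) \<or> (ALL u:TX x. ALL y:N. vext c' (Q u) y (%y. cnj (snd c y $ i)) = 0)"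
 shows "altsum (%u ws. P u (%y. ss y (ext c' ws y))) vs = altsum (%u ws. P u (%y. ss y (ext c ws y))) vs"
proof -
 \<comment> \<open>If \<open>P\<close> kills g, both sides vanish once the commuting extensions are
   exchanged. If \<open>Q\<close> kills g, then w can be replaced by P w, and the extensions of P u
   and P w commute.\<close>
 have key: "P u (%y. vext c' w y g) = P w (%y. vext c' u y g)" if u: "u : TX x" and w: "w : TX x" and g: "smat x g" and
   alt: "(ALL u:TX x. ALL y:N. vext c' (P u) y g = 0) \<or> (ALL u:TX x. ALL y:N. vext c' (Q u) y g = 0)" for u w g using alt
 proof assume z: "ALL u:TX x. ALL y:N. vext c' (P u) y g = 0"
  have "P u (%y. vext c' w y g) = 0" if u: "u : TX x" and w: "w : TX x" for u w
  proof -
   have "P u (%y. vext c' w y g) = w (%y. vext c' (P u) y g)" by (rule vext_commute[OF t c' g P(1)[OF u] w])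
   also have "... = w (%y. 0)" by (rule TD(6)[OF w N(1,2)]) (use z u in blast)
   finally show ?thesis by (simp add: TD(5)[OF w]) qed thus ?thesis using u w by simp next
  assume z: "ALL u:TX x. ALL y:N. vext c' (Q u) y g = 0"
  have "P u (%y. vext c' w y g) = P u (%y. vext c' (P w) y g)" if u: "u : TX x" and w: "w : TX x" for u w
  proof (rule TD(6)[OF P(1)[OF u] N(1,2)]) fix y assume y: "y : N"
   have "vext c' w y g = vext c' (lc 1 (P w) 1 (Q w)) y g" using P(3)[OF w] by simp
   thus "vext c' w y g = vext c' (P w) y g" unfolding vext_lc using z w y by (simp add: lc_def)
  qed thus ?thesis using u w vext_commute[OF t c' g P(1)[OF u] P(1)[OF w]] by simp qed
 let ?G = "%u w. fd c x (P u) (vext c' w)"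
 have "altsum (%u ws. P u (%y. ss y (ext c' ws y))) vs =
   altsum (%u ws. P u (%y. ss y (ext c ws y)) + subs (?G u) (ss x) ws) vs"
  by (rule altsum_cong[OF vs(1)], rule field_subs[OF t c ss P(1) sfield_vec(1)[OF t c'] vext_self[OF t c']]) (use vs(2) in auto)
 also have "... = altsum (%u ws. P u (%y. ss y (ext c ws y))) vs + altsum (%u ws. subs (?G u) (ss x) ws) vs" by (rule altsum_add)
 also have "altsum (%u ws. subs (?G u) (ss x) ws) vs = 0"
 proof (rule altsum_subs_symmetric[OF _ vs(1) fd_props(1)[OF t c]])
  show "altern (TX x) (length vs - 1) (ss x)" using aformD(1)[OF ss] vs(2) by simp
  fix u w assume u: "u : TX x" "w : TX x" note cs = coord_smooth[OF t c]
  show "?G u w = ?G w u" by (rule T_eqI[OF t c fd_props(1)[OF t c] fd_props(1)[OF t c]])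
   (unfold fd_props[OF t c], unfold dz_def dzb_def, rule key[OF u cs N(3)], rule key[OF u smat_cnj[OF cs] N(4)])
 qed finally show ?thesis by simp
qed

lemma chart_independence_p:
 assumes ss: "aform x k ss" and t: "t : BX" and c: "c : XC t" "x : fst c" and c': "c' : XC t" "x : fst c'"
  and vs: "set vs <= TX x" "length vs = Suc k"
 shows "altsum (%u ws. p01 c' x u (%y. ss y (ext c' ws y))) vs = altsum (%u ws. p01 c x u (%y. ss y (ext c ws y))) vs"
  and "altsum (%u ws. p10 c' x u (%y. ss y (ext c' ws y))) vs = altsum (%u ws. p10 c x u (%y. ss y (ext c ws y))) vs"
proof -
 let ?N = "fst c Int fst c'"
 have N: "nbhd ?N" "x : ?N" using XC_open[OF t c(1)] XC_open[OF t c'(1)] c c' by auto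
 note pt = p10_T[OF t c'] and ch = coord_holo[OF t c'(1) c(1)] and ind = p10_indep[OF t c'(1) c(1) c'(2) c(2)]
 have comm: "u = lc 1 (p01 c' x u) 1 (p10 c' x u)" if "u : TX x" for u using p10_add[OF t c' that] by (simp add: lc_def add.commute)
 have "altsum (%u ws. p01 c' x u (%y. ss y (ext c' ws y))) vs = altsum (%u ws. p01 c' x u (%y. ss y (ext c ws y))) vs"
  by (rule chart_independence[OF ss t c c' vs pt(2) pt(1) comm N]) (simp_all add: vext_p[OF t c'] ch)
 also have "... = altsum (%u ws. p01 c x u (%y. ss y (ext c ws y))) vs" by (rule altsum_cong[OF vs(1)]) (simp add: ind(2))
 finally show "altsum (%u ws. p01 c' x u (%y. ss y (ext c' ws y))) vs = altsum (%u ws. p01 c x u (%y. ss y (ext c ws y))) vs" .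
 have "altsum (%u ws. p10 c' x u (%y. ss y (ext c' ws y))) vs = altsum (%u ws. p10 c' x u (%y. ss y (ext c ws y))) vs"
  by (rule chart_independence[OF ss t c c' vs pt(1) pt(2) p10_add[OF t c'] N]) (simp_all add: vext_p[OF t c'] ch)
 also have "... = altsum (%u ws. p10 c x u (%y. ss y (ext c ws y))) vs" by (rule altsum_cong[OF vs(1)]) (simp add: ind(1))
 finally show "altsum (%u ws. p10 c' x u (%y. ss y (ext c' ws y))) vs = altsum (%u ws. p10 c x u (%y. ss y (ext c ws y))) vs" .
qed

subsection \<open>The Dolbeault operator\<close>

lemma p_apply: "p01 c x u f = (SUM j:UNIV. dzb c j u * dzbv c j x f)" "p10 c x u f = (SUM j:UNIV. dz c j u * dzv c j x f)"
 by (simp_all add: p01_def p10_def)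

lemma eform_vext_smooth:
 assumes "eform k s" "t : BX" "(V, rh) : EF t" "x : V" "t' : BX" "c : XC t'" "x : fst c" "length ws = k"
 shows "smat x (%y. rh (s y (ext c ws y)) $ l)"
 using aformD(2)[OF eform_aform[OF assms(1-4)], of "map (vext c) ws"] assms(8) sfield_vec(1)[OF assms(5-7)] by (auto simp: o_def)

lemma dbar_formula:
 assumes "eform k s" "t : BX" "c : XC t" "x : fst c" "(V, ta) : EF t" "x : V" "set vs <= TX x" "length vs = Suc k"
 shows "(SUM q<=k. SUM J:mi q. SUM I:mi (k - q). SUM j:UNIV.
   dzbv c j x (%y. coef X c ta s J I y $ l) * wgs (dzb c j # dzs c J I) vs) =
  altsum (%u ws. p01 c x u (%y. ta (s y (ext c ws y)) $ l)) vs" unfolding coef_def p_apply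
 by (rule local_formula[OF assms(2-4) eform_aform[OF assms(1,2,5,6)] dzv_T(2)[OF assms(2-4)] assms(7,8)])

text \<open>A (0,1)-vector kills the holomorphic transition matrix, which therefore passes through
  the derivative. The chart \<open>c'\<close> of the extensions may belong to another
  structure.\<close>

lemma holo_frame_change:
 assumes s: "eform k s" and t: "t : BX" and c: "c : XC t" "x : fst c" and V: "(V, ta) : EF t" "x : V"
  and V': "(V', ta') : EF t" "x : V'" and ws: "length ws = k"
  and v: "v : TX x" "!!k. dz c k v = 0" and t': "t' : BX" "c' : XC t'" "x : fst c'"
 shows "v (%y. ta' (s y (ext c' ws y)) $ l) = (SUM m:UNIV. wm ta' ta x $ l $ m * v (%y. ta (s y (ext c' ws y)) $ m))"
proof -
 let ?s = "%ta m y. ta (s y (ext c' ws y)) $ m" and ?h = "%m y. wm ta' ta y $ l $ m"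
 note sm = eform_vext_smooth[OF s t V t' ws] and hs = wmat_holo(3)[OF t V'(1) V(1) V'(2) V(2)]
 have oN: "nbhd (fst c' Int V Int V')" "x : fst c' Int V Int V'"
  using XC_open[OF t'(1,2)] EF_open[OF t V(1)] EF_open[OF t V'(1)] t'(3) V V' by auto
 have "v (?s ta' l) = v (%y. SUM m:UNIV. ?h m y * ?s ta m y)"
 proof (rule TD(6)[OF v(1) oN]) fix y assume y: "y : fst c' Int V Int V'"
  have "s y (ext c' ws y) : EE y" by (rule eform_in[OF s XC_fib0[OF t'(2)]]) (use y vext_T[OF t'(1,2)] ws in auto)
  hence "ta' (s y (ext c' ws y)) = wm ta' ta y *v ta (s y (ext c' ws y))" by (intro wmat_holo(1)[OF t V'(1) V(1)]) (use y in auto)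
  thus "?s ta' l y = (SUM m:UNIV. ?h m y * ?s ta m y)" by (simp add: matrix_vector_mult_def)
 qed
 also have "... = (SUM m:UNIV. v (%y. ?h m y * ?s ta m y))" by (rule T_sum[OF v(1)]) (rule smat_mult[OF hs sm])
 also have "... = (SUM m:UNIV. ?h m x * v (?s ta m))"
 proof (rule sum.cong[OF refl]) fix m
  have "v (?h m) = 0" using fun_cong[OF T_decomp[OF t c v(1)], of "?h m"] v(2) wmat_holo(4)[OF t V'(1) V(1) V'(2) V(2) c, of _ l m] by simp
  thus "v (%y. ?h m y * ?s ta m y) = ?h m x * v (?s ta m)" unfolding TD(4)[OF v(1) hs sm] by simp
 qed finally show ?thesis .
qed

text \<open>The local formulas glue: the chart drops out by \<open>chart_independence_p\<close>, the
  frame by \<open>holo_frame_change\<close>.\<close>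

lemma dbar_local:
 assumes s: "eform k s" and t: "t : BX" and c: "c : XC t" "x : fst c" and V: "(V, ta) : EF t" "x : V"
  and vs: "set vs <= TX x" "length vs = Suc k" shows "dbar X t k s x vs : EE x"
  "ta (dbar X t k s x vs) $ l = altsum (%u ws. p01 c x u (%y. ta (s y (ext c ws y)) $ l)) vs"
proof -
 let ?F = "%c ta x vs. \<chi> l. SUM q<=k. SUM J:mi q. SUM I:mi (k - q). SUM j:UNIV.
   dzbv c j x (%y. coef X c ta s J I y $ l) * wgs (dzb c j # dzs c J I) vs"
 have cons: "?F c' ta' x vs = wm ta' ta x *v ?F c ta x vs" if c': "c' : XC t" "x : fst c'" and V': "(V', ta') : EF t" "x : V'" for c' V' ta'
 proof -
  have "?F c' ta' x vs $ l = (wm ta' ta x *v ?F c ta x vs) $ l" for l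
  proof -
   have "?F c' ta' x vs $ l = altsum (%u ws. p01 c' x u (%y. ta' (s y (ext c' ws y)) $ l)) vs"
   using dbar_formula[OF s t c' V' vs, of l] by simp
   also have "... = altsum (%u ws. p01 c x u (%y. ta' (s y (ext c ws y)) $ l)) vs"
   by (rule chart_independence_p(1)[OF eform_aform[OF s t V'] t c c' vs])
   also have "... = altsum (%u ws. SUM m:UNIV. wm ta' ta x $ l $ m * p01 c x u (%y. ta (s y (ext c ws y)) $ m)) vs"
   by (rule altsum_cong[OF vs(1)], rule holo_frame_change[OF s t c V V' _ p10_T(2)[OF t c] p10_dz(3)[OF t c] t c]) (use vs(2) in auto)
   also have "... = (wm ta' ta x *v ?F c ta x vs) $ l"
   unfolding altsum_sum altsum_scale using dbar_formula[OF s t c V vs] by (simp add: matrix_vector_mult_def)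
   finally show ?thesis . qed thus ?thesis by (simp add: vec_eq_iff) qed
 have tl: "vs : tlists X x (Suc k)" using vs by (simp add: tlists_def)
 note G = glue_eq[OF t c V tl, of ?F, OF cons]
 show "dbar X t k s x vs : EE x" unfolding dbar_def by (rule G(1))
 show "ta (dbar X t k s x vs) $ l = altsum (%u ws. p01 c x u (%y. ta (s y (ext c ws y)) $ l)) vs"
 proof -
  have "ta (dbar X t k s x vs) = ?F c ta x vs" unfolding dbar_def by (rule G(2))
  thus ?thesis by (simp only: vec_lambda_beta dbar_formula[OF s t c V vs]) qed
qed

end

context good_fibre
begin

subsection \<open>Contraction with the Beltrami differential\<close>

lemma charts_at:
 assumes "x : M0"
 obtains c d where "c : XC 0" "d : XC t" "x : fst c" "x : fst d" using XC_at[OF base(2) assms] XC_at[OF tb assms] by metis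

text \<open>Contraction with \<phi> acts at each point separately, so its powers can be handled with
  alternation at the single point \<open>x\<close>.\<close>

definition pform :: "'x => nat => ('x tvec list => 'e) => bool" where
 "pform x k S \<longleftrightarrow> (ALL vs:tlists X x k. S vs : EE x) &
   (ALL V ta l. (V, ta) : EF 0 --> x : V --> altern (TX x) k (%vs. ta (S vs) $ l))"

lemma eform_pform: "eform k s ==> x : M0 ==> pform x k (s x)"
 unfolding pform_def using aformD(1)[OF eform_aform0] unfolding eform_def by blast

lemma phi_T: "v : TX x ==> pht x v : TX x" by (rule charts_at[OF TD(1)], assumption, rule phi_props(1))

lemma phi_linear: "v : TX x ==> w : TX x ==> pht x (lc a v b w) = lc a (pht x v) b (pht x w)"
 by (rule charts_at[OF TD(1)], assumption, rule phi_lc)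

text \<open>The sum over i can be carried out inside the first slot, where it yields \<phi> u;
  moving this back to the slot of u gives a substitution.\<close>

lemma iphi_formula:
 assumes c: "c : XC 0" "x : fst c" and aa: "altern (TX x) k aa" and vs: "set vs <= TX x" "length vs = k"
 shows "(SUM i:UNIV. wedge (%v. dz c i (pht x v)) (%ws. aa (dzv c i x # ws)) vs) = subs (pht x) aa vs"
proof -
 have x0: "x : M0" by (rule XC_fib0[OF c])
 obtain d where d: "d : XC t" "x : fst d" by (rule XC_at[OF tb x0])
 have "(SUM i:UNIV. wedge (%v. dz c i (pht x v)) (%ws. aa (dzv c i x # ws)) vs) =
  altsum (%u ws. SUM i:UNIV. dz c i (pht x u) * aa (dzv c i x # ws)) vs" by (simp add: wedge_eq_altsum altsum_sum)
 also have "... = altsum (%u ws. aa (pht x u # ws)) vs"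
 proof (rule altsum_cong[OF vs(1)])
  fix u ws assume u: "u : TX x" and ws: "set ws <= TX x" "Suc (length ws) = length vs"
  have "aa ([] @ (%f. SUM i:UNIV. dz c i (pht x u) * dzv c i x f) # ws) = (SUM i:UNIV. dz c i (pht x u) * aa ([] @ dzv c i x # ws))"
   by (rule alt_sum_slot[OF TX_cspace[OF x0] aa]) (use ws vs(2) dzv_T(1)[OF base(2) c] in auto)
  thus "(SUM i:UNIV. dz c i (pht x u) * aa (dzv c i x # ws)) = aa (pht x u # ws)"
   using p10_phi[OF c(1) d(1) c(2) d(2) u] by (simp add: p10_def) qed
 also have "... = subs (pht x) aa vs" by (rule altsum_front_eq_subs[OF _ vs(1) phi_T]) (use aa vs(2) in auto)
 finally show ?thesis .
qed

lemma iphi_local: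
 assumes s: "pform x k (s x)" and V: "(V, ta) : EF 0" "x : V" and vs: "set vs <= TX x" "length vs = k"
 shows "iphi X t k s x vs : EE x" "ta (iphi X t k s x vs) $ l = subs (pht x) (%ws. ta (s x ws) $ l) vs"
proof -
 have x0: "x : M0" using V EFD(1) by blast
 obtain c where c: "c : XC 0" "x : fst c" by (rule XC_at[OF base(2) x0])
 let ?F = "%c ta x vs. \<chi> l. SUM i:UNIV. wedge (%v. dz c i (pht x v)) (%ws. ta (s x (dzv c i x # ws)) $ l) vs"
 have F: "?F c ta x vs $ l = subs (pht x) (%ws. ta (s x ws) $ l) vs"
  if c: "c : XC 0" "x : fst c" and V: "(V, ta) : EF 0" "x : V" for c V ta l
 proof -
  have "altern (TX x) k (%ws. ta (s x ws) $ l)" using s V unfolding pform_def by blast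
  from iphi_formula[OF c this vs] show ?thesis by simp qed
 have cons: "?F c' ta' x vs = wm ta' ta x *v ?F c ta x vs" if c': "c' : XC 0" "x : fst c'" and V': "(V', ta') : EF 0" "x : V'" for c' V' ta'
 proof -
  have "?F c' ta' x vs $ l = (wm ta' ta x *v ?F c ta x vs) $ l" for l
  proof -
   have "subs (pht x) (%ws. ta' (s x ws) $ l) vs = subs (pht x) (%ws. SUM m:UNIV. wm ta' ta x $ l $ m * ta (s x ws) $ m) vs"
   proof (rule subs_cong[OF vs(1) refl phi_T])
   fix ws assume "set ws <= TX x" "length ws = length vs"
   hence "s x ws : EE x" using s vs(2) unfolding pform_def tlists_def by auto
   from wmat_holo(1)[OF base(2) V'(1) V(1) V'(2) V(2) this]
   show "ta' (s x ws) $ l = (SUM m:UNIV. wm ta' ta x $ l $ m * ta (s x ws) $ m)" by (simp add: matrix_vector_mult_def)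
   qed
   thus ?thesis unfolding F[OF c' V'] matrix_vector_mult_def using F[OF c V] by (simp add: subs_sum subs_scale)
  qed thus ?thesis by (simp add: vec_eq_iff) qed
 have tl: "vs : tlists X x k" using vs by (simp add: tlists_def)
 note G = glue_eq[OF base(2) c V tl, of ?F, OF cons]
 show "iphi X t k s x vs : EE x" unfolding iphi_def by (rule G(1))
 have "ta (iphi X t k s x vs) = ?F c ta x vs" unfolding iphi_def by (rule G(2))
 thus "ta (iphi X t k s x vs) $ l = subs (pht x) (%ws. ta (s x ws) $ l) vs" by (simp only: F[OF c V])
qed

lemma iphi_pform:
 assumes s: "pform x k (s x)" and x0: "x : M0" shows "pform x k (iphi X t k s x)" unfolding pform_def
proof (intro conjI allI impI ballI)
 obtain V0 ta0 where V0: "(V0, ta0) : EF 0" "x : V0" by (rule EF_at[OF base(2) x0])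
 show "iphi X t k s x vs : EE x" if "vs : tlists X x k" for vs
  by (rule iphi_local(1)[where s=s and x=x, OF s V0]) (use that in \<open>auto simp: tlists_def\<close>)
 fix V ta l assume V: "(V, ta) : EF 0" "x : V"
 have "altern (TX x) k (%vs. ta (s x vs) $ l)" using s V unfolding pform_def by blast
 hence "altern (TX x) k (subs (pht x) (%vs. ta (s x vs) $ l))" by (rule alt_subs[OF TX_cspace[OF x0] _ phi_T phi_linear])
 thus "altern (TX x) k (%vs. ta (iphi X t k s x vs) $ l)"
  by (rule alt_cong[rotated, OF _ TX_cspace[OF x0]]) (simp add: iphi_local(2)[where s=s and x=x, OF s V])
qed

text \<open>\<phi> takes values in the (1,0)-vectors of X_0 and kills them, so its square is zero
  and \<open>exp_subs\<close> applies with the endomorphism 1 + \<phi>.\<close>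

lemma exp_iphi_local:
 assumes s: "pform x k (s x)" and V: "(V, ta) : EF 0" "x : V" and vs: "set vs <= TX x" "length vs = k"
 shows "exp_iphi X t k s x vs : EE x"
  "ta (exp_iphi X t k s x vs) $ l = ta (s x (map (%v. lc 1 v 1 (pht x v)) vs)) $ l"
proof -
 have x0: "x : M0" using V EFD(1) by blast
 obtain c d where c: "c : XC 0" "d : XC t" "x : fst c" "x : fst d" by (rule charts_at[OF x0])
 have pow: "pform x k ((iphi X t k ^^ j) s x) & (ALL V ta l vs. (V, ta) : EF 0 --> x : V --> set vs <= TX x --> length vs = k -->
   ta ((iphi X t k ^^ j) s x vs) $ l = (subs (pht x) ^^ j) (%ws. ta (s x ws) $ l) vs)" for j
 proof (induction j)
  case 0 show ?case using s by simp next
  case (Suc j)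
  have P: "pform x k ((iphi X t k ^^ j) s x)" using Suc by blast show ?case
  proof (intro conjI allI impI)
   show "pform x k ((iphi X t k ^^ Suc j) s x)" using iphi_pform[where s="(iphi X t k ^^ j) s" and x=x, OF P x0] by simp
   fix V ta l vs assume V: "(V, ta) : EF 0" "x : V" and vs: "set vs <= TX x" "length vs = k"
   have "ta (iphi X t k ((iphi X t k ^^ j) s) x vs) $ l = subs (pht x) (%ws. ta ((iphi X t k ^^ j) s x ws) $ l) vs"
   by (rule iphi_local(2)[where s="(iphi X t k ^^ j) s" and x=x, OF P V vs])
   also have "... = subs (pht x) (%ws. (subs (pht x) ^^ j) (%ws. ta (s x ws) $ l) ws) vs"
   by (rule subs_cong[OF vs(1) refl phi_T]) (use Suc V vs in auto)
   finally show "ta ((iphi X t k ^^ Suc j) s x vs) $ l = (subs (pht x) ^^ Suc j) (%ws. ta (s x ws) $ l) vs" by simp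
  qed qed
 let ?F = "%c ta x vs. SUM j<=k. (1 / fact j) *s ta ((iphi X t k ^^ j) s x vs)"
 have tl: "vs : tlists X x k" using vs by (simp add: tlists_def)
 have cons: "?F c' ta' x vs = wm ta' ta x *v ?F c ta x vs" if V': "(V', ta') : EF 0" "x : V'" for c' V' ta'
 proof -
  have "ta' ((iphi X t k ^^ j) s x vs) = wm ta' ta x *v ta ((iphi X t k ^^ j) s x vs)" for j
   by (rule wmat_holo(1)[OF base(2) V'(1) V(1) V'(2) V(2)]) (use pow[of j] tl in \<open>auto simp: pform_def\<close>)
  thus ?thesis by (simp add: vec_eq_iff matrix_vector_mult_def sum_distrib_left mult.left_commute sum.swap[of _ UNIV])
 qed note G = glue_eq[OF base(2) c(1,3) V tl, of ?F, OF cons]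
 show "exp_iphi X t k s x vs : EE x" unfolding exp_iphi_def by (rule G(1))
 have "ta (exp_iphi X t k s x vs) = ?F c ta x vs" unfolding exp_iphi_def by (rule G(2))
 hence "ta (exp_iphi X t k s x vs) $ l = (SUM j<=length vs. 1 / fact j * (subs (pht x) ^^ j) (%ws. ta (s x ws) $ l) vs)"
  using pow V vs by simp also have "... = ta (s x (map (%v. lc 1 v 1 (pht x v)) vs)) $ l"
  by (rule exp_subs(1)[where ph="pht x", OF TX_cspace[OF x0] _ vs(1) phi_T phi_phi[OF c]])
   (use s V vs(2) in \<open>auto simp: pform_def\<close>)
 finally show "ta (exp_iphi X t k s x vs) $ l = ta (s x (map (%v. lc 1 v 1 (pht x v)) vs)) $ l" .
qed

lemma iphi_eform:
 assumes s: "eform k s" shows "eform k (iphi X t k s)" unfolding eform_def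
proof (intro conjI ballI allI impI)
 fix x vs assume x: "x : M0" and vs: "vs : tlists X x k"
 show "iphi X t k s x vs : EE x" using iphi_pform[where s=s and x=x, OF eform_pform[OF s x] x] vs unfolding pform_def by blast
next fix V ta x l assume V: "(V, ta) : EF 0" and x: "x : V"
 have x0: "x : M0" using V x EFD(1) by blast
 obtain c d where c: "c : XC 0" "d : XC t" "x : fst c" "x : fst d" by (rule charts_at[OF x0])
 note oV = EF_open[OF base(2) V]
 have "aform x k (%y. subs (pht y) (%vs. ta (s y vs) $ l))"
  by (rule aform_subs[OF base(2) c(1,3) eform_aform0[OF s V x] sfield_phi[OF c] oV x phi_T phi_linear])
 thus "aform x k (%y vs. ta (iphi X t k s y vs) $ l)" by (rule aform_cong[OF oV x, rotated])
   (simp add: iphi_local(2)[where s=s and x=y for y, OF eform_pform[OF s subsetD[OF EFD(1)[OF V]]] V])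
qed

end

lemma altsum_map: "altsum T (map A vs) = altsum (%u ws. T (A u) (map A ws)) vs" by (simp add: altsum_def take_map drop_map)

locale good_pair = good_fibre X t + pair_connection X nab
 for X :: "('x::{t2_space,second_countable_topology}, 'n::{finite,linorder}, 'm::finite, 'e, 'r::finite) family" and t and nab
begin

subsection \<open>The connection and the endomorphism part\<close>

lemma sec_smooth:
 assumes s: "eform k s" and c: "c : XC 0" and ws: "length ws = k" shows "smooth_section X (fst c) (%y. s y (ext c ws y))"
proof (rule ssecI[OF XC_open[OF base(2) c]])
 show "s x (ext c ws x) : EE x" if x: "x : fst c" for x by (rule eform_in[OF s XC_fib0[OF c x]]) (use vext_T[OF base(2) c x] ws in auto)
 show "smat x (%y. ta (s y (ext c ws y)) $ l)" if "x : fst c" "(V, ta) : EF 0" "x : V" for x V ta l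
  by (rule eform_vext_smooth[OF s base(2) that(2,3) base(2) c that(1) ws])
qed

context
 fixes k s c x
 assumes s: "eform k s" and c: "c : XC 0" and x: "x : fst c"
begin

lemma nab_sec:
 assumes V: "(V, ta) : EF 0" "x : V" and v: "v : TX x" and ws: "set ws <= TX x" "length ws = k"
 shows "nab (%y. s y (ext c ws y)) x v : EE x"
  "ta (nab (%y. s y (ext c ws y)) x v) $ l =
   v (%y. ta (s y (ext c ws y)) $ l) + (SUM m:UNIV. cform ta x m l v * ta (s x ws) $ m)"
 using connD(1)[OF sec_smooth[OF s c ws(2)] x v] nab_frame[OF sec_smooth[OF s c ws(2)] x V v, of l]
  vext_map_self[OF base(2) c x ws(1)] by (simp_all add: mult.commute)

lemma nabla_formula:
 assumes V: "(V, ta) : EF 0" "x : V" and vs: "set vs <= TX x" "length vs = Suc k"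
 shows "(SUM q<=k. SUM J:mi q. SUM I:mi (k - q). SUM i:UNIV.
   dzv c i x (%y. coef X c ta s J I y $ l) * wgs (dz c i # dzs c J I) vs) +
   (SUM m:UNIV. wedge (%v. SUM i:UNIV. theta X nab c ta x i m l * dz c i v) (%ws. ta (s x ws) $ m) vs) =
   altsum (%u ws. p10 c x u (%y. ta (s y (ext c ws y)) $ l)) vs +
   altsum (%u ws. SUM m:UNIV. cform ta x m l (p10 c x u) * ta (s x ws) $ m) vs" unfolding coef_def p_apply
  local_formula[OF base(2) c x eform_aform0[OF s V] dzv_T(1)[OF base(2) c x] vs]
  theta_sum[OF V base(2) c x] wedge_eq_altsum altsum_sum ..

lemma nabla_formula':
 assumes V: "(V, ta) : EF 0" "x : V" and vs: "set vs <= TX x" "length vs = Suc k"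
 shows "altsum (%u ws. p10 c x u (%y. ta (s y (ext c ws y)) $ l)) vs +
   altsum (%u ws. SUM m:UNIV. cform ta x m l (p10 c x u) * ta (s x ws) $ m) vs =
   altsum (%u ws. ta (nab (%y. s y (ext c ws y)) x (p10 c x u)) $ l) vs" unfolding altsum_add[symmetric]
 by (rule altsum_cong[OF vs(1)]) (use vs(2) nab_sec(2)[OF V p10_T(1)[OF base(2) c x]] in simp)

end

text \<open>Written with \<open>nab\<close> of the section obtained by inserting constant
  extensions, the alternated terms lie in the fibre and are independent of the frame; the chart is
  handled by \<open>chart_independence_p\<close>. The third form serves to show alternation in
  \<open>nabla_pform\<close>.\<close>

lemma nabla_local:
 assumes s: "eform k s" and c: "c : XC 0" "x : fst c" and V: "(V, ta) : EF 0" "x : V"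
  and vs: "set vs <= TX x" "length vs = Suc k" shows "nabla10 X nab k s x vs : EE x"
  "ta (nabla10 X nab k s x vs) $ l = altsum (%u ws. ta (nab (%y. s y (ext c ws y)) x (p10 c x u)) $ l) vs"
  "ta (nabla10 X nab k s x vs) $ l = (SUM q<=k. SUM J:mi q. SUM I:mi (k - q). SUM i:UNIV.
   dzv c i x (%y. coef X c ta s J I y $ l) * wgs (dz c i # dzs c J I) vs) +
   (SUM m:UNIV. wedge (%v. SUM i:UNIV. theta X nab c ta x i m l * dz c i v) (%ws. ta (s x ws) $ m) vs)"
proof -
 let ?F = "%c ta x vs. \<chi> l. (SUM q<=k. SUM J:mi q. SUM I:mi (k - q). SUM i:UNIV.
   dzv c i x (%y. coef X c ta s J I y $ l) * wgs (dz c i # dzs c J I) vs) +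
   (SUM m:UNIV. wedge (%v. SUM i:UNIV. theta X nab c ta x i m l * dz c i v) (%ws. ta (s x ws) $ m) vs)"
 let ?N = "%ta l. altsum (%u ws. ta (nab (%y. s y (ext c ws y)) x (p10 c x u)) $ l) vs"
 have FN: "?F c ta x vs $ l = ?N ta l" if V: "(V, ta) : EF 0" "x : V" for V ta l
  unfolding vec_lambda_beta nabla_formula[OF s c V vs] nabla_formula'[OF s c V vs] ..
 have cons: "?F c' ta' x vs = wm ta' ta x *v ?F c ta x vs" if c': "c' : XC 0" "x : fst c'" and V': "(V', ta') : EF 0" "x : V'" for c' V' ta'
 proof -
  have "?F c' ta' x vs $ l = (wm ta' ta x *v ?F c ta x vs) $ l" for l
  proof -
   have "altsum (%u ws. SUM m:UNIV. cform ta' x m l (p10 c' x u) * ta' (s x ws) $ m) vs =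
   altsum (%u ws. SUM m:UNIV. cform ta' x m l (p10 c x u) * ta' (s x ws) $ m) vs"
   by (rule altsum_cong[OF vs(1)]) (simp add: p10_indep(1)[OF base(2) c'(1) c(1) c'(2) c(2)])
   hence "?F c' ta' x vs $ l = ?N ta' l"
   unfolding vec_lambda_beta nabla_formula[OF s c' V' vs] chart_independence_p(2)[OF eform_aform0[OF s V'] base(2) c c' vs]
   using nabla_formula'[OF s c V' vs, of l] by simp
   also have "... = altsum (%u ws. SUM m:UNIV. wm ta' ta x $ l $ m * ta (nab (%y. s y (ext c ws y)) x (p10 c x u)) $ m) vs"
   proof (rule altsum_cong[OF vs(1)])
   fix u ws assume "u : TX x" "set ws <= TX x" "Suc (length ws) = length vs"
   hence "nab (%y. s y (ext c ws y)) x (p10 c x u) : EE x" using nab_sec(1)[OF s c V p10_T(1)[OF base(2) c]] vs(2) by simp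
   from wmat_holo(1)[OF base(2) V'(1) V(1) V'(2) V(2) this]
   show "ta' (nab (%y. s y (ext c ws y)) x (p10 c x u)) $ l =
   (SUM m:UNIV. wm ta' ta x $ l $ m * ta (nab (%y. s y (ext c ws y)) x (p10 c x u)) $ m)"
   by (simp only: matrix_vector_mult_def vec_lambda_beta) qed
   also have "... = (wm ta' ta x *v ?F c ta x vs) $ l" unfolding altsum_sum altsum_scale matrix_vector_mult_def FN[OF V, symmetric] by simp
   finally show ?thesis . qed thus ?thesis by (rule vec_eq_iff[THEN iffD2, OF allI]) qed
 have tl: "vs : tlists X x (Suc k)" using vs by (simp add: tlists_def)
 note G = glue_eq[OF base(2) c V tl, of ?F, OF cons]
 show "nabla10 X nab k s x vs : EE x" unfolding nabla10_def by (rule G(1))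
 have *: "ta (nabla10 X nab k s x vs) = ?F c ta x vs" unfolding nabla10_def by (rule G(2))
 show "ta (nabla10 X nab k s x vs) $ l = ?N ta l" unfolding * by (rule FN[OF V])
 show "ta (nabla10 X nab k s x vs) $ l = (SUM q<=k. SUM J:mi q. SUM I:mi (k - q). SUM i:UNIV.
   dzv c i x (%y. coef X c ta s J I y $ l) * wgs (dz c i # dzs c J I) vs) +
   (SUM m:UNIV. wedge (%v. SUM i:UNIV. theta X nab c ta x i m l * dz c i v) (%ws. ta (s x ws) $ m) vs)" unfolding * vec_lambda_beta ..
qed

lemma nabla_pform:
 assumes s: "eform k s" and x0: "x : M0" shows "pform x (Suc k) (nabla10 X nab k s x)" unfolding pform_def
proof (intro conjI allI impI ballI)
 obtain c where c: "c : XC 0" "x : fst c" by (rule XC_at[OF base(2) x0])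
 obtain V0 ta0 where V0: "(V0, ta0) : EF 0" "x : V0" by (rule EF_at[OF base(2) x0])
 show "nabla10 X nab k s x vs : EE x" if "vs : tlists X x (Suc k)" for vs
  by (rule nabla_local(1)[OF s c V0]) (use that in \<open>auto simp: tlists_def\<close>)
 fix V ta l assume V: "(V, ta) : EF 0" "x : V" note cs = TX_cspace[OF x0]
 have lin: "linform (TX x) (%v. SUM i:UNIV. theta X nab c ta x i m l * dz c i v)" for m
  unfolding linform_def by (simp add: dz_lc sum_distrib_left sum.distrib[symmetric] algebra_simps)
 have w: "altern (TX x) (Suc k) (wgs (dz c i # dzs c J I))" if "q : {..k}" "J : mi q" "I : mi (k - q)" for q J I i
 proof -
  have "altern (TX x) (length (dz c i # dzs c J I)) (wgs (dz c i # dzs c J I))" by (rule alt_wedges[OF cs]) (auto intro: linf_dz)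
  thus ?thesis using that by (simp add: mi_def) qed
 have "altern (TX x) (Suc k) (%vs. (SUM q<=k. SUM J:mi q. SUM I:mi (k - q). SUM i:UNIV.
   dzv c i x (%y. coef X c ta s J I y $ l) * wgs (dz c i # dzs c J I) vs))" by (intro alt_sum alt_scale) (rule w)
 moreover have "altern (TX x) (Suc k) (%vs. SUM m:UNIV. wedge (%v. SUM i:UNIV. theta X nab c ta x i m l * dz c i v) (%ws. ta (s x ws) $ m) vs)"
  by (intro alt_sum alt_wedge[OF lin aformD(1)[OF eform_aform0[OF s V]] cs])
 ultimately have "altern (TX x) (Suc k) (%vs. 1 * (SUM q<=k. SUM J:mi q. SUM I:mi (k - q). SUM i:UNIV.
   dzv c i x (%y. coef X c ta s J I y $ l) * wgs (dz c i # dzs c J I) vs) +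
   1 * (SUM m:UNIV. wedge (%v. SUM i:UNIV. theta X nab c ta x i m l * dz c i v) (%ws. ta (s x ws) $ m) vs))" by (rule alt_lincomb)
 thus "altern (TX x) (Suc k) (%vs. ta (nabla10 X nab k s x vs) $ l)"
  by (rule alt_cong[rotated, OF _ cs]) (simp only: nabla_local(3)[OF s c V] mult_1)
qed

lemma wmat_chain:
 assumes "(V, rh) : EF t" "(V', rh') : EF t" "(V0, ta) : EF 0" "x : V" "x : V'" "x : V0"
 shows "wm rh' ta x = wm rh' rh x ** wm rh ta x"
proof (rule wmat_unique[OF base(2) assms(3,6)]) fix e assume e: "e : EE x"
 show "rh' e = (wm rh' rh x ** wm rh ta x) *v ta e"
  using wmat_holo(1)[OF tb assms(2,1,5,4) e] wmat_zero(1)[OF tb assms(1,3,4,6) e] by (simp add: matrix_vector_mul_assoc)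
qed

text \<open>The bracket of the local formula is the derivative of the transition matrix along D v.
  Another frame of E_t multiplies this matrix by a holomorphic one, which the (0,1)-vector D v does
  not differentiate and which cancels against the inverse.\<close>

lemma psi_form_eq:
 assumes c: "c : XC 0" "x : fst c" and V0: "(V0, ta) : EF 0" "x : V0" and V: "(V, rh) : EF t" "x : V" and v: "v : TX x"
 shows "psi_form X nab t c ta x k l v =
  (SUM j:UNIV. minv (wm rh ta x) $ l $ j * Dop x v (%y. wm rh ta y $ j $ k)) + cform ta x k l (pht x v)"
proof -
 have x0: "x : M0" by (rule XC_fib0[OF c])
 obtain d where d: "d : XC t" "x : fst d" by (rule XC_at[OF tb x0])
 note cd = c(1) d(1) c(2) d(2) note D = Dop_props[OF cd v]
 have body: "(SUM j:UNIV. minv (wm rh ta x) $ l $ j * ((SUM i:UNIV. dzbv c i x (%y. wm rh ta y $ j $ k) * dzb c i v) -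
   (SUM i:UNIV. dzv c i x (%y. wm rh ta y $ j $ k) * dz c i (pht x v)))) + (SUM i:UNIV. theta X nab c ta x i k l * dz c i (pht x v)) =
   (SUM j:UNIV. minv (wm rh ta x) $ l $ j * Dop x v (%y. wm rh ta y $ j $ k)) + cform ta x k l (pht x v)" for rh
 proof -
  have "Dop x v f = (SUM i:UNIV. dzbv c i x f * dzb c i v) - (SUM i:UNIV. dzv c i x f * dz c i (pht x v))" for f
  proof -
   have "pht x v f = (SUM i:UNIV. dz c i (pht x v) * dzv c i x f)" using fun_cong[OF p10_phi[OF cd v], of f] by (simp add: p10_def)
   thus ?thesis by (simp add: Dop_eq[OF cd v] lc_def p01_def mult.commute) qed
  thus ?thesis unfolding theta_sum[OF V0 base(2) c] p10_phi[OF cd v] by simp qed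
 have indep: "(SUM j:UNIV. minv (wm rh' ta x) $ l $ j * Dop x v (%y. wm rh' ta y $ j $ k)) =
   (SUM j:UNIV. minv (wm rh ta x) $ l $ j * Dop x v (%y. wm rh ta y $ j $ k))" if V': "(V', rh') : EF t" "x : V'" for V' rh'
 proof -
  let ?W = "wm rh ta" and ?W' = "wm rh' ta" and ?H = "wm rh' rh"
  note Ws = wmat_zero(3)[OF tb V(1) V0(1) V(2) V0(2)] and Hs = wmat_holo(3)[OF tb V'(1) V(1) V'(2) V(2)]
  have oN: "nbhd (V Int V' Int V0)" "x : V Int V' Int V0"
   using EF_open[OF tb V(1)] EF_open[OF tb V'(1)] EF_open[OF base(2) V0(1)] V V' V0 by auto
  have DW: "Dop x v (%y. ?W' y $ j $ k) = (SUM m:UNIV. ?H x $ j $ m * Dop x v (%y. ?W y $ m $ k))" for j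
  proof -
   have "Dop x v (%y. ?W' y $ j $ k) = Dop x v (%y. SUM m:UNIV. ?H y $ j $ m * ?W y $ m $ k)"
   by (rule TD(6)[OF D(1) oN]) (simp add: wmat_chain[OF V(1) V'(1) V0(1)] matrix_matrix_mult_def)
   also have "... = (SUM m:UNIV. Dop x v (%y. ?H y $ j $ m * ?W y $ m $ k))" by (rule T_sum[OF D(1)]) (rule smat_mult[OF Hs Ws])
   also have "... = (SUM m:UNIV. ?H x $ j $ m * Dop x v (%y. ?W y $ m $ k))"
   proof (rule sum.cong[OF refl]) fix m
   have "Dop x v (%y. ?H y $ j $ m) = 0"
   using fun_cong[OF T_decomp[OF tb d D(1)], of "%y. ?H y $ j $ m"] D(3) wmat_holo(4)[OF tb V'(1) V(1) V'(2) V(2) d, of _ j m] by simp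
   thus "Dop x v (%y. ?H y $ j $ m * ?W y $ m $ k) = ?H x $ j $ m * Dop x v (%y. ?W y $ m $ k)" unfolding TD(4)[OF D(1) Hs Ws] by simp
   qed finally show ?thesis . qed
  have inv: "invertible (?W x)" "invertible (?W' x)"
   using wmat_zero(2)[OF tb V(1) V0(1) V(2) V0(2)] wmat_zero(2)[OF tb V'(1) V0(1) V'(2) V0(2)] .
  have "minv (?W' x) ** ?H x = (minv (?W' x) ** (?H x ** ?W x)) ** minv (?W x)"
   by (simp add: matrix_mul_assoc[symmetric] matrix_inv_id[OF inv(1)])
  also have "... = minv (?W x)"
   unfolding wmat_chain[OF V(1) V'(1) V0(1) V(2) V'(2) V0(2), symmetric] by (simp add: matrix_inv_id[OF inv(2)])
  finally have h: "minv (?W' x) ** ?H x = minv (?W x)" .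
  have m: "minv (?W x) $ l $ m = (SUM j:UNIV. minv (?W' x) $ l $ j * ?H x $ j $ m)" for m
   unfolding h[symmetric] by (simp add: matrix_matrix_mult_def)
  show ?thesis unfolding DW m by (simp add: sum_distrib_left sum_distrib_right mult.assoc) (rule sum.swap)
 qed show ?thesis unfolding psi_form_def body
 proof (rule the_equality) show "ALL (V, rh'):EF t. x : V -->
   (SUM j:UNIV. minv (wm rh ta x) $ l $ j * Dop x v (%y. wm rh ta y $ j $ k)) + cform ta x k l (pht x v) =
   (SUM j:UNIV. minv (wm rh' ta x) $ l $ j * Dop x v (%y. wm rh' ta y $ j $ k)) + cform ta x k l (pht x v)"
  proof (rule ballI, unfold split_paired_all prod.case, rule impI)
   fix V' rh' assume "(V', rh') : EF t" "x : V'"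
   from indep[OF this] show "(SUM j:UNIV. minv (wm rh ta x) $ l $ j * Dop x v (%y. wm rh ta y $ j $ k)) + cform ta x k l (pht x v) =
   (SUM j:UNIV. minv (wm rh' ta x) $ l $ j * Dop x v (%y. wm rh' ta y $ j $ k)) + cform ta x k l (pht x v)"
   by (rule arg_cong2[where f="(+)", OF sym refl]) qed
  fix a assume "ALL (V, rh'):EF t. x : V -->
   a = (SUM j:UNIV. minv (wm rh' ta x) $ l $ j * Dop x v (%y. wm rh' ta y $ j $ k)) + cform ta x k l (pht x v)"
  from bspec[OF this V(1)] V(2)
  show "a = (SUM j:UNIV. minv (wm rh ta x) $ l $ j * Dop x v (%y. wm rh ta y $ j $ k)) + cform ta x k l (pht x v)" by simp
 qed
qed

text \<open>The product rule along D v for the change of frame trades the derivative of the matrix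
  for derivatives of the components of the section. The part of D v along \<phi> v combines with the
  connection form to the covariant derivative along \<phi> v.\<close>

lemma psi_section:
 assumes c: "c : XC 0" "x : fst c" and V0: "(V0, ta) : EF 0" "x : V0"
  and V: "(V, rh) : EF t" "x : V" and v: "v : TX x" and S: "smooth_section X U S" "x : U"
 shows "(SUM k:UNIV. psi_form X nab t c ta x k l v * ta (S x) $ k) = (SUM j:UNIV. minv (wm rh ta x) $ l $ j * Dop x v (%y. rh (S y) $ j)) +
  ta (nab S x (pht x v)) $ l - p01 c x v (%y. ta (S y) $ l)"
proof -
 have x0: "x : M0" by (rule XC_fib0[OF c])
 obtain d where d: "d : XC t" "x : fst d" by (rule XC_at[OF tb x0])
 note cd = c(1) d(1) c(2) d(2) note D = Dop_props(1)[OF cd v]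
 let ?W = "wm rh ta"
 note Ws = wmat_zero(3)[OF tb V(1) V0(1) V(2) V0(2)] and Ss = ssecD(4)[OF S V0]
 have oN: "nbhd (V Int V0 Int U)" "x : V Int V0 Int U" using EF_open[OF tb V(1)] EF_open[OF base(2) V0(1)] ssecD(1)[OF S(1)] V V0 S by auto
 have DS: "Dop x v (%y. rh (S y) $ j) = (SUM k:UNIV. Dop x v (%y. ?W y $ j $ k) * ta (S x) $ k) + (SUM k:UNIV. ?W x $ j $ k * Dop x v (%y. ta (S y) $ k))" for j
 proof -
  have "Dop x v (%y. rh (S y) $ j) = Dop x v (%y. SUM k:UNIV. ?W y $ j $ k * ta (S y) $ k)"
  proof (rule TD(6)[OF D oN]) fix y assume y: "y : V Int V0 Int U"
   have "rh (S y) = ?W y *v ta (S y)" by (rule wmat_zero(1)[OF tb V(1) V0(1) _ _ ssecD(2)[OF S(1)]]) (use y in auto)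
   thus "rh (S y) $ j = (SUM k:UNIV. ?W y $ j $ k * ta (S y) $ k)" by (simp add: matrix_vector_mult_def)
  qed also have "... = (SUM k:UNIV. Dop x v (%y. ?W y $ j $ k * ta (S y) $ k))" by (rule T_sum[OF D]) (rule smat_mult[OF Ws Ss])
  also have "... = (SUM k:UNIV. Dop x v (%y. ?W y $ j $ k) * ta (S x) $ k + ?W x $ j $ k * Dop x v (%y. ta (S y) $ k))"
   by (simp only: TD(4)[OF D Ws Ss]) finally show ?thesis by (simp add: sum.distrib) qed
 have "(SUM j:UNIV. minv (?W x) $ l $ j * (SUM k:UNIV. ?W x $ j $ k * Dop x v (%y. ta (S y) $ k))) =
   ((minv (?W x) ** ?W x) *v (\<chi> k. Dop x v (%y. ta (S y) $ k))) $ l"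
  unfolding matrix_vector_mul_assoc[symmetric] by (simp add: matrix_vector_mult_def)
 also have "... = Dop x v (%y. ta (S y) $ l)" by (simp add: matrix_inv_id[OF wmat_zero(2)[OF tb V(1) V0(1) V(2) V0(2)]])
 also have "... = p01 c x v (%y. ta (S y) $ l) - pht x v (%y. ta (S y) $ l)" by (simp add: Dop_eq[OF cd v] lc_def)
 finally have 1: "(SUM j:UNIV. minv (?W x) $ l $ j * (SUM k:UNIV. ?W x $ j $ k * Dop x v (%y. ta (S y) $ k))) =
   p01 c x v (%y. ta (S y) $ l) - pht x v (%y. ta (S y) $ l)" .
 have 2: "(SUM j:UNIV. minv (?W x) $ l $ j * (SUM k:UNIV. Dop x v (%y. ?W y $ j $ k) * ta (S x) $ k)) =
   (SUM k:UNIV. (SUM j:UNIV. minv (?W x) $ l $ j * Dop x v (%y. ?W y $ j $ k)) * ta (S x) $ k)"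
  by (simp add: sum_distrib_left sum_distrib_right mult.assoc) (rule sum.swap)
 have nf: "ta (nab S x (pht x v)) $ l = pht x v (%y. ta (S y) $ l) + (SUM k:UNIV. cform ta x k l (pht x v) * ta (S x) $ k)"
  unfolding nab_frame[OF S V0 phi_T[OF v]] by (simp add: mult.commute)
 show ?thesis unfolding psi_form_eq[OF c V0 V v] DS nf by (simp add: distrib_left distrib_right sum.distrib 1 2)
qed

end

context good_pair
begin

text \<open>An auxiliary frame \<open>rh\<close> of E_t is kept fixed. By \<open>psi_section\<close>
  a change of the frame \<open>ta\<close> acts linearly on each of the three terms, which is the
  consistency needed for gluing.\<close>

lemma psi_local:
 assumes s: "eform k s" and c: "c : XC 0" "x : fst c" and V: "(V, ta) : EF 0" "x : V"
  and Vt: "(V1, rh) : EF t" "x : V1" and vs: "set vs <= TX x" "length vs = Suc k" shows "psi X nab t k s x vs : EE x"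
  "ta (psi X nab t k s x vs) $ l = altsum (%u ws. (SUM j:UNIV. minv (wm rh ta x) $ l $ j * Dop x u (%y. rh (s y (ext c ws y)) $ j)) +
   ta (nab (%y. s y (ext c ws y)) x (pht x u)) $ l - p01 c x u (%y. ta (s y (ext c ws y)) $ l)) vs"
proof -
 have x0: "x : M0" by (rule XC_fib0[OF c])
 let ?S = "%ws y. s y (ext c ws y)"
 let ?T = "%ta l u ws. (SUM j:UNIV. minv (wm rh ta x) $ l $ j * Dop x u (%y. rh (?S ws y) $ j)) +
   ta (nab (?S ws) x (pht x u)) $ l - p01 c x u (%y. ta (?S ws y) $ l)"
 let ?F = "%c ta x vs. \<chi> l. SUM m:UNIV. wedge (psi_form X nab t c ta x m l) (%ws. ta (s x ws) $ m) vs"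
 have FT: "?F c' ta x vs $ l = altsum (?T ta l) vs" if c': "c' : XC 0" "x : fst c'" and V: "(V, ta) : EF 0" "x : V" for V ta l c'
 proof -
  have "?F c' ta x vs $ l = altsum (%u ws. SUM m:UNIV. psi_form X nab t c' ta x m l u * ta (s x ws) $ m) vs"
   by (simp add: wedge_eq_altsum altsum_sum) also have "... = altsum (?T ta l) vs"
  proof (rule altsum_cong[OF vs(1)])
   fix u ws assume u: "u : TX x" and ws: "set ws <= TX x" "Suc (length ws) = length vs"
   have k: "length ws = k" using ws vs by simp
   have Sx: "?S ws x = s x ws" using vext_map_self[OF base(2) c ws(1)] by simp
   have "(SUM m:UNIV. psi_form X nab t c' ta x m l u * ta (s x ws) $ m) = (SUM m:UNIV. psi_form X nab t c ta x m l u * ta (?S ws x) $ m)"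
   unfolding Sx psi_form_eq[OF c' V Vt u] psi_form_eq[OF c V Vt u] ..
   also have "... = ?T ta l u ws" by (rule psi_section[OF c V Vt u sec_smooth[OF s c(1) k] c(2)])
   finally show "(SUM m:UNIV. psi_form X nab t c' ta x m l u * ta (s x ws) $ m) = ?T ta l u ws" .
  qed finally show ?thesis . qed
 have cons: "?F c' ta' x vs = wm ta' ta x *v ?F c ta x vs" if c': "c' : XC 0" "x : fst c'" and V': "(V', ta') : EF 0" "x : V'" for c' V' ta'
 proof -
  let ?h = "wm ta' ta x"
  have "?F c' ta' x vs $ l = (?h *v ?F c ta x vs) $ l" for l
  proof -
   have W: "wm rh ta x = wm rh ta' x ** ?h"
   proof (rule wmat_unique[OF base(2) V]) fix e assume e: "e : EE x"
   show "rh e = (wm rh ta' x ** ?h) *v ta e"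
   unfolding matrix_vector_mul_assoc[symmetric] wmat_holo(1)[OF base(2) V'(1) V(1) V'(2) V(2) e, symmetric]
   by (rule wmat_zero(1)[OF tb Vt(1) V'(1) Vt(2) V'(2) e]) qed
   have inv: "invertible (wm rh ta x)" "invertible (wm rh ta' x)"
   using wmat_zero(2)[OF tb Vt(1) V(1) Vt(2) V(2)] wmat_zero(2)[OF tb Vt(1) V'(1) Vt(2) V'(2)] .
   have "minv (wm rh ta' x) = minv (wm rh ta' x) ** (wm rh ta x ** minv (wm rh ta x))" by (simp add: matrix_inv_id[OF inv(1)])
   also have "... = (minv (wm rh ta' x) ** wm rh ta' x) ** (?h ** minv (wm rh ta x))" unfolding W matrix_mul_assoc ..
   also have "... = ?h ** minv (wm rh ta x)" by (simp add: matrix_inv_id[OF inv(2)])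
   finally have hW: "minv (wm rh ta' x) $ l $ j = (SUM m:UNIV. ?h $ l $ m * minv (wm rh ta x) $ m $ j)" for j
   by (simp add: matrix_matrix_mult_def)
   have "?F c' ta' x vs $ l = altsum (?T ta' l) vs" by (rule FT[OF c' V'])
   also have "... = altsum (%u ws. SUM m:UNIV. ?h $ l $ m * ?T ta m u ws) vs"
   proof (rule altsum_cong[OF vs(1)])
   fix u ws assume u: "u : TX x" and ws: "set ws <= TX x" "Suc (length ws) = length vs"
   have k: "length ws = k" using ws vs by simp
   have 1: "(SUM j:UNIV. minv (wm rh ta' x) $ l $ j * Dop x u (%y. rh (?S ws y) $ j)) =
   (SUM m:UNIV. ?h $ l $ m * (SUM j:UNIV. minv (wm rh ta x) $ m $ j * Dop x u (%y. rh (?S ws y) $ j)))"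
   unfolding hW by (simp add: sum_distrib_left sum_distrib_right mult.assoc) (rule sum.swap)
   have 2: "ta' (nab (?S ws) x (pht x u)) $ l = (SUM m:UNIV. ?h $ l $ m * ta (nab (?S ws) x (pht x u)) $ m)"
   using wmat_holo(1)[OF base(2) V'(1) V(1) V'(2) V(2) nab_sec(1)[OF s c V phi_T[OF u] ws(1) k]]
   by (simp only: matrix_vector_mult_def vec_lambda_beta)
   have 3: "p01 c x u (%y. ta' (?S ws y) $ l) = (SUM m:UNIV. ?h $ l $ m * p01 c x u (%y. ta (?S ws y) $ m))"
   by (rule holo_frame_change[OF s base(2) c V V' k p10_T(2)[OF base(2) c] p10_dz(3)[OF base(2) c] base(2) c])
   show "?T ta' l u ws = (SUM m:UNIV. ?h $ l $ m * ?T ta m u ws)"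
   unfolding 1 2 3 by (simp only: right_diff_distrib distrib_left sum.distrib sum_subtractf)
   qed also have "... = (?h *v ?F c ta x vs) $ l"
   unfolding altsum_sum altsum_scale matrix_vector_mult_def FT[OF c V, symmetric] by (simp only: vec_lambda_beta)
   finally show ?thesis . qed thus ?thesis by (rule vec_eq_iff[THEN iffD2, OF allI]) qed
 have tl: "vs : tlists X x (Suc k)" using vs by (simp add: tlists_def)
 note G = glue_eq[OF base(2) c V tl, of ?F, OF cons]
 show "psi X nab t k s x vs : EE x" unfolding psi_def by (rule G(1))
 have *: "ta (psi X nab t k s x vs) = ?F c ta x vs" unfolding psi_def by (rule G(2))
 show "ta (psi X nab t k s x vs) $ l = altsum (?T ta l) vs" unfolding * by (rule FT[OF c V])
qed

subsection \<open>The deformed operator\<close>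

definition Rform :: "nat => ('x, 'e) form => ('x, 'e) form" where
 "Rform k s = form_add X (Suc k) (form_diff X (Suc k) (dbar X 0 k s) (Lphi10 X nab t k s)) (psi X nab t k s)"

text \<open>The covariant derivative along \<phi> u appears with a minus sign in the commutator and
  with a plus sign in \<open>psi\<close>. The terms with \<phi> inserted under the covariant
  derivative cancel inside the commutator, and \<open>dbar X 0\<close> cancels the last term of
  \<open>psi\<close>. What remains is the derivative along D u of the components in
  \<open>rh\<close> and the derivative of \<phi>.\<close>

lemma Rform_local:
 assumes s: "eform k s" and c: "c : XC 0" "x : fst c"
  and Vt: "(V1, rh) : EF t" "x : V1" and vs: "set vs <= TX x" "length vs = Suc k" shows "Rform k s x vs : EE x"
  "rh (Rform k s x vs) $ j = altsum (%u ws. Dop x u (%y. rh (s y (ext c ws y)) $ j) +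
   subs (%w. fd c x (p10 c x u) (%y. pht y (vext c w y))) (%ws. rh (s x ws) $ j) ws) vs"
proof -
 have x0: "x : M0" by (rule XC_fib0[OF c])
 obtain V ta where V: "(V, ta) : EF 0" "x : V" by (rule EF_at[OF base(2) x0])
 obtain d where d: "d : XC t" "x : fst d" by (rule XC_at[OF tb x0])
 note cd = c(1) d(1) c(2) d(2)
 have tl: "vs : tlists X x (Suc k)" using vs by (simp add: tlists_def)
 note s' = iphi_eform[OF s]
 let ?S = "%ws y. s y (ext c ws y)"
 let ?fd = "%u w. fd c x (p10 c x u) (%y. pht y (vext c w y))"
 have db: "dbar X 0 k s x vs : EE x" "ta (dbar X 0 k s x vs) $ l = altsum (%u ws. p01 c x u (%y. ta (?S ws y) $ l)) vs" for l
  by (rule dbar_local[OF s base(2) c V vs])+ note np = nabla_pform[OF s x0]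
 have ia: "iphi X t (Suc k) (nabla10 X nab k s) x vs : EE x" by (rule iphi_local(1)[where s="nabla10 X nab k s" and x=x, OF np V vs])
 have ib: "ta (iphi X t (Suc k) (nabla10 X nab k s) x vs) $ l = altsum (%u ws. ta (nab (?S ws) x (pht x u)) $ l) vs +
   altsum (%u ws. subs (pht x) (%ws. ta (nab (?S ws) x (p10 c x u)) $ l) ws) vs" for l
 proof -
  have "ta (iphi X t (Suc k) (nabla10 X nab k s) x vs) $ l = subs (pht x) (%vs. ta (nabla10 X nab k s x vs) $ l) vs"
   by (rule iphi_local(2)[where s="nabla10 X nab k s" and x=x, OF np V vs])
  also have "... = subs (pht x) (altsum (%u ws. ta (nab (?S ws) x (p10 c x u)) $ l)) vs"
   by (rule subs_cong[OF vs(1) refl phi_T]) (use nabla_local(2)[OF s c V] vs(2) in auto)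
  also have "... = altsum (%u ws. ta (nab (?S ws) x (p10 c x (pht x u))) $ l) vs +
   altsum (%u ws. subs (pht x) (%ws. ta (nab (?S ws) x (p10 c x u)) $ l) ws) vs" by (rule subs_altsum)
  also have "altsum (%u ws. ta (nab (?S ws) x (p10 c x (pht x u))) $ l) vs = altsum (%u ws. ta (nab (?S ws) x (pht x u)) $ l) vs"
   by (rule altsum_cong[OF vs(1)]) (simp add: p10_phi[OF cd]) finally show ?thesis . qed
 have na: "nabla10 X nab k (iphi X t k s) x vs : EE x" by (rule nabla_local(1)[OF s' c V vs])
 have nb: "ta (nabla10 X nab k (iphi X t k s) x vs) $ l = altsum (%u ws. subs (?fd u) (%ws. ta (s x ws) $ l) ws) vs +
   altsum (%u ws. subs (pht x) (%ws. ta (nab (?S ws) x (p10 c x u)) $ l) ws) vs" for l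
  unfolding nabla_local(2)[OF s' c V vs] altsum_add[symmetric]
 proof (rule altsum_cong[OF vs(1)])
  fix u ws assume u: "u : TX x" and ws: "set ws <= TX x" "Suc (length ws) = length vs"
  have k: "length ws = k" using ws vs by simp note p = p10_T(1)[OF base(2) c, of u]
  have oN: "nbhd (fst c Int V)" "x : fst c Int V" using XC_open[OF base(2) c(1)] EF_open[OF base(2) V(1)] c V by auto
  have "p10 c x u (%y. ta (iphi X t k s y (ext c ws y)) $ l) =
   p10 c x u (%y. subs (pht y) (%vs. ta (s y vs) $ l) (ext c ws y))"
  proof (rule TD(6)[OF p oN]) fix y assume y: "y : fst c Int V"
   hence yc: "y : fst c" and yV: "y : V" by auto
   show "ta (iphi X t k s y (ext c ws y)) $ l = subs (pht y) (%vs. ta (s y vs) $ l) (ext c ws y)"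
   by (rule iphi_local(2)[where s=s and x=y, OF eform_pform[OF s XC_fib0[OF c(1) yc]] V(1) yV]) (use vext_T[OF base(2) c(1) yc] k in auto)
  qed
  also have "... = subs (?fd u) (%ws. ta (s x ws) $ l) ws + subs (pht x) (%vs. p10 c x u (%y. ta (s y (ext c vs y)) $ l)) ws"
   by (rule subs_deriv[OF base(2) c eform_aform0[OF s V] p sfield_phi[OF cd] ws(1) k])
  finally have 1: "p10 c x u (%y. ta (iphi X t k s y (ext c ws y)) $ l) =
   subs (?fd u) (%ws. ta (s x ws) $ l) ws + subs (pht x) (%vs. p10 c x u (%y. ta (s y (ext c vs y)) $ l)) ws" .
  have 2: "(SUM m:UNIV. cform ta x m l (p10 c x u) * ta (iphi X t k s x ws) $ m) =
   subs (pht x) (%ws. SUM m:UNIV. cform ta x m l (p10 c x u) * ta (s x ws) $ m) ws"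
   unfolding subs_sum subs_scale iphi_local(2)[where s=s and x=x, OF eform_pform[OF s x0] V ws(1) k] ..
  have 3: "subs (pht x) (%ws. ta (nab (?S ws) x (p10 c x u)) $ l) ws = subs (pht x)
   (%vs. p10 c x u (%y. ta (s y (ext c vs y)) $ l) + (SUM m:UNIV. cform ta x m l (p10 c x u) * ta (s x vs) $ m)) ws"
   by (rule subs_cong[OF ws(1) refl phi_T]) (use nab_sec(2)[OF s c V p] k in auto)
  show "ta (nab (%y. iphi X t k s y (ext c ws y)) x (p10 c x u)) $ l =
   subs (?fd u) (%ws. ta (s x ws) $ l) ws + subs (pht x) (%ws. ta (nab (?S ws) x (p10 c x u)) $ l) ws"
   unfolding nab_sec(2)[OF s' c V p ws(1) k] 1 2 3 subs_add by simp qed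
 have pa: "psi X nab t k s x vs : EE x" by (rule psi_local(1)[OF s c V Vt vs])
 have pb: "ta (psi X nab t k s x vs) $ l = altsum (%u ws. SUM j:UNIV. minv (wm rh ta x) $ l $ j * Dop x u (%y. rh (?S ws y) $ j)) vs +
   altsum (%u ws. ta (nab (?S ws) x (pht x u)) $ l) vs - altsum (%u ws. p01 c x u (%y. ta (?S ws y) $ l)) vs" for l
  unfolding psi_local(2)[OF s c V Vt vs] altsum_add altsum_diff ..
 note L = form_comb[where s="iphi X t (Suc k) (nabla10 X nab k s)" and s'="nabla10 X nab k (iphi X t k s)" and x=x and vs=vs, OF x0 tl ia na]
 have La: "Lphi10 X nab t k s x vs : EE x" unfolding Lphi10_def by (rule L(2))
 have Lb: "ta (Lphi10 X nab t k s x vs) = ta (iphi X t (Suc k) (nabla10 X nab k s) x vs) - ta (nabla10 X nab k (iphi X t k s) x vs)"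
  unfolding Lphi10_def by (rule L(4)[OF V])
 note D = form_comb[where s="dbar X 0 k s" and s'="Lphi10 X nab t k s" and x=x and vs=vs, OF x0 tl db(1) La]
 note E = form_comb[where s="form_diff X (Suc k) (dbar X 0 k s) (Lphi10 X nab t k s)" and s'="psi X nab t k s" and x=x and vs=vs, OF x0 tl D(2) pa]
 show R: "Rform k s x vs : EE x" unfolding Rform_def by (rule E(1))
 have "ta (Rform k s x vs) = ta (dbar X 0 k s x vs) - ta (Lphi10 X nab t k s x vs) + ta (psi X nab t k s x vs)"
  unfolding Rform_def E(3)[OF V] D(4)[OF V] ..
 hence ta: "ta (Rform k s x vs) $ l = altsum (%u ws. SUM j:UNIV. minv (wm rh ta x) $ l $ j * Dop x u (%y. rh (?S ws y) $ j)) vs +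
   altsum (%u ws. subs (?fd u) (%ws. ta (s x ws) $ l) ws) vs" for l by (simp add: Lb db(2) ib nb pb)
 \<comment> \<open>Multiplication by the transition matrix passes to the frame of E_t and absorbs
   the inverse matrix coming from \<open>psi\<close>.\<close>
 let ?W = "wm rh ta x"
 have "rh (Rform k s x vs) $ j = (SUM l:UNIV. ?W $ j $ l * ta (Rform k s x vs) $ l)"
  using wmat_zero(1)[OF tb Vt(1) V(1) Vt(2) V(2) R] by (simp add: matrix_vector_mult_def)
 also have "... = altsum (%u ws. SUM l:UNIV. ?W $ j $ l * (SUM i:UNIV. minv ?W $ l $ i * Dop x u (%y. rh (?S ws y) $ i)) +
   ?W $ j $ l * subs (?fd u) (%ws. ta (s x ws) $ l) ws) vs" unfolding ta altsum_sum altsum_add altsum_scale by (simp only: distrib_left)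
 also have "... = altsum (%u ws. Dop x u (%y. rh (?S ws y) $ j) + subs (?fd u) (%ws. rh (s x ws) $ j) ws) vs"
 proof (rule altsum_cong[OF vs(1)])
  fix u ws assume u: "u : TX x" and ws: "set ws <= TX x" "Suc (length ws) = length vs"
  have "(SUM l:UNIV. ?W $ j $ l * (SUM i:UNIV. minv ?W $ l $ i * Dop x u (%y. rh (?S ws y) $ i))) =
   ((?W ** minv ?W) *v (\<chi> i. Dop x u (%y. rh (?S ws y) $ i))) $ j"
   unfolding matrix_vector_mul_assoc[symmetric] by (simp add: matrix_vector_mult_def)
  also have "... = Dop x u (%y. rh (?S ws y) $ j)" by (simp add: matrix_inv_id[OF wmat_zero(2)[OF tb Vt(1) V(1) Vt(2) V(2)]])
  finally have 1: "(SUM l:UNIV. ?W $ j $ l * (SUM i:UNIV. minv ?W $ l $ i * Dop x u (%y. rh (?S ws y) $ i))) = Dop x u (%y. rh (?S ws y) $ j)" .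
  have 2: "subs (?fd u) (%ws. rh (s x ws) $ j) ws = (SUM l:UNIV. ?W $ j $ l * subs (?fd u) (%ws. ta (s x ws) $ l) ws)"
   unfolding subs_scale[symmetric] subs_sum[symmetric]
  proof (rule subs_cong[OF ws(1) refl fd_props(1)[OF base(2) c]])
   fix ws' assume "set ws' <= TX x" "length ws' = length ws"
   hence "s x ws' : EE x" using eform_in[OF s x0] ws vs by simp
   from wmat_zero(1)[OF tb Vt(1) V(1) Vt(2) V(2) this]
   show "rh (s x ws') $ j = (SUM l:UNIV. ?W $ j $ l * ta (s x ws') $ l)" by (simp add: matrix_vector_mult_def)
  qed
  show "(SUM l:UNIV. ?W $ j $ l * (SUM i:UNIV. minv ?W $ l $ i * Dop x u (%y. rh (?S ws y) $ i)) +
   ?W $ j $ l * subs (?fd u) (%ws. ta (s x ws) $ l) ws) = Dop x u (%y. rh (?S ws y) $ j) + subs (?fd u) (%ws. rh (s x ws) $ j) ws"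
   unfolding sum.distrib 1 2 .. qed
 finally show "rh (Rform k s x vs) $ j = altsum (%u ws. Dop x u (%y. rh (?S ws y) $ j) + subs (?fd u) (%ws. rh (s x ws) $ j) ws) vs" .
qed

end

section \<open>Pullback by the bundle automorphism\<close>

context good_fibre
begin

definition pull :: "nat => ('x, 'e) form => ('x, 'e) form" where
 "pull k s = (%x vs. if x : M0 & vs : tlists X x k then s x (map (Aop x) vs) else undefined)"

lemma Aop_T: "v : TX x ==> Aop x v : TX x" by (rule charts_at[OF TD(1)], assumption, rule Aop_props(1))

lemma Aop_linear: "v : TX x ==> w : TX x ==> Aop x (lc a v b w) = lc a (Aop x v) b (Aop x w)"
 by (rule charts_at[OF TD(1)], assumption, rule Aop_lc)

lemma pull_eq: "x : M0 ==> set vs <= TX x ==> length vs = k ==> pull k s x vs = s x (map (Aop x) vs)" by (simp add: pull_def tlists_def)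

lemma map_Aop_T: "set vs <= TX x ==> set (map (Aop x) vs) <= TX x" using Aop_T by auto

lemma pull_eform:
 assumes s: "eform k s" shows "eform k (pull k s)" unfolding eform_def
proof (intro conjI ballI allI impI)
 fix x vs assume x: "x : M0" and vs: "vs : tlists X x k"
 have vs': "set vs <= TX x" "length vs = k" using vs by (auto simp: tlists_def)
 show "pull k s x vs : EE x" unfolding pull_eq[OF x vs'] by (rule eform_in[OF s x map_Aop_T[OF vs'(1)]]) (simp add: vs'(2))
next fix V ta x l assume V: "(V, ta) : EF 0" and x: "x : V"
 have x0: "x : M0" using V x EFD(1) by blast note ss = eform_aform0[OF s V x, of l]
 obtain c d where cd: "c : XC 0" "d : XC t" "x : fst c" "x : fst d" by (rule charts_at[OF x0])
 obtain N where N: "nbhd N" "x : N" "ALL y:N. altern (TX y) k (%vs. ta (s y vs) $ l)" by (rule aform_nbhd[OF ss])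
 have "aform x k (%y vs. ta (s y (map (Aop y) vs)) $ l)" unfolding aform_def
 proof (intro conjI allI impI exI[of _ N] N(1,2))
  show "ALL y:N. altern (TX y) k (%vs. ta (s y (map (Aop y) vs)) $ l)"
  proof fix y assume "y : N"
   hence "altern (TX y) k (%vs. ta (s y vs) $ l)" using N(3) by blast
   from alt_compose[OF this Aop_T Aop_linear]
   show "altern (TX y) k (%vs. ta (s y (map (Aop y) vs)) $ l)" . qed
  fix Fs assume Fs: "length Fs = k" "ALL F:set Fs. sfield x F"
  have "smat x (%y. ta (s y (map (%F. F y) (map (%F y. Aop y (F y)) Fs))) $ l)"
   by (rule aformD(2)[OF ss]) (use Fs sfield_Aop[OF cd] in auto)
  thus "smat x (%y. ta (s y (map (Aop y) (map (%F. F y) Fs))) $ l)" by (simp add: o_def)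
 qed
 thus "aform x k (%y vs. ta (pull k s y vs) $ l)" by (rule aform_cong[OF EF_open[OF base(2) V] x, rotated])
   (simp add: pull_eq subsetD[OF EFD(1)[OF V]])
qed

text \<open>The image under A of a constant-coefficient field in the chart \<open>d\<close> of X_t,
  normalized to take the value \<open>w\<close> at \<open>x\<close>. Evaluating a pullback on
  constant fields of \<open>d\<close> means evaluating the original form on such fields.\<close>

definition transport :: "('x, 'n) chart => 'x => 'x tvec => 'x => 'x tvec" where
 "transport d x w y = Aop y (vext d (Ainv x w) y)"

context
 fixes c d x and k :: 'n
 assumes c: "c : XC 0" and d: "d : XC t" and xc: "x : fst c" and xd: "x : fst d"
begin

text \<open>The product rule for a (1,0)-field of X_0 applied to z_t^k: derivatives of the
  coefficients, and the second derivative with coefficients frozen at \<open>x\<close>.\<close>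

private lemma leibniz:
 assumes v: "v : TX x" and g: "!!i. smat x (g i)" and a: "!!i. dz c i a = g i x"
 shows "v (%y. SUM i:UNIV. g i y * dzv c i y (%y. snd d y $ k)) =
  (SUM i:UNIV. v (g i) * dzv c i x (%y. snd d y $ k)) + v (%y. vext c (p10 c x a) y (%y. snd d y $ k))"
proof -
 let ?M = "%i y. dzv c i y (%y. snd d y $ k)"
 have M: "smat x (?M i)" for i by (rule T_apply_smooth(1)[OF base(2) c xc coord_smooth[OF tb d xd]])
 have "v (%y. SUM i:UNIV. g i y * ?M i y) = (SUM i:UNIV. v (%y. g i y * ?M i y))" by (rule T_sum[OF v]) (rule smat_mult[OF g M])
 also have "... = (SUM i:UNIV. v (g i) * ?M i x) + (SUM i:UNIV. g i x * v (?M i))" by (simp only: TD(4)[OF v g M] sum.distrib)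
 also have "(SUM i:UNIV. g i x * v (?M i)) = (SUM i:UNIV. v (%y. g i x * ?M i y))" by (simp only: T_scale[OF v])
 also have "... = v (%y. SUM i:UNIV. g i x * ?M i y)" by (rule T_sum[OF v, symmetric]) (rule smat_scale[OF M])
 also have "(%y. SUM i:UNIV. g i x * ?M i y) = (%y. vext c (p10 c x a) y (%y. snd d y $ k))" unfolding vext_p(1)[OF base(2) c xc] a ..
 finally show ?thesis .
qed

private lemma dz_p10: "dz d k (p10 c x v) = (SUM i:UNIV. dz c i v * dzv c i x (%y. snd d y $ k))" by (simp add: dz_def[of d] p10_def)

private lemma smooth_zd: "smat x (%y. vext c v y (%y. snd d y $ k))" by (rule vext_smooth[OF base(2) c xc coord_smooth[OF tb d xd]])

lemma N_cd: "nbhd (fst c Int fst d)" "x : fst c Int fst d" using XC_open[OF base(2) c] XC_open[OF tb d] xc xd by auto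

lemma transport_sfield: "sfield x (transport d x w)"
 unfolding transport_def[abs_def] by (rule sfield_Aop[OF c d xc xd sfield_vec(1)[OF tb d xd]])

lemma transport_self: "w : TX x ==> transport d x w x = w"
 unfolding transport_def vext_self[OF tb d xd Ainv_props(1)[OF c d xc xd]] by (rule Ainv_props(4)[OF c d xc xd])

text \<open>By \<open>dz_Aop\<close>, dz_t of the (1,0)-part of a transported field is constant, so
  its derivative vanishes and \<open>leibniz\<close> expresses the derivative of the coefficients by
  second derivatives of z_t. The dzbar-coefficients are first derivatives of conjugate coordinates
  along a constant (0,1)-field of \<open>d\<close>.\<close>

lemma D_Phi:
 assumes u: "u : TX x" and w: "w : TX x"
 shows "dz d k (p10 c x (fd c x (Dop x u) (transport d x w))) = - Dop x u (%y. vext c (p10 c x w) y (%y. snd d y $ k))"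
  "dzb c i (fd c x (Dop x u) (transport d x w)) = Dop x u (%y. vext d (Dop x w) y (%y. cnj (snd c y $ i)))"
proof - note D = Dop_props(1)[OF c d xc xd u] and a = Ainv_props[OF c d xc xd w]
 have e: "vext d (Ainv x w) y : TX y" if "y : fst c Int fst d" for y by (rule vext_T[OF tb d]) (use that in auto)
 have "Dop x u (%y. SUM i:UNIV. dz c i (transport d x w y) * dzv c i y (%y. snd d y $ k)) = Dop x u (%y. dz d k (Ainv x w))"
 proof (rule TD(6)[OF D N_cd]) fix y assume y: "y : fst c Int fst d"
  hence yc: "y : fst c" and yd: "y : fst d" by auto
  have "(SUM i:UNIV. dz c i (transport d x w y) * dzv c i y (%y. snd d y $ k)) = dz d k (p10 c y (transport d x w y))"
   by (simp add: dz_def[of d] p10_def)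
  also have "... = dz d k (vext d (Ainv x w) y)" unfolding transport_def by (rule dz_Aop[OF c d yc yd e[OF y], symmetric])
  finally show "(SUM i:UNIV. dz c i (transport d x w y) * dzv c i y (%y. snd d y $ k)) = dz d k (Ainv x w)"
   by (simp add: vext_dz[OF tb d yd]) qed also have "... = 0" by (rule TD(5)[OF D])
 finally have "(SUM i:UNIV. Dop x u (%y. dz c i (transport d x w y)) * dzv c i x (%y. snd d y $ k)) + Dop x u (%y. vext c (p10 c x w) y (%y. snd d y $ k)) = 0"
  using leibniz[OF D sfield_coord(1)[OF transport_sfield[of w] base(2) c xc], where a=w] transport_self[OF w] by simp
 thus "dz d k (p10 c x (fd c x (Dop x u) (transport d x w))) = - Dop x u (%y. vext c (p10 c x w) y (%y. snd d y $ k))"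
  unfolding dz_p10 fd_props[OF base(2) c xc] by (simp add: add_eq_0_iff2)
 show "dzb c i (fd c x (Dop x u) (transport d x w)) = Dop x u (%y. vext d (Dop x w) y (%y. cnj (snd c y $ i)))"
  unfolding fd_props[OF base(2) c xc]
 proof (rule TD(6)[OF D N_cd]) fix y assume y: "y : fst c Int fst d"
  hence yc: "y : fst c" and yd: "y : fst d" by auto
  have "dzb c i (transport d x w y) = dzb c i (p01 d y (vext d (Ainv x w) y))"
   unfolding transport_def by (rule Aop_props(3)[OF c d yc yd e[OF y]])
  also have "p01 d y (vext d (Ainv x w) y) = vext d (p01 d x (Ainv x w)) y"
   unfolding vext_p(2)[OF tb d xd] by (simp add: p01_def vext_dz[OF tb d yd])
  finally show "dzb c i (transport d x w y) = vext d (Dop x w) y (%y. cnj (snd c y $ i))" by (simp add: a(3) dzb_def)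
 qed
qed

lemma D_phi:
 assumes u: "u : TX x" and w: "w : TX x" shows "dz d k (p10 c x (fd c x (p10 c x u) (%y. pht y (vext c w y)))) =
   p10 c x u (%y. vext c (Dop x w) y (%y. snd d y $ k))"
  "dzb c i (fd c x (p10 c x u) (%y. pht y (vext c w y))) = 0"
proof -
 let ?p = "p10 c x u" and ?F = "%y. pht y (vext c w y)"
 note p = p10_T(1)[OF base(2) c xc, of u]
 have F: "sfield x ?F" by (rule sfield_phi[OF c d xc xd sfield_vec(1)[OF base(2) c xc]])
 have e: "vext c w y : TX y" if "y : fst c Int fst d" for y by (rule vext_T[OF base(2) c]) (use that in auto)
 have "?p (%y. SUM i:UNIV. dz c i (?F y) * dzv c i y (%y. snd d y $ k)) = ?p (%y. vext c (p01 c x w) y (%y. snd d y $ k))"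
 proof (rule TD(6)[OF p N_cd]) fix y assume y: "y : fst c Int fst d"
  hence yc: "y : fst c" and yd: "y : fst d" by auto
  have "(SUM i:UNIV. dz c i (?F y) * dzv c i y (%y. snd d y $ k)) = dz d k (p10 c y (?F y))" by (simp add: dz_def[of d] p10_def)
  also have "... = dz d k (p01 c y (vext c w y))" unfolding p10_phi[OF c d yc yd e[OF y]] by (rule phi_props(3)[OF c d yc yd e[OF y]])
  also have "p01 c y (vext c w y) = vext c (p01 c x w) y"
   unfolding vext_p(2)[OF base(2) c xc] by (simp add: p01_def vext_dz[OF base(2) c yc])
  finally show "(SUM i:UNIV. dz c i (?F y) * dzv c i y (%y. snd d y $ k)) = vext c (p01 c x w) y (%y. snd d y $ k)" by (simp add: dz_def)
 qed moreover have "?p (%y. SUM i:UNIV. dz c i (?F y) * dzv c i y (%y. snd d y $ k)) =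
  (SUM i:UNIV. ?p (%y. dz c i (?F y)) * dzv c i x (%y. snd d y $ k)) + ?p (%y. vext c (p10 c x (pht x w)) y (%y. snd d y $ k))"
  by (rule leibniz[OF p sfield_coord(1)[OF F base(2) c xc]]) (simp add: vext_self[OF base(2) c xc w])
 ultimately have "dz d k (p10 c x (fd c x ?p ?F)) = ?p (%y. vext c (p01 c x w) y (%y. snd d y $ k)) - ?p (%y. vext c (pht x w) y (%y. snd d y $ k))"
  unfolding dz_p10 fd_props[OF base(2) c xc] p10_phi[OF c d xc xd w] by (simp add: eq_diff_eq)
 also have "... = ?p (%y. vext c (p01 c x w) y (%y. snd d y $ k) - vext c (pht x w) y (%y. snd d y $ k))"
  by (rule T_diff[OF p smooth_zd smooth_zd, symmetric])
 also have "... = ?p (%y. vext c (Dop x w) y (%y. snd d y $ k))" unfolding Dop_eq[OF c d xc xd w] vext_lc by (simp add: lc_def)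
 finally show "dz d k (p10 c x (fd c x ?p ?F)) = ?p (%y. vext c (Dop x w) y (%y. snd d y $ k))" .
 have "?p (%y. dzb c i (?F y)) = ?p (%y. 0)" by (rule TD(6)[OF p N_cd]) (auto intro!: phi_props(2)[OF c d] e)
 thus "dzb c i (fd c x ?p ?F) = 0" unfolding fd_props[OF base(2) c xc] TD(5)[OF p] .
qed

end

text \<open>The first-order discrepancy between the two sides of the main identity is the tangent vector
 below; it only enters alternated in \<open>u\<close> and \<open>w\<close>, so its symmetry makes it disappear.\<close>

lemma discrepancy_symmetric:
 assumes c: "c : XC 0" and d: "d : XC t" and xc: "x : fst c" and xd: "x : fst d" and u: "u : TX x" and w: "w : TX x"
 shows "lc 1 (fd c x (Dop x u) (transport d x w)) (-1) (fd c x (p10 c x u) (%y. pht y (vext c w y))) =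
  lc 1 (fd c x (Dop x w) (transport d x u)) (-1) (fd c x (p10 c x w) (%y. pht y (vext c u y)))" (is "?G u w = ?G w u")
proof - note cd = c d xc xd
 have G: "?G u w : TX x" for u w by (rule lc_T[OF fd_props(1)[OF base(2) c xc] fd_props(1)[OF base(2) c xc]])
 \<comment> \<open>The term from \<open>D_phi\<close> becomes, after exchanging the commuting
   extensions in \<open>c\<close>, the term from \<open>D_Phi\<close> with u and w
   interchanged.\<close>
 have 1: "dz d k (p10 c x (?G u w)) = - Dop x u (%y. vext c (p10 c x w) y (%y. snd d y $ k)) - Dop x w (%y. vext c (p10 c x u) y (%y. snd d y $ k))"
  if u: "u : TX x" and w: "w : TX x" for u w k unfolding p10_lc dz_lc D_Phi(1)[OF cd u w] D_phi(1)[OF cd u w]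
   vext_commute[OF base(2) c xc coord_smooth[OF tb d xd] p10_T(1)[OF base(2) c xc] Dop_props(1)[OF cd w]] by simp
 have 2: "dzb c i (?G u w) = Dop x u (%y. vext d (Dop x w) y (%y. cnj (snd c y $ i)))"
  if u: "u : TX x" and w: "w : TX x" for u w i unfolding dz_lc D_Phi(2)[OF cd u w] D_phi(2)[OF cd u w] by simp
 show ?thesis
 proof (rule T_eqI[OF base(2) c xc G G])
  show "dz c i (?G u w) = dz c i (?G w u)" for i by (rule p10_eqI[OF cd G G]) (simp add: 1[OF u w] 1[OF w u])
  show "dzb c i (?G u w) = dzb c i (?G w u)" for i unfolding 2[OF u w] 2[OF w u]
   by (rule vext_commute[OF tb d xd smat_cnj[OF coord_smooth[OF base(2) c xc]] Dop_props(1)[OF cd u] Dop_props(1)[OF cd w]])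
 qed
qed

end

lemma (in good_pair) dbar_pull:
 assumes s: "eform k s" shows "dbar X t k (pull k s) = pull (Suc k) (Rform k s)"
proof (rule ext, rule ext) fix x vs
 show "dbar X t k (pull k s) x vs = pull (Suc k) (Rform k s) x vs"
 proof (cases "x : M0 & vs : tlists X x (Suc k)")
  case False
  \<comment> \<open>Forms are compared as functions; off their domain both sides are
    \<open>undefined\<close>.\<close>
  thus ?thesis unfolding dbar_def glue_undef[OF False] pull_def by (rule if_not_P[symmetric])
 next
  case True
  hence x0: "x : M0" and vs: "set vs <= TX x" "length vs = Suc k" by (auto simp: tlists_def)
  obtain c d where cd: "c : XC 0" "d : XC t" "x : fst c" "x : fst d" by (rule charts_at[OF x0])
  note c = cd(1,3) and d = cd(2,4)
  obtain V rh where V: "(V, rh) : EF t" "x : V" by (rule EF_at[OF tb x0])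
  note sp = pull_eform[OF s]
  let ?A = "map (Aop x)"
  have vs': "set (?A vs) <= TX x" "length (?A vs) = Suc k" using map_Aop_T[OF vs(1)] vs(2) by auto
  let ?T = "%j u ws. Dop x u (%y. rh (s y (ext c ws y)) $ j) +
   subs (%w. fd c x (Dop x u) (transport d x w)) (%ws. rh (s x ws) $ j) ws"
  let ?T' = "%j u ws. Dop x u (%y. rh (s y (ext c ws y)) $ j) +
   subs (%w. fd c x (p10 c x u) (%y. pht y (vext c w y))) (%ws. rh (s x ws) $ j) ws"
  have comp: "rh (dbar X t k (pull k s) x vs) $ j = rh (Rform k s x (?A vs)) $ j" for j
  proof - note ss = eform_aform[OF s tb V, of j]
   have "rh (dbar X t k (pull k s) x vs) $ j = altsum (%u ws. p01 d x u (%y. rh (pull k s y (ext d ws y)) $ j)) vs"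
   by (rule dbar_local(2)[OF sp tb d V vs])
   also have "... = altsum (%u ws. ?T j (Aop x u) (?A ws)) vs"
   proof (rule altsum_cong[OF vs(1)])
   fix u ws assume u: "u : TX x" and ws: "set ws <= TX x" "Suc (length ws) = length vs"
   have k: "length ws = k" using ws vs by simp note D = Dop_props(1)[OF cd Aop_T[OF u]]
   have "p01 d x u (%y. rh (pull k s y (ext d ws y)) $ j) =
   Dop x (Aop x u) (%y. rh (s y (map (%w. transport d x w y) (?A ws))) $ j)" unfolding p01_Dop[OF cd u]
   proof (rule TD(6)[OF D XC_open[OF tb d(1)] d(2)]) fix y assume y: "y : fst d"
   \<comment> \<open>The \<open>Ainv\<close> inside \<open>transport\<close> undoes the A applied at
     \<open>x\<close>, leaving A at \<open>y\<close> of the constant fields in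
     \<open>d\<close>.\<close>
   have "map (%w. transport d x w y) (?A ws) = map (Aop y) (ext d ws y)" using ws(1) Ainv_Aop[OF cd] by (auto simp: transport_def)
   moreover have "pull k s y (ext d ws y) = s y (map (Aop y) (ext d ws y))"
   by (rule pull_eq[OF XC_fib0[OF d(1) y]]) (use vext_T[OF tb d(1) y] k in auto)
   ultimately show "rh (pull k s y (ext d ws y)) $ j = rh (s y (map (%w. transport d x w y) (?A ws))) $ j" by (simp only:)
   qed also have "... = ?T j (Aop x u) (?A ws)"
   by (rule field_subs[OF base(2) c ss D transport_sfield[OF cd] transport_self[OF cd] map_Aop_T[OF ws(1)]]) (use k in simp_all)
   finally show "p01 d x u (%y. rh (pull k s y (ext d ws y)) $ j) = ?T j (Aop x u) (?A ws)" .
   qed also have "... = altsum (?T j) (?A vs)" by (rule altsum_map[symmetric])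
   also have "... = altsum (?T' j) (?A vs)"
   proof -
   \<comment> \<open>The derivative terms of the two integrands agree, and \<open>subs\<close> is
     additive in the endomorphism, so only the substitution of this discrepancy remains.\<close>
   let ?G = "%u w. lc 1 (fd c x (Dop x u) (transport d x w)) (-1) (fd c x (p10 c x u) (%y. pht y (vext c w y)))"
   have al: "altern (TX x) k (%ws. rh (s x ws) $ j)" by (rule aformD(1)[OF ss])
   have "altsum (?T j) (?A vs) - altsum (?T' j) (?A vs) = altsum (%u ws. subs (?G u) (%ws. rh (s x ws) $ j) ws) (?A vs)"
   unfolding altsum_diff[symmetric]
   proof (rule altsum_cong[OF vs'(1)])
   fix u ws assume u: "u : TX x" and ws: "set ws <= TX x" "Suc (length ws) = length (?A vs)"
   have al': "altern (TX x) (length ws) (%ws. rh (s x ws) $ j)" using al ws vs' by simp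
   show "?T j u ws - ?T' j u ws = subs (?G u) (%ws. rh (s x ws) $ j) ws"
   unfolding subs_map_add[OF TX_cspace[OF x0] al' ws(1) fd_props(1)[OF base(2) c] fd_props(1)[OF base(2) c]] by simp
   qed also have "... = 0"
   by (rule altsum_subs_symmetric[OF _ vs'(1) lc_T[OF fd_props(1)[OF base(2) c] fd_props(1)[OF base(2) c]] discrepancy_symmetric[OF cd]])
   (use al vs'(2) in simp_all) finally show ?thesis by simp qed
   also have "... = rh (Rform k s x (?A vs)) $ j" by (rule Rform_local(2)[OF s c V vs', symmetric])
   finally show ?thesis . qed
  have "dbar X t k (pull k s) x vs = Rform k s x (?A vs)"
  proof (rule efib_eqI[OF tb V])
   show "dbar X t k (pull k s) x vs : EE x" by (rule dbar_local(1)[OF sp tb d V vs])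
   show "Rform k s x (?A vs) : EE x" by (rule Rform_local(1)[OF s c V vs'])
   show "rh (dbar X t k (pull k s) x vs) = rh (Rform k s x (?A vs))" using comp by (simp add: vec_eq_iff)
  qed thus ?thesis using pull_eq[OF x0 vs] by simp qed
qed

section \<open>Exterior products on lists of mixed type\<close>

lemma wedges_map: "wgs (map aa I) (map h vs) = wgs (map (%i. aa i o h) I) vs"
 by (induction I arbitrary: vs) (simp_all add: wedge_def take_map drop_map flip: map_append)

text \<open>The mirrored pigeonhole argument: there are more \<open>aas\<close> than
  \<open>us\<close>, so some covector of \<open>aas\<close> receives a vector of
  \<open>ws\<close>.\<close>

lemma wedges_block_zero':
 assumes "length us < length aas" "length aas + length bbs = length us + length ws"
  "!!aa w. aa : set aas ==> w : set ws ==> aa w = 0" shows "wgs (aas @ bbs) (us @ ws) = 0" using assms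
proof (induction aas arbitrary: us)
 case Nil thus ?case by simp
next
 case (Cons aa aas us)
 have z: "altsum (%u xs. aa u * wgs (aas @ bbs) (us @ xs)) ws = 0"
 proof -
  have "altsum (%u xs. aa u * wgs (aas @ bbs) (us @ xs)) ws = altsum (%u xs. 0) ws"
   by (rule altsum_cong[of ws "set ws"]) (use Cons.prems(3) in auto)
  thus ?thesis by (simp add: altsum_zero) qed
 have y: "altsum (%u xs. aa u * wgs (aas @ bbs) (xs @ ws)) us = 0"
 proof -
  have "altsum (%u xs. aa u * wgs (aas @ bbs) (xs @ ws)) us = altsum (%u xs. 0) us"
  proof (rule altsum_cong[of us UNIV])
   fix u and xs :: "'a list" assume l: "Suc (length xs) = length us"
   have "wgs (aas @ bbs) (xs @ ws) = 0" by (rule Cons.IH) (use Cons.prems l in auto)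
   thus "aa u * wgs (aas @ bbs) (xs @ ws) = 0" by simp qed simp
  thus ?thesis by (simp add: altsum_zero) qed
 show ?case by (simp add: wedge_eq_altsum altsum_append z y)
qed

lemma wedges_block_ne:
 assumes "length us ~= length aas" "length aas + length bbs = length us + length ws"
  "!!aa w. aa : set aas ==> w : set ws ==> aa w = 0" "!!bb u. bb : set bbs ==> u : set us ==> bb u = 0"
 shows "wgs (aas @ bbs) (us @ ws) = 0"
 using wedges_block_zero[of aas us bbs ws] wedges_block_zero'[of us aas bbs ws] assms by (cases "length us < length aas") auto

lemma mi_zero: "mi 0 = {[]}" by (auto simp: mi_def)

context pair_family
begin

subsection \<open>Forms of pure type\<close>

text \<open>The type condition of \<open>Apq\<close> for a scalar form at a single point, with
  coefficients that are mere numbers.\<close>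

definition stype :: "(complex, 'm) vec => nat => nat => 'x => ('x tvec list => complex) => bool" where
 "stype t p q x aa \<longleftrightarrow> (ALL c:XC t. x : fst c --> (EX a. ALL vs. set vs <= TX x --> length vs = p + q -->
   aa vs = (SUM J:mi q. SUM I:mi p. wgs (dzs c J I) vs * a J I)))"

abbreviation bas :: "('x, 'n) chart => 'x => 'n list => 'n list => 'x tvec list" where
 "bas c x J I \<equiv> map (%j. dzbv c j x) J @ map (%i. dzv c i x) I"

lemma stype_lincomb:
 assumes "!!m. stype t p q x (aa m)"
  "!!vs. set vs <= TX x ==> length vs = p + q ==> bb vs = (SUM m:(UNIV::'r set). w m * aa m vs)" shows "stype t p q x bb"
 unfolding stype_def
proof (intro ballI impI) fix c assume c: "c : XC t" "x : fst c"
 have ex: "EX a. ALL vs. set vs <= TX x --> length vs = p + q -->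
   aa m vs = (SUM J:mi q. SUM I:mi p. wgs (dzs c J I) vs * a J I)" for m using assms(1)[of m] c unfolding stype_def by blast
 define a where "a m = (SOME a. ALL vs. set vs <= TX x --> length vs = p + q -->
   aa m vs = (SUM J:mi q. SUM I:mi p. wgs (dzs c J I) vs * a J I))" for m
 have a: "ALL vs. set vs <= TX x --> length vs = p + q -->
   aa m vs = (SUM J:mi q. SUM I:mi p. wgs (dzs c J I) vs * a m J I)" for m unfolding a_def by (rule someI_ex[OF ex])
 show "EX a. ALL vs. set vs <= TX x --> length vs = p + q -->
   bb vs = (SUM J:mi q. SUM I:mi p. wgs (dzs c J I) vs * a J I)"
 proof (intro exI[of _ "%J I. SUM m:UNIV. w m * a m J I"] allI impI)
  fix vs assume vs: "set vs <= TX x" "length vs = p + q"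
  have "bb vs = (SUM m:UNIV. SUM J:mi q. SUM I:mi p. w m * (wgs (dzs c J I) vs * a m J I))"
   unfolding assms(2)[OF vs] a[rule_format, OF vs] by (simp only: sum_distrib_left)
  also have "... = (SUM J:mi q. SUM I:mi p. SUM m:UNIV. w m * (wgs (dzs c J I) vs * a m J I))"
   by (subst sum.swap, rule sum.cong[OF refl], rule sum.swap)
  finally show "bb vs = (SUM J:mi q. SUM I:mi p. wgs (dzs c J I) vs * (SUM m:UNIV. w m * a m J I))"
   by (simp add: sum_distrib_left mult.left_commute) qed
qed

context
 fixes t c x
 assumes t: "t : BX" and c: "c : XC t" and x: "x : fst c"
begin

lemma bas_T: "set (bas c x J I) <= TX x" using dzv_T[OF t c x] by auto

lemma wedges_bas:
 assumes "J : mi q" "I : mi p" "J' : mi q'" "I' : mi p'" "p + q = p' + q'"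
 shows "wgs (dzs c J I) (bas c x J' I') = (if J = J' & I = I' then 1 else 0)"
 by (rule wedges_dual) (use assms coord_dual[OF t c x] in \<open>auto simp: mi_def\<close>)

lemma alt_dz:
 assumes "length J + length I = k" shows "altern (TX x) k (wgs (dzs c J I))" using aformD(1)[OF aform_wedges[OF t c x assms]] .

lemma expand_bas:
 assumes "altern (TX x) k aa" "set vs <= TX x" "length vs = k"
 shows "aa vs = (SUM q<=k. SUM J:mi q. SUM I:mi (k - q). aa (bas c x J I) * wgs (dzs c J I) vs)"
 using alt_expand[OF TX_cspace[OF XC_fib0[OF c x]] dzv_T[OF t c x] _ assms(2) T_decomp[OF t c x], where aa=aa] assms(1,3) by simp

lemma expand_pure:
 assumes aa: "altern (TX x) (p + q) aa" and z: "!!J I. length J ~= q ==> length J + length I = p + q ==> aa (bas c x J I) = 0"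
  and vs: "set vs <= TX x" "length vs = p + q"
 shows "aa vs = (SUM J:mi q. SUM I:mi p. wgs (dzs c J I) vs * aa (bas c x J I))"
proof -
 have "aa vs = (SUM q'<=p + q. if q' = q then (SUM J:mi q. SUM I:mi p. wgs (dzs c J I) vs * aa (bas c x J I)) else 0)"
  unfolding expand_bas[OF aa vs]
 proof (rule sum.cong[OF refl]) fix q' assume q': "q' : {..p + q}"
  show "(SUM J:mi q'. SUM I:mi (p + q - q'). aa (bas c x J I) * wgs (dzs c J I) vs) =
   (if q' = q then (SUM J:mi q. SUM I:mi p. wgs (dzs c J I) vs * aa (bas c x J I)) else 0)"
  proof (cases "q' = q")
   case True thus ?thesis by (simp add: mult.commute) next
   case False
   have "aa (bas c x J I) = 0" if "J : mi q'" "I : mi (p + q - q')" for J I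
   by (rule z) (use that False q' in \<open>auto simp: mi_def\<close>)
   thus ?thesis using False by simp qed qed thus ?thesis by simp
qed

lemma stype_eq:
 assumes "stype t p q x aa" "set vs <= TX x" "length vs = p + q"
 shows "aa vs = (SUM J:mi q. SUM I:mi p. wgs (dzs c J I) vs * aa (bas c x J I))"
proof -
 obtain a where a: "!!vs. set vs <= TX x ==> length vs = p + q ==>
   aa vs = (SUM J:mi q. SUM I:mi p. wgs (dzs c J I) vs * a J I)" using assms(1) c x unfolding stype_def by blast
 have "aa (bas c x J I) = a J I" if J: "J : mi q" and I: "I : mi p" for J I
 proof -
  have "aa (bas c x J I) = (SUM J':mi q. SUM I':mi p. wgs (dzs c J' I') (bas c x J I) * a J' I')"
   by (rule a[OF bas_T]) (use J I in \<open>auto simp: mi_def\<close>)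
  also have "... = (SUM J':mi q. SUM I':mi p. if I' = I then (if J' = J then a J' I' else 0) else 0)"
   by (intro sum.cong refl) (simp add: wedges_bas[OF _ _ J I])
  also have "... = a J I" using J I by (simp add: mi_finite) finally show ?thesis . qed
 thus ?thesis unfolding a[OF assms(2,3)] by simp
qed

lemma stype_altern:
 assumes "stype t p q x aa" shows "altern (TX x) (p + q) aa"
proof (rule alt_cong[OF stype_eq[OF assms, symmetric] _ TX_cspace[OF XC_fib0[OF c x]]])
 have "altern (TX x) (p + q) (%vs. SUM J:mi q. SUM I:mi p. aa (bas c x J I) * wgs (dzs c J I) vs)"
  by (intro alt_sum alt_scale alt_dz) (auto simp: mi_def)
 thus "altern (TX x) (p + q) (%vs. SUM J:mi q. SUM I:mi p. wgs (dzs c J I) vs * aa (bas c x J I))" by (simp add: mult.commute)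
qed

text \<open>On such a list every exterior product in the expansion is a determinant with an
  oversized zero block.\<close>

lemma stype_vanish:
 assumes "stype t p q x aa" "set bs <= TX x" "set fs <= TX x" "length bs + length fs = p + q" "length bs ~= q"
  "!!b i. b : set bs ==> dz c i b = 0" "!!f i. f : set fs ==> dzb c i f = 0" shows "aa (bs @ fs) = 0"
proof -
 have "wgs (dzs c J I) (bs @ fs) = 0" if "J : mi q" "I : mi p" for J I
  by (rule wedges_block_ne) (use that assms(4-7) in \<open>auto simp: mi_def\<close>)
 thus ?thesis using stype_eq[OF assms(1), of "bs @ fs"] assms(2-4) by simp
qed

end

lemma stypeI:
 assumes t: "t : BX" and aa: "altern (TX x) (p + q) aa"
  and z: "!!c J I. c : XC t ==> x : fst c ==> length J ~= q ==> length J + length I = p + q ==> aa (bas c x J I) = 0"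
 shows "stype t p q x aa" unfolding stype_def
proof (intro ballI impI) fix c assume c: "c : XC t" "x : fst c"
 show "EX a. ALL vs. set vs <= TX x --> length vs = p + q -->
   aa vs = (SUM J:mi q. SUM I:mi p. wgs (dzs c J I) vs * a J I)"
  by (intro exI[of _ "%J I. aa (bas c x J I)"] allI impI) (rule expand_pure[OF t c aa z[OF c]])
qed

lemma ApqD:
 assumes s: "s : Apq X t p q" shows "x : M0 ==> set vs <= TX x ==> length vs = p + q ==> s x vs : EE x"
  "~ (x : M0 & vs : tlists X x (p + q)) ==> s x vs = undefined"
  "c : XC t ==> (V, ta) : EF t ==> EX a :: 'n list => 'n list => 'x => (complex, 'r) vec.
   (ALL J:mi q. ALL I:mi p. ALL k. ALL x:fst c Int V. smat x (%y. a J I y $ k)) &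
   (ALL x:fst c Int V. ALL vs:tlists X x (p + q). ta (s x vs) = (SUM J:mi q. SUM I:mi p.
   wgs (dzs c J I) vs *s a J I x))"
proof -
 have "ALL x vs. if x : M0 & vs : tlists X x (p + q) then s x vs : EE x else s x vs = undefined"
  using s unfolding Apq_def by (elim CollectE conjE)
 thus "x : M0 ==> set vs <= TX x ==> length vs = p + q ==> s x vs : EE x"
  "~ (x : M0 & vs : tlists X x (p + q)) ==> s x vs = undefined" by (metis (mono_tags, lifting) mem_Collect_eq tlists_def)+
 have "ALL c:XC t. ALL (V, ta):EF t. EX a :: 'n list => 'n list => 'x => (complex, 'r) vec.
   (ALL J:mi q. ALL I:mi p. ALL k. ALL x:fst c Int V. smat x (%y. a J I y $ k)) &
   (ALL x:fst c Int V. ALL vs:tlists X x (p + q). ta (s x vs) = (SUM J:mi q. SUM I:mi p.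
   wgs (dzs c J I) vs *s a J I x))" using s unfolding Apq_def by (elim CollectE conjE)
 from bspec[OF bspec[OF this], of c "(V, ta)", unfolded prod.case]
 show "c : XC t ==> (V, ta) : EF t ==> EX a :: 'n list => 'n list => 'x => (complex, 'r) vec.
   (ALL J:mi q. ALL I:mi p. ALL k. ALL x:fst c Int V. smat x (%y. a J I y $ k)) &
   (ALL x:fst c Int V. ALL vs:tlists X x (p + q). ta (s x vs) = (SUM J:mi q. SUM I:mi p.
   wgs (dzs c J I) vs *s a J I x))" .
qed

lemma Apq_stype:
 assumes s: "s : Apq X t p q" and V: "(V, ta) : EF t" "x : V" shows "stype t p q x (%vs. ta (s x vs) $ l)" unfolding stype_def
proof (intro ballI impI) fix c assume c: "c : XC t" "x : fst c"
 from ApqD(3)[OF s c(1) V(1)] obtain a where a: "ALL x:fst c Int V. ALL vs:tlists X x (p + q). ta (s x vs) = (SUM J:mi q. SUM I:mi p.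
   wgs (dzs c J I) vs *s a J I x)" by blast
 show "EX a. ALL vs. set vs <= TX x --> length vs = p + q -->
   ta (s x vs) $ l = (SUM J:mi q. SUM I:mi p. wgs (dzs c J I) vs * a J I)"
  by (rule exI[of _ "%J I. a J I x $ l"]) (use a V c in \<open>auto simp: tlists_def\<close>)
qed

lemma Apq_eform:
 assumes s: "s : Apq X 0 p q" shows "eform (p + q) s" unfolding eform_def
proof (intro conjI ballI allI impI)
 show "s x vs : EE x" if "x : M0" "vs : tlists X x (p + q)" for x vs
  by (rule ApqD(1)[OF s]) (use that in \<open>auto simp: tlists_def\<close>)
 fix V ta x l assume V: "(V, ta) : EF 0" "x : V"
 have x0: "x : M0" using V EFD(1) by blast
 obtain c where c: "c : XC 0" "x : fst c" by (rule XC_at[OF base(2) x0])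
 from ApqD(3)[OF s c(1) V(1)] obtain a where a: "ALL J:mi q. ALL I:mi p. ALL k. ALL x:fst c Int V. smat x (%y. a J I y $ k)"
   "ALL x:fst c Int V. ALL vs:tlists X x (p + q). ta (s x vs) = (SUM J:mi q. SUM I:mi p.
   wgs (dzs c J I) vs *s a J I x)" by blast
 have "aform x (p + q) (%y vs. SUM J:mi q. (%_. 1) y * (SUM I:mi p. a J I y $ l * wgs (dzs c J I) vs))"
  by (intro aform_sum[OF x0] mi_finite aform_wedges[OF base(2) c] smat_const[OF x0]) (use a(1) c V in \<open>auto simp: mi_def\<close>)
 thus "aform x (p + q) (%y vs. ta (s y vs) $ l)"
 proof (rule aform_cong[of "fst c Int V", rotated 3])
  show "nbhd (fst c Int V)" "x : fst c Int V" using XC_open[OF base(2) c(1)] EF_open[OF base(2) V(1)] c V by auto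
  fix y vs assume "y : fst c Int V" "set vs <= TX y" "length vs = p + q"
  hence "ta (s y vs) = (SUM J:mi q. SUM I:mi p. wgs (dzs c J I) vs *s a J I y)" using a(2) by (auto simp: tlists_def)
  thus "(SUM J:mi q. (%_. 1) y * (SUM I:mi p. a J I y $ l * wgs (dzs c J I) vs)) = ta (s y vs) $ l" by (simp add: mult.commute)
 qed
qed

lemma ApqI:
 assumes t: "t : BX" and s: "!!x vs. x : M0 ==> set vs <= TX x ==> length vs = p + q ==> s x vs : EE x"
   "!!x vs. ~ (x : M0 & vs : tlists X x (p + q)) ==> s x vs = undefined"
  and al: "!!x V ta l. (V, ta) : EF t ==> x : V ==> altern (TX x) (p + q) (%vs. ta (s x vs) $ l)"
  and z: "!!x V ta l c J I. (V, ta) : EF t ==> x : V ==> c : XC t ==> x : fst c ==> length J ~= q ==>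
   length J + length I = p + q ==> ta (s x (bas c x J I)) $ l = 0"
  and sm: "!!x V ta l c J I. (V, ta) : EF t ==> x : V ==> c : XC t ==> x : fst c ==>
   length J + length I = p + q ==> smat x (%y. ta (s y (bas c y J I)) $ l)" shows "s : Apq X t p q" unfolding Apq_def
proof (rule CollectI, intro conjI ballI allI)
 show "if x : M0 & vs : tlists X x (p + q) then s x vs : EE x else s x vs = undefined" for x vs
  using s(1)[of x vs] s(2)[of x vs] by (auto simp: tlists_def)
 fix c f assume c: "c : XC t" and f: "f : EF t"
 obtain V ta where ff: "f = (V, ta)" by (cases f) note V = f[unfolded ff]
 have "ta (s x vs) = (SUM J:mi q. SUM I:mi p. wgs (dzs c J I) vs *s ta (s x (bas c x J I)))"
  if x: "x : fst c" "x : V" and vs: "vs : tlists X x (p + q)" for x vs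
 proof -
  have "ta (s x vs) $ l = (SUM J:mi q. SUM I:mi p. wgs (dzs c J I) vs * ta (s x (bas c x J I)) $ l)" for l
   by (rule expand_pure[OF t c x(1) al[OF V x(2)] z[OF V x(2) c x(1)]]) (use vs in \<open>auto simp: tlists_def\<close>)
  thus ?thesis by (simp add: vec_eq_iff) qed
 moreover have "smat x (%y. ta (s y (bas c y J I)) $ l)" if "J : mi q" "I : mi p" "x : fst c" "x : V" for J I x l
  by (rule sm[OF V that(4) c that(3)]) (use that in \<open>auto simp: mi_def\<close>)
 ultimately show "case f of (V, ta) => EX a :: 'n list => 'n list => 'x => (complex, 'r) vec.
   (ALL J:mi q. ALL I:mi p. ALL k. ALL x:fst c Int V. smat x (%y. a J I y $ k)) &
   (ALL x:fst c Int V. ALL vs:tlists X x (p + q). ta (s x vs) = (SUM J:mi q. SUM I:mi p.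
   wgs (dzs c J I) vs *s a J I x))" unfolding ff prod.case by (intro exI[of _ "%J I y. ta (s y (bas c y J I))"]) auto
qed

text \<open>Coefficients of bidegree other than (p,q) vanish identically near each point, hence so
  do their derivatives; the terms that remain carry q + 1 factors dzbar.\<close>

lemma dbar_Apq:
 assumes t: "t : BX" and s: "s : Apq X t p q" "eform (p + q) s" shows "dbar X t (p + q) s : Apq X t p (Suc q)"
proof -
 have formula: "ta (dbar X t (p + q) s x vs) $ l = (SUM q'<=p + q. SUM J:mi q'. SUM I:mi (p + q - q'). SUM j:UNIV.
   dzbv c j x (%y. coef X c ta s J I y $ l) * wgs (dzs c (j # J) I) vs)"
  if "(V, ta) : EF t" "x : V" "c : XC t" "x : fst c" "set vs <= TX x" "length vs = Suc (p + q)" for V ta x c vs l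
  using dbar_local(2)[OF s(2) t that(3,4,1,2,5,6)] dbar_formula[OF s(2) t that(3,4,1,2,5,6)] by simp
 show ?thesis
 proof (rule ApqI[OF t])
  fix x vs assume x: "x : M0" and vs: "set vs <= TX x" "length vs = p + Suc q"
  obtain c where c: "c : XC t" "x : fst c" by (rule XC_at[OF t x])
  obtain V ta where V: "(V, ta) : EF t" "x : V" by (rule EF_at[OF t x])
  show "dbar X t (p + q) s x vs : EE x" by (rule dbar_local(1)[OF s(2) t c V vs(1)]) (use vs(2) in simp)
 next fix x vs assume "~ (x : M0 & vs : tlists X x (p + Suc q))"
  thus "dbar X t (p + q) s x vs = undefined" unfolding dbar_def by (intro glue_undef) simp
 next fix x V ta l assume V: "(V, ta) : EF t" "x : V"
  have x0: "x : M0" using V EFD(1) by blast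
  obtain c where c: "c : XC t" "x : fst c" by (rule XC_at[OF t x0])
  have "altern (TX x) (p + Suc q) (%vs. SUM q'<=p + q. SUM J:mi q'. SUM I:mi (p + q - q'). SUM j:UNIV.
   dzbv c j x (%y. coef X c ta s J I y $ l) * wgs (dzs c (j # J) I) vs)" by (intro alt_sum alt_scale alt_dz[OF t c]) (auto simp: mi_def)
  thus "altern (TX x) (p + Suc q) (%vs. ta (dbar X t (p + q) s x vs) $ l)"
   by (rule alt_cong[rotated, OF _ TX_cspace[OF x0]]) (simp only: formula[OF V c] add_Suc_right)
 next fix x V ta l c and J' I' :: "'n list"
  assume V: "(V, ta) : EF t" "x : V" and c: "c : XC t" "x : fst c" and J': "length J' ~= Suc q" "length J' + length I' = p + Suc q"
  have z: "dzbv c j x (%y. coef X c ta s J I y $ l) * wgs (dzs c (j # J) I) (bas c x J' I') = 0"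
   if "q' <= p + q" "J : mi q'" "I : mi (p + q - q')" for q' J I j
  proof (cases "q' = q")
   case True
   have "wgs (dzs c (j # J) I) (bas c x J' I') = 0"
   by (rule wedges_block_ne) (use that True J' coord_dual[OF t c] in \<open>auto simp: mi_def\<close>)
   thus ?thesis by simp next
   case False
   have oN: "nbhd (fst c Int V)" "x : fst c Int V" using XC_open[OF t c(1)] EF_open[OF t V(1)] c V by auto
   have "dzbv c j x (%y. coef X c ta s J I y $ l) = dzbv c j x (%y. 0)"
   proof (rule TD(6)[OF dzv_T(2)[OF t c] oN]) fix y assume y: "y : fst c Int V"
   hence yc: "y : fst c" and yV: "y : V" by auto
   show "coef X c ta s J I y $ l = 0" unfolding coef_def by (rule stype_vanish[OF t c(1) yc Apq_stype[OF s(1) V(1) yV]])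
   (use that False dzv_T[OF t c(1) yc] coord_dual[OF t c(1) yc] in \<open>auto simp: mi_def\<close>)
   qed thus ?thesis by (simp add: TD(5)[OF dzv_T(2)[OF t c]]) qed
  have len: "length (bas c x J' I') = Suc (p + q)" using J' by simp
  show "ta (dbar X t (p + q) s x (bas c x J' I')) $ l = 0" unfolding formula[OF V c bas_T[OF t c] len] by (intro sum.neutral ballI z) auto
 next fix x V ta l c and J' I' :: "'n list"
  assume V: "(V, ta) : EF t" "x : V" and c: "c : XC t" "x : fst c" and J': "length J' + length I' = p + Suc q"
  have x0: "x : M0" by (rule XC_fib0[OF c])
  have oN: "nbhd (fst c Int V)" "x : fst c Int V" using XC_open[OF t c(1)] EF_open[OF t V(1)] c V by auto
  have w: "smat x (%y. wgs (dzs c J I) (bas c y J' I'))" for J I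
  proof -
   have "smat x (%y. wgs (dzs c J I) (map (%F. F y) (map (dzbv c) J' @ map (dzv c) I')))"
   by (rule smat_wedges[OF x0]) (use sfield_coord[OF sfield_vec(2)[OF t c] t c] sfield_coord[OF sfield_vec(3)[OF t c] t c] in auto)
   thus ?thesis by (simp add: o_def) qed
  have co: "smat x (%y. dzbv c j y (%y. coef X c ta s J I y $ l))" if "length J + length I = p + q" for J I j
  proof (rule T_apply_smooth(2)[OF t c])
   have "smat x (%y. ta (s y (map (%F. F y) (map (dzbv c) J @ map (dzv c) I))) $ l)"
   by (rule aformD(2)[OF eform_aform[OF s(2) t V]]) (use that sfield_vec[OF t c] in auto)
   thus "smat x (%y. coef X c ta s J I y $ l)" by (simp add: coef_def o_def) qed
  have "smat x (%y. SUM q'<=p + q. SUM J:mi q'. SUM I:mi (p + q - q'). SUM j:UNIV.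
   dzbv c j y (%y. coef X c ta s J I y $ l) * wgs (dzs c (j # J) I) (bas c y J' I'))"
   by (intro smat_sum[OF x0] smat_mult w co) (auto simp: mi_def)
  thus "smat x (%y. ta (dbar X t (p + q) s y (bas c y J' I')) $ l)"
  proof (rule smat_cong[OF oN, rotated]) fix y assume y: "y : fst c Int V"
   hence yc: "y : fst c" and yV: "y : V" by auto
   show "(SUM q'<=p + q. SUM J:mi q'. SUM I:mi (p + q - q'). SUM j:UNIV.
   dzbv c j y (%y. coef X c ta s J I y $ l) * wgs (dzs c (j # J) I) (bas c y J' I')) =
   ta (dbar X t (p + q) s y (bas c y J' I')) $ l" by (rule formula[OF V(1) yV c(1) yc bas_T[OF t c(1) yc], symmetric]) (use J' in simp)
  qed qed
qed

end

context pair_family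
begin

subsection \<open>The canonical bundle\<close>

lemma dz_zero: "dz c i (%_. 0) = 0" "dzb c i (%_. 0) = 0" by (simp_all add: dz_def dzb_def)

context
 fixes t c x
 assumes t: "t : BX" and c: "c : XC t" and x: "x : fst c"
begin

text \<open>In the expansion by bidegree every term with a dzbar evaluates the form on a
  (0,1)-vector. Only the empty J remains, and with it the full list of holomorphic indices.\<close>

lemma canon_form:
 assumes al: "altern (TX x) CARD('n) kk"
  and z: "!!ws v. set ws <= TX x ==> length ws = CARD('n) ==> v : set ws ==> (!!i. dz c i v = 0) ==> kk ws = 0"
  and ws: "set ws <= TX x" "length ws = CARD('n)"
 shows "kk ws = kk (map (%i. dzv c i x) all_idx) * wgs (map (dz c) all_idx) ws"
proof -
 have al': "altern (TX x) (CARD('n) + 0) kk" using al by simp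
 have "kk ws = (SUM J:mi 0. SUM I:mi CARD('n). wgs (dzs c J I) ws * kk (bas c x J I))"
 proof (rule expand_pure[OF t c x al'])
  fix J I :: "'n list" assume J: "length J ~= 0" "length J + length I = CARD('n) + 0"
  then obtain j where "j : set J" by (cases J) auto thus "kk (bas c x J I) = 0"
   by (intro z[of _ "dzbv c j x"]) (use J bas_T[OF t c x, of J I] coord_dual[OF t c x] in auto)
 qed (use ws in auto) thus ?thesis by (simp add: mi_zero mi_card mult.commute)
qed

lemma wedges_all_bas: "wgs (map (dz c) all_idx) (map (%i. dzv c i x) all_idx) = 1"
 using wedges_bas[OF t c x, of "[]" 0 all_idx "CARD('n)" "[]" 0 all_idx "CARD('n)"] by (simp add: mi_zero mi_card)

text \<open>Together with \<open>canonD\<close> this describes the canonical fibre by the type of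
  vectors alone, the form in which it can be transported by A.\<close>

lemma canonI:
 assumes "altern (TX x) CARD('n) kk"
  "!!ws v. set ws <= TX x ==> length ws = CARD('n) ==> v : set ws ==> (!!i. dz c i v = 0) ==> kk ws = 0"
  "!!ws. ws \<notin> tlists X x CARD('n) ==> kk ws = 0" shows "kk : canon X t x" unfolding canon_def
proof (rule CollectI, rule bexI[OF _ c], rule conjI[OF x], rule exI[of _ "kk (map (%i. dzv c i x) all_idx)"], rule ext)
 fix ws
 show "kk ws = (if ws : tlists X x CARD('n) then kk (map (%i. dzv c i x) all_idx) * wgs (map (dz c) all_idx) ws else 0)"
  using canon_form[OF assms(1,2), where ws=ws] assms(3)[of ws] by (auto simp: tlists_def)
qed

lemma canonD:
 assumes kk: "kk : canon X t x" shows "altern (TX x) CARD('n) kk"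
  "set ws <= TX x ==> length ws = CARD('n) ==> v : set ws ==> (!!i. dz c i v = 0) ==> kk ws = 0"
  "ws \<notin> tlists X x CARD('n) ==> kk ws = 0"
  "set ws <= TX x ==> length ws = CARD('n) ==> kk ws = kk (map (%i. dzv c i x) all_idx) * wgs (map (dz c) all_idx) ws"
proof -
 obtain c' a where c': "c' : XC t" "x : fst c'" and k: "kk = (%ws. if ws : tlists X x CARD('n) then a * wgs (map (dz c') all_idx) ws else 0)"
  using kk unfolding canon_def by blast
 have "altern (TX x) CARD('n) (wgs (dzs c' [] all_idx))" by (rule alt_dz[OF t c']) (simp add: length_all_idx)
 hence "altern (TX x) CARD('n) (%ws. a * wgs (map (dz c') all_idx) ws)" by (intro alt_scale) simp
 thus al: "altern (TX x) CARD('n) kk" by (rule alt_cong[rotated, OF _ TX_cspace[OF XC_fib0[OF c x]]]) (simp add: k tlists_def)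
 show z: "kk ws = 0" if "set ws <= TX x" "length ws = CARD('n)" "v : set ws" "!!i. dz c i v = 0" for ws v
 proof -
  have "dz c' i v = 0" for i by (rule T_zero_chart(2)[OF t c c'(1) x c'(2)]) (use that in auto)
  hence "wgs (map (dz c') all_idx) ws = 0" by (intro wedges_vanish[OF _ that(3)]) (use that(2) in \<open>auto simp: length_all_idx\<close>)
  thus ?thesis by (simp add: k) qed
 show "ws \<notin> tlists X x CARD('n) ==> kk ws = 0" by (simp add: k)
 show "set ws <= TX x ==> length ws = CARD('n) ==> kk ws = kk (map (%i. dzv c i x) all_idx) * wgs (map (dz c) all_idx) ws"
  by (rule canon_form[OF al z])
qed

end

subsection \<open>The isomorphism with forms of bidegree \<open>(n, q)\<close>\<close>

text \<open>One frame component of \<open>Iop\<close>: \<open>aa\<close> is that component of the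
  form at \<open>x\<close>, while \<open>kk\<close> and \<open>us\<close> are the arguments of the
  coefficient bundle.\<close>

definition Eform :: "nat => nat => ('x, 'n) chart => 'x => ('x tvec list => complex) => ('x tvec list => complex) => 'x tvec list => 'x tvec list => complex" where
 "Eform p q c x aa kk us ws = (SUM J:mi q. SUM I:mi p. wgs (dzs c J all_idx) ws *
   wgs (map (dz c) I) us * kk (map (%i. dzv c i x) all_idx) * aa (bas c x J I))"

context
 fixes t c x
 assumes t: "t : BX" and c: "c : XC t" and x: "x : fst c"
begin

lemma Eform_altern: "altern (TX x) (CARD('n) + q) (Eform p q c x aa kk us)"
proof -
 have "altern (TX x) (CARD('n) + q) (%ws. SUM J:mi q. SUM I:mi p.
   (wgs (map (dz c) I) us * kk (map (%i. dzv c i x) all_idx) * aa (bas c x J I)) * wgs (dzs c J all_idx) ws)"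
  by (intro alt_sum alt_scale alt_dz[OF t c x]) (auto simp: mi_def length_all_idx)
 thus ?thesis by (simp add: Eform_def[abs_def] ac_simps)
qed

text \<open>The covectors dz vanish on \<open>bs\<close>, so the determinants are block triangular.
  The right side involves the chart only through the type projection.\<close>

lemma Eform_block:
 assumes st: "stype t p q x aa" and kk: "kk : canon X t x"
  and bs: "set bs <= TX x" "length bs = q" "!!b i. b : set bs ==> dz c i b = 0"
  and fs: "set fs <= TX x" "length fs = CARD('n)" and us: "length us = p"
 shows "Eform p q c x aa kk us (bs @ fs) = kk fs * aa (bs @ map (p10 c x) us)"
proof -
 have "aa (bs @ map (p10 c x) us) = (SUM J:mi q. SUM I:mi p. wgs (dzs c J I) (bs @ map (p10 c x) us) * aa (bas c x J I))"
  by (rule stype_eq[OF t c x st]) (use bs us p10_T(1)[OF t c x] in auto)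
 also have "... = (SUM J:mi q. SUM I:mi p. wgs (map (dzb c) J) bs * wgs (map (dz c) I) us * aa (bas c x J I))"
 proof (intro sum.cong refl) fix J I :: "'n list" assume JI: "J : mi q" "I : mi p"
  have "wgs (dzs c J I) (bs @ map (p10 c x) us) = wgs (map (dzb c) J) bs * wgs (map (dz c) I) (map (p10 c x) us)"
   by (rule wedges_block) (use JI bs us in \<open>auto simp: mi_def\<close>)
  also have "wgs (map (dz c) I) (map (p10 c x) us) = wgs (map (dz c) I) us" unfolding wedges_map by (simp add: o_def p10_dz[OF t c x])
  finally show "wgs (dzs c J I) (bs @ map (p10 c x) us) * aa (bas c x J I) =
   wgs (map (dzb c) J) bs * wgs (map (dz c) I) us * aa (bas c x J I)" by simp qed
 finally have 1: "aa (bs @ map (p10 c x) us) = (SUM J:mi q. SUM I:mi p. wgs (map (dzb c) J) bs * wgs (map (dz c) I) us * aa (bas c x J I))" .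
 have 2: "wgs (dzs c J all_idx) (bs @ fs) = wgs (map (dzb c) J) bs * wgs (map (dz c) all_idx) fs" if "J : mi q" for J
  by (rule wedges_block) (use that bs fs in \<open>auto simp: mi_def length_all_idx\<close>)
 show ?thesis unfolding Eform_def 1 canonD(4)[OF t c x kk fs] sum_distrib_left by (intro sum.cong refl) (simp add: 2)
qed

lemma Eform_block_zero:
 assumes "length bs > q" "length bs + length fs = CARD('n) + q" "!!b i. b : set bs ==> dz c i b = 0"
 shows "Eform p q c x aa kk us (bs @ fs) = 0"
proof -
 have "wgs (dzs c J all_idx) (bs @ fs) = 0" if "J : mi q" for J
  by (rule wedges_block_zero) (use that assms in \<open>auto simp: mi_def length_all_idx\<close>)
 thus ?thesis by (simp add: Eform_def)
qed

text \<open>It suffices to test on coordinate vectors, and at most n of these can be of type (1,0)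
  without repetition; so at least \<open>q\<close> leading vectors are of type (0,1).\<close>

lemma Eform_unique:
 assumes "altern (TX x) (CARD('n) + q) gg" "altern (TX x) (CARD('n) + q) gg'"
  and eq: "!!bs fs. set bs <= TX x ==> set fs <= TX x ==> length bs + length fs = CARD('n) + q ==> q <= length bs ==>
   (!!b i. b : set bs ==> dz c i b = 0) ==> gg (bs @ fs) = gg' (bs @ fs)"
  and ws: "set ws <= TX x" "length ws = CARD('n) + q" shows "gg ws = gg' ws"
 unfolding expand_bas[OF t c x assms(1) ws] expand_bas[OF t c x assms(2) ws]
proof (intro sum.cong refl)
 fix q' and J I :: "'n list" assume q': "q' : {..CARD('n) + q}" "J : mi q'" "I : mi (CARD('n) + q - q')"
 \<comment> \<open>There is no increasing list of more than n indices, so an existing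
   \<open>I\<close> forces q' to be at least q.\<close>
 have "~ CARD('n) + q - q' > CARD('n)" using mi_gt_card[of "CARD('n) + q - q'"] q'(3) by blast
 hence "gg (bas c x J I) = gg' (bas c x J I)"
  by (intro eq) (use q' dzv_T[OF t c x] coord_dual[OF t c x] in \<open>auto simp: mi_def\<close>)
 thus "gg (bas c x J I) * wgs (dzs c J I) ws = gg' (bas c x J I) * wgs (dzs c J I) ws" by simp
qed

end

lemma Eform_chart:
 assumes t: "t : BX" and c: "c : XC t" "x : fst c" and c': "c' : XC t" "x : fst c'"
  and st: "stype t p q x aa" and kk: "kk : canon X t x"
  and us: "set us <= TX x" "length us = p" and ws: "set ws <= TX x" "length ws = CARD('n) + q"
 shows "Eform p q c' x aa kk us ws = Eform p q c x aa kk us ws"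
proof (rule Eform_unique[OF t c Eform_altern[OF t c'] Eform_altern[OF t c] _ ws])
 fix bs fs
 assume bs: "set bs <= TX x" and fs: "set fs <= TX x" and l: "length bs + length fs = CARD('n) + q" "q <= length bs"
  and z: "!!b i. b : set bs ==> dz c i b = 0"
 have z': "dz c' i b = 0" if "b : set bs" for b i by (rule T_zero_chart(2)[OF t c(1) c'(1) c(2) c'(2)]) (use bs z that in auto)
 show "Eform p q c' x aa kk us (bs @ fs) = Eform p q c x aa kk us (bs @ fs)"
 proof (cases "length bs = q")
  case True
  have fl: "length fs = CARD('n)" using l True by simp
  have "map (p10 c' x) us = map (p10 c x) us" by (rule map_cong[OF refl], rule p10_indep(1)[OF t c'(1) c(1) c'(2) c(2)]) (use us in auto)
  moreover have "Eform p q c' x aa kk us (bs @ fs) = kk fs * aa (bs @ map (p10 c' x) us)"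
   by (rule Eform_block[OF t c' st kk bs True z' fs fl us(2)])
  moreover have "Eform p q c x aa kk us (bs @ fs) = kk fs * aa (bs @ map (p10 c x) us)"
   by (rule Eform_block[OF t c st kk bs True z fs fl us(2)])
  ultimately show ?thesis by (simp only:) next
  case False
  thus ?thesis using l Eform_block_zero[OF t c' _ l(1) z'] Eform_block_zero[OF t c _ l(1) z] by simp
 qed
qed

lemma Eform_sum: "Eform p q c x (%vs. SUM m:(UNIV::'r set). w m * aa m vs) kk us ws = (SUM m:UNIV. w m * Eform p q c x (aa m) kk us ws)"
proof -
 have "Eform p q c x (%vs. SUM m:(UNIV::'r set). w m * aa m vs) kk us ws = (SUM J:mi q. SUM I:mi p. SUM m:UNIV. w m * (wgs (dzs c J all_idx) ws *
   wgs (map (dz c) I) us * kk (map (%i. dzv c i x) all_idx) * aa m (bas c x J I)))"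
  unfolding Eform_def by (simp only: sum_distrib_left mult.left_commute)
 also have "... = (SUM m:UNIV. SUM J:mi q. SUM I:mi p. w m * (wgs (dzs c J all_idx) ws *
   wgs (map (dz c) I) us * kk (map (%i. dzv c i x) all_idx) * aa m (bas c x J I)))" by (subst (2) sum.swap, subst sum.swap) (rule refl)
 finally show ?thesis unfolding Eform_def sum_distrib_left .
qed

lemma Eform_cong:
 assumes "t : BX" "c : XC t" "x : fst c"
  "!!vs. set vs <= TX x ==> length vs = p + q ==> aa vs = bb vs"
 shows "Eform p q c x aa kk us ws = Eform p q c x bb kk us ws" unfolding Eform_def
proof (intro sum.cong refl arg_cong2[where f="(*)"])
 fix J I :: "'n list" assume "J : mi q" "I : mi p"
 thus "aa (bas c x J I) = bb (bas c x J I)" by (intro assms(4) bas_T[OF assms(1-3)]) (auto simp: mi_def)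
qed

lemma frame_matrix:
 assumes t: "t : BX" and V: "(V, rh) : EF t" "x : V" and V0: "(V0, ta) : EF 0" "x : V0" and e: "e : EE x"
 shows "rh e $ l = (SUM m:UNIV. wm rh ta x $ l $ m * ta e $ m)"
  "ta e $ l = (SUM m:UNIV. minv (wm rh ta x) $ l $ m * rh e $ m)"
proof -
 note w = wmat_zero(1)[OF t V(1) V0(1) V(2) V0(2) e] and inv = wmat_zero(2)[OF t V(1) V0(1) V(2) V0(2)]
 show "rh e $ l = (SUM m:UNIV. wm rh ta x $ l $ m * ta e $ m)" unfolding w by (simp add: matrix_vector_mult_def)
 have "ta e = minv (wm rh ta x) *v rh e" unfolding w by (simp add: matrix_vector_mul_assoc matrix_inv_id[OF inv])
 thus "ta e $ l = (SUM m:UNIV. minv (wm rh ta x) $ l $ m * rh e $ m)" by (simp add: matrix_vector_mult_def)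
qed

lemma Iop_local:
 assumes t: "t : BX" and c: "c : XC t" "x : fst c" and V: "(V, ta) : EF t" "x : V"
  and s: "!!vs. set vs <= TX x ==> length vs = p + q ==> s x vs : EE x"
  and st: "!!V ta l. (V, ta) : EF t ==> x : V ==> stype t p q x (%vs. ta (s x vs) $ l)"
  and us: "us : tlists X x p" and kk: "kk : canon X t x" and vs: "set vs <= TX x" "length vs = CARD('n) + q"
 shows "Iop X t p q s x vs us kk : EE x"
  "ta (Iop X t p q s x vs us kk) $ l = Eform p q c x (%vs. ta (s x vs) $ l) kk us vs"
proof -
 have x0: "x : M0" by (rule XC_fib0[OF c])
 let ?F = "%c ta y ws. SUM J:mi q. SUM I:mi p. (wgs (dzs c J all_idx) ws *
   wgs (map (dz c) I) us * kk (map (%i. dzv c i y) all_idx)) *s coef X c ta s J I y"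
 have I: "Iop X t p q s x vs us kk = glue X t (CARD('n) + q) ?F x vs" unfolding Iop_def using x0 us kk by simp
 have tl: "vs : tlists X x (CARD('n) + q)" using vs by (simp add: tlists_def)
 have us': "set us <= TX x" "length us = p" using us by (auto simp: tlists_def)
 have F: "?F c ta x vs $ l = Eform p q c x (%vs. ta (s x vs) $ l) kk us vs" for c ta l by (simp add: Eform_def coef_def)
 have cons: "?F c' ta' x vs = wm ta' ta x *v ?F c ta x vs" if c': "c' : XC t" "x : fst c'" and V': "(V', ta') : EF t" "x : V'" for c' V' ta'
 proof -
  have "?F c' ta' x vs $ l = (wm ta' ta x *v ?F c ta x vs) $ l" for l
  proof -
   have "?F c' ta' x vs $ l = Eform p q c x (%vs. ta' (s x vs) $ l) kk us vs"
   unfolding F by (rule Eform_chart[OF t c c' st[OF V'] kk us' vs])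
   also have "... = Eform p q c x (%vs. SUM m:UNIV. wm ta' ta x $ l $ m * ta (s x vs) $ m) kk us vs"
   by (rule Eform_cong[OF t c]) (simp add: wmat_holo(1)[OF t V'(1) V(1) V'(2) V(2) s] matrix_vector_mult_def)
   also have "... = (wm ta' ta x *v ?F c ta x vs) $ l"
   unfolding Eform_sum F[symmetric] by (simp only: matrix_vector_mult_def vec_lambda_beta)
   finally show ?thesis . qed thus ?thesis by (rule vec_eq_iff[THEN iffD2, OF allI]) qed
 note G = glue_eq[OF t c V tl, of ?F, OF cons]
 show "Iop X t p q s x vs us kk : EE x" unfolding I by (rule G(1))
 have *: "ta (Iop X t p q s x vs us kk) = ?F c ta x vs" unfolding I by (rule G(2))
 show "ta (Iop X t p q s x vs us kk) $ l = Eform p q c x (%vs. ta (s x vs) $ l) kk us vs" unfolding * by (rule F)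
qed

end

context good_fibre
begin

subsection \<open>The map \<open>P\<^sub>t\<close> as a pullback\<close>

lemma Ainv_T: "w : TX x ==> Ainv x w : TX x" by (rule charts_at[OF TD(1)], assumption, rule Ainv_props(1))

lemma Ainv_linear:
 assumes v: "v : TX x" and w: "w : TX x" shows "Ainv x (lc a v b w) = lc a (Ainv x v) b (Ainv x w)"
proof -
 obtain c d where cd: "c : XC 0" "d : XC t" "x : fst c" "x : fst d" by (rule charts_at[OF TD(1)[OF v]])
 note i = Ainv_T[OF v] Ainv_T[OF w]
 have "Aop x (lc a (Ainv x v) b (Ainv x w)) = lc a v b w" unfolding Aop_lc[OF cd i] Ainv_props(4)[OF cd v] Ainv_props(4)[OF cd w] ..
 thus ?thesis using Ainv_Aop[OF cd lc_T[OF i], of a b] by simp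
qed

text \<open>At \<open>x\<close> a change between frames of E_0 and E_t mixes the components by
  numbers, which preserves the bidegree with respect to either structure.\<close>

lemma stype_frame:
 assumes V: "(V, rh) : EF t" "x : V" and V0: "(V0, ta) : EF 0" "x : V0"
  and s: "!!vs. set vs <= TX x ==> length vs = p + q ==> S vs : EE x"
 shows "(!!m. stype r p q x (%vs. ta (S vs) $ m)) ==> stype r p q x (%vs. rh (S vs) $ l)"
  "(!!m. stype r p q x (%vs. rh (S vs) $ m)) ==> stype r p q x (%vs. ta (S vs) $ l)"
 by (erule stype_lincomb, rule frame_matrix(1)[OF tb V V0 s], assumption, assumption,
   erule stype_lincomb, rule frame_matrix(2)[OF tb V V0 s])

context
 fixes c d x
 assumes c: "c : XC 0" and d: "d : XC t" and xc: "x : fst c" and xd: "x : fst d"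
begin

text \<open>An (n,0)-form sees only (1,0)-parts, and A preserves the (1,0)-part of a (1,0)-vector of
  X_0. With \<open>canon_inj\<close> this evaluates the inverse of the identification of canonical
  bundles inside \<open>ident_V\<close>.\<close>

lemma canon_pull:
 assumes kk: "kk : canon X 0 x" shows "(%ws. if ws : tlists X x CARD('n) then kk (map (Aop x) ws) else 0) : canon X t x"
  "pi10 X x CARD('n) (%ws. if ws : tlists X x CARD('n) then kk (map (Aop x) ws) else 0) = kk"
proof -
 let ?kk = "%ws. if ws : tlists X x CARD('n) then kk (map (Aop x) ws) else 0"
 note K = canonD[OF base(2) c xc kk]
 have x0: "x : M0" by (rule x_fib0[OF c d xc xd]) show "?kk : canon X t x"
 proof (rule canonI[OF tb d xd]) show "altern (TX x) CARD('n) ?kk"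
   by (rule alt_cong[OF _ alt_compose[OF K(1) Aop_T Aop_linear] TX_cspace[OF x0]]) (simp_all add: tlists_def)
  fix ws v assume ws: "set ws <= TX x" "length ws = CARD('n)" "v : set ws" and z: "!!i. dz d i v = 0"
  have "kk (map (Aop x) ws) = 0" by (rule K(2)[of _ "Aop x v"]) (use ws Aop_T Aop_type(1)[OF c d xc xd _ z] in auto)
  thus "?kk ws = 0" by simp qed simp show "pi10 X x CARD('n) ?kk = kk"
 proof fix ws show "pi10 X x CARD('n) ?kk ws = kk ws"
  proof (cases "ws : tlists X x CARD('n)")
   case True hence ws: "set ws <= TX x" "length ws = CARD('n)" by (auto simp: tlists_def)
   let ?ws = "map (p10 c x) ws"
   have m: "map (pr10 X x) ws = ?ws" using ws(1) pr10_eq[OF c xc] by auto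
   have t1: "?ws : tlists X x CARD('n)" "set (map (Aop x) ?ws) <= TX x" using ws p10_T(1)[OF base(2) c xc] Aop_T by (auto simp: tlists_def)
   have d1: "dz c i (Aop x (p10 c x v)) = dz c i v" for i v
   proof - note p = p10_T(1)[OF base(2) c xc, of v]
   show ?thesis unfolding Aop_props(2)[OF c d xc xd p] phi_zero[OF c d xc xd p p10_dz(2)[OF base(2) c xc]]
   by (simp add: p10_dz[OF base(2) c xc] dz_zero) qed
   have w: "wgs (map (dz c) all_idx) (map (Aop x) ?ws) = wgs (map (dz c) all_idx) ws" unfolding wedges_map by (simp add: o_def d1)
   have "pi10 X x CARD('n) ?kk ws = kk (map (Aop x) ?ws)" unfolding pi10_def if_P[OF True] m if_P[OF t1(1)] ..
   also have "... = kk ws" using K(4)[OF t1(2)] K(4)[OF ws] ws(2) w by (simp only: length_map)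
   finally show ?thesis . next
   case False thus ?thesis using K(3) by (simp add: pi10_def) qed qed
qed

text \<open>By \<open>dz_Aop\<close> the (1,0)-parts on X_0 of the transported coordinate vectors
  have the same dz_t as the coordinate vectors. Hence an (n,0)-form of X_t can be recovered from its
  image, which gives injectivity.\<close>

lemma canon_eval:
 assumes kk: "kk : canon X t x"
 shows "pi10 X x CARD('n) kk (map (%i. Aop x (dzv d i x)) all_idx) = kk (map (%i. dzv d i x) all_idx)"
proof -
 let ?e = "%i. dzv d i x" note e = dzv_T(1)[OF tb d xd]
 have ws: "map (%i. Aop x (?e i)) all_idx : tlists X x CARD('n)" using e Aop_T by (auto simp: tlists_def length_all_idx)
 have m: "map (pr10 X x) (map (%i. Aop x (?e i)) all_idx) = map (%i. p10 c x (Aop x (?e i))) all_idx"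
  using pr10_eq[OF c xc Aop_T[OF e]] by simp
 have l: "set (map (%i. p10 c x (Aop x (?e i))) all_idx) <= TX x" "length (map (%i. p10 c x (Aop x (?e i))) all_idx) = CARD('n)"
  using p10_T(1)[OF base(2) c xc] by (auto simp: length_all_idx)
 have "wgs (map (dz d) all_idx) (map (%i. p10 c x (Aop x (?e i))) all_idx) = wgs (map (dz d) all_idx) (map ?e all_idx)"
 proof -
  have "wgs (map (dz d) all_idx) (map (%i. p10 c x (Aop x (?e i))) all_idx) =
   wgs (map (%k. dz d k o (%i. p10 c x (Aop x (?e i)))) all_idx) all_idx" by (rule wedges_map)
  also have "(%k. dz d k o (%i. p10 c x (Aop x (?e i)))) = (%k. dz d k o ?e)" by (simp add: fun_eq_iff dz_Aop[OF c d xc xd e])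
  finally show ?thesis unfolding wedges_map . qed
 thus ?thesis unfolding pi10_def m using ws canonD(4)[OF tb d xd kk l] by (simp add: wedges_all_bas[OF tb d xd])
qed

lemma canon_inj: "inj_on (pi10 X x CARD('n)) (canon X t x)"
proof (rule inj_onI)
 fix kk kk' assume k: "kk : canon X t x" "kk' : canon X t x" and eq: "pi10 X x CARD('n) kk = pi10 X x CARD('n) kk'"
 have e: "kk (map (%i. dzv d i x) all_idx) = kk' (map (%i. dzv d i x) all_idx)" using canon_eval[OF k(1)] canon_eval[OF k(2)] eq by simp
 show "kk = kk'"
 proof fix ws show "kk ws = kk' ws"
  proof (cases "ws : tlists X x CARD('n)")
   case True
   thus ?thesis using canonD(4)[OF tb d xd k(1), of ws] canonD(4)[OF tb d xd k(2), of ws] e by (auto simp: tlists_def)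
  next
   case False
   thus ?thesis using canonD(3)[OF tb d xd k(1)] canonD(3)[OF tb d xd k(2)] by simp qed
 qed
qed

lemma canon_push:
 assumes kk: "kk : canon X t x" shows "pi10 X x CARD('n) kk : canon X 0 x"
proof (rule canonI[OF base(2) c xc]) note K = canonD[OF tb d xd kk]
 have x0: "x : M0" by (rule x_fib0[OF c d xc xd])
 have m: "pi10 X x CARD('n) kk ws = kk (map (p10 c x) ws)" if ws: "set ws <= TX x" "length ws = CARD('n)" for ws
 proof -
  have "map (pr10 X x) ws = map (p10 c x) ws" using ws(1) pr10_eq[OF c xc] by auto
  moreover have "ws : tlists X x CARD('n)" using ws by (simp add: tlists_def)
  ultimately show ?thesis by (simp only: pi10_def if_True) qed
 have "altern (TX x) CARD('n) (%ws. kk (map (p10 c x) ws))" by (rule alt_compose[OF K(1) p10_T(1)[OF base(2) c xc] p10_lc(1)])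
 thus "altern (TX x) CARD('n) (pi10 X x CARD('n) kk)" by (rule alt_cong[rotated, OF _ TX_cspace[OF x0]]) (simp add: m)
 show "pi10 X x CARD('n) kk ws = 0" if "ws \<notin> tlists X x CARD('n)" for ws using that by (simp add: pi10_def)
 fix ws v assume ws: "set ws <= TX x" "length ws = CARD('n)" "v : set ws" and z: "!!i. dz c i v = 0"
 have "p10 c x v = (%_. 0)" by (simp add: p10_def z)
 hence "(%_. 0) : set (map (p10 c x) ws)" using ws(3) by force
 hence "kk (map (p10 c x) ws) = 0" by (rule K(2)[OF _ _ _ dz_zero(1), rotated 2]) (use ws p10_T(1)[OF base(2) c xc] in auto)
 thus "pi10 X x CARD('n) kk ws = 0" using m[OF ws(1,2)] by simp
qed

end

text \<open>The type is that of X_0 but the frames are those of E_t, because the two sides of the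
  equation for P_t are compared in a frame of E_t.\<close>

definition ptyped :: "nat => nat => ('x, 'e) form => bool" where
 "ptyped p q s \<longleftrightarrow> (ALL x:fib X 0. ALL vs:tlists X x (p + q). s x vs : EE x) &
   (ALL V rh x l. (V, rh) : EF t --> x : V --> stype 0 p q x (%vs. rh (s x vs) $ l))"

lemma ptypedD:
 assumes "ptyped p q s" shows "x : M0 ==> set vs <= TX x ==> length vs = p + q ==> s x vs : EE x"
  "(V, rh) : EF t ==> x : V ==> stype 0 p q x (%vs. rh (s x vs) $ l)"
  "(V0, ta) : EF 0 ==> x : V0 ==> stype 0 p q x (%vs. ta (s x vs) $ l)"
proof -
 show e: "x : M0 ==> set vs <= TX x ==> length vs = p + q ==> s x vs : EE x" for x vs using assms unfolding ptyped_def tlists_def by blast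
 show st: "(V, rh) : EF t ==> x : V ==> stype 0 p q x (%vs. rh (s x vs) $ l)" for V rh l using assms unfolding ptyped_def by blast
 assume V0: "(V0, ta) : EF 0" "x : V0"
 have x0: "x : M0" using V0 EFD(1) by blast
 obtain V rh where V: "(V, rh) : EF t" "x : V" by (rule EF_at[OF tb x0])
 show "stype 0 p q x (%vs. ta (s x vs) $ l)" by (rule stype_frame(2)[OF V V0 e[OF x0] st[OF V]])
qed

lemma ident_pull:
 assumes s: "ptyped p q s" and P: "pull (p + q) s : Apq X t p q"
 shows "ident_V X t p (Iop X t p q (pull (p + q) s)) = exp_iphi_V X t p q (Iop X 0 p q s)"
proof (intro ext) fix x vs us kk
 show "ident_V X t p (Iop X t p q (pull (p + q) s)) x vs us kk = exp_iphi_V X t p q (Iop X 0 p q s) x vs us kk"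
 proof (cases "x : M0 & us : tlists X x p & kk : canon X 0 x")
  case False thus ?thesis by (simp only: ident_V_def exp_iphi_V_def if_False) next
  case True
  hence x0: "x : M0" and us: "us : tlists X x p" and kk: "kk : canon X 0 x" by auto
  have us': "set us <= TX x" "length us = p" using us by (auto simp: tlists_def)
  obtain c d where cd: "c : XC 0" "d : XC t" "x : fst c" "x : fst d" by (rule charts_at[OF x0])
  note c = cd(1,3) and d = cd(2,4)
  obtain V rh where V: "(V, rh) : EF t" "x : V" by (rule EF_at[OF tb x0])
  obtain V0 ta where V0: "(V0, ta) : EF 0" "x : V0" by (rule EF_at[OF base(2) x0])
  let ?kk = "%ws. if ws : tlists X x CARD('n) then kk (map (Aop x) ws) else 0"
  note kk' = canon_pull[OF cd kk]
  have inv: "iv (canon X t x) (pi10 X x CARD('n)) kk = ?kk"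
   by (rule inv_into_f_eq[where f="pi10 X x CARD('n)" and x="?kk", OF canon_inj[OF cd] kk'])
  let ?us = "map (pr10 X x) us"
  have usm: "?us = map (p10 c x) us" using us'(1) pr10_eq[OF c] by auto
  have ust: "?us : tlists X x p" unfolding usm tlists_def using us'(2) p10_T(1)[OF base(2) c] by auto
  have L: "ident_V X t p (Iop X t p q (pull (p + q) s)) x vs us kk = Iop X t p q (pull (p + q) s) x vs ?us ?kk"
   unfolding ident_V_def using True inv by simp
  let ?e0 = "%y ws. Iop X 0 p q s y ws us kk"
  have R: "exp_iphi_V X t p q (Iop X 0 p q s) x vs us kk = exp_iphi X t (CARD('n) + q) ?e0 x vs" unfolding exp_iphi_V_def using True by simp
  show ?thesis
  proof (cases "vs : tlists X x (CARD('n) + q)")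
   case False
   have "Iop X t p q (pull (p + q) s) x vs ?us ?kk = undefined" unfolding Iop_def using x0 ust kk'(1) False by (simp add: glue_def)
   moreover have "exp_iphi X t (CARD('n) + q) ?e0 x vs = undefined" unfolding exp_iphi_def using False by (simp add: glue_def)
   ultimately show ?thesis unfolding L R by simp next
   case True
   hence vs: "set vs <= TX x" "length vs = CARD('n) + q" by (auto simp: tlists_def)
   let ?B = "%v. lc 1 v 1 (pht x v)"
   have Bt: "?B v : TX x" if "v : TX x" for v by (rule lc_T[OF that phi_T[OF that]])
   have Bl: "?B (lc a v b w) = lc a (?B v) b (?B w)" if "v : TX x" "w : TX x" for v w a b
   unfolding phi_linear[OF that] by (simp add: lc_def fun_eq_iff algebra_simps)
   have I0: "Iop X 0 p q s x ws us kk : EE x" "ta (Iop X 0 p q s x ws us kk) $ l = Eform p q c x (%vs. ta (s x vs) $ l) kk us ws"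
   if "(V, ta) : EF 0" "x : V" "set ws <= TX x" "length ws = CARD('n) + q" for V ta ws l
   by (rule Iop_local[where s=s and x=x, OF base(2) c that(1,2) ptypedD(1)[OF s x0] ptypedD(3)[where x=x, OF s] us kk that(3,4)]; assumption)+
   have pf: "pform x (CARD('n) + q) (?e0 x)" unfolding pform_def
   proof (intro conjI ballI allI impI)
   show "?e0 x ws : EE x" if "ws : tlists X x (CARD('n) + q)" for ws
   by (rule I0(1)[OF V0]) (use that in \<open>auto simp: tlists_def\<close>)
   fix V ta l assume V: "(V, ta) : EF 0" "x : V"
   show "altern (TX x) (CARD('n) + q) (%vs. ta (?e0 x vs) $ l)"
   by (rule alt_cong[rotated, OF Eform_altern[OF base(2) c] TX_cspace[OF x0]]) (rule I0(2)[OF V, symmetric])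
   qed note X = exp_iphi_local[where s="?e0" and x=x, OF pf V0 vs]
   have sin: "pull (p + q) s x ws : EE x" if "set ws <= TX x" "length ws = p + q" for ws by (rule ApqD(1)[OF P x0 that])
   have It: "Iop X t p q (pull (p + q) s) x vs ?us ?kk : EE x"
   "rh (Iop X t p q (pull (p + q) s) x vs ?us ?kk) $ l = Eform p q d x (%vs. rh (pull (p + q) s x vs) $ l) ?kk ?us vs" for l
   by (rule Iop_local[where s="pull (p + q) s" and x=x, OF tb d V sin Apq_stype[where x=x, OF P] ust kk'(1) vs]; assumption)+
   have mB: "set (map ?B vs) <= TX x" "length (map ?B vs) = CARD('n) + q" using vs Bt by auto
   have comp: "rh (Iop X t p q (pull (p + q) s) x vs ?us ?kk) $ j = rh (exp_iphi X t (CARD('n) + q) ?e0 x vs) $ j" for j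
   proof - note stp = Apq_stype[OF P V, of j] and st0 = ptypedD(2)[OF s V, of j]
   have alB: "altern (TX x) (CARD('n) + q) (%vs. Eform p q c x (%vs. rh (s x vs) $ j) kk us (map ?B vs))"
   by (rule alt_compose[OF Eform_altern[OF base(2) c] Bt Bl])
   have "rh (exp_iphi X t (CARD('n) + q) ?e0 x vs) $ j = (SUM m:UNIV. wm rh ta x $ j $ m * Eform p q c x (%vs. ta (s x vs) $ m) kk us (map ?B vs))"
   unfolding frame_matrix(1)[OF tb V V0 X(1)] X(2) I0(2)[OF V0 mB] ..
   also have "... = Eform p q c x (%vs. SUM m:UNIV. wm rh ta x $ j $ m * ta (s x vs) $ m) kk us (map ?B vs)" by (rule Eform_sum[symmetric])
   also have "... = Eform p q c x (%vs. rh (s x vs) $ j) kk us (map ?B vs)"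
   by (rule Eform_cong[OF base(2) c]) (rule frame_matrix(1)[OF tb V V0 ptypedD(1)[OF s x0], symmetric])
   also have "... = Eform p q d x (%vs. rh (pull (p + q) s x vs) $ j) ?kk ?us vs"
   proof (rule Eform_unique[OF tb d alB Eform_altern[OF tb d] _ vs]) fix bs fs
   assume bs: "set bs <= TX x" and fs: "set fs <= TX x" and l: "length bs + length fs = CARD('n) + q" "q <= length bs"
   and z: "!!b i. b : set bs ==> dz d i b = 0"
   \<comment> \<open>A (0,1)-vector of X_t is its own (0,1)-part there, and on such vectors the
     substitution 1 + \<phi> of the exponential coincides with A.\<close>
   have BA: "?B b = Aop x b" if b: "b : set bs" for b
   proof -
   have bt: "b : TX x" using b bs by blast
   have "p01 d x b = b" by (rule T_eqI[OF tb d p10_T(2)[OF tb d] bt]) (simp_all add: p10_dz[OF tb d] z[OF b])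
   thus ?thesis by (intro T_eqI[OF base(2) c Bt[OF bt] Aop_T[OF bt]]) (simp_all add: dz_lc Aop_props[OF cd bt] phi_props[OF cd bt])
   qed
   have mb: "map ?B bs = map (Aop x) bs" using BA by simp
   have zA: "dz c i b = 0" if "b : set (map (Aop x) bs)" for b i using that bs z Aop_type(1)[OF cd] by auto
   have At: "set (map (Aop x) bs) <= TX x" "set (map (Aop x) fs) <= TX x" "set (map ?B fs) <= TX x" using bs fs Aop_T Bt by auto
   show "Eform p q c x (%vs. rh (s x vs) $ j) kk us (map ?B (bs @ fs)) = Eform p q d x (%vs. rh (pull (p + q) s x vs) $ j) ?kk ?us (bs @ fs)"
   proof (cases "length bs = q")
   case True
   have fl: "length fs = CARD('n)" using l True by simp
   \<comment> \<open>On arbitrary vectors 1 + \<phi> and A differ by (0,1)-vectors of X_0, which an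
     (n,0)-form ignores; so the remaining n slots may also be read as transported by A.\<close>
   have w: "wgs (map (dz c) all_idx) (map ?B fs) = wgs (map (dz c) all_idx) (map (Aop x) fs)" unfolding wedges_map
   by (rule wedges_map_cong[OF fs]) (simp add: dz_lc Aop_props[OF cd])
   have k: "kk (map ?B fs) = kk (map (Aop x) fs)"
   using canonD(4)[OF base(2) c kk At(3)] canonD(4)[OF base(2) c kk At(2)] fl w by (simp only: length_map)
   have fl': "length (map ?B fs) = CARD('n)" "length (map (Aop x) bs) = q" using fl True by auto
   have ul: "length ?us = p" using us'(2) by simp
   have "Eform p q c x (%vs. rh (s x vs) $ j) kk us (map ?B (bs @ fs)) = kk (map (Aop x) fs) * rh (s x (map (Aop x) bs @ map (p10 c x) us)) $ j"
   unfolding map_append mb k[symmetric] by (rule Eform_block[OF base(2) c st0 kk At(1) fl'(2) zA At(3) fl'(1) us'(2)])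
   moreover have "Eform p q d x (%vs. rh (pull (p + q) s x vs) $ j) ?kk ?us (bs @ fs) = ?kk fs * rh (pull (p + q) s x (bs @ map (p10 d x) ?us)) $ j"
   by (rule Eform_block[OF tb d stp kk'(1) bs True z fs fl ul])
   moreover have "?kk fs = kk (map (Aop x) fs)" using fs fl by (simp add: tlists_def)
   moreover have "pull (p + q) s x (bs @ map (p10 d x) ?us) = s x (map (Aop x) bs @ map (p10 c x) us)"
   proof -
   have "map (Aop x) (map (p10 d x) ?us) = map (p10 c x) us" unfolding usm using us'(1) Aop_p10[OF cd] by auto
   moreover have "pull (p + q) s x (bs @ map (p10 d x) ?us) = s x (map (Aop x) (bs @ map (p10 d x) ?us))"
   by (rule pull_eq[OF x0]) (use bs True us'(2) p10_T(1)[OF tb d] in auto)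
   ultimately show ?thesis by (simp only: map_append) qed
   ultimately show ?thesis by (simp only:) next
   case False hence "q < length bs" using l by simp
   have "Eform p q d x (%vs. rh (pull (p + q) s x vs) $ j) ?kk ?us (bs @ fs) = 0"
   by (rule Eform_block_zero[OF tb d \<open>q < length bs\<close> l(1) z])
   moreover have "Eform p q c x (%vs. rh (s x vs) $ j) kk us (map ?B (bs @ fs)) = 0"
   unfolding map_append mb by (rule Eform_block_zero[OF base(2) c _ _ zA]) (use l(1) \<open>q < length bs\<close> in simp_all)
   ultimately show ?thesis by (simp only:) qed qed
   also have "... = rh (Iop X t p q (pull (p + q) s) x vs ?us ?kk) $ j" by (rule It(2)[symmetric])
   finally show ?thesis by (rule sym) qed
   show ?thesis unfolding L R by (rule efib_eqI[OF tb V It(1) X(1)]) (simp add: vec_eq_iff comp)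
  qed qed
qed

text \<open>Every coefficient in a chart \<open>d\<close> is recovered as a value: the arguments in
  the covector slots are images under A of coordinate vectors, and the argument in the canonical
  slot is the image of dz^1 \<and> ... \<and> dz^n.\<close>

lemma ident_inj: "inj_on (ident_V X t p o Iop X t p q) (Apq X t p q)"
proof (rule inj_onI, unfold o_def)
 fix S S' assume S: "S : Apq X t p q" and S': "S' : Apq X t p q"
  and eq: "ident_V X t p (Iop X t p q S) = ident_V X t p (Iop X t p q S')" show "S = S'"
 proof (intro ext) fix x vs show "S x vs = S' x vs"
  proof (cases "x : M0 & vs : tlists X x (p + q)")
   case False thus ?thesis using ApqD(2)[OF S] ApqD(2)[OF S'] by simp next
   case True
   hence x0: "x : M0" and vs: "set vs <= TX x" "length vs = p + q" by (auto simp: tlists_def)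
   obtain c d where cd: "c : XC 0" "d : XC t" "x : fst c" "x : fst d" by (rule charts_at[OF x0])
   note c = cd(1,3) and d = cd(2,4)
   obtain V rh where V: "(V, rh) : EF t" "x : V" by (rule EF_at[OF tb x0])
   let ?kk = "%ws. if ws : tlists X x CARD('n) then 1 * wgs (map (dz d) all_idx) ws else 0"
   have kk: "?kk : canon X t x" unfolding canon_def using d by blast
   let ?K = "pi10 X x CARD('n) ?kk"
   have inv: "iv (canon X t x) (pi10 X x CARD('n)) ?K = ?kk" by (rule inv_into_f_f[OF canon_inj[OF cd] kk])
   have K0: "?K : canon X 0 x" by (rule canon_push[OF cd kk]) note e = dzv_T[OF tb d]
   have val: "rh (ident_V X t p (Iop X t p q S) x (bas d x J all_idx) (map (%i. Aop x (dzv d i x)) I) ?K) $ l = rh (S x (bas d x J I)) $ l"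
   if S: "S : Apq X t p q" and JI: "J : mi q" "I : mi p" for S J I l
   proof -
   let ?us = "map (%i. Aop x (dzv d i x)) I"
   have us: "?us : tlists X x p" using JI(2) Aop_T[OF e(1)] by (auto simp: tlists_def mi_def)
   have usm: "map (pr10 X x) ?us = map (%i. p10 c x (Aop x (dzv d i x))) I" using pr10_eq[OF c Aop_T[OF e(1)]] by simp
   have ust: "map (pr10 X x) ?us : tlists X x p" unfolding usm using JI(2) p10_T(1)[OF base(2) c] by (auto simp: tlists_def mi_def)
   have vs: "set (bas d x J all_idx) <= TX x" "length (bas d x J all_idx) = CARD('n) + q"
   using bas_T[OF tb d] JI(1) by (auto simp: mi_def length_all_idx)
   have p: "map (p10 d x) (map (pr10 X x) ?us) = map (%i. dzv d i x) I"
   unfolding usm using p10_p10_Aop[OF cd e(1) coord_dual(3)[OF tb d]] by simp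
   have "rh (ident_V X t p (Iop X t p q S) x (bas d x J all_idx) ?us ?K) $ l =
   rh (Iop X t p q S x (bas d x J all_idx) (map (pr10 X x) ?us) ?kk) $ l" unfolding ident_V_def using x0 us K0 inv by simp
   also have "... = Eform p q d x (%vs. rh (S x vs) $ l) ?kk (map (pr10 X x) ?us) (bas d x J all_idx)"
   by (rule Iop_local(2)[where s=S and x=x, OF tb d V ApqD(1)[OF S x0] Apq_stype[where x=x, OF S] ust kk vs]; assumption)
   also have "... = ?kk (map (%i. dzv d i x) all_idx) * rh (S x (map (%j. dzbv d j x) J @ map (p10 d x) (map (pr10 X x) ?us))) $ l"
   by (rule Eform_block[OF tb d Apq_stype[OF S V] kk]) (use JI e coord_dual(2)[OF tb d] in \<open>auto simp: mi_def length_all_idx\<close>)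
   also have "?kk (map (%i. dzv d i x) all_idx) = 1" using e wedges_all_bas[OF tb d] by (auto simp: tlists_def length_all_idx)
   finally show ?thesis unfolding p by simp qed
   have "rh (S x vs) $ l = rh (S' x vs) $ l" for l unfolding stype_eq[OF tb d Apq_stype[OF S V] vs] stype_eq[OF tb d Apq_stype[OF S' V] vs]
   by (intro sum.cong refl arg_cong2[where f="(*)"]) (simp only: val[OF S, symmetric] val[OF S', symmetric] eq)
   hence "rh (S x vs) = rh (S' x vs)" by (simp add: vec_eq_iff)
   thus ?thesis by (rule efib_eqI[OF tb V ApqD(1)[OF S x0 vs] ApqD(1)[OF S' x0 vs]]) qed
 qed
qed

lemma Pmap_eq:
 assumes "ptyped p q s" "pull (p + q) s : Apq X t p q" shows "Pmap X t p q s = pull (p + q) s"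
proof -
 have "(ident_V X t p o Iop X t p q) (pull (p + q) s) = exp_iphi_V X t p q (Iop X 0 p q s)" by (simp add: ident_pull[OF assms])
 hence "iv (Apq X t p q) (ident_V X t p o Iop X t p q) (exp_iphi_V X t p q (Iop X 0 p q s)) = pull (p + q) s"
  by (rule inv_into_f_eq[OF ident_inj assms(2)]) thus ?thesis unfolding Pmap_def by simp
qed

lemma pull_Apq:
 assumes s: "s : Apq X 0 p q" shows "ptyped p q s" "pull (p + q) s : Apq X t p q"
proof - note ef = Apq_eform[OF s] show pt: "ptyped p q s" unfolding ptyped_def
 proof (intro conjI ballI allI impI)
  show "s x vs : EE x" if "x : M0" "vs : tlists X x (p + q)" for x vs
   by (rule ApqD(1)[OF s]) (use that in \<open>auto simp: tlists_def\<close>)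
  fix V rh x l assume V: "(V, rh) : EF t" "x : V"
  have x0: "x : M0" using V EFD(1) by blast
  obtain V0 ta where V0: "(V0, ta) : EF 0" "x : V0" by (rule EF_at[OF base(2) x0])
  show "stype 0 p q x (%vs. rh (s x vs) $ l)" by (rule stype_frame(1)[OF V V0 ApqD(1)[OF s x0] Apq_stype[OF s V0]])
 qed show "pull (p + q) s : Apq X t p q"
 proof (rule ApqI[OF tb]) note ep = pull_eform[OF ef]
  show "pull (p + q) s x vs : EE x" if "x : M0" "set vs <= TX x" "length vs = p + q" for x vs by (rule eform_in[OF ep that])
  show "pull (p + q) s x vs = undefined" if "~ (x : M0 & vs : tlists X x (p + q))" for x vs unfolding pull_def by (rule if_not_P[OF that])
  show "altern (TX x) (p + q) (%vs. ta (pull (p + q) s x vs) $ l)" if "(V, ta) : EF t" "x : V" for x V ta l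
   by (rule aformD(1)[OF eform_aform[OF ep tb that]]) fix x V ta l d and J I :: "'n list"
  assume V: "(V, ta) : EF t" "x : V" and d: "d : XC t" "x : fst d" and JI: "length J + length I = p + q"
  have "smat x (%y. ta (pull (p + q) s y (map (%F. F y) (map (dzbv d) J @ map (dzv d) I))) $ l)"
   by (rule aformD(2)[OF eform_aform[OF ep tb V]]) (use JI sfield_vec[OF tb d] in auto)
  thus "smat x (%y. ta (pull (p + q) s y (bas d y J I)) $ l)" by (simp add: o_def)
  assume J: "length J ~= q"
  have x0: "x : M0" by (rule XC_fib0[OF d])
  obtain c where c: "c : XC 0" "x : fst c" by (rule XC_at[OF base(2) x0])
  note cd = c(1) d(1) c(2) d(2) note e = dzv_T[OF tb d] and A = Aop_type[OF cd]
  have "ta (s x (map (Aop x) (map (%j. dzbv d j x) J) @ map (Aop x) (map (%i. dzv d i x) I))) $ l = 0"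
   by (rule stype_vanish[OF base(2) c ptypedD(2)[OF pt V]]) (use J JI Aop_T e A(1)[OF e(2)] A(2)[OF e(1)] coord_dual[OF tb d] in auto)
  thus "ta (pull (p + q) s x (bas d x J I)) $ l = 0" using pull_eq[OF x0 bas_T[OF tb d]] JI by simp
 qed
qed

text \<open>The inverse of A respects types, so the type of a form on X_0 can be inferred from that
  of its pullback on X_t.\<close>

lemma ptyped_of_pull:
 assumes P: "pull (p + q) R : Apq X t p q" and R: "!!x vs. x : M0 ==> set vs <= TX x ==> length vs = p + q ==> R x vs : EE x"
 shows "ptyped p q R" unfolding ptyped_def
proof (intro conjI ballI allI impI)
 show "R x vs : EE x" if "x : M0" "vs : tlists X x (p + q)" for x vs by (rule R) (use that in \<open>auto simp: tlists_def\<close>)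
 fix V rh x l assume V: "(V, rh) : EF t" "x : V"
 have x0: "x : M0" using V EFD(1) by blast
 obtain c0 d where cd0: "c0 : XC 0" "d : XC t" "x : fst c0" "x : fst d" by (rule charts_at[OF x0])
 note d = cd0(2,4) note st = Apq_stype[OF P V, of l]
 have R_eq: "rh (pull (p + q) R x (map (Ainv x) vs)) $ l = rh (R x vs) $ l" if vs: "set vs <= TX x" "length vs = p + q" for vs
 proof -
  have "map (Aop x) (map (Ainv x) vs) = vs" using vs(1) Ainv_props(4)[OF cd0] by (auto intro!: map_idI)
  moreover have "pull (p + q) R x (map (Ainv x) vs) = R x (map (Aop x) (map (Ainv x) vs))" by (rule pull_eq[OF x0]) (use vs Ainv_T in auto)
  ultimately show ?thesis by (simp only:) qed show "stype 0 p q x (%vs. rh (R x vs) $ l)"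
 proof (rule stypeI[OF base(2)]) show "altern (TX x) (p + q) (%vs. rh (R x vs) $ l)"
   by (rule alt_cong[OF R_eq alt_compose[OF stype_altern[OF tb d st] Ainv_T Ainv_linear] TX_cspace[OF x0]])
  fix c and J I :: "'n list"
  assume c: "c : XC 0" "x : fst c" and J: "length J ~= q" "length J + length I = p + q"
  note cd = c(1) d(1) c(2) d(2) note e = dzv_T[OF base(2) c] and A = Ainv_type[OF cd]
  have "rh (pull (p + q) R x (map (Ainv x) (map (%j. dzbv c j x) J) @ map (Ainv x) (map (%i. dzv c i x) I))) $ l = 0"
   by (rule stype_vanish[OF tb d st]) (use J Ainv_T e A(1)[OF e(2)] A(2)[OF e(1)] coord_dual[OF base(2) c] in auto)
  thus "rh (R x (bas c x J I)) $ l = 0" using R_eq[OF bas_T[OF base(2) c]] J by simp qed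
qed

end

theorem theorem1p1:
  fixes X :: "('x::{t2_space,second_countable_topology}, 'n::{finite,linorder}, 'm::finite, 'e, 'r::finite) family"
    and h :: "'e \<Rightarrow> 'e \<Rightarrow> complex"
    and nab :: "('x \<Rightarrow> 'e) \<Rightarrow> 'x \<Rightarrow> 'x tvec \<Rightarrow> 'e"
  assumes "family_of_pairs X"
    and "compatible_trivialization X"
    and "hermitian_metric X h"
    and "chern_connection X h nab"
  shows "\<exists>\<Delta>. open \<Delta> \<and> 0 \<in> \<Delta> \<and> \<Delta> \<subseteq> base X \<and>
    (\<forall>t\<in>\<Delta>. \<forall>p q. \<forall>s\<in>Apq X 0 p q.
       dbar X t (p + q) (Pmap X t p q s) =
       Pmap X t p (Suc q)
         (form_add X (Suc (p + q))
           (form_diff X (Suc (p + q)) (dbar X 0 (p + q) s) (Lphi10 X nab t (p + q) s))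
           (psi X nab t (p + q) s)))"
proof -
 interpret pair_family X by unfold_locales (rule assms)+
 obtain \<Delta> where \<Delta>: "open \<Delta>" "0 : \<Delta>" "\<Delta> <= base X" "ALL t:\<Delta>. good t" using good_nhd by blast
 have "dbar X t (p + q) (Pmap X t p q s) =
   Pmap X t p (Suc q) (form_add X (Suc (p + q)) (form_diff X (Suc (p + q)) (dbar X 0 (p + q) s) (Lphi10 X nab t (p + q) s))
   (psi X nab t (p + q) s))" if t: "t : \<Delta>" and s: "s : Apq X 0 p q" for t p q s
 proof -
  interpret good_pair X t nab by unfold_locales (use \<Delta>(4) t assms(4) in \<open>auto simp: chern_connection_def\<close>)
  let ?R = "Rform (p + q) s" note P = pull_Apq[OF s] and ef = Apq_eform[OF s]
  note D = dbar_pull[OF ef]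
  \<comment> \<open>The type of the right-hand form is obtained from the left-hand side: its
    pullback is the Dolbeault derivative on X_t of a form of type (p,q), hence of type
    (p,q+1).\<close>
  have "pull (Suc (p + q)) ?R : Apq X t p (Suc q)" unfolding D[symmetric] by (rule dbar_Apq[OF tb P(2) pull_eform[OF ef]])
  hence PR: "pull (p + Suc q) ?R : Apq X t p (Suc q)" by simp
  have "ptyped p (Suc q) ?R"
  proof (rule ptyped_of_pull[OF PR])
   fix x vs assume x: "x : fib X 0" and vs: "set vs <= tangent X x" "length vs = p + Suc q"
   obtain c where c: "c : Xcharts X 0" "x : fst c" by (rule XC_at[OF base(2) x])
   obtain V rh where V: "(V, rh) : Eframes X t" "x : V" by (rule EF_at[OF tb x])
   show "?R x vs : efib X x" by (rule Rform_local(1)[OF ef c V vs(1)]) (use vs(2) in simp)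
  qed hence "Pmap X t p (Suc q) ?R = pull (Suc (p + q)) ?R" using Pmap_eq[OF _ PR] by simp
  thus ?thesis using D Pmap_eq[OF P] unfolding Rform_def by simp qed
 thus ?thesis using \<Delta>(1-3) by blast
qed

end
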